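(* Let $q$ be an odd prime power, and for $n\ge 2$ let $\mathrm{Tr}:\mathbb{F}_{q^n}\to\mathbb{F}_q$ be the trace map $\mathrm{Tr}(\xi)=\sum_{i=0}^{n-1}\xi^{q^i}$. (1) For every integer $n\ge 3$ and every $\beta\in\mathbb{F}_q$, there exists a $2$-primitive element $\xi\in\mathbb{F}_{q^n}$ with $\mathrm{Tr}(\xi)=\beta$. (2) If $q\notin\{3,5,7,9,11,13,31\}$, then for every $\beta\in\mathbb{F}_q^*$ there exists a $2$-primitive element $\xi\in\mathbb{F}_{q^2}$ with $\mathrm{Tr}(\xi)=\beta$. For $q\in\{3,5,7,9,11,13,31\}$, the set $\{\mathrm{Tr}(\xi):\ \xi\in\mathbb{F}_{q^2}\text{ is }2\text{-primitive}\}$ is exactly: $q=3$: $\{0\}$; $q=5$: $\{2,3\}$; $q=7$: $\{1,2,5,6\}$; $q=9$: $\{1,-1,i,-i\}$, where $\mathbb{F}_9=\mathbb{F}_3(i)$ with $i^2+1=0$; $q=11$: $\{1,2,3,4,7,8,9,10\}$; $q=13$: $\{1,3,4,5,6,7,8,9,10,12\}$; $q=31$: $\mathbb{F}_{31}\setminus\{0,11,20\}$.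
   Context: For a prime power $q$, an integer $n\ge 2$ and a divisor $r$ of $q^n-1$, an element of $\mathbb{F}_{q^n}$ is called $r$-primitive if its multiplicative order is $(q^n-1)/r$; $1$-primitive elements are the primitive elements (generators of $\mathbb{F}_{q^n}^*$). For prime $q$, elements of $\mathbb{F}_q$ are written as integers modulo $q$. *)

theory Defs
  imports "HOL-Library.Cardinality" "HOL-Computational_Algebra.Computational_Algebra" "HOL-Number_Theory.Prime_Powers"
begin

definition is_subfield :: "'a::field set \<Rightarrow> bool" where
  "is_subfield K \<longleftrightarrow> 0 \<in> K \<and> 1 \<in> K \<and>
     (\<forall>x\<in>K. \<forall>y\<in>K. x - y \<in> K) \<and> (\<forall>x\<in>K. \<forall>y\<in>K. x * y \<in> K) \<and> (\<forall>x\<in>K. inverse x \<in> K)"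

text \<open>Meaningful for nonzero elements of a finite field only: no power of 0 with positive
  exponent is 1, so the value at 0 is unspecified.\<close>

definition mult_order :: "'a::finite_field \<Rightarrow> nat" where
  "mult_order x = (LEAST d. 0 < d \<and> x ^ d = 1)"

definition r_primitive :: "nat \<Rightarrow> 'a::finite_field \<Rightarrow> bool" where
  "r_primitive r x \<longleftrightarrow> r dvd CARD('a) - 1 \<and> x \<noteq> 0 \<and> mult_order x = (CARD('a) - 1) div r"

text \<open>The trace from the field with \<open>q ^ n\<close> elements to its subfield with \<open>q\<close> elements,
  as a function with values in the large field.\<close>

definition field_trace :: "nat \<Rightarrow> nat \<Rightarrow> 'a::finite_field \<Rightarrow> 'a" where
  "field_trace q n x = (\<Sum>i<n. x ^ (q ^ i))"

end

theory Submission
  imports Defs Complex_Main "HOL-Number_Theory.Residues" "HOL-Number_Theory.Pocklington"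
begin

text \<open>Fix a generator \<open>g\<close> of the multiplicative group and let \<open>T\<close> be the set of exponents \<open>k < (q ^ n - 1) div 2\<close> for
  which \<open>g ^ (2 * k)\<close> has the prescribed trace. Sums of multiplicative characters over the elements of
  given trace have absolute value at most \<open>sqrt q ^ (n - 1)\<close>; this follows from a second moment argument, since scaling
  by the subfield permutes the nonzero traces. Hence \<open>T\<close> is equidistributed modulo the divisors of \<open>(q ^ n - 1) div 2\<close>,
  and a sieve, with a core of small primes treated by inclusion and exclusion, produces an exponent
  that is coprime to \<open>(q ^ n - 1) div 2\<close>, that is, a 2-primitive element, except for finitely many pairs \<open>(q, n)\<close>.
  For \<open>n = 2\<close> the exceptions below 15000 are treated by writing a 2-primitive element as an element
  of the subfield times an element \<open>w ^ k\<close> of norm one, whose trace \<open>w ^ k + w ^ (- k)\<close> is a Lucas sequence.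
  A composite degree \<open>n = p * e\<close> reduces to the degree \<open>p\<close> over the field with \<open>q ^ e\<close> elements.\<close>

subsection \<open>Sieving sets of exponents by character sums\<close>

text \<open>As \<open>q ^ n - 1\<close> is even, the 2-primitive elements are exactly the squares
  \<open>g ^ (2 * k)\<close> with \<open>k\<close> coprime to \<open>(q ^ n - 1) div 2\<close>. The
  bound \<open>sqrt q ^ (n - 1)\<close> alone is too weak for many small fields. The decisive gain
  is that a character trivial on the subfield has sums of modulus exactly
  \<open>sqrt q ^ (n - 2)\<close> over a nonzero trace. The sieve therefore carries two bounds and
  keeps the primes that profit from the smaller one apart. Trace zero behaves differently: the
  kernel is stable under scaling by the subfield, so only the primes of
  \<open>(q ^ n - 1) div (q - 1)\<close> obstruct. In degree two a nonzero element of trace zero has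
  order dividing \<open>2 * (q - 1)\<close> and is not 2-primitive for \<open>q > 3\<close>; hence
  the reduction from an even degree must pass through a nonzero intermediate trace. When the
  intermediate field has nine elements (\<open>q = 3\<close>, \<open>n = 4\<close>), the explicit
  list of traces in degree two is needed.\<close>

definition unity_char :: "nat \<Rightarrow> nat \<Rightarrow> nat \<Rightarrow> complex" where
  "unity_char M j k = cis (2 * pi * real j * real k / real M)"

lemma norm_unity_char [simp]: "norm (unity_char M j k) = 1"
  by (simp add: unity_char_def)

lemma unity_char_add: "unity_char M (i + j) k = unity_char M i k * unity_char M j k"
  by (simp add: unity_char_def cis_mult add_divide_distrib distrib_left distrib_right)

lemma unity_char_add_right: "unity_char M j (k + k') = unity_char M j k * unity_char M j k'"
  by (simp add: unity_char_def cis_mult add_divide_distrib distrib_left)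

lemma unity_char_eq_1_iff:
  assumes "M > 0"
  shows "unity_char M j k = 1 \<longleftrightarrow> M dvd j * k"
proof -
  let ?x = "2 * pi * real j * real k / real M"
  have "cis ?x = 1 \<longleftrightarrow> cos ?x = 1"
    by (metis cis.sel(1) cis.code cos_one_sin_zero one_complex.sel(1) one_complex.code)
  then have "unity_char M j k = 1 \<longleftrightarrow> (\<exists>z::int. ?x = of_int z * 2 * pi)"
    by (simp only: unity_char_def cos_one_2pi_int)
  moreover have "(?x = of_int z * 2 * pi) \<longleftrightarrow> real_of_int (int (j * k)) = real_of_int (int M * z)" for z
  proof -
    have "?x = of_int z * 2 * pi \<longleftrightarrow> (2 * pi) * (real j * real k) = (2 * pi) * (real M * of_int z)"
      using assms by (simp only: divide_eq_eq) (auto simp: mult_ac)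
    also have "\<dots> \<longleftrightarrow> real j * real k = real M * of_int z"
      by (subst mult_cancel_left) simp
    finally show ?thesis by simp
  qed
  ultimately have "unity_char M j k = 1 \<longleftrightarrow> int M dvd int (j * k)"
    unfolding dvd_def by (simp only: of_int_eq_iff)
  then show ?thesis by (simp only: int_dvd_int_iff)
qed

lemma unity_char_power: "unity_char M j k ^ m = unity_char M (m * j) k"
  by (simp add: unity_char_def DeMoivre mult_ac)

lemma sum_unity_char:
  assumes "M > 0"
  shows "(\<Sum>i<M. unity_char M i k) = (if M dvd k then of_nat M else 0)"
proof -
  have *: "unity_char M i k = unity_char M 1 k ^ i" for i
    by (simp add: unity_char_power)
  show ?thesis
  proof (cases "M dvd k")
    case True
    then have "unity_char M 1 k = 1" using unity_char_eq_1_iff[OF assms, of 1 k] by simp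
    then have "unity_char M i k = 1" for i using *[of i] by simp
    then show ?thesis using True by simp
  next
    case False
    then have ne: "unity_char M 1 k \<noteq> 1" using unity_char_eq_1_iff[OF assms, of 1 k] by simp
    have "unity_char M 1 k ^ M = 1"
      unfolding unity_char_power using unity_char_eq_1_iff[OF assms, of "M * 1" k] by simp
    then have "(\<Sum>i<M. unity_char M 1 k ^ i) = 0" by (simp only: geometric_sum[OF ne]) simp
    then show ?thesis using False by (simp only: *[symmetric]) simp
  qed
qed

lemma unity_char_div:
  assumes "l dvd M" "M > 0"
  shows "unity_char M (i * (M div l)) k = unity_char l i k"
proof -
  obtain c where c: "M = l * c" using assms(1) by blast
  then have "l > 0" "c > 0" using assms(2) by auto
  then show ?thesis by (simp add: unity_char_def c field_simps)
qed

lemma dvd_indicator_unity_char: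
  assumes "l dvd M" "M > 0"
  shows "(if l dvd k then 1 else 0) = (\<Sum>i<l. unity_char M (i * (M div l)) k) / of_nat l"
proof -
  have "l > 0" using assms by (simp add: dvd_pos_nat)
  then show ?thesis using assms by (simp add: unity_char_div sum_unity_char)
qed

text \<open>Two bounds are kept because the frequencies divisible by \<open>d\<close> may give
  smaller sums. The choice \<open>d = 0\<close> switches the second bound off:
  \<open>0 dvd j\<close> forces \<open>j = 0\<close>, which \<open>M\<close> divides.\<close>

locale char_sum_bounds =
  fixes M d :: nat and T :: "nat set" and bA b :: real
  assumes M_pos: "M > 0" and fin: "finite T"
    and bA_nonneg: "0 \<le> bA" and bA_le: "bA \<le> b"
    and bound: "\<And>j. \<not> M dvd j \<Longrightarrow> norm (\<Sum>k\<in>T. unity_char M j k) \<le> b"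
    and boundA: "\<And>j. \<not> M dvd j \<Longrightarrow> d dvd j \<Longrightarrow> norm (\<Sum>k\<in>T. unity_char M j k) \<le> bA"
begin

definition sifted :: "nat set \<Rightarrow> nat set" where
  "sifted C = {k \<in> T. \<forall>l\<in>C. \<not> l dvd k}"

definition twist :: "nat set \<Rightarrow> nat \<Rightarrow> complex" where
  "twist C j = (\<Sum>k\<in>sifted C. unity_char M j k)"

text \<open>Divisibility by \<open>l\<close> is detected by the frequencies
  \<open>i * (M div l)\<close>; for these \<open>l\<close> all of them are multiples of
  \<open>d\<close>, so that the better bound \<open>bA\<close> applies.\<close>

definition smooth :: "nat set \<Rightarrow> nat set" where
  "smooth C = {l \<in> C. d dvd M div l}"

definition dens :: "nat set \<Rightarrow> real" where
  "dens C = (\<Prod>l\<in>C. 1 - 1 / real l)"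

lemma fin_sifted [simp]: "finite (sifted C)"
  using fin by (simp add: sifted_def)

lemma twist_empty: "twist {} j = (\<Sum>k\<in>T. unity_char M j k)"
  by (simp add: twist_def sifted_def)

lemma sum_dvd_part:
  assumes "l dvd M"
  shows "(\<Sum>k\<in>{k\<in>sifted C. l dvd k}. unity_char M j k) =
    (\<Sum>i<l. twist C (j + i * (M div l))) / of_nat l"
proof -
  have "(\<Sum>k\<in>{k\<in>sifted C. l dvd k}. unity_char M j k) =
      (\<Sum>k\<in>sifted C. (if l dvd k then 1 else 0) * unity_char M j k)"
    by (intro sum.mono_neutral_cong_left) auto
  also have "\<dots> = (\<Sum>k\<in>sifted C. \<Sum>i<l. unity_char M (j + i * (M div l)) k / of_nat l)"
    by (simp only: dvd_indicator_unity_char[OF assms M_pos] unity_char_add sum_divide_distrib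
        sum_distrib_right) (simp add: mult_ac)
  also have "\<dots> = (\<Sum>i<l. \<Sum>k\<in>sifted C. unity_char M (j + i * (M div l)) k / of_nat l)"
    by (rule sum.swap)
  finally show ?thesis by (simp add: twist_def sum_divide_distrib)
qed

lemma twist_insert:
  assumes "l dvd M"
  shows "twist (insert l C) j = twist C j - (\<Sum>i<l. twist C (j + i * (M div l))) / of_nat l"
proof -
  have "sifted C = sifted (insert l C) \<union> {k\<in>sifted C. l dvd k}"
    "sifted (insert l C) \<inter> {k\<in>sifted C. l dvd k} = {}"
    by (auto simp: sifted_def)
  then have "twist C j = twist (insert l C) j + (\<Sum>k\<in>{k\<in>sifted C. l dvd k}. unity_char M j k)"
    unfolding twist_def by (metis (no_types, lifting) fin_sifted finite_Un sum.union_disjoint)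
  then show ?thesis by (simp add: sum_dvd_part[OF assms])
qed

lemma split_first:
  assumes "(l::nat) > 0"
  shows "(\<Sum>i<l. f i :: 'b::comm_monoid_add) = f 0 + (\<Sum>i\<in>{1..<l}. f i)"
proof -
  have "{..<l} = insert 0 {1..<l}" using assms by auto
  then show ?thesis by simp
qed

text \<open>Removing the multiples of the primes in \<open>C\<close> expands into one block of
  frequencies per subset of \<open>C\<close>, each of total weight \<open>dens C\<close>. Subsets of
  \<open>smooth C\<close> cost only \<open>bA\<close>. \<open>err0\<close> omits the block of the
  trivial frequency; \<open>errA\<close> and \<open>errB\<close> belong to a nontrivial starting
  frequency, divisible by \<open>d\<close> or arbitrary.\<close>

definition err0 :: "nat set \<Rightarrow> real" where
  "err0 C = bA * (2 ^ card (smooth C) - 1) + b * (2 ^ card C - 2 ^ card (smooth C))"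
definition errA :: "nat set \<Rightarrow> real" where
  "errA C = bA * 2 ^ card (smooth C) + b * (2 ^ card C - 2 ^ card (smooth C))"
definition errB :: "nat set \<Rightarrow> real" where
  "errB C = b * 2 ^ card C"

lemma dens_pos:
  assumes "\<And>l. l \<in> C \<Longrightarrow> prime l"
  shows "dens C > 0"
  unfolding dens_def
proof (intro prod_pos)
  fix l assume "l \<in> C"
  then have "1 < real l" using assms prime_gt_1_nat by simp
  then show "0 < 1 - 1 / real l" by simp
qed

lemma err_le: "finite C \<Longrightarrow> errA C \<le> errB C"
proof -
  have "bA * 2 ^ card (smooth C) \<le> b * 2 ^ card (smooth C)" using bA_le by (intro mult_right_mono) auto
  then show ?thesis by (simp add: errA_def errB_def algebra_simps)
qed

text \<open>Induction over \<open>C\<close> with \<open>j\<close> varying, because inserting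
  \<open>l\<close> brings in the frequencies \<open>j + i * (M div l)\<close>. \<open>D\<close> is a
  multiple of the order of \<open>j\<close>; its coprimality to \<open>C\<close> keeps every proper
  shift nontrivial, and for the shifted frequencies \<open>D * l\<close> takes its place.\<close>

lemma twist_bounds:
  assumes "finite C" "\<And>l. l \<in> C \<Longrightarrow> prime l \<and> l dvd M"
    and "D dvd M" "coprime D (\<Prod>C)" "M dvd D * j"
  shows "M dvd j \<Longrightarrow> norm (twist C j - of_real (dens C * card T)) \<le> dens C * err0 C"
    and "\<not> M dvd j \<Longrightarrow> d dvd j \<Longrightarrow> norm (twist C j) \<le> dens C * errA C"
    and "\<not> M dvd j \<Longrightarrow> norm (twist C j) \<le> dens C * errB C"
proof -
  have "(M dvd j \<longrightarrow> norm (twist C j - of_real (dens C * card T)) \<le> dens C * err0 C) \<and>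
    (\<not> M dvd j \<and> d dvd j \<longrightarrow> norm (twist C j) \<le> dens C * errA C) \<and>
    (\<not> M dvd j \<longrightarrow> norm (twist C j) \<le> dens C * errB C)"
    using assms
  proof (induction C arbitrary: D j rule: finite_induct)
    case empty
    have "twist {} j = of_nat (card T)" if "M dvd j"
    proof -
      have "unity_char M j k = 1" for k using that unity_char_eq_1_iff[OF M_pos, of j k] by simp
      then show ?thesis by (simp add: twist_empty)
    qed
    then show ?case using bound[of j] boundA[of j]
      by (auto simp: twist_empty dens_def err0_def errA_def errB_def smooth_def)
  next
    case (insert l C)
    have pl: "prime l" and lM: "l dvd M" using insert.prems(1)[of l] by auto
    then have l1: "l > 1" and l0: "l > 0" using prime_gt_1_nat prime_gt_0_nat by auto
    have pC: "\<And>l. l \<in> C \<Longrightarrow> prime l \<and> l dvd M" using insert.prems(1) by auto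
    have copDl: "coprime D l" and copDC: "coprime D (\<Prod>C)"
      using insert.prems(3) insert.hyps by simp_all
    have coplC: "coprime l (\<Prod>C)"
      using pl pC insert.hyps(2) by (intro prod_coprime_right) (metis primes_coprime)
    obtain c where c: "M = l * c" using lM by blast
    have c0: "c > 0" and Mdl: "M div l = c" using c M_pos l0 by auto
    have DlM: "D * l dvd M" using insert.prems(2) lM copDl by (simp add: divides_mult)
    have copDlC: "coprime (D * l) (\<Prod>C)" using copDC coplC by simp
    have MD: "M dvd (D * l) * (j + i * (M div l))" for i
    proof -
      have "M dvd D * l * j" using insert.prems(4) by (metis dvd_mult mult.assoc mult.commute)
      moreover have "M dvd D * l * (i * (M div l))" unfolding Mdl c by simp
      ultimately show ?thesis by (simp add: distrib_left)
    qed
    note IHi = insert.IH[OF pC DlM copDlC MD]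
    note IH0 = insert.IH[OF pC insert.prems(2) copDC insert.prems(4)]
    have nontriv: "\<not> M dvd j + i * (M div l)" if i: "i \<in> {1..<l}" for i
    proof
      assume "M dvd j + i * (M div l)"
      then have "M dvd D * j + D * (i * c)" unfolding Mdl by (metis distrib_left dvd_mult)
      then have "M dvd D * (i * c)" using insert.prems(4) dvd_add_right_iff by blast
      then have "l dvd D * i" using c c0 by (auto simp: mult_ac)
      then have "l dvd i" using copDl by (metis coprime_commute coprime_dvd_mult_right_iff)
      then show False using i by (auto dest: dvd_imp_le)
    qed
    have dC: "dens (insert l C) = (1 - 1 / real l) * dens C"
      using insert.hyps by (simp add: dens_def)
    have tw: "twist (insert l C) j = of_real (1 - 1 / real l) * twist C j -
       (\<Sum>i\<in>{1..<l}. twist C (j + i * (M div l))) / of_nat l"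
      using l0 by (simp add: twist_insert[OF lM] split_first add_divide_distrib ring_distribs)
    \<comment> \<open>The \<open>l - 1\<close> shifted sums are divided by \<open>l\<close> and so
      carry the factor \<open>1 - 1 / l\<close>, the same as the unshifted term. This is why the
      density factors out of the error.\<close>
    have rest: "norm ((\<Sum>i\<in>{1..<l}. twist C (j + i * (M div l))) / of_nat l) \<le> (1 - 1 / real l) * (dens C * B)"
      if "\<And>i. i \<in> {1..<l} \<Longrightarrow> norm (twist C (j + i * (M div l))) \<le> dens C * B" for B
    proof -
      have "norm (\<Sum>i\<in>{1..<l}. twist C (j + i * (M div l))) \<le> real (card {1..<l}) * (dens C * B)"
        using that by (intro sum_norm_bound) auto
      then have "norm (\<Sum>i\<in>{1..<l}. twist C (j + i * (M div l))) / real l \<le> real (card {1..<l}) * (dens C * B) / real l"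
        by (intro divide_right_mono) auto
      also have "\<dots> = (1 - 1 / real l) * (dens C * B)"
        using l0 by (simp add: of_nat_diff field_simps)
      finally show ?thesis by (simp add: norm_divide)
    qed
    have restB: "norm ((\<Sum>i\<in>{1..<l}. twist C (j + i * (M div l))) / of_nat l) \<le> (1 - 1 / real l) * (dens C * errB C)"
      using IHi nontriv by (intro rest) blast
    have restA: "norm ((\<Sum>i\<in>{1..<l}. twist C (j + i * (M div l))) / of_nat l) \<le> (1 - 1 / real l) * (dens C * errA C)"
      if "d dvd j" "d dvd M div l"
      using IHi nontriv that by (intro rest) (metis dvd_add dvd_mult)
    have t0: "0 \<le> 1 - 1 / real l" using l0 by simp
    have smooth1: "smooth (insert l C) = (if d dvd M div l then insert l (smooth C) else smooth C)"
      by (auto simp: smooth_def)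
    have fs: "finite (smooth C)" "l \<notin> smooth C" using insert.hyps by (auto simp: smooth_def)
    have errs: "err0 (insert l C) = err0 C + (if d dvd M div l then errA C else errB C)"
      "errA (insert l C) = errA C + (if d dvd M div l then errA C else errB C)"
      "errB (insert l C) = errB C + errB C"
      using fs insert.hyps by (auto simp: err0_def errA_def errB_def smooth1 algebra_simps)
    have main: "norm (twist (insert l C) j - z * of_real (1 - 1 / real l)) \<le> dens (insert l C) * (B1 + B2)"
      if "norm (twist C j - z) \<le> dens C * B1"
         "norm ((\<Sum>i\<in>{1..<l}. twist C (j + i * (M div l))) / of_nat l) \<le> (1 - 1 / real l) * (dens C * B2)"
       for z B1 B2
    proof -
      have "twist (insert l C) j - z * of_real (1 - 1 / real l) = of_real (1 - 1 / real l) * (twist C j - z)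
         - (\<Sum>i\<in>{1..<l}. twist C (j + i * (M div l))) / of_nat l"
        unfolding tw by (simp add: algebra_simps)
      also have "norm \<dots> \<le> norm (of_real (1 - 1 / real l) * (twist C j - z))
         + norm ((\<Sum>i\<in>{1..<l}. twist C (j + i * (M div l))) / of_nat l)"
        by (rule norm_triangle_ineq4)
      also have "norm (of_real (1 - 1 / real l) * (twist C j - z)) = (1 - 1 / real l) * norm (twist C j - z)"
        using t0 by (simp only: norm_mult norm_of_real abs_of_nonneg)
      also have "\<dots> \<le> (1 - 1 / real l) * (dens C * B1)" using that t0 by (intro mult_left_mono) auto
      also note that(2)
      also have "(1 - 1 / real l) * (dens C * B1) + (1 - 1 / real l) * (dens C * B2) = dens (insert l C) * (B1 + B2)"
        unfolding dC by (simp only: distrib_left mult.assoc)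
      finally show ?thesis by simp
    qed
    have eqT: "of_real (dens (insert l C) * card T) = (of_real (dens C * card T) :: complex) * of_real (1 - 1 / real l)"
      unfolding dC by simp
    show ?case
    proof (intro conjI impI)
      assume "M dvd j"
      then have dj: "norm (twist C j - of_real (dens C * card T)) \<le> dens C * err0 C" using IH0 by blast
      have cj: "d dvd j" if "d dvd M div l"
      proof -
        have "M div l dvd M" using c Mdl by simp
        then show ?thesis using that \<open>M dvd j\<close> by (meson dvd_trans)
      qed
      show "norm (twist (insert l C) j - of_real (dens (insert l C) * card T)) \<le> dens (insert l C) * err0 (insert l C)"
        unfolding eqT errs using main[OF dj restB] main[OF dj restA] cj by (auto split: if_splits)
    next
      assume "\<not> M dvd j \<and> d dvd j"
      then have nj: "norm (twist C j - 0) \<le> dens C * errA C" and "d dvd j" using IH0 by auto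
      then show "norm (twist (insert l C) j) \<le> dens (insert l C) * errA (insert l C)"
        unfolding errs using main[OF nj restB] main[OF nj restA] by (auto split: if_splits)
    next
      assume "\<not> M dvd j"
      then have nj: "norm (twist C j - 0) \<le> dens C * errB C" using IH0 by auto
      then show "norm (twist (insert l C) j) \<le> dens (insert l C) * errB (insert l C)"
        unfolding errs using main[OF nj restB] by auto
    qed
  qed
  then show "M dvd j \<Longrightarrow> norm (twist C j - of_real (dens C * card T)) \<le> dens C * err0 C"
    and "\<not> M dvd j \<Longrightarrow> d dvd j \<Longrightarrow> norm (twist C j) \<le> dens C * errA C"
    and "\<not> M dvd j \<Longrightarrow> norm (twist C j) \<le> dens C * errB C"
    by auto
qed

lemma twist_0: "twist C 0 = of_nat (card (sifted C))"
  by (simp add: twist_def unity_char_def)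

lemma card_sifted_ge:
  assumes "finite C" "\<And>l. l \<in> C \<Longrightarrow> prime l \<and> l dvd M"
  shows "real (card (sifted C)) \<ge> dens C * (card T - err0 C)"
proof -
  have "norm (twist C 0 - of_real (dens C * card T)) \<le> dens C * err0 C"
    using twist_bounds(1)[OF assms, of 1 0] by simp
  also have "twist C 0 - of_real (dens C * card T) = of_real (card (sifted C) - dens C * card T)"
    by (simp add: twist_0)
  finally show ?thesis unfolding norm_of_real by (simp add: algebra_simps)
qed

text \<open>The frequencies that detect \<open>l\<close> have order \<open>l\<close>, which is
  coprime to \<open>C\<close>, so the bounds for \<open>twist C\<close> apply with
  \<open>D = l\<close>; the trivial frequency yields the expected share
  \<open>card (sifted C) / l\<close>.\<close>

lemma card_sifted_dvd_le:
  assumes "finite C" "\<And>l. l \<in> C \<Longrightarrow> prime l \<and> l dvd M" "prime l" "l dvd M" "l \<notin> C"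
  shows "real (card {k\<in>sifted C. l dvd k}) \<le> card (sifted C) / l +
     (1 - 1 / l) * dens C * (if d dvd M div l then errA C else errB C)"
proof -
  let ?e = "if d dvd M div l then errA C else errB C"
  have l0: "l > 0" using assms(3) prime_gt_0_nat by auto
  obtain c where c: "M = l * c" using assms(4) by blast
  have c0: "c > 0" and Mdl: "M div l = c" using c M_pos l0 by auto
  have cop: "coprime l (\<Prod>C)"
    using assms by (intro prod_coprime_right) (metis primes_coprime)
  have each: "norm (twist C (i * (M div l))) \<le> dens C * ?e" if i: "i \<in> {1..<l}" for i
  proof -
    have "\<not> M dvd i * (M div l)" using i c0 unfolding Mdl c by (auto dest: dvd_imp_le)
    moreover have "M dvd l * (i * (M div l))" unfolding Mdl c by simp
    ultimately show ?thesis
      using twist_bounds(2,3)[OF assms(1,2) assms(4) cop, of "i * (M div l)"] by auto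
  qed
  have "of_nat (card {k\<in>sifted C. l dvd k}) = (\<Sum>k\<in>{k\<in>sifted C. l dvd k}. unity_char M 0 k)"
    by (simp add: unity_char_def)
  also have "\<dots> = (\<Sum>i<l. twist C (0 + i * (M div l))) / of_nat l"
    by (rule sum_dvd_part[OF assms(4)])
  also have "\<dots> = of_nat (card (sifted C)) / of_nat l + (\<Sum>i\<in>{1..<l}. twist C (i * (M div l))) / of_nat l"
    using l0 by (simp add: split_first add_divide_distrib twist_0)
  finally have "of_real (card {k\<in>sifted C. l dvd k} - card (sifted C) / l) = (\<Sum>i\<in>{1..<l}. twist C (i * (M div l))) / of_nat l"
    by (simp add: algebra_simps)
  then have "\<bar>card {k\<in>sifted C. l dvd k} - card (sifted C) / l\<bar> = norm (\<Sum>i\<in>{1..<l}. twist C (i * (M div l))) / l"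
    by (metis norm_of_real norm_divide norm_of_nat)
  also have "\<dots> \<le> (real (card {1..<l}) * (dens C * ?e)) / l"
    using each by (intro divide_right_mono sum_norm_bound) auto
  also have "\<dots> = (1 - 1 / l) * dens C * ?e" using l0 by (simp add: of_nat_diff field_simps)
  finally show ?thesis by linarith
qed

text \<open>The primes of \<open>C\<close> are removed exactly, those of \<open>S\<close> by a union
  bound over \<open>sifted C\<close>. The cost of \<open>S\<close> is then additive in its primes
  instead of doubling with each of them.\<close>

theorem sieve:
  assumes "finite C" "finite S" "C \<inter> S = {}" "\<And>l. l \<in> C \<union> S \<Longrightarrow> prime l \<and> l dvd M"
    and pos: "0 < 1 - (\<Sum>l\<in>S. 1 / real l)"
    and ineq: "(\<Sum>l\<in>S. (1 - 1 / real l) * (if d dvd M div l then errA C else errB C))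
       < (1 - (\<Sum>l\<in>S. 1 / real l)) * (card T - err0 C)"
  shows "\<exists>k\<in>T. \<forall>l\<in>C \<union> S. \<not> l dvd k"
proof (rule ccontr)
  assume none: "\<not> ?thesis"
  let ?e = "\<lambda>l. if d dvd M div l then errA C else errB C"
  have sub: "sifted C \<subseteq> (\<Union>l\<in>S. {k\<in>sifted C. l dvd k})"
  proof
    fix k assume k: "k \<in> sifted C"
    then have "k \<in> T" "\<forall>l\<in>C. \<not> l dvd k" by (simp_all add: sifted_def)
    then obtain l where "l \<in> S" "l dvd k" using none by blast
    then show "k \<in> (\<Union>l\<in>S. {k\<in>sifted C. l dvd k})" using k by blast
  qed
  have "card (sifted C) \<le> card (\<Union>l\<in>S. {k\<in>sifted C. l dvd k})"
    using assms(2) by (intro card_mono sub) auto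
  also have "\<dots> \<le> (\<Sum>l\<in>S. card {k\<in>sifted C. l dvd k})"
    by (rule card_UN_le[OF assms(2)])
  finally have "real (card (sifted C)) \<le> real (\<Sum>l\<in>S. card {k\<in>sifted C. l dvd k})"
    by (simp only: of_nat_le_iff)
  also have "\<dots> \<le> (\<Sum>l\<in>S. card (sifted C) / l + (1 - 1 / l) * dens C * ?e l)"
    unfolding of_nat_sum
  proof (intro sum_mono card_sifted_dvd_le[OF assms(1)])
    fix l assume "l \<in> S"
    then show "prime l" "l dvd M" "l \<notin> C" using assms(3,4) by auto
  qed (use assms(4) in auto)
  also have "\<dots> = card (sifted C) * (\<Sum>l\<in>S. 1 / real l) + dens C * (\<Sum>l\<in>S. (1 - 1 / l) * ?e l)"
    by (simp add: sum.distrib sum_distrib_left mult_ac)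
  \<comment> \<open>\<open>card (sifted C)\<close> occurs on both sides; it is collected first, and
    its lower bound enters only afterwards.\<close>
  finally have "card (sifted C) * (1 - (\<Sum>l\<in>S. 1 / real l)) \<le> dens C * (\<Sum>l\<in>S. (1 - 1 / l) * ?e l)"
    by (simp add: algebra_simps)
  moreover have "dens C * (card T - err0 C) * (1 - (\<Sum>l\<in>S. 1 / real l)) \<le> card (sifted C) * (1 - (\<Sum>l\<in>S. 1 / real l))"
    using pos assms(4) by (intro mult_right_mono card_sifted_ge[OF assms(1)]) auto
  ultimately have "dens C * ((1 - (\<Sum>l\<in>S. 1 / real l)) * (card T - err0 C)) \<le> dens C * (\<Sum>l\<in>S. (1 - 1 / l) * ?e l)"
    by (simp only: mult_ac)
  moreover have "dens C > 0" using assms(4) by (intro dens_pos) auto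
  ultimately show False using ineq by (simp only: mult_le_cancel_left_pos)
qed

end

subsection \<open>Cyclic multiplicative groups and traces of finite fields\<close>

lemma finite_field_generator:
  "\<exists>g::'a::finite_field. g \<noteq> 0 \<and> bij_betw (\<lambda>k. g ^ k) {..<CARD('a) - 1} (UNIV - {0})"
proof -
  \<comment> \<open>Cyclicity is available for fields given by a carrier, so the type is repackaged
    as such a record.\<close>
  let ?R = "\<lparr>carrier = UNIV, monoid.mult = (*), one = 1, ring.zero = 0, add = (+)\<rparr> :: 'a ring"
  have "\<exists>y. x + y = 0" for x :: 'a
    using add.right_inverse by blast
  moreover have "x \<noteq> 0 \<Longrightarrow> \<exists>y. x * y = 1" for x :: 'a
    by (rule exI[of _ "inverse x"]) auto
  ultimately interpret R: field ?R
    using add.right_inverse by unfold_locales (auto simp: algebra_simps Units_def)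
  have pow: "a [^]\<^bsub>?R\<^esub> (i::nat) = a ^ i" for a i
    by (induction i) (simp_all add: nat_pow_def mult.commute)
  have fin: "finite (carrier ?R)" by simp
  obtain a where "a \<in> carrier (mult_of ?R)" "carrier (mult_of ?R) = {a [^]\<^bsub>?R\<^esub> i | i::nat. i \<in> UNIV}"
    using R.finite_field_mult_group_has_gen[OF fin] by blast
  moreover have "carrier (mult_of ?R) = UNIV - {0}"
    by simp
  ultimately have a0: "a \<noteq> 0" and gen: "UNIV - {0} = {a ^ i | i. True}"
    by (simp_all add: pow)
  let ?N = "CARD('a) - 1"
  have "card {0, 1 :: 'a} \<le> CARD('a)" by (intro card_mono) auto
  then have N: "?N > 0" "Suc ?N = CARD('a)" by auto
  have "a * a ^ ?N = a" using finite_field_power_card_eq_same[of a] N(2) by (metis power_Suc)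
  then have aN: "a ^ ?N = 1" using a0 by simp
  have "a ^ i = a ^ (i mod ?N)" for i
  proof -
    have "a ^ i = a ^ (?N * (i div ?N) + i mod ?N)" by simp
    also have "\<dots> = a ^ (i mod ?N)" unfolding power_add power_mult aN by simp
    finally show ?thesis .
  qed
  then have img: "(\<lambda>k. a ^ k) ` {..<?N} = UNIV - {0}"
    unfolding gen using mod_less_divisor[OF N(1)] by (force simp: image_iff)
  moreover have "inj_on (\<lambda>k. a ^ k) {..<?N}"
    by (rule eq_card_imp_inj_on) (simp_all only: img card_lessThan, simp_all add: card_Diff_subset)
  ultimately show ?thesis using a0 unfolding bij_betw_def by blast
qed

locale cyclic_field =
  fixes g :: "'a::finite_field" and N :: nat
  assumes N_def: "N = CARD('a) - 1" and g_nonzero [simp]: "g \<noteq> 0"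
    and bij_pow: "bij_betw (\<lambda>k. g ^ k) {..<N} (UNIV - {0})"
begin

lemma N_pos: "N > 0"
proof -
  have "card {0, 1 :: 'a} \<le> CARD('a)" by (intro card_mono) auto
  then show ?thesis by (simp add: N_def)
qed

lemma Suc_N: "CARD('a) = Suc N"
  using N_pos N_def by simp

lemma ex_pow: "x \<noteq> 0 \<Longrightarrow> \<exists>k<N. x = g ^ k"
  using bij_betw_imp_surj_on[OF bij_pow] by (auto simp: set_eq_iff image_iff)

lemma power_N: "x \<noteq> 0 \<Longrightarrow> x ^ N = (1::'a)"
  using finite_field_power_card_eq_same[of x] unfolding Suc_N by simp

lemma power_eq_1_iff: "g ^ k = 1 \<longleftrightarrow> N dvd k"
proof
  assume k: "g ^ k = 1"
  have "g ^ k = g ^ (N * (k div N) + k mod N)" by simp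
  also have "\<dots> = g ^ (k mod N)" unfolding power_add power_mult power_N[OF g_nonzero] by simp
  finally have "g ^ (k mod N) = g ^ 0" using k by simp
  then have "k mod N = 0"
    using inj_onD[OF bij_betw_imp_inj_on[OF bij_pow], of "k mod N" 0] N_pos by simp
  then show "N dvd k" by blast
next
  assume "N dvd k"
  then show "g ^ k = 1" by (auto simp: dvd_def power_mult power_N)
qed

lemma power_eq_iff: "g ^ i = g ^ j \<longleftrightarrow> [i = j] (mod N)"
proof (induction i j rule: linorder_wlog)
  case (le i j)
  have "g ^ j = g ^ i * g ^ (j - i)" using le by (simp flip: power_add)
  then have "g ^ i = g ^ j \<longleftrightarrow> g ^ (j - i) = 1" by auto
  also have "\<dots> \<longleftrightarrow> [i = j] (mod N)"
    unfolding power_eq_1_iff cong_sym_eq[of i] using le by (simp add: cong_altdef_nat)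
  finally show ?case .
next
  case (sym i j)
  then show ?case by (metis cong_sym)
qed

lemma mult_order_power: "mult_order (g ^ k) = N div gcd k N"
proof -
  let ?e = "gcd k N"
  have e: "?e > 0" using N_pos by simp
  have iff: "(g ^ k) ^ d = 1 \<longleftrightarrow> N div ?e dvd d" for d
  proof -
    have "(g ^ k) ^ d = 1 \<longleftrightarrow> N dvd k * d" by (simp add: power_eq_1_iff flip: power_mult)
    also have "\<dots> \<longleftrightarrow> ?e * (N div ?e) dvd ?e * ((k div ?e) * d)" by (simp flip: mult.assoc)
    also have "\<dots> \<longleftrightarrow> N div ?e dvd (k div ?e) * d" using e by (simp only: dvd_times_left_cancel_iff)
    also have "\<dots> \<longleftrightarrow> N div ?e dvd d"
      using div_gcd_coprime[of k N] e by (metis coprime_commute coprime_dvd_mult_right_iff gcd_eq_0_iff neq0_conv)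
    finally show ?thesis .
  qed
  have "N div ?e > 0" using e N_pos by (simp add: div_greater_zero_iff dvd_imp_le)
  then show ?thesis unfolding mult_order_def iff
    by (intro Least_equality) (auto dest: dvd_imp_le)
qed

lemma two_primitive_power_iff:
  assumes "even N"
  shows "r_primitive 2 (g ^ k) \<longleftrightarrow> gcd k N = 2"
proof -
  have "N div gcd k N = N div 2 \<longleftrightarrow> gcd k N = 2"
  proof
    assume "N div gcd k N = N div 2"
    then have "gcd k N * (N div 2) = 2 * (N div 2)"
      using assms by (metis dvd_mult_div_cancel gcd_dvd2)
    moreover have "N div 2 > 0" using assms N_pos by (auto elim!: evenE)
    ultimately show "gcd k N = 2" by simp
  qed simp
  then show ?thesis using assms unfolding r_primitive_def N_def[symmetric]
    by (simp add: mult_order_power)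
qed

definition dlog :: "'a \<Rightarrow> nat" where
  "dlog x = (SOME k. x = g ^ k)"

lemma power_dlog: "x \<noteq> 0 \<Longrightarrow> g ^ dlog x = x"
  unfolding dlog_def using ex_pow[of x] by (metis (mono_tags, lifting) someI)

text \<open>The character of index \<open>j\<close> of the multiplicative group, extended by 0 even
  for \<open>j = 0\<close>, so that sums over fibres never count the zero element.
  \<open>dlog\<close> matters only modulo \<open>N\<close>, which is the period of
  \<open>unity_char N j\<close>.\<close>

definition mchar :: "nat \<Rightarrow> 'a \<Rightarrow> complex" where
  "mchar j x = (if x = 0 then 0 else unity_char N j (dlog x))"

lemma unity_char_cong: "[i = k] (mod N) \<Longrightarrow> unity_char N j i = unity_char N j k"
proof (induction i k rule: linorder_wlog)
  case (le i k)
  then have "N dvd k - i" unfolding cong_sym_eq[of i] by (simp add: cong_altdef_nat)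
  then have "unity_char N j (k - i) = 1" using unity_char_eq_1_iff[OF N_pos, of j "k - i"] by simp
  then show ?case using le unity_char_add_right[of N j i "k - i"] by simp
next
  case (sym i k)
  then show ?case by (metis cong_sym)
qed

lemma mchar_power: "mchar j (g ^ k) = unity_char N j k"
proof -
  have "g ^ dlog (g ^ k) = g ^ k" by (rule power_dlog) simp
  then show ?thesis by (simp add: mchar_def power_eq_iff unity_char_cong)
qed

lemma mchar_0 [simp]: "mchar j 0 = 0"
  by (simp add: mchar_def)

lemma norm_mchar: "x \<noteq> 0 \<Longrightarrow> norm (mchar j x) = 1"
  by (simp add: mchar_def)

lemma mchar_mult: "mchar j (x * y) = mchar j x * mchar j y"
proof (cases "x = 0 \<or> y = 0")
  case False
  then obtain a b where "x = g ^ a" "y = g ^ b" using ex_pow by meson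
  then show ?thesis by (simp add: mchar_power unity_char_add_right flip: power_add)
qed auto

lemma mchar_1 [simp]: "mchar j 1 = 1"
  using mchar_power[of j 0] by (simp add: unity_char_def)

lemma sum_nonzero_powers: "(\<Sum>x\<in>UNIV - {0}. f x) = (\<Sum>k<N. f (g ^ k))"
  using sum.reindex_bij_betw[OF bij_pow, of f] by simp

lemma sum_mchar:
  assumes "\<not> N dvd j"
  shows "(\<Sum>x\<in>UNIV. mchar j x) = 0"
proof -
  have "(\<Sum>x\<in>UNIV. mchar j x) = (\<Sum>x\<in>UNIV - {0}. mchar j x)"
    by (intro sum.mono_neutral_right) auto
  also have "\<dots> = (\<Sum>k<N. unity_char N j k)"
    by (simp add: sum_nonzero_powers mchar_power)
  also have "\<dots> = (\<Sum>k<N. unity_char N k j)"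
    by (simp add: unity_char_def mult_ac)
  finally show ?thesis using assms by (simp add: sum_unity_char[OF N_pos])
qed

end

section \<open>The trace map, its fibres and the subfield of \<open>q\<close> elements\<close>

locale trace_field = cyclic_field g N for g :: "'a::finite_field" and N :: nat +
  fixes q n :: nat
  assumes q: "primepow q" and n_pos: "n > 0" and card_q: "CARD('a) = q ^ n"
begin

definition base :: "'a set" where "base = {x. x ^ q = x}"

abbreviation Tr :: "'a \<Rightarrow> 'a" where "Tr \<equiv> field_trace q n"

lemma q_gt_1: "q > 1"
  using q by (simp add: primepow_gt_Suc_0)

lemma ex_CHAR_power: "\<exists>m. q = CHAR('a) ^ m"
proof -
  obtain p m where pm: "prime p" "q = p ^ m" "m > 0" using q by (auto simp: primepow_def)
  have "CHAR('a) dvd p ^ (m * n)"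
    using CHAR_dvd_CARD[where ?'a = 'a] by (simp add: card_q pm power_mult)
  moreover have "prime CHAR('a)" by (rule prime_CHAR_semidom) (simp add: CHAR_pos_iff pos_char_exists)
  ultimately have "CHAR('a) = p" using pm(1) by (metis prime_dvd_power primes_dvd_imp_eq)
  then show ?thesis using pm by blast
qed

lemma frobenius_add: "(x + y :: 'a) ^ (q ^ i) = x ^ (q ^ i) + y ^ (q ^ i)"
proof -
  obtain m where "q = CHAR('a) ^ m" using ex_CHAR_power by blast
  then show ?thesis by (simp add: freshmans_dream' flip: power_mult)
qed

lemma frobenius_sum: "(\<Sum>x\<in>A. f x :: 'a) ^ (q ^ i) = (\<Sum>x\<in>A. f x ^ (q ^ i))"
  using q_gt_1 by (induction A rule: infinite_finite_induct) (auto simp: frobenius_add)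

lemma power_q_n: "(x::'a) ^ (q ^ n) = x"
  using finite_field_power_card_eq_same[of x] by (simp add: card_q)

lemma base_power: "c \<in> base \<Longrightarrow> c ^ (q ^ i) = c"
  by (induction i) (auto simp: base_def power_mult)

lemma trace_add: "Tr (x + y) = Tr x + Tr y"
  by (simp add: field_trace_def frobenius_add sum.distrib)

lemma trace_mult_base: "c \<in> base \<Longrightarrow> Tr (c * x) = c * Tr x"
  by (simp add: field_trace_def power_mult_distrib base_power sum_distrib_left)

lemma trace_in_base: "Tr x \<in> base"
proof -
  have "Tr x ^ q = Tr x ^ (q ^ 1)" by simp
  also have "\<dots> = (\<Sum>i<n. x ^ (q ^ Suc i))"
    unfolding field_trace_def frobenius_sum by (simp add: mult.commute flip: power_mult)
  also have "\<dots> = (\<Sum>i<Suc n. x ^ (q ^ i)) - x"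
    by (subst sum.lessThan_Suc_shift) simp
  also have "\<dots> = Tr x" by (simp add: field_trace_def power_q_n)
  finally show ?thesis by (simp add: base_def)
qed

lemma trace_0 [simp]: "Tr 0 = 0"
  using q_gt_1 by (simp add: field_trace_def power_0_left)

lemma trace_minus: "Tr (x - y) = Tr x - Tr y"
  using trace_add[of "x - y" y] by simp

text \<open>The index of the nonzero elements of \<open>base\<close> in the multiplicative group;
  \<open>g ^ m\<close> generates them, and \<open>x ^ m\<close> is the norm of
  \<open>x\<close>.\<close>

definition m :: nat where "m = (q ^ n - 1) div (q - 1)"

lemma N_eq: "N = (q - 1) * m" "N = q ^ n - 1"
proof -
  show "N = q ^ n - 1" by (simp add: N_def card_q)
  moreover have "q - 1 dvd q ^ n - 1"
  proof -
    have "int q - 1 dvd int q ^ n - 1" by (simp add: power_diff_1_eq)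
    then have "int (q - 1) dvd int (q ^ n - 1)" using q_gt_1 by (simp add: of_nat_diff)
    then show ?thesis by (simp only: int_dvd_int_iff)
  qed
  ultimately show "N = (q - 1) * m" by (simp add: m_def)
qed

lemma m_pos: "m > 0"
  using N_pos unfolding N_eq(1) by simp

lemma base_nonzero_iff: "g ^ k \<in> base \<longleftrightarrow> m dvd k"
proof -
  have "g ^ k \<in> base \<longleftrightarrow> g ^ k * g ^ (k * (q - 1)) = g ^ k * 1"
    using q_gt_1 unfolding base_def by (simp flip: power_mult power_add add: algebra_simps) 
  also have "\<dots> \<longleftrightarrow> N dvd k * (q - 1)"
    by (simp add: power_eq_1_iff)
  also have "\<dots> \<longleftrightarrow> m dvd k" using q_gt_1 unfolding N_eq(1) by (simp add: mult.commute)
  finally show ?thesis .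
qed

lemma base_bij: "bij_betw (\<lambda>i. g ^ (m * i)) {..<q - 1} (base - {0})"
proof (intro bij_betw_imageI)
  show "inj_on (\<lambda>i. g ^ (m * i)) {..<q - 1}"
  proof (rule inj_onI)
    fix i j assume ij: "i \<in> {..<q - 1}" "j \<in> {..<q - 1}" "g ^ (m * i) = g ^ (m * j)"
    then have "[m * i = m * j] (mod m * (q - 1))" by (simp add: power_eq_iff N_eq(1) mult.commute)
    then have "[i = j] (mod (q - 1))" using m_pos by (simp add: cong_def)
    then show "i = j" using ij by (simp add: cong_def)
  qed
  show "(\<lambda>i. g ^ (m * i)) ` {..<q - 1} = base - {0}"
  proof (intro equalityI subsetI)
    fix x assume x: "x \<in> base - {0}"
    then obtain k where k: "k < N" "x = g ^ k" using ex_pow by auto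
    then obtain i where "k = m * i" using x base_nonzero_iff by (auto simp: dvd_def)
    then show "x \<in> (\<lambda>i. g ^ (m * i)) ` {..<q - 1}" using k N_eq(1) m_pos by (auto simp: mult.commute)
  qed (auto simp: base_nonzero_iff)
qed

lemma card_base: "card base = q"
proof -
  have "card (base - {0}) = q - 1" using bij_betw_same_card[OF base_bij] by simp
  moreover have "0 \<in> base" using q_gt_1 by (simp add: base_def)
  ultimately show ?thesis using q_gt_1 by (simp add: card_Diff_singleton)
qed

definition fibre :: "'a \<Rightarrow> 'a set" where "fibre b = {x. Tr x = b}"

text \<open>The trace is a polynomial function of degree \<open>q ^ (n - 1)\<close>, which bounds
  the number of roots.\<close>

lemma card_fibre_le: "card (fibre b) \<le> q ^ (n - 1)"
proof -
  define P :: "'a poly" where "P = (\<Sum>i<n. Polynomial.monom 1 (q ^ i)) - [:b:]"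
  have "poly P x = Tr x - b" for x
    by (simp add: P_def field_trace_def poly_sum poly_monom)
  then have eq: "fibre b = {x. poly P x = 0}" by (auto simp: fibre_def)
  have co: "Polynomial.coeff P (q ^ (n - 1)) = 1"
  proof -
    have "Polynomial.coeff P (q ^ (n - 1)) = (\<Sum>i<n. if i = n - 1 then 1 else 0)"
      using q_gt_1 by (simp add: P_def coeff_sum coeff_pCons split: nat.splits)
    then show ?thesis using n_pos by simp
  qed
  have "Polynomial.degree P \<le> q ^ (n - 1)"
    unfolding P_def
  proof (intro degree_diff_le degree_sum_le)
    fix i assume "i \<in> {..<n}"
    then have "q ^ i \<le> q ^ (n - 1)" using q_gt_1 by (intro power_increasing) auto
    then show "Polynomial.degree (Polynomial.monom (1::'a) (q ^ i)) \<le> q ^ (n - 1)" by (simp add: degree_monom_eq)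
  qed auto
  moreover have "P \<noteq> 0" using co by auto
  ultimately show ?thesis unfolding eq using card_poly_roots_bound[of P] by linarith
qed

text \<open>The \<open>q\<close> fibres over \<open>base\<close> exhaust all \<open>q ^ n\<close>
  elements and none exceeds \<open>q ^ (n - 1)\<close>, so each attains it.\<close>

lemma card_fibre: "b \<in> base \<Longrightarrow> card (fibre b) = q ^ (n - 1)"
proof -
  assume b: "b \<in> base"
  have "CARD('a) = card (\<Union>b\<in>base. fibre b)"
    using trace_in_base by (intro arg_cong[of _ _ card]) (auto simp: fibre_def)
  also have "\<dots> = (\<Sum>b\<in>base. card (fibre b))"
    by (intro card_UN_disjoint) (auto simp: fibre_def)
  finally have "(\<Sum>b\<in>base. card (fibre b)) = (\<Sum>b\<in>base. q ^ (n - 1))"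
    using n_pos by (simp add: card_base card_q flip: power_Suc)
  moreover have "card (fibre b) < q ^ (n - 1) \<Longrightarrow> (\<Sum>b\<in>base. card (fibre b)) < (\<Sum>b\<in>base. q ^ (n - 1))"
    using b card_fibre_le by (intro sum_strict_mono_ex1) auto
  ultimately show ?thesis using card_fibre_le[of b] by force
qed

end

section \<open>Character sums over trace fibres\<close>

context trace_field
begin

definition S :: "nat \<Rightarrow> 'a \<Rightarrow> complex" where
  "S j b = (\<Sum>x\<in>fibre b. mchar j x)"

lemma zero_in_base [simp]: "0 \<in> base" and one_in_base [simp]: "1 \<in> base"
  using q_gt_1 by (simp_all add: base_def)

lemma sum_fibres: "(\<Sum>b\<in>base. \<Sum>x\<in>fibre b. f x) = (\<Sum>x\<in>UNIV. f x)"
proof -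
  have "(\<Sum>b\<in>base. \<Sum>x\<in>{x\<in>UNIV. Tr x = b}. f x) = (\<Sum>x\<in>UNIV. f x)"
    using trace_in_base by (intro sum.group) auto
  then show ?thesis by (simp add: fibre_def)
qed

text \<open>Opening the square with \<open>x = z * y\<close> turns a pair in one fibre into the
  condition \<open>Tr ((z - 1) * y) = 0\<close>. The number of nonzero solutions \<open>y\<close> is
  the same for all \<open>z \<noteq> 1\<close>, so orthogonality leaves only the surplus at
  \<open>z = 1\<close>. No Gauss sums are involved.\<close>

lemma second_moment:
  assumes "\<not> N dvd j"
  shows "(\<Sum>b\<in>base. (norm (S j b))\<^sup>2) = real q ^ n - real q ^ (n - 1)"
proof -
  define Z where "Z y = {z. Tr ((z - 1) * y) = 0}" for y
  have S_trace: "S j (Tr y) * cnj (mchar j y) = (\<Sum>z\<in>Z y. mchar j z)" if "y \<noteq> 0" for y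
  proof -
    have "S j (Tr y) = (\<Sum>z\<in>Z y. mchar j (z * y))"
      unfolding S_def
      by (rule sum.reindex_bij_witness[of _ "\<lambda>z. z * y" "\<lambda>x. x / y"])
        (use that in \<open>auto simp: fibre_def Z_def left_diff_distrib trace_minus\<close>)
    then have "S j (Tr y) * cnj (mchar j y) = (\<Sum>z\<in>Z y. mchar j z * (mchar j y * cnj (mchar j y)))"
      by (simp add: mchar_mult sum_distrib_right mult.assoc)
    moreover have "mchar j y * cnj (mchar j y) = 1"
      using norm_mchar[OF that, of j] by (simp add: complex_norm_square[symmetric])
    ultimately show ?thesis by simp
  qed
  have cardZ: "card {y \<in> UNIV - {0}. z \<in> Z y} = (if z = 1 then N else q ^ (n - 1) - 1)" for z
  proof (cases "z = 1")
    case True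
    then have "{y \<in> UNIV - {0}. z \<in> Z y} = UNIV - {0}" by (auto simp: Z_def)
    then show ?thesis using True by (simp add: card_Diff_singleton N_def)
  next
    case False
    have "bij_betw (\<lambda>y. (z - 1) * y) {y \<in> UNIV - {0}. z \<in> Z y} (fibre 0 - {0})"
      by (rule bij_betw_byWitness[where f' = "\<lambda>y. y / (z - 1)"])
        (use False in \<open>auto simp: Z_def fibre_def\<close>)
    then have "card {y \<in> UNIV - {0}. z \<in> Z y} = card (fibre 0 - {0})" by (rule bij_betw_same_card)
    also have "\<dots> = q ^ (n - 1) - 1"
      using card_fibre[of 0] by (simp add: card_Diff_singleton fibre_def)
    finally show ?thesis using False by simp
  qed
  have "of_real (\<Sum>b\<in>base. (norm (S j b))\<^sup>2) = (\<Sum>b\<in>base. S j b * cnj (S j b))"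
    by (simp only: of_real_sum complex_norm_square)
  also have "\<dots> = (\<Sum>b\<in>base. \<Sum>y\<in>fibre b. S j (Tr y) * cnj (mchar j y))"
  proof (rule sum.cong[OF refl])
    fix b
    have "S j b * cnj (S j b) = (\<Sum>y\<in>fibre b. S j b * cnj (mchar j y))"
      by (subst (2) S_def) (simp add: sum_distrib_left)
    then show "S j b * cnj (S j b) = (\<Sum>y\<in>fibre b. S j (Tr y) * cnj (mchar j y))"
      by (simp add: fibre_def)
  qed
  also have "\<dots> = (\<Sum>y\<in>UNIV. S j (Tr y) * cnj (mchar j y))" by (rule sum_fibres)
  also have "\<dots> = (\<Sum>y\<in>UNIV - {0}. S j (Tr y) * cnj (mchar j y))"
    by (intro sum.mono_neutral_right) auto
  also have "\<dots> = (\<Sum>y\<in>UNIV - {0}. \<Sum>z\<in>{z\<in>UNIV. z \<in> Z y}. mchar j z)"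
    using S_trace by (intro sum.cong) auto
  also have "\<dots> = (\<Sum>z\<in>UNIV. \<Sum>y\<in>{y\<in>UNIV - {0}. z \<in> Z y}. mchar j z)"
    by (rule sum.swap_restrict) auto
  also have "\<dots> = (\<Sum>z\<in>UNIV. of_nat (card {y\<in>UNIV - {0}. z \<in> Z y}) * mchar j z)"
    by (simp only: sum_constant)
  also have "\<dots> = (\<Sum>z\<in>UNIV. (if z = 1 then of_nat N - of_nat (q ^ (n - 1) - 1) else 0) +
      of_nat (q ^ (n - 1) - 1) * mchar j z)"
    unfolding cardZ by (intro sum.cong refl) simp
  also have "\<dots> = of_nat N - of_nat (q ^ (n - 1) - 1) + of_nat (q ^ (n - 1) - 1) * (\<Sum>z\<in>UNIV. mchar j z)"
    by (simp only: sum.distrib sum_distrib_left) simp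
  also have "\<dots> = of_nat N - of_nat (q ^ (n - 1) - 1)"
    by (simp only: sum_mchar[OF assms]) simp
  also have "\<dots> = of_real (real q ^ n - real q ^ (n - 1))"
    using q_gt_1 by (simp add: N_eq(2) of_nat_diff)
  finally show ?thesis by (simp only: of_real_eq_iff)
qed

lemma S_scale:
  assumes "c \<in> base - {0}"
  shows "S j (c * b) = mchar j c * S j b"
proof -
  have "S j (c * b) = (\<Sum>x\<in>fibre b. mchar j (c * x))"
    unfolding S_def
  proof (rule sum.reindex_bij_witness[of _ "\<lambda>x. c * x" "\<lambda>x. x / c"])
    fix x assume "x \<in> fibre (c * b)"
    then have "c * Tr (x / c) = c * b" using assms trace_mult_base[of c "x / c"] by (simp add: fibre_def)
    then show "x / c \<in> fibre b" using assms by (simp add: fibre_def)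
  qed (use assms trace_mult_base in \<open>auto simp: fibre_def\<close>)
  then show ?thesis by (simp add: mchar_mult S_def flip: sum_distrib_left)
qed

lemma mchar_base: "mchar j (g ^ (m * i)) = 1 \<longleftrightarrow> q - 1 dvd j * i"
proof -
  have "mchar j (g ^ (m * i)) = 1 \<longleftrightarrow> m * (q - 1) dvd m * (j * i)"
    unfolding mchar_power unity_char_eq_1_iff[OF N_pos] by (subst N_eq(1)) (simp add: mult_ac)
  then show ?thesis using m_pos by (simp only: dvd_times_left_cancel_iff)
qed

lemma norm_S_const:
  assumes "b \<in> base - {0}"
  shows "norm (S j b) = norm (S j 1)"
  using S_scale[OF assms, of j 1] norm_mchar[of b j] assms by (simp add: norm_mult)

lemma second_moment':
  assumes "\<not> N dvd j"
  shows "(norm (S j 0))\<^sup>2 + real (q - 1) * (norm (S j 1))\<^sup>2 = real q ^ n - real q ^ (n - 1)"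
proof -
  have "(\<Sum>b\<in>base. (norm (S j b))\<^sup>2) = (norm (S j 0))\<^sup>2 + (\<Sum>b\<in>base - {0}. (norm (S j b))\<^sup>2)"
    by (intro sum.remove) auto
  also have "(\<Sum>b\<in>base - {0}. (norm (S j b))\<^sup>2) = (\<Sum>b\<in>base - {0}. (norm (S j 1))\<^sup>2)"
    by (intro sum.cong refl) (simp only: norm_S_const)
  also have "\<dots> = real (q - 1) * (norm (S j 1))\<^sup>2"
    by (simp add: card_Diff_singleton card_base)
  finally show ?thesis using second_moment[OF assms] by simp
qed

lemma q_power_diff: "real q ^ n - real q ^ (n - 1) = real (q - 1) * real q ^ (n - 1)"
proof -
  have "real q ^ n = real q * real q ^ (n - 1)" using n_pos by (simp flip: power_Suc)
  then show ?thesis using q_gt_1 by (simp add: of_nat_diff algebra_simps)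
qed

lemma norm_S_le:
  assumes "\<not> N dvd j" "b \<in> base - {0}"
  shows "norm (S j b) \<le> sqrt (real q) ^ (n - 1)"
proof -
  have "real (q - 1) * (norm (S j 1))\<^sup>2 \<le> real (q - 1) * real q ^ (n - 1)"
    using second_moment'[OF assms(1)] unfolding q_power_diff by (smt (verit) zero_le_power2)
  then have "(norm (S j 1))\<^sup>2 \<le> (sqrt (real q) ^ (n - 1))\<^sup>2"
    using q_gt_1 by (simp flip: power_mult add: mult.commute[of _ 2]) (simp add: power_mult)
  then show ?thesis unfolding norm_S_const[OF assms(2)] by (rule power2_le_imp_le) simp
qed

text \<open>Such a character is trivial on \<open>base\<close>, so all nonzero traces give the same
  sum, and the sums over all traces add up to zero.\<close>

lemma S_0_trivial:
  assumes "\<not> N dvd j" "q - 1 dvd j"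
  shows "S j 0 = - of_nat (q - 1) * S j 1"
proof -
  have "mchar j c = 1" if c: "c \<in> base - {0}" for c
  proof -
    obtain i where "c = g ^ (m * i)" using c unfolding bij_betw_imp_surj_on[OF base_bij, symmetric] by blast
    then show ?thesis using mchar_base[of j i] assms(2) by simp
  qed
  then have const: "S j b = S j 1" if "b \<in> base - {0}" for b
    using S_scale[OF that, of j 1] that by simp
  have "0 = (\<Sum>b\<in>base. S j b)"
    using sum_fibres[of "mchar j"] by (simp add: S_def sum_mchar[OF assms(1)])
  also have "\<dots> = S j 0 + (\<Sum>b\<in>base - {0}. S j b)" by (intro sum.remove) auto
  also have "(\<Sum>b\<in>base - {0}. S j b) = (\<Sum>b\<in>base - {0}. S j 1)"
    by (intro sum.cong refl const)
  also have "\<dots> = of_nat (q - 1) * S j 1" by (simp add: card_Diff_singleton card_base)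
  finally show ?thesis by (simp add: algebra_simps add_eq_0_iff)
qed

text \<open>Scaling by a generator of \<open>base\<close> preserves the fibre over zero but
  multiplies the sum by a value other than 1.\<close>

lemma S_0_nontrivial:
  assumes "\<not> q - 1 dvd j"
  shows "S j 0 = 0"
proof -
  have "q - 1 > 1" using assms q_gt_1 by (cases "q - 1 = 1") auto
  then have c: "g ^ (m * 1) \<in> base - {0}" using bij_betwE[OF base_bij] by blast
  have "mchar j (g ^ (m * 1)) \<noteq> 1" using assms mchar_base[of j 1] by simp
  then show ?thesis using S_scale[OF c, of j 0] by simp
qed

text \<open>Since the sum over the kernel is \<open>q - 1\<close> times as large, the second moment
  determines the modulus exactly. The saving of \<open>sqrt q\<close> over the general case is the
  source of the better bound in the sieve.\<close>

lemma norm_S_trivial: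
  assumes "\<not> N dvd j" "q - 1 dvd j" "n \<ge> 2" "b \<in> base - {0}"
  shows "norm (S j b) = sqrt (real q) ^ (n - 2)"
proof -
  have q1: "real (q - 1) = real q - 1" "real q > 1" using q_gt_1 by (simp_all add: of_nat_diff)
  have "norm (S j 0) = real (q - 1) * norm (S j 1)"
    using S_0_trivial[OF assms(1,2)] by (simp add: norm_mult)
  then have *: "(real (q - 1) * norm (S j 1))\<^sup>2 + real (q - 1) * (norm (S j 1))\<^sup>2 = real (q - 1) * real q ^ (n - 1)"
    using second_moment'[OF assms(1)] unfolding q_power_diff by simp
  then have "real (q - 1) * real q * (norm (S j 1))\<^sup>2 = real (q - 1) * real q * real q ^ (n - 2)"
  proof -
    have "real q ^ (n - 1) = real q * real q ^ (n - 2)"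
      using assms(3) by (simp flip: power_Suc) (simp add: Suc_diff_Suc numeral_2_eq_2)
    moreover have "(real (q - 1) * x)\<^sup>2 + real (q - 1) * x\<^sup>2 = real (q - 1) * real q * x\<^sup>2" for x :: real
      unfolding q1 by (simp add: power2_eq_square algebra_simps)
    ultimately show ?thesis using * by simp
  qed
  then have "(norm (S j 1))\<^sup>2 = (sqrt (real q) ^ (n - 2))\<^sup>2"
    using q1 by (simp flip: power_mult add: mult.commute[of _ 2]) (simp add: power_mult)
  then have "norm (S j 1) = sqrt (real q) ^ (n - 2)" by (simp add: power2_eq_iff_nonneg)
  then show ?thesis unfolding norm_S_const[OF assms(4)] .
qed

lemma norm_S_0_le:
  assumes "\<not> N dvd j" "n \<ge> 2"
  shows "norm (S j 0) \<le> real (q - 1) * sqrt (real q) ^ (n - 2)"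
proof (cases "q - 1 dvd j")
  case True
  then show ?thesis
    using S_0_trivial[OF assms(1)] norm_S_trivial[OF assms(1) _ assms(2), of 1] by (simp add: norm_mult)
qed (simp add: S_0_nontrivial)

section \<open>Exponent sets of elements and of squares with given trace\<close>

definition exps :: "'a \<Rightarrow> nat set" where
  "exps b = {k. k < N \<and> Tr (g ^ k) = b}"

definition half_exps :: "'a \<Rightarrow> nat set" where
  "half_exps b = {k. k < N div 2 \<and> Tr (g ^ (2 * k)) = b}"

lemma finite_exps [simp]: "finite (exps b)" "finite (half_exps b)"
  by (simp_all add: exps_def half_exps_def)

lemma S_exps: "S j b = (\<Sum>k\<in>exps b. unity_char N j k)"
proof -
  have "S j b = (\<Sum>x\<in>fibre b - {0}. mchar j x)"
    unfolding S_def by (intro sum.mono_neutral_right) auto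
  also have "bij_betw (\<lambda>k. g ^ k) (exps b) (fibre b - {0})"
  proof (rule bij_betw_imageI)
    show "inj_on (\<lambda>k. g ^ k) (exps b)"
      by (rule inj_on_subset[OF bij_betw_imp_inj_on[OF bij_pow]]) (auto simp: exps_def)
    show "(\<lambda>k. g ^ k) ` exps b = fibre b - {0}"
      using ex_pow by (fastforce simp: exps_def fibre_def)
  qed
  then have "(\<Sum>x\<in>fibre b - {0}. mchar j x) = (\<Sum>k\<in>exps b. mchar j (g ^ k))"
    by (simp add: sum.reindex_bij_betw)
  finally show ?thesis by (simp add: mchar_power)
qed

lemma card_exps_0: "card (exps 0) = q ^ (n - 1) - 1"
proof -
  have "S 0 0 = of_nat (card (exps 0))" by (simp add: S_exps unity_char_def)
  moreover have "S 0 0 = (\<Sum>x\<in>fibre 0 - {0}. mchar 0 x)"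
    unfolding S_def by (intro sum.mono_neutral_right) auto
  moreover have "\<dots> = (\<Sum>x\<in>fibre 0 - {0}. 1)"
    by (intro sum.cong) (auto simp: mchar_def unity_char_def)
  moreover have "\<dots> = of_nat (q ^ (n - 1) - 1)"
    using card_fibre[of 0] by (simp add: card_Diff_singleton fibre_def)
  ultimately show ?thesis by (metis of_nat_eq_iff)
qed

lemma S_0_index: "b \<noteq> 0 \<Longrightarrow> b \<in> base \<Longrightarrow> S 0 b = of_nat (q ^ (n - 1))"
proof -
  assume b: "b \<noteq> 0" "b \<in> base"
  have "S 0 b = (\<Sum>x\<in>fibre b. 1)"
    unfolding S_def using b by (intro sum.cong) (auto simp: mchar_def unity_char_def fibre_def)
  then show ?thesis using card_fibre[OF b(2)] by simp
qed

text \<open>Even exponents are selected by averaging with the quadratic character, whose index is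
  \<open>N div 2\<close>; a sum over squares therefore involves two sums, at \<open>j\<close> and at
  \<open>j + N div 2\<close>.\<close>

lemma sum_half_exps:
  assumes "even N"
  shows "(\<Sum>k\<in>half_exps b. unity_char (N div 2) j k) = (S j b + S (j + N div 2) b) / 2"
proof -
  have half: "unity_char N (N div 2) k = (if even k then 1 else - 1)" for k
  proof -
    have r: "real (N div 2) = real N / 2" using assms by (auto elim!: evenE)
    have "unity_char N (N div 2) k = cis (pi * real k)"
      using N_pos unfolding unity_char_def r by (simp add: field_simps)
    also have "\<dots> = cis pi ^ k" by (simp only: DeMoivre mult.commute)
    finally show ?thesis by simp
  qed
  have "S j b + S (j + N div 2) b = (\<Sum>k\<in>exps b. unity_char N j k * (1 + unity_char N (N div 2) k))"
    by (simp add: S_exps unity_char_add distrib_left sum.distrib)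
  also have "\<dots> = (\<Sum>k\<in>{k\<in>exps b. even k}. unity_char N j k * 2)"
    by (intro sum.mono_neutral_cong_right) (auto simp: half)
  also have "\<dots> = (\<Sum>k\<in>half_exps b. unity_char N j (2 * k) * 2)"
    by (rule sum.reindex_bij_witness[of _ "\<lambda>k. 2 * k" "\<lambda>k. k div 2"])
      (use assms in \<open>auto simp: exps_def half_exps_def elim!: evenE\<close>)
  also have "\<dots> = (\<Sum>k\<in>half_exps b. unity_char (N div 2) j k) * 2"
  proof -
    have "unity_char N j (2 * k) = unity_char (N div 2) j k" for k
    proof -
      obtain c where c: "N = 2 * c" using assms by blast
      then have "c > 0" using N_pos by simp
      then show ?thesis unfolding unity_char_def c by (simp add: field_simps)
    qed
    then show ?thesis by (simp add: sum_distrib_right)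
  qed
  finally show ?thesis by simp
qed

lemma not_dvd_half: 
  assumes "even N" "\<not> N div 2 dvd j" shows "\<not> N dvd j" "\<not> N dvd j + N div 2"
proof -
  have "N div 2 dvd N" using assms(1) by (metis dvd_triv_right dvd_mult_div_cancel)
  moreover have "N div 2 dvd j + N div 2 \<longleftrightarrow> N div 2 dvd j" by simp
  ultimately show "\<not> N dvd j" "\<not> N dvd j + N div 2"
    using assms(2) by (meson dvd_trans)+
qed

lemma norm_half_sum_le:
  assumes "even N" "\<not> N div 2 dvd j" "b \<in> base - {0}"
  shows "norm (\<Sum>k\<in>half_exps b. unity_char (N div 2) j k) \<le> sqrt (real q) ^ (n - 1)"
proof -
  note nd = not_dvd_half[OF assms(1,2)]
  have "norm (S j b + S (j + N div 2) b) \<le> sqrt (real q) ^ (n - 1) + sqrt (real q) ^ (n - 1)"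
    using norm_S_le[OF nd(1) assms(3)] norm_S_le[OF nd(2) assms(3)]
    by (intro norm_triangle_mono)
  then show ?thesis by (simp add: sum_half_exps[OF assms(1)] norm_divide)
qed

lemma card_half_exps:
  assumes "even N"
  shows "of_nat (card (half_exps b)) = (S 0 b + S (N div 2) b) / 2"
  using sum_half_exps[OF assms, where j = 0 and b = b] by (simp add: unity_char_def)

text \<open>The trivial character gives the main term, and the quadratic character is the only
  source of error.\<close>

lemma card_half_exps_ge:
  assumes "even N" "b \<in> base - {0}" "norm (S (N div 2) b) \<le> B"
  shows "real (card (half_exps b)) \<ge> (real q ^ (n - 1) - B) / 2"
proof -
  have "of_nat (card (half_exps b)) * 2 - of_nat (q ^ (n - 1)) = S (N div 2) b"
    using card_half_exps[OF assms(1), of b] assms(2) by (simp add: S_0_index)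
  then have "norm (of_real (real (card (half_exps b)) * 2 - real q ^ (n - 1)) :: complex) \<le> B"
    using assms(3) by simp
  then have "\<bar>real (card (half_exps b)) * 2 - real q ^ (n - 1)\<bar> \<le> B"
    unfolding norm_of_real .
  then have "real q ^ (n - 1) - B \<le> real (card (half_exps b)) * 2" by linarith
  then show ?thesis by simp
qed

lemma N_half: "even N \<Longrightarrow> \<not> N dvd N div 2"
  using N_pos by (intro nat_dvd_not_less) (auto elim!: evenE)

end

context char_sum_bounds
begin

text \<open>Both error terms shrink when more primes count as smooth, so it is enough to exhibit
  some smooth primes.\<close>

lemma err0_le: "finite C \<Longrightarrow> A \<subseteq> C \<Longrightarrow> (\<And>l. l \<in> A \<Longrightarrow> d dvd M div l) \<Longrightarrow>
    err0 C \<le> bA * (2 ^ card A - 1) + b * (2 ^ card C - 2 ^ card A)"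
  and errA_le: "finite C \<Longrightarrow> A \<subseteq> C \<Longrightarrow> (\<And>l. l \<in> A \<Longrightarrow> d dvd M div l) \<Longrightarrow>
    errA C \<le> bA * 2 ^ card A + b * (2 ^ card C - 2 ^ card A)"
proof -
  assume *: "finite C" "A \<subseteq> C" "\<And>l. l \<in> A \<Longrightarrow> d dvd M div l"
  then have "A \<subseteq> smooth C" "finite (smooth C)" by (auto simp: smooth_def)
  then have "(2::real) ^ card A \<le> 2 ^ card (smooth C)" by (intro power_increasing card_mono) auto
  then have "(b - bA) * 2 ^ card A \<le> (b - bA) * 2 ^ card (smooth C)"
    using bA_le by (intro mult_left_mono) auto
  then show "err0 C \<le> bA * (2 ^ card A - 1) + b * (2 ^ card C - 2 ^ card A)"
    "errA C \<le> bA * 2 ^ card A + b * (2 ^ card C - 2 ^ card A)"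
    by (simp_all add: err0_def errA_def algebra_simps)
qed

text \<open>The form used in the applications: smooth primes are named as \<open>CA\<close> and
  \<open>SA\<close>, so \<open>smooth\<close> need not be determined exactly, and a lower bound
  \<open>T0\<close> replaces \<open>card T\<close>.\<close>

corollary sieve_split:
  fixes T0 :: real
  assumes fin: "finite CA" "finite CB" "finite SA" "finite SB"
    and disj: "CA \<inter> CB = {}" "SA \<inter> SB = {}" "(CA \<union> CB) \<inter> (SA \<union> SB) = {}"
    and pr: "\<And>l. l \<in> CA \<union> CB \<union> SA \<union> SB \<Longrightarrow> prime l \<and> l dvd M"
    and smooth: "\<And>l. l \<in> CA \<union> SA \<Longrightarrow> d dvd M div l"
    and T0: "T0 \<le> card T"
    and pos: "0 < 1 - (\<Sum>l\<in>SA. 1 / real l) - (\<Sum>l\<in>SB. 1 / real l)"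
    and ineq: "(\<Sum>l\<in>SA. 1 - 1 / real l) * (bA * 2 ^ card CA + b * (2 ^ (card CA + card CB) - 2 ^ card CA)) +
         (\<Sum>l\<in>SB. 1 - 1 / real l) * (b * 2 ^ (card CA + card CB))
       < (1 - (\<Sum>l\<in>SA. 1 / real l) - (\<Sum>l\<in>SB. 1 / real l)) *
         (T0 - (bA * (2 ^ card CA - 1) + b * (2 ^ (card CA + card CB) - 2 ^ card CA)))"
  shows "\<exists>k\<in>T. \<forall>l\<in>CA \<union> CB \<union> SA \<union> SB. \<not> l dvd k"
proof -
  let ?C = "CA \<union> CB" and ?S = "SA \<union> SB"
  have cC: "card ?C = card CA + card CB" using fin disj by (simp add: card_Un_disjoint)
  have sumS: "(\<Sum>l\<in>?S. f l) = (\<Sum>l\<in>SA. f l) + (\<Sum>l\<in>SB. f l)" for f :: "nat \<Rightarrow> real"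
    using fin disj by (intro sum.union_disjoint) auto
  have fC: "finite ?C" using fin by simp
  have sm: "\<And>l. l \<in> CA \<Longrightarrow> d dvd M div l" using smooth by auto
  have t: "0 \<le> 1 - 1 / real l" if "l \<in> ?S" for l
  proof -
    have "prime l" using pr that by blast
    then show ?thesis using prime_gt_0_nat[of l] by simp
  qed
  have e: "errA ?C \<le> bA * 2 ^ card CA + b * (2 ^ (card CA + card CB) - 2 ^ card CA)"
    "err0 ?C \<le> bA * (2 ^ card CA - 1) + b * (2 ^ (card CA + card CB) - 2 ^ card CA)"
    "errB ?C = b * 2 ^ (card CA + card CB)"
    using errA_le[OF fC _ sm] err0_le[OF fC _ sm] by (auto simp: cC errB_def)
  have "(\<Sum>l\<in>?S. (1 - 1 / real l) * (if d dvd M div l then errA ?C else errB ?C))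
      \<le> (\<Sum>l\<in>SA. (1 - 1 / real l) * errA ?C) + (\<Sum>l\<in>SB. (1 - 1 / real l) * errB ?C)"
    unfolding sumS using t smooth err_le[OF fC]
    by (intro add_mono sum_mono mult_left_mono) auto
  also have "\<dots> \<le> (\<Sum>l\<in>SA. (1 - 1 / real l) * (bA * 2 ^ card CA + b * (2 ^ (card CA + card CB) - 2 ^ card CA)))
      + (\<Sum>l\<in>SB. (1 - 1 / real l) * (b * 2 ^ (card CA + card CB)))"
    using t e by (intro add_mono sum_mono mult_left_mono) auto
  also have "\<dots> = (\<Sum>l\<in>SA. 1 - 1 / real l) * (bA * 2 ^ card CA + b * (2 ^ (card CA + card CB) - 2 ^ card CA)) +
         (\<Sum>l\<in>SB. 1 - 1 / real l) * (b * 2 ^ (card CA + card CB))"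
    by (simp only: sum_distrib_right)
  also note ineq
  also have "(1 - (\<Sum>l\<in>SA. 1 / real l) - (\<Sum>l\<in>SB. 1 / real l)) *
         (T0 - (bA * (2 ^ card CA - 1) + b * (2 ^ (card CA + card CB) - 2 ^ card CA))) \<le>
      (1 - (\<Sum>l\<in>SA. 1 / real l) - (\<Sum>l\<in>SB. 1 / real l)) * (card T - err0 ?C)"
    using pos T0 e by (intro mult_left_mono) auto
  also have "1 - (\<Sum>l\<in>SA. 1 / real l) - (\<Sum>l\<in>SB. 1 / real l) = 1 - (\<Sum>l\<in>?S. 1 / real l)"
    unfolding sumS by simp
  finally have "\<exists>k\<in>T. \<forall>l\<in>?C \<union> ?S. \<not> l dvd k"
    using pos fin disj(3) pr sumS[of "\<lambda>l. 1 / real l"] by (intro sieve) auto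
  then show ?thesis by (simp add: Un_assoc)
qed

corollary sieve_core:
  fixes T0 :: real
  assumes "finite C" "\<And>l. l \<in> C \<Longrightarrow> prime l \<and> l dvd M" "T0 \<le> card T" "b * (2 ^ card C - 1) < T0"
  shows "\<exists>k\<in>T. \<forall>l\<in>C. \<not> l dvd k"
  using sieve_split[of "{}" C "{}" "{}" T0] assms by simp

end

section \<open>Criteria for 2-primitive elements of given trace\<close>

locale odd_trace_field = trace_field +
  assumes odd_q: "odd q"
begin

lemma even_N: "even N"
  using odd_q n_pos by (simp add: N_eq(2))

lemma q_ge_3: "q \<ge> 3"
  using odd_q q_gt_1 by (cases "q = 2") auto

lemma two_primitive_of_coprime:
  assumes "\<And>l. prime l \<Longrightarrow> l dvd N div 2 \<Longrightarrow> \<not> l dvd k"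
  shows "r_primitive 2 (g ^ (2 * k))"
proof -
  have "gcd k (N div 2) = 1"
  proof (rule ccontr)
    assume "gcd k (N div 2) \<noteq> 1"
    then obtain l where "prime l" "l dvd gcd k (N div 2)" using prime_factor_nat by blast
    then show False using assms by auto
  qed
  moreover have "gcd (2 * k) (2 * (N div 2)) = 2 * gcd k (N div 2)" by (rule gcd_mult_distrib_nat[symmetric])
  ultimately show ?thesis using even_N by (simp add: two_primitive_power_iff)
qed

lemma half_N_pos: "N div 2 > 0"
  using even_N N_pos by (auto elim!: evenE)

lemma ex_two_primitive:
  assumes "\<exists>k\<in>half_exps b. \<forall>l\<in>prime_factors (N div 2). \<not> l dvd k"
  shows "\<exists>x. r_primitive 2 x \<and> Tr x = b"
proof -
  obtain k where "k \<in> half_exps b" "\<forall>l\<in>prime_factors (N div 2). \<not> l dvd k"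
    using assms by blast
  then show ?thesis
    using two_primitive_of_coprime[of k] half_N_pos
    by (intro exI[of _ "g ^ (2 * k)"]) (auto simp: half_exps_def prime_factors_dvd)
qed

lemma half_exps_bounds:
  assumes "b \<in> base - {0}"
  shows "char_sum_bounds (N div 2) 0 (half_exps b) (sqrt (real q) ^ (n - 1)) (sqrt (real q) ^ (n - 1))"
proof
  fix j assume "\<not> N div 2 dvd j" 
  then show "norm (\<Sum>k\<in>half_exps b. unity_char (N div 2) j k) \<le> sqrt (real q) ^ (n - 1)"
    using norm_half_sum_le[OF even_N _ assms] by blast
  then show "norm (\<Sum>k\<in>half_exps b. unity_char (N div 2) j k) \<le> sqrt (real q) ^ (n - 1)" .
qed (use half_N_pos in auto)

lemma sqrt_power_sq: "sqrt (real q) ^ k * sqrt (real q) ^ k = real q ^ k"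
  by (simp flip: power_mult_distrib)

lemma half_exps_card:
  assumes "b \<in> base - {0}"
  shows "(real q ^ (n - 1) - sqrt (real q) ^ (n - 1)) / 2 \<le> real (card (half_exps b))"
  using card_half_exps_ge[OF even_N assms norm_S_le] N_half[OF even_N] assms by blast

text \<open>With all \<open>r\<close> primes in the core and \<open>B = sqrt q ^ (n - 1)\<close>,
  the requirement \<open>B * (2 ^ r - 1) < (B * B - B) / 2\<close> follows from
  \<open>2 * 2 ^ r \<le> B\<close>.\<close>

lemma two_primitive_of_core:
  assumes "b \<in> base - {0}" and W: "2 * 2 ^ card (prime_factors (N div 2)) \<le> sqrt (real q) ^ (n - 1)"
  shows "\<exists>x. r_primitive 2 x \<and> Tr x = b"
proof (rule ex_two_primitive)
  interpret char_sum_bounds "N div 2" 0 "half_exps b" "sqrt (real q) ^ (n - 1)" "sqrt (real q) ^ (n - 1)"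
    by (rule half_exps_bounds[OF assms(1)])
  let ?B = "sqrt (real q) ^ (n - 1)"
  have B: "?B > 0" using q_gt_1 by simp
  have "?B * (2 * 2 ^ card (prime_factors (N div 2)) - 2) < ?B * (?B - 1)"
    using W B by (intro mult_strict_left_mono) auto
  also have "?B * (?B - 1) = real q ^ (n - 1) - ?B"
    by (simp only: right_diff_distrib sqrt_power_sq mult_1_right)
  finally show "\<exists>k\<in>half_exps b. \<forall>l\<in>prime_factors (N div 2). \<not> l dvd k"
    by (intro sieve_core[OF _ _ half_exps_card[OF assms(1)]]) (auto simp: prime_factors_dvd algebra_simps)
qed

lemma exps_bounds:
  assumes "n \<ge> 2"
  shows "char_sum_bounds N 0 (exps 0) (real (q - 1) * sqrt (real q) ^ (n - 2)) (real (q - 1) * sqrt (real q) ^ (n - 2))"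
proof
  fix j assume "\<not> N dvd j" 
  then show "norm (\<Sum>k\<in>exps 0. unity_char N j k) \<le> real (q - 1) * sqrt (real q) ^ (n - 2)"
    using norm_S_0_le[OF _ assms] by (simp add: S_exps)
  then show "norm (\<Sum>k\<in>exps 0. unity_char N j k) \<le> real (q - 1) * sqrt (real q) ^ (n - 2)" .
qed (use N_pos in auto)

lemma m_dvd_N: "m dvd N" by (subst N_eq(1)) simp

text \<open>A kernel element generating modulo \<open>base\<close> is made 2-primitive by scaling with \<open>base\<close>.\<close>

lemma two_primitive_trace_0:
  assumes "odd m" "k \<in> exps 0" "\<forall>l\<in>prime_factors m. \<not> l dvd k"
  shows "\<exists>x. r_primitive 2 x \<and> Tr x = 0"
proof -
  define D where "D = \<Prod>{l \<in> prime_factors (N div 2). \<not> l dvd m}"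
  have "coprime m l" if "l \<in> {l \<in> prime_factors (N div 2). \<not> l dvd m}" for l
    using that by (metis (no_types, lifting) coprime_commute in_prime_factors_iff mem_Collect_eq prime_imp_coprime)
  then have "coprime m D" unfolding D_def by (intro prod_coprime_right) auto
  \<comment> \<open>\<open>(m + 1) div 2\<close> inverts 2 modulo the odd \<open>m\<close>, so
    \<open>y\<close> is half of \<open>k\<close> modulo \<open>m\<close>; modulo the remaining
    primes of \<open>N div 2\<close> it is 1.\<close>
  then obtain y where y: "[y = k * ((m + 1) div 2)] (mod m)" "[y = 1] (mod D)"
    using binary_chinese_remainder_nat by blast
  \<comment> \<open>The added multiple disturbs neither congruence and ensures
    \<open>k \<le> 2 * z\<close>, so that \<open>2 * z - k\<close> is a genuine difference.\<close>
  define z where "z = y + k * (m * D)"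
  have zm: "[2 * z = k] (mod m)"
  proof -
    have "z = y + (k * D) * m" by (simp add: z_def)
    then have "[2 * z = 2 * y] (mod m)" by (intro cong_scalar_left) (simp add: cong_def)
    also have "[2 * y = 2 * (k * ((m + 1) div 2))] (mod m)" using y(1) by (rule cong_scalar_left)
    also have "2 * (k * ((m + 1) div 2)) = k + k * m" using assms(1) by (auto elim!: oddE)
    also have "[k + k * m = k] (mod m)" by (simp add: cong_def)
    finally show ?thesis .
  qed
  have D0: "D > 0" unfolding D_def by (intro prod_pos) (auto intro!: prime_gt_0_nat simp: in_prime_factors_iff)
  have zD: "[z = 1] (mod D)"
  proof -
    have "[z = y] (mod D)" by (simp add: z_def cong_def flip: mult.assoc)
    then show ?thesis using y(2) cong_trans by blast
  qed
  have "r_primitive 2 (g ^ (2 * z))"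
  proof (rule two_primitive_of_coprime)
    fix l assume l: "prime l" "l dvd N div 2"
    show "\<not> l dvd z"
    proof (cases "l dvd m")
      case True
      then have "[2 * z = k] (mod l)" using zm cong_dvd_modulus_nat by blast
      moreover have "\<not> l dvd k" using assms(3) True l m_pos by (simp add: in_prime_factors_iff)
      ultimately show ?thesis by (metis cong_dvd_iff dvd_mult)
    next
      case False
      then have "l \<in> {l \<in> prime_factors (N div 2). \<not> l dvd m}" using l half_N_pos by (simp add: in_prime_factors_iff)
      then have "l dvd D" unfolding D_def by (intro dvd_prodI) auto
      then have "[z = 1] (mod l)" using zD cong_dvd_modulus_nat by blast
      then show ?thesis using l by (metis cong_dvd_iff not_prime_unit nat_dvd_1_iff_1)
    qed
  qed
  moreover have "Tr (g ^ (2 * z)) = 0"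
  proof -
    have "k \<le> k * (m * D)" using m_pos D0 by simp
    also have "X \<le> 2 * (y + X)" for X :: nat by simp
    finally have "k \<le> 2 * z" unfolding z_def .
    then have "m dvd 2 * z - k" using zm by (simp add: cong_altdef_nat)
    then have "g ^ (2 * z - k) \<in> base" by (simp add: base_nonzero_iff)
    then have "Tr (g ^ (2 * z - k) * g ^ k) = g ^ (2 * z - k) * Tr (g ^ k)" by (rule trace_mult_base)
    then show ?thesis using assms(2) \<open>k \<le> 2 * z\<close> by (simp add: exps_def flip: power_add)
  qed
  ultimately show ?thesis by blast
qed

lemma m_geometric: "m = (\<Sum>i<n. q ^ i)"
proof -
  have "int (q - 1) * int m = int (q - 1) * (\<Sum>i<n. int q ^ i)"
  proof -
    have "int (q - 1) * int m = int q ^ n - 1"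
      using N_eq q_gt_1 by (metis One_nat_def Suc_leI less_imp_of_nat_less of_nat_1 of_nat_diff of_nat_mult of_nat_power
          one_le_power zero_less_one zero_less_power less_trans of_nat_power)
    also have "\<dots> = int (q - 1) * (\<Sum>i<n. int q ^ i)"
      using q_gt_1 by (simp add: power_diff_1_eq of_nat_diff)
    finally show ?thesis .
  qed
  then have "int m = int (\<Sum>i<n. q ^ i)" using q_gt_1 by simp
  then show ?thesis by (simp only: of_nat_eq_iff)
qed

lemma odd_m: "odd n \<Longrightarrow> odd m"
proof -
  have "odd (\<Sum>i<k. q ^ i) \<longleftrightarrow> odd k" for k using odd_q by (induction k) auto
  then show "odd n \<Longrightarrow> odd m" by (simp add: m_geometric)
qed

lemma m_cong_n: "l dvd q - 1 \<Longrightarrow> [m = n] (mod l)"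
proof -
  assume "l dvd q - 1"
  then have "[q = 1] (mod l)" using q_gt_1 by (simp add: cong_altdef_nat)
  then have "[(\<Sum>i<n. q ^ i) = (\<Sum>i<n. 1 ^ i)] (mod l)" by (intro cong_sum cong_pow)
  then show ?thesis by (simp add: m_geometric)
qed

text \<open>If \<open>l\<close> divides \<open>q - 1\<close>, then \<open>m\<close> is congruent to
  \<open>n\<close> modulo \<open>l\<close>. Otherwise \<open>q\<close> has order exactly
  \<open>n\<close> modulo \<open>l\<close>, as \<open>n\<close> is prime; hence \<open>n\<close>
  divides \<open>l - 1\<close>, and \<open>l\<close> is odd because \<open>m\<close> is.\<close>

lemma prime_dvd_m:
  assumes "prime n" "odd n" "prime l" "l dvd m"
  shows "l = n \<and> n dvd q - 1 \<or> l \<ge> 2 * n + 1 \<and> 2 * n dvd l - 1 \<and> \<not> l dvd q - 1"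
proof (cases "l dvd q - 1")
  case True
  then have "l dvd n" using m_cong_n[OF True] assms(4) by (metis cong_dvd_iff)
  then show ?thesis using True assms by (metis primes_dvd_imp_eq)
next
  case False
  have "l dvd q ^ n - 1" using assms(4) m_dvd_N N_eq(2) dvd_trans by blast
  then have qn: "[q ^ n = 1] (mod l)" using q_gt_1 by (simp add: cong_altdef_nat)
  then have "ord l q dvd n" by (simp only: ord_divides)
  moreover have "ord l q \<noteq> 1"
  proof
    assume "ord l q = 1"
    then have "[q = 1] (mod l)" using ord[of q l] by simp
    then show False using False q_gt_1 by (simp add: cong_altdef_nat)
  qed
  ultimately have o: "ord l q = n" using assms(1) prime_nat_iff by blast
  have cop: "coprime l q"
  proof -
    have "\<not> l dvd q"
    proof
      assume "l dvd q"
      then have "l dvd q ^ n" using n_pos by (cases n) auto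
      then have "l dvd 1" using qn by (metis cong_dvd_iff)
      then show False using assms(3) by (simp add: not_prime_unit)
    qed
    then show ?thesis using assms(3) by (simp add: prime_imp_coprime)
  qed
  then have "n dvd totient l" using order_divides_totient o by (metis coprime_commute)
  then have nl: "n dvd l - 1" using assms(3) by (simp add: totient_prime)
  have "odd l" using odd_m[OF assms(2)] assms(4) dvd_trans by blast
  then have "2 dvd l - 1" by simp
  moreover have "coprime 2 n" using assms(2) by simp
  ultimately have n2: "2 * n dvd l - 1" using nl by (intro divides_mult) auto
  moreover have "l - 1 > 0" using assms(3) prime_gt_1_nat by auto
  ultimately have "2 * n \<le> l - 1" using n2 by (intro dvd_imp_le)
  then have "2 * n + 1 \<le> l" using \<open>l - 1 > 0\<close> by linarith
  then show ?thesis using False n2 by simp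
qed

end

subsection \<open>Prime degree at least five\<close>

text \<open>Pigeonhole: \<open>L\<close> lists all candidates below its last entry, so an element of
  \<open>A\<close> cannot precede the entry of \<open>L\<close> with the same rank. Past the end of
  \<open>L\<close> its last entry bounds everything.\<close>

lemma sorted_enumeration:
  fixes L :: "nat list"
  assumes L: "sorted L" "L \<noteq> []" and A: "finite A" "\<And>l. l \<in> A \<Longrightarrow> l < last L \<Longrightarrow> l \<in> set L"
  obtains h where "bij_betw h {..<card A} A" "\<And>i. i < card A \<Longrightarrow> L ! min i (length L - 1) \<le> h i"
proof
  let ?xs = "sorted_list_of_set A"
  have xs: "sorted ?xs" "distinct ?xs" "set ?xs = A" "length ?xs = card A" using A(1) by auto
  show "bij_betw (\<lambda>i. ?xs ! i) {..<card A} A"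
    using bij_betw_nth[OF xs(2), of "{..<card A}" A] xs by simp
  fix i assume i: "i < card A"
  let ?j = "min i (length L - 1)"
  show "L ! ?j \<le> ?xs ! i"
  proof (rule ccontr)
    assume less: "\<not> ?thesis"
    have j: "?j < length L" using L(2) by (cases L) auto
    have "(\<lambda>k. ?xs ! k) ` {..i} \<subseteq> (\<lambda>t. L ! t) ` {..<?j}"
    proof (rule image_subsetI)
      fix k assume k: "k \<in> {..i}"
      then have "?xs ! k \<le> ?xs ! i" using sorted_nth_mono[OF xs(1)] i xs(4) by simp
      then have lt: "?xs ! k < L ! ?j" using less by simp
      also have "L ! ?j \<le> last L"
        using sorted_nth_mono[OF L(1), of ?j "length L - 1"] L(2) by (simp add: last_conv_nth)
      finally have "?xs ! k \<in> set L" using A(2) nth_mem[of k ?xs] k i xs by simp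
      then obtain t where t: "t < length L" "?xs ! k = L ! t" by (auto simp: in_set_conv_nth)
      then have "t < ?j" using sorted_nth_mono[OF L(1), of ?j t] lt by (metis not_le leD)
      then show "?xs ! k \<in> (\<lambda>t. L ! t) ` {..<?j}" using t by auto
    qed
    moreover have "inj_on (\<lambda>k. ?xs ! k) {..i}" using i xs by (auto simp: inj_on_def nth_eq_iff_index_eq)
    ultimately have "card {..i} \<le> card {..<?j}"
      by (metis card_image card_image_le card_mono finite_imageI finite_lessThan le_trans)
    then show False by simp
  qed
qed

text \<open>When only the number of primes is known, the smallest candidates are the worst case for
  the reciprocal sum.\<close>

lemma sum_inverse_le_sorted:
  fixes L :: "nat list"
  assumes "sorted L" "L \<noteq> []" "finite A" "\<And>l. l \<in> A \<Longrightarrow> l < last L \<Longrightarrow> l \<in> set L" "0 \<notin> set L"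
  shows "(\<Sum>l\<in>A. 1 / real l) \<le> (\<Sum>i<card A. 1 / real (L ! min i (length L - 1)))"
proof -
  obtain h where h: "bij_betw h {..<card A} A" "\<And>i. i < card A \<Longrightarrow> L ! min i (length L - 1) \<le> h i"
    using sorted_enumeration[OF assms(1-4)] by blast
  have "(\<Sum>l\<in>A. 1 / real l) = (\<Sum>i<card A. 1 / real (h i))"
    using sum.reindex_bij_betw[OF h(1), of "\<lambda>l. 1 / real l"] by simp
  also have "\<dots> \<le> (\<Sum>i<card A. 1 / real (L ! min i (length L - 1)))"
  proof (intro sum_mono divide_left_mono)
    fix i assume i: "i \<in> {..<card A}"
    have "min i (length L - 1) < length L" using assms(2) by (cases L) auto
    then have "L ! min i (length L - 1) > 0" using assms(5) by (metis gr0I nth_mem)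
    then show "real (L ! min i (length L - 1)) \<le> real (h i)" "0 < real (h i) * real (L ! min i (length L - 1))"
      using h(2)[of i] i by auto
  qed simp
  finally show ?thesis .
qed

text \<open>The converse use: many prime divisors force a number to be large.\<close>

lemma prod_ge_sorted:
  fixes L :: "nat list"
  assumes "sorted L" "L \<noteq> []" "finite A" "\<And>l. l \<in> A \<Longrightarrow> l < last L \<Longrightarrow> l \<in> set L"
  shows "(\<Prod>i<card A. L ! min i (length L - 1)) \<le> \<Prod>A"
proof -
  obtain h where h: "bij_betw h {..<card A} A" "\<And>i. i < card A \<Longrightarrow> L ! min i (length L - 1) \<le> h i"
    using sorted_enumeration[OF assms(1-4)] by blast
  have "\<Prod>A = (\<Prod>i<card A. h i)"
    using prod.reindex_bij_betw[OF h(1), of "\<lambda>l. l"] by simp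
  then show ?thesis using h(2) by (auto intro: prod_mono)
qed

lemma prod_primes_dvd:
  fixes x :: nat
  assumes "finite P" "\<And>l. l \<in> P \<Longrightarrow> prime l \<and> l dvd x"
  shows "\<Prod>P dvd x"
  using assms
proof (induction P rule: finite_induct)
  case (insert l P)
  have "coprime l (\<Prod>P)"
    using insert by (intro prod_coprime_right) (metis insertCI primes_coprime)
  then show ?case using insert by (simp add: divides_mult)
qed simp

lemma prod_prime_factors_le: "x > 0 \<Longrightarrow> P \<subseteq> prime_factors x \<Longrightarrow> \<Prod>P \<le> (x::nat)"
proof (rule dvd_imp_le[OF prod_primes_dvd])
  assume "P \<subseteq> prime_factors x"
  then show "finite P" using finite_subset by blast
qed (auto simp: in_prime_factors_iff subset_iff)

lemma primepow_prime_unique: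
  fixes x :: nat
  assumes "primepow x" "prime a" "prime b" "a dvd x" "b dvd x"
  shows "a = b"
proof -
  obtain p k where "prime p" "x = p ^ k" using assms(1) by (auto simp: primepow_def)
  then show ?thesis using assms by (metis prime_dvd_power primes_dvd_imp_eq)
qed

lemma two_power_card_le_prod:
  assumes "finite P" "\<And>l. l \<in> P \<Longrightarrow> prime (l::nat)"
  shows "2 ^ card P \<le> \<Prod>P"
proof -
  have "(\<Prod>l\<in>P. 2) \<le> \<Prod>P" using assms prime_ge_2_nat by (intro prod_mono) auto
  then show ?thesis by simp
qed

text \<open>Only 2 and 3 lie below 4, and together they lose the factor
  \<open>16 / 6\<close>.\<close>

lemma four_power_card_le_prod:
  assumes "finite P" "\<And>l. l \<in> P \<Longrightarrow> prime (l::nat)"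
  shows "3 * 4 ^ card P \<le> 8 * \<Prod>P"
proof -
  define R where "R = P - {2, 3}"
  have R: "finite R" "2 \<notin> R" "3 \<notin> R" using assms(1) by (auto simp: R_def)
  have "4 \<le> l" if "l \<in> R" for l
  proof -
    have "prime l" "l \<noteq> 2" "l \<noteq> 3" using that assms by (auto simp: R_def)
    then show ?thesis using prime_ge_2_nat[of l] by linarith
  qed
  then have "(\<Prod>l\<in>R. 4) \<le> \<Prod>R" by (intro prod_mono) auto
  then have *: "4 ^ card R \<le> \<Prod>R" by simp
  consider "P = R" | "P = insert 2 R" | "P = insert 3 R" | "P = insert 2 (insert 3 R)"
    unfolding R_def by blast
  then show ?thesis by cases (use R * in auto)
qed

context odd_trace_field
begin

lemma twice_m_le: "2 * m \<le> 3 * q ^ (n - 1)"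
proof -
  have "2 * m * (q - 1) = 2 * (q ^ n - 1)" using N_eq by (simp add: mult_ac)
  also have "\<dots> \<le> 2 * (q * q ^ (n - 1))" using n_pos by (simp flip: power_Suc)
  also have "\<dots> = (2 * q) * q ^ (n - 1)" by simp
  also have "2 * q \<le> 3 * (q - 1)" using q_ge_3 by linarith
  then have "(2 * q) * q ^ (n - 1) \<le> 3 * (q - 1) * q ^ (n - 1)" by (rule mult_right_mono) simp
  finally have "(2 * m) * (q - 1) \<le> (3 * q ^ (n - 1)) * (q - 1)" by (simp add: mult_ac)
  then show ?thesis using q_gt_1 by simp
qed

lemma half_N: "N div 2 = ((q - 1) div 2) * m"
proof -
  have "even (q - 1)" using odd_q by simp
  then show ?thesis using N_eq(1) by (metis div_mult_swap dvd_div_mult mult.commute)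
qed

abbreviation "P1 \<equiv> prime_factors ((q - 1) div 2)"
abbreviation "P2 \<equiv> {l \<in> prime_factors m. \<not> l dvd q - 1}"

lemma half_q_pos: "(q - 1) div 2 > 0" using q_ge_3 by (simp add: div_greater_zero_iff)

lemma prime_factors_half_N:
  assumes "odd n"
  shows "prime_factors (N div 2) \<subseteq> P1 \<union> P2"
proof
  fix l assume "l \<in> prime_factors (N div 2)"
  then have l: "prime l" "l dvd (q - 1) div 2 \<or> l dvd m"
    by (auto simp: half_N in_prime_factors_iff prime_dvd_mult_iff)
  show "l \<in> P1 \<union> P2"
  proof (cases "l dvd (q - 1) div 2")
    case False
    then have lm: "l dvd m" using l by simp
    have "\<not> l dvd q - 1"
    proof
      assume "l dvd q - 1"
      then have "l dvd 2 * ((q - 1) div 2)" using odd_q by simp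
      then have "l dvd 2" using False l by (simp add: prime_dvd_mult_iff)
      then have "l = 2" using l by (metis primes_dvd_imp_eq two_is_prime_nat)
      then show False using odd_m[OF assms] lm by simp
    qed
    then show ?thesis using l lm m_pos by (simp add: in_prime_factors_iff)
  qed (use l half_q_pos in \<open>simp add: in_prime_factors_iff\<close>)
qed

text \<open>The share of the primes of \<open>(q - 1) div 2\<close> in the quantity
  \<open>2 * 2 ^ r\<close> of the core criterion.\<close>

definition W1 :: nat where "W1 = 2 * 2 ^ card P1"

lemma W1_le: "W1 \<le> q - 1"
proof -
  have "2 ^ card P1 \<le> \<Prod>P1" by (rule two_power_card_le_prod) auto
  also have "\<dots> \<le> (q - 1) div 2" using half_q_pos by (intro prod_prime_factors_le) auto
  finally show ?thesis unfolding W1_def by linarith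
qed

lemma W1_sq_le: "3 * 4 ^ card P1 \<le> 8 * ((q - 1) div 2)" "3 * W1\<^sup>2 \<le> 16 * (q - 1)"
proof -
  have "3 * 4 ^ card P1 \<le> 8 * \<Prod>P1" by (rule four_power_card_le_prod) auto
  also have "\<Prod>P1 \<le> (q - 1) div 2" using half_q_pos by (intro prod_prime_factors_le) auto
  finally show *: "3 * 4 ^ card P1 \<le> 8 * ((q - 1) div 2)" by simp
  have "3 * W1\<^sup>2 = 4 * (3 * 4 ^ card P1)"
    by (simp add: W1_def power_mult_distrib mult.commute flip: power_mult) (simp add: power_mult)
  also have "\<dots> \<le> 32 * ((q - 1) div 2)" using * by simp
  also have "\<dots> \<le> 16 * (q - 1)" by simp
  finally show "3 * W1\<^sup>2 \<le> 16 * (q - 1)" .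
qed

lemma sqrt_power_10: "(sqrt (real q) ^ k) ^ 10 = real (q ^ (5 * k))"
proof -
  have "x ^ 10 = (x ^ 2) ^ 5" for x :: real by simp
  then have "(sqrt (real q) ^ k) ^ 10 = ((sqrt (real q) ^ k) ^ 2) ^ 5" .
  also have "(sqrt (real q) ^ k) ^ 2 = real q ^ k" by (simp add: power2_eq_square sqrt_power_sq)
  finally show ?thesis by (simp flip: power_mult add: mult.commute)
qed

lemma le_sqrt_power: "x ^ 10 \<le> q ^ (5 * k) \<Longrightarrow> real x \<le> sqrt (real q) ^ k"
proof -
  assume "x ^ 10 \<le> q ^ (5 * k)"
  then have "real (x ^ 10) \<le> real (q ^ (5 * k))" by (simp only: of_nat_le_iff)
  then have "real x ^ 10 \<le> (sqrt (real q) ^ k) ^ 10" by (simp only: sqrt_power_10 of_nat_power)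
  then show ?thesis by (rule power_le_imp_le_base[where n = 9, simplified]) simp
qed

text \<open>Each of these primes is at least \<open>2 * n + 1 \<ge> 11\<close>, and
  \<open>2 ^ 10 < 11 ^ 3\<close>. This is why tenth powers are compared: up to a constant,
  \<open>P2\<close> uses \<open>q ^ (3 * (n - 1))\<close> of the available
  \<open>q ^ (5 * (n - 1))\<close>.\<close>

lemma two_power_card_P2:
  assumes "prime n" "odd n" "n \<ge> 5"
  shows "11 ^ card P2 \<le> m" "8 * (2 ^ card P2) ^ 10 \<le> 27 * q ^ (3 * (n - 1))"
proof -
  have ge: "l \<ge> 11" if "l \<in> P2" for l
    using prime_dvd_m[OF assms(1,2), of l] that assms(3) by (auto simp: in_prime_factors_iff)
  then have "(\<Prod>l\<in>P2. 11) \<le> \<Prod>P2" by (intro prod_mono) auto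
  also have "\<Prod>P2 \<le> m" using m_pos by (intro prod_prime_factors_le) auto
  finally show *: "11 ^ card P2 \<le> m" by simp
  have "(2 ^ card P2) ^ 10 = (1024::nat) ^ card P2" by (simp add: mult.commute flip: power_mult) (simp add: power_mult)
  also have "\<dots> \<le> 1331 ^ card P2" by (rule power_mono) auto
  also have "\<dots> = (11 ^ card P2) ^ 3" by (simp add: mult.commute flip: power_mult) (simp add: power_mult)
  also have "\<dots> \<le> m ^ 3" using * by (rule power_mono) simp
  finally have "8 * (2 ^ card P2) ^ 10 \<le> (2 * m) ^ 3" by (simp add: power_mult_distrib)
  also have "\<dots> \<le> (3 * q ^ (n - 1)) ^ 3" using twice_m_le by (rule power_mono) simp
  finally show "8 * (2 ^ card P2) ^ 10 \<le> 27 * q ^ (3 * (n - 1))"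
    by (simp add: power_mult_distrib mult.commute flip: power_mult)
qed

lemma ge5_nonzero:
  assumes n: "prime n" "n \<ge> 5" and b: "b \<in> base - {0}"
  shows "\<exists>x. r_primitive 2 x \<and> Tr x = b"
proof (rule two_primitive_of_core[OF b])
  have odd: "odd n" using n prime_odd_nat by auto
  let ?s = "card P2"
  have "2 * 2 ^ card (prime_factors (N div 2)) \<le> (2 * 2 ^ (card P1 + ?s) :: nat)"
  proof -
    have "card (prime_factors (N div 2)) \<le> card (P1 \<union> P2)"
      using prime_factors_half_N[OF odd] by (intro card_mono) auto
    also have "\<dots> \<le> card P1 + ?s" by (rule card_Un_le)
    finally show ?thesis by simp
  qed
  also have "\<dots> = W1 * 2 ^ ?s" by (simp add: W1_def power_add)
  finally have le: "2 * 2 ^ card (prime_factors (N div 2)) \<le> W1 * 2 ^ ?s" .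
  note P2 = two_power_card_P2[OF n(1) odd n(2)]
  \<comment> \<open>What remains for the primes of \<open>q - 1\<close> is
    \<open>q ^ (2 * (n - 1))\<close>, up to the constant \<open>8 / 27\<close>.\<close>
  have main: "(W1 * 2 ^ ?s) ^ 10 \<le> q ^ (5 * (n - 1))" if "27 * W1 ^ 10 \<le> 8 * q ^ (2 * (n - 1))"
  proof -
    have "8 * (27 * (W1 * 2 ^ ?s) ^ 10) = (27 * W1 ^ 10) * (8 * (2 ^ ?s) ^ 10)"
      by (simp add: power_mult_distrib)
    also have "\<dots> \<le> (8 * q ^ (2 * (n - 1))) * (27 * q ^ (3 * (n - 1)))"
      using that P2(2) by (rule mult_mono) auto
    also have "\<dots> = 8 * (27 * q ^ (2 * (n - 1) + 3 * (n - 1)))"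
      by (simp only: power_add mult_ac)
    also have "2 * (n - 1) + 3 * (n - 1) = 5 * (n - 1)" by simp
    finally show ?thesis by simp
  qed
  \<comment> \<open>For \<open>n \<ge> 7\<close> the trivial estimate \<open>W1 < q\<close>
    suffices; for \<open>n = 5\<close> it takes \<open>W1 ^ 2 \<le> 16 / 3 * q\<close> and a finite
    check below 25.\<close>
  have "real (W1 * 2 ^ ?s) \<le> sqrt (real q) ^ (n - 1)"
  proof (cases "n = 5")
    case False
    have "n \<noteq> 6" using odd by auto
    then have "n \<ge> 7" using n False by linarith
    have "27 * W1 ^ 10 \<le> 27 * q ^ 10"
      using W1_le by (intro mult_left_mono power_mono) auto
    also have "\<dots> \<le> 8 * q ^ 2 * q ^ 10"
    proof -
      have "3 ^ 2 \<le> q ^ 2" using q_ge_3 by (rule power_mono) simp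
      then show ?thesis by (intro mult_right_mono) auto
    qed
    also have "\<dots> = 8 * q ^ 12" by (simp flip: power_add)
    also have "\<dots> \<le> 8 * q ^ (2 * (n - 1))"
      using \<open>n \<ge> 7\<close> q_gt_1 by (intro mult_left_mono power_increasing) auto
    finally show ?thesis by (intro le_sqrt_power main)
  next
    case True
    show ?thesis
    proof (cases "q \<ge> 25")
      case True
      have "9 * (27 * W1 ^ 10) = (3 * W1\<^sup>2) ^ 5" by (simp add: power_mult_distrib flip: power_mult)
      also have "\<dots> \<le> (16 * q) ^ 5" using W1_sq_le(2) by (intro power_mono) auto
      also have "\<dots> = 1048576 * q ^ 5" by (simp add: power_mult_distrib)
      also have "\<dots> \<le> (72 * q ^ 3) * q ^ 5"
      proof -
        have "25 ^ 3 \<le> q ^ 3" using True by (rule power_mono) simp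
        then show ?thesis by (intro mult_right_mono) auto
      qed
      also have "\<dots> = 9 * (8 * q ^ (2 * (n - 1)))" using \<open>n = 5\<close> by (simp flip: power_add)
      finally have "27 * W1 ^ 10 \<le> 8 * q ^ (2 * (n - 1))" by simp
      then show ?thesis by (intro le_sqrt_power main)
    next
      case False
      have "q \<noteq> 15" and "q \<noteq> 21"
      proof -
        have "\<not> primepow (15::nat)" using primepow_prime_unique[of 15 3 5] by auto
        moreover have "\<not> primepow (21::nat)" using primepow_prime_unique[of 21 3 7] by auto
        ultimately show "q \<noteq> 15" "q \<noteq> 21" using q by auto
      qed
      then have qs: "q \<in> {3, 5, 7, 9, 11, 13, 17, 19, 23}"
        using False odd_q q_ge_3 unfolding insert_iff empty_iff by presburger
      have c: "card P1 \<le> c" if "8 * ((q - 1) div 2) < 3 * 4 ^ Suc c" for c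
      proof (rule ccontr)
        assume "\<not> ?thesis"
        then have "3 * 4 ^ Suc c \<le> 3 * (4::nat) ^ card P1" by (intro mult_left_mono power_increasing) auto
        then show False using W1_sq_le(1) that by linarith
      qed
      have W: "W1 ^ 10 \<le> (2 * 2 ^ c) ^ 10" if "card P1 \<le> c" for c
        unfolding W1_def using that by (intro power_mono mult_left_mono power_increasing) auto
      have s: "?s \<le> k" if "m < 11 ^ Suc k" for k
      proof (rule ccontr)
        assume "\<not> ?thesis"
        then have "(11::nat) ^ Suc k \<le> 11 ^ ?s" by (intro power_increasing) auto
        then show False using P2(1) that by linarith
      qed
      have m5: "m = 1 + q + q ^ 2 + q ^ 3 + q ^ 4"
      proof -
        have "m = (\<Sum>i<5. q ^ i)" using m_geometric unfolding True .
        then show ?thesis by (simp add: eval_nat_numeral lessThan_Suc)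
      qed
      \<comment> \<open>For \<open>q = 5\<close> and \<open>q = 13\<close> the tenth-power budget is
        exceeded; there \<open>11 ^ card P2 \<le> m\<close> bounds the number of primes
        directly.\<close>
      have sm: "(W1 * 2 ^ ?s) ^ 10 \<le> q ^ (5 * (n - 1))" if "card P1 \<le> c" "?s \<le> k" "(2 * 2 ^ c * 2 ^ k) ^ 10 \<le> q ^ 20" for c k
      proof -
        have "(W1 * 2 ^ ?s) ^ 10 \<le> (2 * 2 ^ c * 2 ^ k) ^ 10"
          unfolding W1_def using that(1,2) by (intro power_mono mult_mono power_increasing) auto
        also note that(3)
        also have "(20::nat) = 5 * (n - 1)" using True by simp
        finally show ?thesis .
      qed
      have "(W1 * 2 ^ ?s) ^ 10 \<le> q ^ (5 * (n - 1))"
        using qs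
      proof (elim insertE emptyE)
        assume [simp]: "q = 3"
        show ?thesis by (rule main) (use W[OF c[of 0]] \<open>n = 5\<close> in simp)
      next
        assume [simp]: "q = 5"
        show ?thesis by (rule sm[OF c[of 1] s[of 2]]) (use m5 in simp_all)
      next
        assume [simp]: "q = 7"
        show ?thesis by (rule main) (use W[OF c[of 1]] \<open>n = 5\<close> in simp)
      next
        assume [simp]: "q = 9"
        show ?thesis by (rule main) (use W[OF c[of 1]] \<open>n = 5\<close> in simp)
      next
        assume [simp]: "q = 11"
        show ?thesis by (rule main) (use W[OF c[of 1]] \<open>n = 5\<close> in simp)
      next
        assume [simp]: "q = 13"
        show ?thesis by (rule sm[OF c[of 2] s[of 4]]) (use m5 in simp_all)
      next
        assume [simp]: "q = 17"
        show ?thesis by (rule main) (use W[OF c[of 2]] \<open>n = 5\<close> in simp)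
      next
        assume [simp]: "q = 19"
        show ?thesis by (rule main) (use W[OF c[of 2]] \<open>n = 5\<close> in simp)
      next
        assume [simp]: "q = 23"
        show ?thesis by (rule main) (use W[OF c[of 2]] \<open>n = 5\<close> in simp)
      qed
      then show ?thesis by (rule le_sqrt_power)
    qed
  qed
  then show "2 * 2 ^ card (prime_factors (N div 2)) \<le> sqrt (real q) ^ (n - 1)"
  proof -
    assume "real (W1 * 2 ^ ?s) \<le> sqrt (real q) ^ (n - 1)"
    moreover have "real (2 * 2 ^ card (prime_factors (N div 2))) \<le> real (W1 * 2 ^ ?s)"
      using le by (simp only: of_nat_le_iff)
    ultimately have "real (2 * 2 ^ card (prime_factors (N div 2))) \<le> sqrt (real q) ^ (n - 1)"
      by linarith
    then show ?thesis by simp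
  qed
qed

text \<open>The factor \<open>q - 1\<close> is common to the sum bound and, up to lower terms, to
  the size of the kernel; cancelling it leaves the exponent \<open>n - 2\<close>. Only primes of
  \<open>m\<close> count, since scaling by \<open>base\<close> repairs the others.\<close>

lemma trace_0_of_core:
  assumes "n \<ge> 2" "odd n" and P: "real (2 ^ card (prime_factors m)) \<le> sqrt (real q) ^ (n - 2)"
  shows "\<exists>x. r_primitive 2 x \<and> Tr x = 0"
proof -
  interpret char_sum_bounds N 0 "exps 0" "real (q - 1) * sqrt (real q) ^ (n - 2)" "real (q - 1) * sqrt (real q) ^ (n - 2)"
    by (rule exps_bounds[OF assms(1)])
  let ?r = "sqrt (real q) ^ (n - 2)"
  have r: "?r \<ge> 1" using q_gt_1 by simp
  have q1: "real (q - 1) = real q - 1" "real q - 1 > 0" using q_gt_1 by (simp_all add: of_nat_diff)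
  have qn: "real q ^ (n - 1) = real q * real q ^ (n - 2)"
    using assms(1) by (simp flip: power_Suc) (simp add: Suc_diff_Suc numeral_2_eq_2)
  have "real (q - 1) * ?r * (2 ^ card (prime_factors m) - 1) \<le> real (q - 1) * ?r * (?r - 1)"
    using P r q1 by (intro mult_left_mono) auto
  also have "\<dots> = (real q - 1) * (real q ^ (n - 2) - ?r)"
    unfolding q1 by (simp only: right_diff_distrib mult.assoc sqrt_power_sq mult_1_right)
  also have "\<dots> < (real q - 1) * real q ^ (n - 2)"
    using q1 r by (intro mult_strict_left_mono) auto
  also have "\<dots> = real q ^ (n - 1) - real q ^ (n - 2)" unfolding qn by (simp add: algebra_simps)
  also have "\<dots> \<le> real q ^ (n - 1) - 1" using q_gt_1 by simp
  also have "\<dots> = real (card (exps 0))" using q_gt_1 by (simp add: card_exps_0 of_nat_diff)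
  finally have "\<exists>k\<in>exps 0. \<forall>l\<in>prime_factors m. \<not> l dvd k"
    by (intro sieve_core[OF _ _ order_refl]) (use m_dvd_N in \<open>auto simp: in_prime_factors_iff intro: dvd_trans\<close>)
  then show ?thesis using two_primitive_trace_0[OF odd_m[OF assms(2)]] by blast
qed

lemma ge5_zero:
  assumes n: "prime n" "n \<ge> 5"
  shows "\<exists>x. r_primitive 2 x \<and> Tr x = 0"
proof (rule trace_0_of_core)
  show odd: "odd n" using n prime_odd_nat by auto
  show "n \<ge> 2" using n by simp
  let ?P = "prime_factors m"
  have sub: "n dvd q - 1 \<Longrightarrow> ?P \<subseteq> insert n P2" "\<not> n dvd q - 1 \<Longrightarrow> ?P \<subseteq> P2"
    using prime_dvd_m[OF n(1) odd] by (auto simp: in_prime_factors_iff)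
  have "(2 ^ card ?P) ^ 10 \<le> q ^ (5 * (n - 2))"
  proof -
    \<comment> \<open>Again \<open>P2\<close> is charged to \<open>q ^ (3 * (n - 1))\<close>; the
      first factor has to pay for the constants and for a possible prime \<open>n\<close>.\<close>
    have exp: "q ^ (5 * (n - 2)) = q ^ (2 * n - 7) * q ^ (3 * (n - 1))"
    proof -
      have "5 * (n - 2) = (2 * n - 7) + 3 * (n - 1)" using n(2) by arith
      then show ?thesis by (simp only: power_add)
    qed
    note P2 = two_power_card_P2[OF n(1) odd n(2)]
    show ?thesis
    proof (cases "n dvd q - 1")
      case True
      \<comment> \<open>The prime \<open>n\<close> can divide \<open>m\<close> only in this case,
        and then \<open>q\<close> is large enough to absorb it.\<close>
      have "2 * n dvd q - 1"
      proof (rule divides_mult)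
        show "coprime 2 n" using odd by simp
      qed (use True odd_q in auto)
      then have "2 * n \<le> q - 1" using q_gt_1 by (intro dvd_imp_le) auto
      then have "q \<ge> 11" using n by linarith
      then have "11 ^ 3 \<le> q ^ 3" by (rule power_mono) simp
      also have "\<dots> \<le> q ^ (2 * n - 7)" using n q_gt_1 by (intro power_increasing) auto
      finally have q7: "1331 \<le> q ^ (2 * n - 7)" by simp
      define P' where "P' = ?P - {n}"
      have fP': "finite P'" "n \<notin> P'" by (auto simp: P'_def)
      have "P' \<subseteq> P2" using sub(1)[OF True] by (auto simp: P'_def)
      then have ge: "l \<ge> 11" if "l \<in> P'" for l
      proof -
        have "prime l" "l dvd m" "\<not> l dvd q - 1"
          using that \<open>P' \<subseteq> P2\<close> by (auto simp: in_prime_factors_iff subset_iff)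
        then show ?thesis using prime_dvd_m[OF n(1) odd, of l] n(2) True by auto
      qed
      have "(\<Prod>l\<in>P'. 2 ^ 10) \<le> (\<Prod>l\<in>P'. l ^ 3)"
      proof (rule prod_mono)
        fix l assume "l \<in> P'"
        then have "11 ^ 3 \<le> l ^ 3" using ge by (intro power_mono) auto
        then show "0 \<le> (2::nat) ^ 10 \<and> 2 ^ 10 \<le> l ^ 3" by simp
      qed
      moreover have "(2 ^ card P') ^ 10 = (\<Prod>l\<in>P'. 2 ^ 10 :: nat)"
        by (simp only: prod_constant power_mult[symmetric] mult.commute)
      ultimately have P': "(2 ^ card P') ^ 10 \<le> (\<Prod>P') ^ 3"
        by (simp only: prod_power_distrib)
      have "(5::nat) ^ 3 \<le> n ^ 3" using n by (intro power_mono) auto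
      \<comment> \<open>This prices the additional prime \<open>n\<close> on the same scale as the
        primes from 11 on.\<close>
      then have n3: "1024 \<le> 9 * n ^ 3" by simp
      have "(2 ^ card ?P) ^ 10 \<le> 9 * (\<Prod>(insert n P')) ^ 3"
      proof -
        have "?P \<subseteq> insert n P'" by (auto simp: P'_def)
        then have "card ?P \<le> card (insert n P')" using fP' by (intro card_mono) auto
        then have "card ?P \<le> Suc (card P')" using fP' by simp
        then have "(2 ^ card ?P) ^ 10 \<le> ((2 ^ Suc (card P')) ^ 10 :: nat)"
          by (intro power_mono power_increasing) auto
        also have "\<dots> = 1024 * (2 ^ card P') ^ 10"
          by (simp add: power_mult_distrib)
        also have "\<dots> \<le> (9 * n ^ 3) * (\<Prod>P') ^ 3" using n3 P' by (rule mult_mono) auto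
        finally show ?thesis using fP' by (simp add: power_mult_distrib)
      qed
      also have "\<dots> \<le> 9 * m ^ 3"
      proof -
        have "n dvd m" using m_cong_n[OF True] by (metis cong_dvd_iff dvd_refl)
        then have "insert n P' \<subseteq> ?P" using n(1) m_pos by (auto simp: P'_def in_prime_factors_iff)
        then show ?thesis using m_pos by (intro mult_left_mono power_mono prod_prime_factors_le) auto
      qed
      finally have "8 * (2 ^ card ?P) ^ 10 \<le> 9 * (2 * m) ^ 3" by (simp add: power_mult_distrib)
      also have "\<dots> \<le> 9 * (3 * q ^ (n - 1)) ^ 3"
        using twice_m_le by (intro mult_left_mono power_mono) auto
      also have "\<dots> = 243 * q ^ (3 * (n - 1))"
        by (simp add: power_mult_distrib mult.commute flip: power_mult)
      also have "\<dots> \<le> (8 * q ^ (2 * n - 7)) * q ^ (3 * (n - 1))"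
        using q7 by (intro mult_right_mono) auto
      finally show ?thesis unfolding exp by simp
    next
      case False
      have "card ?P \<le> card P2" using sub(2)[OF False] by (intro card_mono) auto
      then have "8 * (2 ^ card ?P) ^ 10 \<le> (8 * (2 ^ card P2) ^ 10 :: nat)"
        by (intro mult_left_mono power_mono power_increasing) auto
      also have "\<dots> \<le> 27 * q ^ (3 * (n - 1))" by (rule P2(2))
      also have "\<dots> \<le> (8 * q ^ (2 * n - 7)) * q ^ (3 * (n - 1))"
      proof -
        have "3 ^ 3 \<le> q ^ 3" using q_ge_3 by (rule power_mono) simp
        also have "\<dots> \<le> q ^ (2 * n - 7)" using n q_gt_1 by (intro power_increasing) auto
        finally show ?thesis by (intro mult_right_mono) auto
      qed
      finally show ?thesis unfolding exp by simp
    qed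
  qed
  then show "real (2 ^ card ?P) \<le> sqrt (real q) ^ (n - 2)" by (rule le_sqrt_power)
qed

end

section \<open>Bounding prime factors by trial division and integer weights\<close>

lemma sum_inverse_le_sorted':
  fixes L :: "nat list"
  assumes "sorted L" "L \<noteq> []" "finite A" "\<And>l. l \<in> A \<Longrightarrow> l < last L \<Longrightarrow> l \<in> set L" "0 \<notin> set L"
    and "card A \<le> k"
  shows "(\<Sum>l\<in>A. 1 / real l) \<le> (\<Sum>i<k. 1 / real (L ! min i (length L - 1)))"
proof -
  have "(\<Sum>l\<in>A. 1 / real l) \<le> (\<Sum>i<card A. 1 / real (L ! min i (length L - 1)))"
    by (rule sum_inverse_le_sorted[OF assms(1-5)])
  also have "\<dots> \<le> (\<Sum>i<k. 1 / real (L ! min i (length L - 1)))"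
    using assms(6) by (intro sum_mono2) auto
  finally show ?thesis .
qed

lemma prod_ge_sorted':
  fixes L :: "nat list"
  assumes "sorted L" "L \<noteq> []" "finite A" "\<And>l. l \<in> A \<Longrightarrow> l < last L \<Longrightarrow> l \<in> set L" "0 \<notin> set L"
    and "k \<le> card A"
  shows "(\<Prod>i<k. L ! min i (length L - 1)) \<le> \<Prod>A"
proof -
  have "L ! min i (length L - 1) \<ge> 1" for i
  proof -
    have "min i (length L - 1) < length L" using assms(2) by (cases L) auto
    then show ?thesis using assms(5) by (metis gr0I nth_mem One_nat_def Suc_leI)
  qed
  then have "(\<Prod>i<k. L ! min i (length L - 1)) \<le> (\<Prod>i<card A. L ! min i (length L - 1))"
  proof (intro dvd_imp_le prod_dvd_prod_subset)
    show "0 < (\<Prod>i<card A. L ! min i (length L - 1))"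
      using \<open>\<And>i. L ! min i (length L - 1) \<ge> 1\<close> by (intro prod_pos) (auto simp: Suc_le_eq)
  qed (use assms(6) in auto)
  also have "\<dots> \<le> \<Prod>A" by (rule prod_ge_sorted[OF assms(1-4)])
  finally show ?thesis .
qed

lemma primes_below_13:
  assumes "prime (l::nat)" "l < 13"
  shows "l \<in> {2, 3, 5, 7, 11}"
proof -
  have "l \<in> {0..<13}" using assms by simp
  then have "l \<in> set (filter prime [0..<13])" using assms by simp
  also have "filter prime [0..<13] = [2, 3, 5, 7, 11::nat]" by code_simp
  finally show ?thesis by simp
qed

lemma primes_below_73:
  assumes "prime (l::nat)" "l < 73"
  shows "l \<in> {2, 3, 5, 7, 11, 13, 17, 19, 23, 29, 31, 37, 41, 43, 47, 53, 59, 61, 67, 71}"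
proof -
  have "l \<in> {0..<73}" using assms by simp
  then have "l \<in> set (filter prime [0..<73])" using assms by simp
  also have "filter prime [0..<73] = [2, 3, 5, 7, 11, 13, 17, 19, 23, 29, 31, 37, 41, 43, 47, 53, 59, 61, 67, 71::nat]"
    by code_simp
  finally show ?thesis by simp
qed

text \<open>Trial division: primes outside the list \<open>L\<close> are at least \<open>p\<close>, so at most \<open>e\<close> of
  them can divide a cofactor below \<open>p ^ Suc e\<close>.\<close>

lemma prime_factors_split:
  fixes L :: "int list" and x :: nat
  assumes x: "x > 0" and L: "distinct L" "\<forall>l\<in>set L. l > 0 \<and> prime (nat l)"
    and p: "\<forall>l. prime l \<longrightarrow> l dvd x \<longrightarrow> l < p \<longrightarrow> int l \<in> set L" "p > 1"
    and rest: "int x < int p ^ Suc e * prod_list (filter (\<lambda>l. int x mod l = 0) L)"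
  shows "\<exists>R. prime_factors x = nat ` set (filter (\<lambda>l. int x mod l = 0) L) \<union> R \<and>
    nat ` set L \<inter> R = {} \<and> finite R \<and> card R \<le> e \<and> (\<forall>l\<in>R. p \<le> l)"
proof -
  let ?A = "filter (\<lambda>l. int x mod l = 0) L"
  have Lp: "\<And>l. l \<in> set L \<Longrightarrow> l > 0 \<and> prime (nat l)" using L(2) by blast
  have inj: "inj_on nat (set L)" using Lp by (auto intro!: inj_onI simp: eq_nat_nat_iff less_imp_le)
  have div: "nat l dvd x" if "l \<in> set ?A" for l
  proof -
    have "int (nat l) dvd int x" using that Lp[of l] by (simp add: mod_eq_0_iff_dvd)
    then show ?thesis by (simp only: int_dvd_int_iff)
  qed
  define R where "R = prime_factors x - nat ` set L"
  have "prime_factors x \<inter> nat ` set L = nat ` set ?A"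
  proof (intro equalityI subsetI)
    fix y assume "y \<in> prime_factors x \<inter> nat ` set L"
    then obtain l where l: "y = nat l" "l \<in> set L" "nat l dvd x" by (auto simp: in_prime_factors_iff)
    then have "int (nat l) dvd int x" by (simp only: int_dvd_int_iff)
    then show "y \<in> nat ` set ?A" using l Lp[of l] by (auto simp: mod_eq_0_iff_dvd)
  next
    fix y assume "y \<in> nat ` set ?A"
    then show "y \<in> prime_factors x \<inter> nat ` set L" using div Lp x by (auto simp: in_prime_factors_iff)
  qed
  then have eq: "prime_factors x = nat ` set ?A \<union> R" unfolding R_def by blast
  have ge: "l \<ge> p" if "l \<in> R" for l
  proof (rule ccontr)
    assume "\<not> l \<ge> p"
    then have "int l \<in> set L" using that p(1) by (simp add: R_def in_prime_factors_iff)
    then have "l \<in> nat ` set L" by (metis image_eqI nat_int)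
    then show False using that by (simp add: R_def)
  qed
  have "card R \<le> e"
  proof (rule ccontr)
    assume "\<not> ?thesis"
    then have "p ^ Suc e \<le> p ^ card R" using p(2) by (intro power_increasing) auto
    also have "\<dots> = (\<Prod>l\<in>R. p)" by simp
    also have "\<dots> \<le> \<Prod>R" using ge by (intro prod_mono) auto
    finally have R: "int p ^ Suc e \<le> int (\<Prod>R)" by (metis of_nat_le_iff of_nat_power)
    have "prod_list ?A = prod (\<lambda>l. l) (set ?A)"
      using prod.distinct_set_conv_list[of ?A "\<lambda>l. l"] L(1) by simp
    also have "\<dots> = (\<Prod>l\<in>set ?A. int (nat l))" using Lp by (intro prod.cong) (auto simp: less_imp_le)
    also have "\<dots> = (\<Prod>l\<in>nat ` set ?A. int l)"
      using inj by (subst prod.reindex) (auto intro: inj_on_subset)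
    finally have A: "prod_list ?A = int (\<Prod>(nat ` set ?A))" by simp
    have "nat ` set ?A \<inter> R = {}" by (auto simp: R_def)
    then have "\<Prod>(prime_factors x) = \<Prod>(nat ` set ?A) * \<Prod>R"
      unfolding eq by (intro prod.union_disjoint) (auto simp: R_def)
    then have "int (\<Prod>R) * prod_list ?A = int (\<Prod>(prime_factors x))" unfolding A by simp
    also have "\<dots> \<le> int x" using prod_prime_factors_le[OF x order_refl] by (simp only: of_nat_le_iff)
    finally have "int (\<Prod>R) * prod_list ?A \<le> int x" .
    moreover have "int p ^ Suc e * prod_list ?A \<le> int (\<Prod>R) * prod_list ?A"
      using R by (intro mult_right_mono) (simp_all add: A prod_nonneg)
    ultimately show False using rest by linarith
  qed
  moreover have "nat ` set L \<inter> R = {}" "finite R" by (auto simp: R_def)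
  ultimately show ?thesis using eq ge by blast
qed

text \<open>A pair \<open>(l, u)\<close> carries an integer \<open>u\<close> that is at least
  \<open>10000 / l\<close>, so that reciprocal sums can be compared in integers.\<close>

lemma sum_weights_ge:
  fixes A :: "(int \<times> int) list"
  assumes "distinct (map fst A)" "\<And>l u. (l, u) \<in> set A \<Longrightarrow> 0 < l \<and> 10000 \<le> l * u"
  shows "(\<Sum>l\<in>nat ` set (map fst A). 1 / real l) \<le> real_of_int (sum_list (map snd A)) / 10000"
proof -
  have inj: "inj_on nat (set (map fst A))"
    using assms(2) by (fastforce intro!: inj_onI simp: eq_nat_nat_iff less_imp_le)
  have "(\<Sum>l\<in>nat ` set (map fst A). 1 / real l) = (\<Sum>l\<in>set (map fst A). 1 / real (nat l))"
    by (subst sum.reindex[OF inj]) simp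
  also have "\<dots> = (\<Sum>x\<leftarrow>A. 1 / real (nat (fst x)))"
    using sum.distinct_set_conv_list[OF assms(1), of "\<lambda>l. 1 / real (nat l)"] by (simp add: comp_def)
  also have "\<dots> \<le> (\<Sum>x\<leftarrow>A. real_of_int (snd x) / 10000)"
  proof (rule sum_list_mono)
    fix x assume "x \<in> set A"
    then have "0 < fst x \<and> 10000 \<le> fst x * snd x" using assms(2)[of "fst x" "snd x"] by simp
    then have "0 < fst x" "10000 \<le> real_of_int (fst x) * real_of_int (snd x)"
      by (auto simp flip: of_int_mult)
    then show "1 / real (nat (fst x)) \<le> real_of_int (snd x) / 10000" by (simp add: field_simps)
  qed
  also have "\<dots> = real_of_int (sum_list (map snd A)) / 10000"
    by (induction A) (auto simp: add_divide_distrib)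
  finally show ?thesis .
qed

section \<open>Degree three\<close>

context odd_trace_field
begin

text \<open>\<open>N div 2\<close> is \<open>m\<close> times \<open>(q - 1) div 2\<close> with
  \<open>m\<close> odd. So if \<open>(q - 1) div 2\<close> divides \<open>j\<close>, one of
  \<open>j\<close> and \<open>j + N div 2\<close> is a multiple of \<open>q - 1\<close>, and its sum
  is smaller by \<open>sqrt q\<close>; averaging gives the bound.\<close>

lemma half_exps_bounds_odd:
  assumes "odd n" "n \<ge> 2" "b \<in> base - {0}"
  shows "char_sum_bounds (N div 2) ((q - 1) div 2) (half_exps b)
     ((sqrt (real q) ^ (n - 2) + sqrt (real q) ^ (n - 1)) / 2) (sqrt (real q) ^ (n - 1))"
proof
  have "sqrt (real q) ^ (n - 2) \<le> sqrt (real q) ^ (n - 1)"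
    using q_gt_1 assms(2) by (intro power_increasing) auto
  then show "(sqrt (real q) ^ (n - 2) + sqrt (real q) ^ (n - 1)) / 2 \<le> sqrt (real q) ^ (n - 1)" by simp
  fix j assume j: "\<not> N div 2 dvd j"
  show "norm (\<Sum>k\<in>half_exps b. unity_char (N div 2) j k) \<le> sqrt (real q) ^ (n - 1)"
    using norm_half_sum_le[OF even_N j assms(3)] .
  assume "(q - 1) div 2 dvd j"
  then obtain i where i: "j = (q - 1) div 2 * i" by blast
  have q2: "q - 1 = 2 * ((q - 1) div 2)" using odd_q by simp
  have jN: "j + N div 2 = (q - 1) div 2 * (i + m)" by (simp add: i half_N algebra_simps)
  note nd = not_dvd_half[OF even_N j]
  have dv: "q - 1 dvd (q - 1) div 2 * k" if "even k" for k
  proof -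
    have "(q - 1) div 2 * 2 dvd (q - 1) div 2 * k" using that by (intro mult_dvd_mono) auto
    then show ?thesis using q2 by (metis mult.commute)
  qed
  have "norm (S j b + S (j + N div 2) b) \<le> sqrt (real q) ^ (n - 2) + sqrt (real q) ^ (n - 1)"
  proof (cases "even i")
    case True
    then have "norm (S j b) = sqrt (real q) ^ (n - 2)"
      using norm_S_trivial[OF nd(1) _ assms(2,3)] dv i by simp
    then show ?thesis using norm_S_le[OF nd(2) assms(3)] norm_triangle_ineq[of "S j b" "S (j + N div 2) b"]
      by linarith
  next
    case False
    then have "even (i + m)" using odd_m[OF assms(1)] by simp
    then have "norm (S (j + N div 2) b) = sqrt (real q) ^ (n - 2)"
      using norm_S_trivial[OF nd(2) _ assms(2,3)] dv jN by simp
    then show ?thesis using norm_S_le[OF nd(1) assms(3)] norm_triangle_ineq[of "S j b" "S (j + N div 2) b"]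
      by linarith
  qed
  then show "norm (\<Sum>k\<in>half_exps b. unity_char (N div 2) j k) \<le> (sqrt (real q) ^ (n - 2) + sqrt (real q) ^ (n - 1)) / 2"
    by (simp add: sum_half_exps[OF even_N] norm_divide)
qed (use half_N_pos in auto)

abbreviation "inv_sum \<equiv> (\<Sum>l\<in>prime_factors m. 1 / real l)"
abbreviation "core3 \<equiv> {l \<in> P1. \<not> l dvd m}"

lemma sum_one_minus_inv: "(\<Sum>l\<in>prime_factors m. 1 - 1 / real l) = card (prime_factors m) - inv_sum"
  by (simp add: sum_subtractf)

lemma inv_sum_le_card: "inv_sum \<le> card (prime_factors m)"
proof -
  have "inv_sum \<le> (\<Sum>l\<in>prime_factors m. 1)"
  proof (rule sum_mono)
    fix l assume "l \<in> prime_factors m"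
    then have "prime l" by auto
    then show "1 / real l \<le> 1" using prime_gt_0_nat[of l] by simp
  qed
  then show ?thesis by simp
qed

text \<open>Rewritten as \<open>s * X + u * (Y - X) < Y\<close>, the sieve inequality is monotone in
  the prime count and in the reciprocal sum as long as \<open>X \<le> Y\<close>, so upper bounds for
  both suffice.\<close>

lemma monotone_criterion:
  fixes s u X Y :: real
  assumes "card (prime_factors m) \<le> s" "inv_sum \<le> u" "1 \<le> s" "0 \<le> X" "X \<le> Y" "s * X + u * (Y - X) < Y"
  shows "inv_sum < 1" "(card (prime_factors m) - inv_sum) * X < (1 - inv_sum) * Y"
proof -
  have sX: "1 * X \<le> s * X" using assms by (intro mult_right_mono) auto
  then have "u * (Y - X) < 1 * (Y - X)" using assms(6) by simp
  moreover have "1 * (Y - X) \<le> u * (Y - X)" if "1 \<le> u"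
    using that assms(5) by (intro mult_right_mono) auto
  ultimately have "u < 1" by linarith
  then show "inv_sum < 1" using assms(2) by linarith
  have "card (prime_factors m) * X \<le> s * X" "inv_sum * (Y - X) \<le> u * (Y - X)"
    using assms by (auto intro!: mult_right_mono)
  then have "card (prime_factors m) * X + inv_sum * (Y - X) < Y" using assms(6) by linarith
  then show "(card (prime_factors m) - inv_sum) * X < (1 - inv_sum) * Y" by (simp add: algebra_simps)
qed

text \<open>The core consists of the primes of \<open>(q - 1) div 2\<close> not dividing
  \<open>m\<close>; all primes of \<open>m\<close> are sieved with the better bound. The expression
  \<open>(q + r) / 2 + q * (w - 1)\<close> is the error per sieved prime, with \<open>r\<close> for
  \<open>sqrt q\<close> and \<open>w\<close> for \<open>2 ^ card core3\<close>; it is set against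
  the main term minus the error of the core.\<close>

lemma three_nonzero:
  fixes s u r w :: real
  assumes n: "n = 3" and b: "b \<in> base - {0}"
    and s: "card (prime_factors m) \<le> s" "inv_sum \<le> u" "1 \<le> s" "sqrt q \<le> r" "2 ^ card core3 \<le> w"
    and XY: "(q + r) / 2 + q * (w - 1) \<le> (real q * q - q) / 2 - q * (w - 1)"
    and ineq: "s * ((q + r) / 2 + q * (w - 1)) +
      u * ((real q * q - q) / 2 - q * (w - 1) - ((q + r) / 2 + q * (w - 1))) < (real q * q - q) / 2 - q * (w - 1)"
  shows "\<exists>x. r_primitive 2 x \<and> Tr x = b"
proof (rule ex_two_primitive)
  interpret char_sum_bounds "N div 2" "(q - 1) div 2" "half_exps b" "(sqrt q + q) / 2" "q"
    using half_exps_bounds_odd[OF _ _ b] n by (simp add: power2_eq_square)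
  let ?X = "(q + r) / 2 + q * (w - 1)" and ?Y = "(real q * q - q) / 2 - q * (w - 1)"
  have w1: "w \<ge> 1" using s(5) by (rule order_trans[rotated]) simp
  have r0: "r \<ge> 0" using s(4) by (rule order_trans[rotated]) simp
  have X0: "0 \<le> ?X" using w1 r0 by simp
  note mc = monotone_criterion[OF s(1-3) X0 XY ineq]
  let ?c = "2 ^ card core3 :: real"
  have qc: "q * (?c - 1) \<le> q * (w - 1)" using s(5) by (intro mult_left_mono) auto
  have "(card (prime_factors m) - inv_sum) * ((sqrt q + q) / 2 + q * (?c - 1)) \<le> (card (prime_factors m) - inv_sum) * ?X"
  proof (intro mult_left_mono)
    show "(sqrt q + q) / 2 + q * (?c - 1) \<le> ?X"
    proof -
      have "(sqrt q + q) / 2 \<le> (q + r) / 2" using s(4) by simp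
      then show ?thesis using qc by (rule add_mono)
    qed
  qed (use inv_sum_le_card in auto)
  also note mc(2)
  also have "(1 - inv_sum) * ?Y \<le> (1 - inv_sum) * ((real q * q - q) / 2 - q * (?c - 1))"
    using mc(1) qc by (intro mult_left_mono) auto
  finally have main: "(card (prime_factors m) - inv_sum) * ((sqrt q + q) / 2 + q * (?c - 1)) <
     (1 - inv_sum) * ((real q * q - q) / 2 - q * (?c - 1))" .
  have T0: "(real q * q - q) / 2 \<le> card (half_exps b)"
    using half_exps_card[OF b] n by (simp add: power2_eq_square)
  have "\<exists>k\<in>half_exps b. \<forall>l\<in>{} \<union> core3 \<union> prime_factors m \<union> {}. \<not> l dvd k"
  proof (rule sieve_split[OF _ _ _ _ _ _ _ _ _ T0])
    show "l \<in> {} \<union> core3 \<union> prime_factors m \<union> {} \<Longrightarrow> prime l \<and> l dvd N div 2" for l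
      by (auto simp: half_N in_prime_factors_iff)
    show "(q - 1) div 2 dvd N div 2 div l" if "l \<in> {} \<union> prime_factors m" for l
    proof -
      have l: "l > 0" "l dvd m" using that by (auto simp: in_prime_factors_iff prime_gt_0_nat)
      then obtain c where c: "m = l * c" "l > 0" by blast
      have "N div 2 = l * ((q - 1) div 2 * c)" by (simp add: half_N c)
      then show ?thesis using c(2) by simp
    qed
    show "(\<Sum>l\<in>prime_factors m. 1 - 1 / real l) * ((sqrt (real q) + real q) / 2 * 2 ^ card {} +
       real q * (2 ^ (card {} + card core3) - 2 ^ card {})) +
      (\<Sum>l\<in>{}. 1 - 1 / real l) * (real q * 2 ^ (card {} + card core3))
      < (1 - inv_sum - (\<Sum>l\<in>{}. 1 / real l)) * ((real q * real q - real q) / 2 -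
        ((sqrt (real q) + real q) / 2 * (2 ^ card {} - 1) + real q * (2 ^ (card {} + card core3) - 2 ^ card {})))"
      using main by (simp add: sum_one_minus_inv)
  qed (use mc(1) in \<open>auto simp: in_prime_factors_iff\<close>)
  moreover have "prime_factors (N div 2) \<subseteq> core3 \<union> prime_factors m"
    by (auto simp: half_N in_prime_factors_iff prime_dvd_mult_iff)
  ultimately show "\<exists>k\<in>half_exps b. \<forall>l\<in>prime_factors (N div 2). \<not> l dvd k" by blast
qed

text \<open>The core is empty; dividing by the common factor \<open>q - 1\<close> leaves
  \<open>sqrt q\<close> against \<open>q + 1\<close>.\<close>

lemma three_zero:
  fixes s u r :: real
  assumes n: "n = 3" and s: "card (prime_factors m) \<le> s" "inv_sum \<le> u" "1 \<le> s" "sqrt q \<le> r"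
    and XY: "r \<le> q + 1" and ineq: "s * r + u * (q + 1 - r) < q + 1"
  shows "\<exists>x. r_primitive 2 x \<and> Tr x = 0"
proof -
  interpret char_sum_bounds N 0 "exps 0" "real (q - 1) * sqrt q" "real (q - 1) * sqrt q"
    using exps_bounds n by simp
  have r0: "r \<ge> 0" using s(4) by (rule order_trans[rotated]) simp
  note mc = monotone_criterion[OF s(1-3) r0 XY ineq]
  have "(card (prime_factors m) - inv_sum) * sqrt q \<le> (card (prime_factors m) - inv_sum) * r"
    using inv_sum_le_card s(4) by (intro mult_left_mono) auto
  also note mc(2)
  finally have "real (q - 1) * ((card (prime_factors m) - inv_sum) * sqrt q) < real (q - 1) * ((1 - inv_sum) * (q + 1))"
    using q_gt_1 by (intro mult_strict_left_mono) auto
  then have main: "(card (prime_factors m) - inv_sum) * (real (q - 1) * sqrt q) < (1 - inv_sum) * (real (q - 1) * (q + 1))"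
    by (simp only: mult_ac)
  have "real (q - 1) * (q + 1) = real q ^ 2 - 1"
    using q_gt_1 by (simp add: of_nat_diff power2_eq_square algebra_simps)
  also have "\<dots> = card (exps 0)" using q_gt_1 unfolding card_exps_0 unfolding n by (simp add: of_nat_diff)
  finally have T0: "real (q - 1) * (q + 1) \<le> card (exps 0)" by simp
  have "\<exists>k\<in>exps 0. \<forall>l\<in>{} \<union> {} \<union> {} \<union> prime_factors m. \<not> l dvd k"
  proof (rule sieve_split[OF _ _ _ _ _ _ _ _ _ T0])
    show "l \<in> {} \<union> {} \<union> {} \<union> prime_factors m \<Longrightarrow> prime l \<and> l dvd N" for l
      using m_dvd_N by (auto simp: in_prime_factors_iff intro: dvd_trans)
    show "(\<Sum>l\<in>{}. 1 - 1 / real l) * (real (q - 1) * sqrt (real q) * 2 ^ card {} +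
        real (q - 1) * sqrt (real q) * (2 ^ (card {} + card {}) - 2 ^ card {})) +
      (\<Sum>l\<in>prime_factors m. 1 - 1 / real l) * (real (q - 1) * sqrt (real q) * 2 ^ (card {} + card {}))
      < (1 - (\<Sum>l\<in>{}. 1 / real l) - inv_sum) * (real (q - 1) * real (q + 1) -
        (real (q - 1) * sqrt (real q) * (2 ^ card {} - 1) + real (q - 1) * sqrt (real q) * (2 ^ (card {} + card {}) - 2 ^ card {})))"
    proof -
      have q1: "real (q - 1) = real q - 1" using q_gt_1 by (simp add: of_nat_diff)
      show ?thesis using main unfolding q1 by (simp add: sum_one_minus_inv add.commute)
    qed
  qed (use mc(1) in auto)
  then show ?thesis using two_primitive_trace_0 odd_m n by auto
qed

end

text \<open>In degree three a prime factor of \<open>m\<close> is 3 or congruent to 1 modulo 6;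
  these are the candidates below 37.\<close>

definition weights3 :: "(int \<times> int) list" where
  "weights3 = [(3, 3334), (7, 1429), (13, 770), (19, 527), (31, 323)]"

definition smalls3 :: "int list" where
  "smalls3 = [2, 3, 5, 7, 11]"

lemma weights3: "(l, u) \<in> set weights3 \<Longrightarrow> 1 \<le> l \<and> prime (nat l) \<and> 10000 \<le> l * u"
  and distinct_weights3: "distinct (map fst weights3)"
  and weights3_fst: "fst ` set weights3 = {3, 7, 13, 19, 31}"
  by (auto simp: weights3_def)

lemma smalls3: "l \<in> set smalls3 \<Longrightarrow> 1 \<le> l \<and> prime (nat l)"
  and set_smalls3: "set smalls3 = {2, 3, 5, 7, 11}" and distinct_smalls3: "distinct smalls3"
  by (auto simp: smalls3_def)

lemma prod_list_ge_1: "(\<And>l. l \<in> set xs \<Longrightarrow> l \<ge> 1) \<Longrightarrow> prod_list xs \<ge> (1::int)"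
proof (induction xs)
  case (Cons l xs)
  then have "1 \<le> l" "1 \<le> prod_list xs" by simp_all
  then have "1 * 1 \<le> l * prod_list xs" by (intro mult_mono) auto
  then show ?case by simp
qed simp

text \<open>Upper bounds for the prime count, the scaled reciprocal sum and the core size.
  \<open>e\<close> bounds the number of prime factors of \<open>m\<close> from 37 on, each of weight
  below 271, and \<open>f\<close> that of the factors of \<open>(q - 1) div 2\<close> from 13 on.
  The final values 2 and 1 are justified for \<open>q < 154\<close>.\<close>

definition crit3_values :: "int \<Rightarrow> int \<times> int \<times> int" where
  "crit3_values q = (let m = q * q + q + 1; x = (q - 1) div 2;
     A = filter (\<lambda>(l, u). m mod l = 0) weights3;
     B = filter (\<lambda>l. x mod l = 0) smalls3;
     r = prod_list (map fst A);
     e = (if m < 37 * r then 0 else if m < 1369 * r then 1 else 2);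
     f = (if x < 13 * prod_list B then 0 else 1)
   in (int (length A) + e, sum_list (map snd A) + 271 * e, 2 ^ nat (int (length (filter (\<lambda>l. m mod l \<noteq> 0) B)) + f)))"

text \<open>The inequality of \<open>three_nonzero\<close> multiplied by 160000, with
  \<open>sqrt q\<close> replaced by its tangent \<open>(q + 16) / 8\<close> at 16.\<close>

definition crit3 :: "int \<Rightarrow> bool" where
  "crit3 q = (case crit3_values q of (s, u, w) \<Rightarrow>
     (let X = 9 * q + 16 + 16 * q * (w - 1); Y = 8 * q * (q - 1) - 16 * q * (w - 1)
      in X \<le> Y \<and> 10000 * s * X + u * (Y - X) < 10000 * Y))"

definition crit3_zero :: "int \<Rightarrow> bool" where
  "crit3_zero q = (case crit3_values q of (s, u, w) \<Rightarrow>
     (let X = q + 16; Y = 8 * (q + 1) in X \<le> Y \<and> 10000 * s * X + u * (Y - X) < 10000 * Y))"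

text \<open>The two indices left out are \<open>q = 5\<close> and \<open>q = 9\<close>, which
  receive separate arguments.\<close>

lemma crit3_all: "list_all (\<lambda>i. i = 1 \<or> i = 3 \<or> crit3 (2 * i + 3)) [0..75]"
  by code_simp

lemma crit3_zero_all: "list_all (\<lambda>i. crit3_zero (2 * i + 3)) [0..35]"
  by code_simp

context odd_trace_field
begin

lemma m_three: "n = 3 \<Longrightarrow> m = q * q + q + 1"
proof -
  assume n: "n = 3"
  have "m = (\<Sum>i<3. q ^ i)" using m_geometric unfolding n .
  then show ?thesis by (simp add: eval_nat_numeral lessThan_Suc)
qed

lemma prime_factor_m_three:
  assumes "n = 3" "l \<in> prime_factors m" "l < 73"
  shows "l \<in> {3, 7, 13, 19, 31, 37, 43, 61, 67}"
proof -
  have l: "prime l" "l dvd m" using assms(2) by auto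
  have "l = 3 \<or> 6 dvd l - 1" using prime_dvd_m[of l] l assms(1) by auto
  then show ?thesis using primes_below_73[OF l(1) assms(3)] by auto
qed

text \<open>The tangent to the square root at \<open>c\<^sup>2\<close>, a bound linear in
  \<open>q\<close>.\<close>

lemma sqrt_le_amgm:
  fixes c :: real
  assumes "c > 0"
  shows "sqrt (real q) \<le> (q + c\<^sup>2) / (2 * c)"
proof -
  have "0 \<le> (sqrt (real q) - c)\<^sup>2" by simp
  then have "2 * c * sqrt q \<le> q + c\<^sup>2" by (simp add: power2_diff algebra_simps)
  then show ?thesis using assms by (simp add: field_simps)
qed

lemma crit3_values_sound:
  assumes n: "n = 3" and q: "q < 154" and v: "crit3_values (int q) = (s, u, w)"
  shows "card (prime_factors m) \<le> real_of_int s" "inv_sum \<le> real_of_int u / 10000"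
    "2 ^ card core3 \<le> real_of_int w" "1 \<le> real_of_int s"
proof -
  define A where "A = filter (\<lambda>(l, u). int m mod l = 0) weights3"
  define x where "x = (q - 1) div 2"
  define B :: "int list" where "B = filter (\<lambda>l. int x mod l = 0) smalls3"
  define r where "r = prod_list (map fst A)"
  define e :: int where "e = (if int m < 37 * r then 0 else if int m < 1369 * r then 1 else 2)"
  define f :: int where "f = (if int x < 13 * prod_list B then 0 else 1)"
  have mi: "int q * int q + int q + 1 = int m" by (simp add: m_three[OF n])
  have xi: "(int q - 1) div 2 = int x" using q_gt_1 by (simp add: x_def zdiv_int of_nat_diff)
  have "crit3_values (int q) = (int (length A) + e, sum_list (map snd A) + 271 * e,
      2 ^ nat (int (length (filter (\<lambda>l. int m mod l \<noteq> 0) B)) + f))"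
    unfolding crit3_values_def Let_def mi xi A_def[symmetric] B_def[symmetric] r_def[symmetric]
      e_def[symmetric] f_def[symmetric] by (rule refl)
  then have suw: "s = int (length A) + e" "u = sum_list (map snd A) + 271 * e"
    "w = 2 ^ nat (int (length (filter (\<lambda>l. int m mod l \<noteq> 0) B)) + f)"
    unfolding v by simp_all
  have e0: "0 \<le> e" and f0: "0 \<le> f" by (auto simp: e_def f_def)
  have mapA: "map fst A = filter (\<lambda>l. int m mod l = 0) (map fst weights3)"
    by (simp add: A_def filter_map comp_def split_def)
  have r1: "r \<ge> 1" unfolding r_def by (intro prod_list_ge_1) (auto simp: A_def dest: weights3)
  have "q * q \<le> 153 * 153" using q by (intro mult_le_mono) auto
  then have m_le: "int m \<le> 23563" using q m_three[OF n] by linarith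
  have rest: "int m < int 37 ^ Suc (nat e) * prod_list (filter (\<lambda>l. int m mod l = 0) (map fst weights3))"
  proof -
    have "e = 0 \<or> e = 1 \<or> e = 2" by (auto simp: e_def)
    then have "int 37 ^ Suc (nat e) = (if e = 0 then 37 else if e = 1 then 1369 else 50653)" by auto
    then show ?thesis
      unfolding mapA[symmetric] r_def[symmetric] using m_le r1 by (auto simp: e_def)
  qed
  have h1: "\<forall>l\<in>set (map fst weights3). 0 < l \<and> prime (nat l)"
    by (auto dest!: weights3)
  have h2: "\<forall>l. prime l \<longrightarrow> l dvd m \<longrightarrow> l < 37 \<longrightarrow> int l \<in> set (map fst weights3)"
  proof (intro allI impI)
    fix l assume that: "prime l" "l dvd m" "l < 37"
    have "l \<in> {3, 7, 13, 19, 31, 37, 43, 61, 67}"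
      using that m_pos by (intro prime_factor_m_three[OF n]) (auto simp: in_prime_factors_iff)
    then have "int l \<in> {3, 7, 13, 19, 31}" using that(3) by auto
    then show "int l \<in> set (map fst weights3)" by (simp only: set_map weights3_fst)
  qed
  obtain R where R: "prime_factors m = nat ` set (map fst A) \<union> R" "nat ` set (map fst weights3) \<inter> R = {}"
      "finite R" "card R \<le> nat e" "\<forall>l\<in>R. l \<ge> 37"
    using prime_factors_split[OF m_pos distinct_weights3 h1 h2 _ rest] unfolding mapA by auto
  have dA: "distinct (map fst A)" unfolding mapA by (intro distinct_filter distinct_weights3)
  have cA: "card (nat ` set (map fst A)) \<le> length A"
    using card_image_le[of "set (map fst A)" nat] card_length[of "map fst A"] by simp
  have "card (prime_factors m) \<le> card (nat ` set (map fst A)) + card R"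
    unfolding R(1) by (rule card_Un_le)
  then have "int (card (prime_factors m)) \<le> s" using cA R(4) e0 suw(1) by linarith
  then show s: "card (prime_factors m) \<le> real_of_int s" by linarith
  have "inv_sum = (\<Sum>l\<in>nat ` set (map fst A). 1 / real l) + (\<Sum>l\<in>R. 1 / real l)"
  proof (unfold R(1), intro sum.union_disjoint)
    have "set (map fst A) \<subseteq> set (map fst weights3)" unfolding mapA by (rule filter_is_subset)
    then show "nat ` set (map fst A) \<inter> R = {}" using R(2) by blast
  qed (use R(3) in auto)
  also have "(\<Sum>l\<in>nat ` set (map fst A). 1 / real l) \<le> real_of_int (sum_list (map snd A)) / 10000"
    using dA by (intro sum_weights_ge) (auto simp: A_def dest!: weights3)
  also have "(\<Sum>l\<in>R. 1 / real l) \<le> (\<Sum>l\<in>R. 271 / 10000)"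
  proof (rule sum_mono)
    fix l assume "l \<in> R"
    then have "real l \<ge> 37" using R(5) by simp
    then show "1 / real l \<le> 271 / 10000" by (simp add: field_simps)
  qed
  also have "(\<Sum>l\<in>R. 271 / 10000) \<le> real_of_int e * (271 / 10000 :: real)"
  proof -
    have "real (card R) \<le> real_of_int e" using R(4) e0 by linarith
    then show ?thesis by simp
  qed
  finally show "inv_sum \<le> real_of_int u / 10000" by (simp add: suw(2) field_simps)
  have x0: "x > 0" using half_q_pos by (simp add: x_def)
  have rest2: "int x < int 13 ^ Suc (nat f) * prod_list (filter (\<lambda>l. int x mod l = 0) smalls3)"
  proof -
    have "prod_list B \<ge> 1" unfolding B_def by (intro prod_list_ge_1) (auto dest: smalls3)
    moreover have "x \<le> 76" using q by (simp add: x_def)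
    moreover have "f = 0 \<or> f = 1" by (auto simp: f_def)
    then have "int 13 ^ Suc (nat f) = (if f = 0 then 13 else 169)" by auto
    ultimately show ?thesis unfolding B_def[symmetric] by (auto simp: f_def)
  qed
  have h3: "\<forall>l\<in>set smalls3. 0 < l \<and> prime (nat l)"
    by (auto dest!: smalls3)
  have h4: "\<forall>l. prime l \<longrightarrow> l dvd x \<longrightarrow> l < 13 \<longrightarrow> int l \<in> set smalls3"
    using primes_below_13 by (fastforce simp: set_smalls3)
  obtain R' where R': "prime_factors x = nat ` set B \<union> R'" "finite R'" "card R' \<le> nat f"
    using prime_factors_split[OF x0 distinct_smalls3 h3 h4 _ rest2] unfolding B_def by auto
  have "core3 \<subseteq> nat ` set (filter (\<lambda>l. int m mod l \<noteq> 0) B) \<union> R'"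
  proof
    fix l assume l: "l \<in> core3"
    then have "l \<in> nat ` set B \<union> R'" using R'(1) by (simp add: x_def)
    moreover have "nat y \<in> nat ` set (filter (\<lambda>l. int m mod l \<noteq> 0) B)" if "y \<in> set B" "\<not> nat y dvd m" for y
    proof -
      have "y > 0" using that smalls3[of y] by (auto simp: B_def)
      then have "\<not> y dvd int m" using that(2) by (metis int_dvd_int_iff int_nat_eq less_imp_le)
      then show ?thesis using that by (auto simp: mod_eq_0_iff_dvd)
    qed
    ultimately show "l \<in> nat ` set (filter (\<lambda>l. int m mod l \<noteq> 0) B) \<union> R'" using l by auto
  qed
  then have "card core3 \<le> card (nat ` set (filter (\<lambda>l. int m mod l \<noteq> 0) B) \<union> R')"
    using R'(2) by (intro card_mono) auto
  also have "\<dots> \<le> card (nat ` set (filter (\<lambda>l. int m mod l \<noteq> 0) B)) + card R'" by (rule card_Un_le)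
  also have "\<dots> \<le> length (filter (\<lambda>l. int m mod l \<noteq> 0) B) + nat f"
    using card_image_le[OF finite_set, of nat "filter (\<lambda>l. int m mod l \<noteq> 0) B"]
      card_length[of "filter (\<lambda>l. int m mod l \<noteq> 0) B"] R'(3) by linarith
  finally have "card core3 \<le> nat (int (length (filter (\<lambda>l. int m mod l \<noteq> 0) B)) + f)"
    using f0 by linarith
  then have "(2::real) ^ card core3 \<le> 2 ^ nat (int (length (filter (\<lambda>l. int m mod l \<noteq> 0) B)) + f)"
    by (rule power_increasing) simp
  then show "2 ^ card core3 \<le> real_of_int w" by (simp add: suw(3))
  have "m > 1" using m_three[OF n] q_gt_1 by simp
  then obtain l where "prime l" "l dvd m" using prime_factor_nat[of m] by auto
  then have "l \<in> prime_factors m" using m_pos by (simp add: in_prime_factors_iff)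
  then have "card (prime_factors m) > 0" by (auto simp only: card_gt_0_iff finite_set_mset)
  then show "1 \<le> real_of_int s" using s by linarith
qed

lemma three_nonzero_small:
  assumes n: "n = 3" and q: "q < 154" "crit3 (int q)" and b: "b \<in> base - {0}"
  shows "\<exists>x. r_primitive 2 x \<and> Tr x = b"
proof -
  obtain s u w where v: "crit3_values (int q) = (s, u, w)" by (cases "crit3_values (int q)") auto
  note snd = crit3_values_sound[OF n q(1) v]
  define X where "X = 9 * int q + 16 + 16 * int q * (w - 1)"
  define Y where "Y = 8 * int q * (int q - 1) - 16 * int q * (w - 1)"
  have "X \<le> Y" "10000 * s * X + u * (Y - X) < 10000 * Y"
    using q(2) by (simp_all add: crit3_def v Let_def X_def Y_def)
  then have "real_of_int X \<le> real_of_int Y"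
    "real_of_int (10000 * s * X + u * (Y - X)) < real_of_int (10000 * Y)"
    by (simp_all only: of_int_le_iff of_int_less_iff)
  then have c: "real_of_int X / 16 \<le> real_of_int Y / 16"
    "s * (real_of_int X / 16) + u / 10000 * (real_of_int Y / 16 - real_of_int X / 16) < real_of_int Y / 16"
    by (simp_all add: field_simps)
  let ?r = "(real q + 16) / 8"
  have X: "(q + ?r) / 2 + q * (real_of_int w - 1) = real_of_int X / 16"
    and Y: "(real q * q - q) / 2 - q * (real_of_int w - 1) = real_of_int Y / 16"
    by (simp_all add: X_def Y_def field_simps)
  show ?thesis
    by (rule three_nonzero[OF n b snd(1,2,4) _ snd(3), of ?r, unfolded X Y])
      (use sqrt_le_amgm[of 4] c in simp_all)
qed

lemma three_zero_small:
  assumes n: "n = 3" and q: "q < 154" "crit3_zero (int q)"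
  shows "\<exists>x. r_primitive 2 x \<and> Tr x = 0"
proof -
  obtain s u w where v: "crit3_values (int q) = (s, u, w)" by (cases "crit3_values (int q)") auto
  note snd = crit3_values_sound[OF n q(1) v]
  define X where "X = int q + 16"
  define Y where "Y = 8 * (int q + 1)"
  have "X \<le> Y" "10000 * s * X + u * (Y - X) < 10000 * Y"
    using q(2) by (simp_all add: crit3_zero_def v Let_def X_def Y_def)
  then have "real_of_int X \<le> real_of_int Y"
    "real_of_int (10000 * s * X + u * (Y - X)) < real_of_int (10000 * Y)"
    by (simp_all only: of_int_le_iff of_int_less_iff)
  then have c: "real_of_int X / 8 \<le> real_of_int Y / 8"
    "s * (real_of_int X / 8) + u / 10000 * (real_of_int Y / 8 - real_of_int X / 8) < real_of_int Y / 8"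
    by (simp_all add: field_simps)
  have X: "real_of_int X / 8 = (real q + 16) / 8" and Y: "real_of_int Y / 8 = q + 1"
    by (simp_all add: X_def Y_def)
  show ?thesis
    by (rule three_zero[OF n snd(1,2,4), of "(real q + 16) / 8"])
      (use sqrt_le_amgm[of 4] c[unfolded X Y] in simp_all)
qed

text \<open>Candidates for prime factors of \<open>m\<close>; the final 73 stands for everything
  from there on.\<close>

definition primes3 :: "nat list" where "primes3 = [3, 7, 13, 19, 31, 37, 43, 61, 67, 73]"

lemma primes3_facts: "sorted primes3" "primes3 \<noteq> []" "0 \<notin> set primes3" "length primes3 = 10"
  by (simp_all add: primes3_def)

lemma primes3_contains: "n = 3 \<Longrightarrow> l \<in> prime_factors m \<Longrightarrow> l < last primes3 \<Longrightarrow> l \<in> set primes3"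
proof -
  assume "n = 3" "l \<in> prime_factors m" "l < last primes3"
  then have "l \<in> {3, 7, 13, 19, 31, 37, 43, 61, 67}"
    by (intro prime_factor_m_three) (simp_all add: primes3_def)
  then show "l \<in> set primes3" unfolding primes3_def by auto
qed

lemma inv_sum_three:
  assumes "n = 3" "card (prime_factors m) \<le> k" "k \<le> 10"
  shows "inv_sum \<le> sum_list (map (\<lambda>l. 1 / real l) (take k primes3))"
proof -
  have "inv_sum \<le> (\<Sum>i<k. 1 / real (primes3 ! min i (length primes3 - 1)))"
    using assms primes3_contains primes3_facts by (intro sum_inverse_le_sorted') auto
  also have "\<dots> = (\<Sum>i<k. 1 / real (take k primes3 ! i))"
    using assms(3) primes3_facts(4) by (intro sum.cong) auto
  also have "\<dots> = sum_list (map (\<lambda>l. 1 / real l) (take k primes3))"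
    using assms(3) primes3_facts(4) by (simp add: sum_list_sum_nth atLeast0LessThan)
  finally show ?thesis .
qed

lemma prod_three:
  assumes "n = 3" "k \<le> card (prime_factors m)" "k \<le> 10"
  shows "prod_list (take k primes3) \<le> q * q + q + 1"
proof -
  have "prod_list (take k primes3) = (\<Prod>i<k. take k primes3 ! i)"
    using assms(3) primes3_facts(4) by (simp add: prod.list_conv_set_nth atLeast0LessThan)
  also have "\<dots> = (\<Prod>i<k. primes3 ! min i (length primes3 - 1))"
    using assms(3) primes3_facts(4) by (intro prod.cong) auto
  also have "\<dots> \<le> \<Prod>(prime_factors m)"
    using assms primes3_contains primes3_facts by (intro prod_ge_sorted') auto
  also have "\<dots> \<le> m" using m_pos by (intro prod_prime_factors_le) auto
  finally show ?thesis using m_three[OF assms(1)] by simp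
qed

end

context odd_trace_field
begin

text \<open>A coarser form for larger \<open>q\<close>: bounding \<open>sqrt q\<close> by
  \<open>q\<close> makes the two error bounds equal, and a common factor \<open>q / 2\<close>
  cancels.\<close>

lemma three_nonzero_W:
  fixes W s u :: real
  assumes n: "n = 3" and b: "b \<in> base - {0}"
    and s: "card (prime_factors m) \<le> s" "inv_sum \<le> u" "1 \<le> s" "real W1 \<le> W"
    and u: "u < 1" and ineq: "W * (s + 1 - 2 * u) < (1 - u) * (q + 1)"
  shows "\<exists>x. r_primitive 2 x \<and> Tr x = b"
proof -
  have W0: "W \<ge> 0" using s(4) by (rule order_trans[rotated]) simp
  have "(1 - u) * (2 * W) \<le> W * (s + 1 - 2 * u)"
  proof -
    have "W * (2 * (1 - u)) \<le> W * (s + 1 - 2 * u)" using s(3) W0 by (intro mult_left_mono) auto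
    then show ?thesis by (simp add: mult_ac)
  qed
  then have "(1 - u) * (2 * W) < (1 - u) * (q + 1)" using ineq by linarith
  then have W2: "2 * W < q + 1" using u by (simp only: mult_less_cancel_left_pos diff_gt_0_iff_gt)
  have X: "(q + real q) / 2 + q * (W / 2 - 1) = q / 2 * W"
    and Y: "(real q * q - q) / 2 - q * (W / 2 - 1) = q / 2 * (q + 1 - W)"
    by (simp_all add: field_simps)
  have q0: "real q / 2 > 0" using q_gt_1 by simp
  have "card core3 \<le> card P1" by (intro card_mono) auto
  then have "(2::real) ^ card core3 \<le> 2 ^ card P1" by (intro power_increasing) auto
  also have "\<dots> = real W1 / 2" by (simp add: W1_def)
  also have "\<dots> \<le> W / 2" using s(4) by simp
  finally have w: "2 ^ card core3 \<le> W / 2" .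
  have sq: "sqrt q \<le> real q"
    using q_gt_1 by (intro real_le_lsqrt) (auto simp: power2_eq_square)
  show ?thesis
  proof (rule three_nonzero[OF n b s(1-3) sq w, unfolded X Y])
    show "q / 2 * W \<le> q / 2 * (q + 1 - W)" using W2 q0 by (intro mult_left_mono) auto
    have "q / 2 * (s * W + u * (q + 1 - W - W)) < q / 2 * (q + 1 - W)"
      using ineq q0 by (intro mult_strict_left_mono) (auto simp: algebra_simps)
    moreover have "s * (h * W) + u * (h * A - h * W) = h * (s * W + u * (A - W))" for h A
      by (simp add: algebra_simps)
    note this[of "q / 2" "q + 1 - W"]
    ultimately show "s * (q / 2 * W) + u * (q / 2 * (q + 1 - W) - q / 2 * W) < q / 2 * (q + 1 - W)"
      by linarith
  qed
qed

text \<open>Four primes need \<open>(q - 1) div 2 \<ge> 2 * 3 * 5 * 7 = 210\<close>, and five need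
  2310.\<close>

lemma card_P1_le:
  "q < 421 \<Longrightarrow> card P1 \<le> 3" "q < 4621 \<Longrightarrow> card P1 \<le> 4"
proof -
  let ?L = "[2, 3, 5, 7, 11] :: nat list"
  have L: "l \<in> P1 \<Longrightarrow> l < last ?L \<Longrightarrow> l \<in> set ?L" for l
    using primes_below_13[of l] by auto
  have le: "(\<Prod>i<k. ?L ! min i (length ?L - 1)) \<le> (q - 1) div 2" if "k \<le> card P1" for k
  proof -
    have "(\<Prod>i<k. ?L ! min i (length ?L - 1)) \<le> \<Prod>P1"
      using L that by (intro prod_ge_sorted') auto
    also have "\<dots> \<le> (q - 1) div 2" using half_q_pos by (intro prod_prime_factors_le) auto
    finally show ?thesis .
  qed
  show "card P1 \<le> 3" if "q < 421"
  proof (rule ccontr)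
    assume "\<not> ?thesis"
    then have "(\<Prod>i<4. ?L ! min i (length ?L - 1)) \<le> (q - 1) div 2" by (intro le) simp
    then have "210 \<le> (q - 1) div 2" by (simp add: eval_nat_numeral lessThan_Suc)
    then show False using that by linarith
  qed
  show "card P1 \<le> 4" if "q < 4621"
  proof (rule ccontr)
    assume "\<not> ?thesis"
    then have "(\<Prod>i<5. ?L ! min i (length ?L - 1)) \<le> (q - 1) div 2" by (intro le) simp
    then have "2310 \<le> (q - 1) div 2" by (simp add: eval_nat_numeral lessThan_Suc)
    then show False using that by linarith
  qed
qed

lemma W1_le_two_power: "card P1 \<le> k \<Longrightarrow> real W1 \<le> 2 * 2 ^ k"
proof -
  assume "card P1 \<le> k"
  then have "(2::real) ^ card P1 \<le> 2 ^ k" by (intro power_increasing) auto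
  then show ?thesis by (simp add: W1_def)
qed

text \<open>Few prime factors of \<open>m\<close> keep the reciprocal sum small and many force
  \<open>q\<close> to be large; either way the sieve inequality has room.\<close>

lemma three_large_sieve:
  assumes n: "n = 3"
  shows "card (prime_factors m) \<le> 4 \<Longrightarrow> inv_sum \<le> 0.6058"
    and "card (prime_factors m) \<le> 5 \<Longrightarrow> inv_sum \<le> 0.6381"
    and "card (prime_factors m) \<le> 6 \<Longrightarrow> inv_sum \<le> 0.6652"
    and "card (prime_factors m) \<le> 9 \<Longrightarrow> inv_sum \<le> 0.7197"
    and "5 \<le> card (prime_factors m) \<Longrightarrow> 400 \<le> q"
    and "6 \<le> card (prime_factors m) \<Longrightarrow> 2438 \<le> q"
    and "7 \<le> card (prime_factors m) \<Longrightarrow> 15993 \<le> q"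
proof -
  show "card (prime_factors m) \<le> 4 \<Longrightarrow> inv_sum \<le> 0.6058"
    using inv_sum_three[OF n, of 4] by (simp add: primes3_def)
  show "card (prime_factors m) \<le> 5 \<Longrightarrow> inv_sum \<le> 0.6381"
    using inv_sum_three[OF n, of 5] by (simp add: primes3_def)
  show "card (prime_factors m) \<le> 6 \<Longrightarrow> inv_sum \<le> 0.6652"
    using inv_sum_three[OF n, of 6] by (simp add: primes3_def)
  show "card (prime_factors m) \<le> 9 \<Longrightarrow> inv_sum \<le> 0.7197"
    using inv_sum_three[OF n, of 9] by (simp add: primes3_def)
  have q: "q \<ge> k" if "(k - 1) * (k - 1) + (k - 1) + 1 < q * q + q + 1" for k
  proof (rule ccontr)
    assume "\<not> k \<le> q"
    then have "q \<le> k - 1" by simp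
    then have "q * q + q + 1 \<le> (k - 1) * (k - 1) + (k - 1) + 1" by (intro add_mono mult_le_mono) auto
    then show False using that by simp
  qed
  show "5 \<le> card (prime_factors m) \<Longrightarrow> 400 \<le> q"
    using prod_three[OF n, of 5] by (intro q) (simp add: primes3_def)
  show "6 \<le> card (prime_factors m) \<Longrightarrow> 2438 \<le> q"
    using prod_three[OF n, of 6] by (intro q) (simp add: primes3_def)
  show "7 \<le> card (prime_factors m) \<Longrightarrow> 15993 \<le> q"
    using prod_three[OF n, of 7] by (intro q) (simp add: primes3_def)
qed

text \<open>Beyond the tenth, each prime is at least 73 and more than pays for a factor 16, so
  \<open>16 ^ r\<close> for \<open>r\<close> primes stays below a fixed multiple of
  \<open>q * q\<close>.\<close>

lemma three_many:
  assumes n: "n = 3" and s: "10 \<le> card (prime_factors m)"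
  shows "16 * 4 ^ card (prime_factors m) \<le> 3 * q"
proof -
  let ?k = "card (prime_factors m)"
  have "prod_list primes3 * 16 ^ (k - 10) \<le> (\<Prod>i<k. primes3 ! min i (length primes3 - 1))" if "10 \<le> k" for k
    using that
  proof (induction k rule: dec_induct)
    case base
    have "prod_list primes3 = (\<Prod>i<10. primes3 ! i)"
      by (simp add: prod.list_conv_set_nth atLeast0LessThan primes3_facts(4))
    also have "\<dots> = (\<Prod>i<10. primes3 ! min i (length primes3 - 1))"
      by (intro prod.cong) (auto simp: primes3_facts(4))
    finally show ?case by simp
  next
    case (step k)
    obtain t where t: "k = 10 + t" using step(1) le_Suc_ex by blast
    have "primes3 ! min k (length primes3 - 1) = 73" using step by (simp add: primes3_def)
    moreover have "(16::nat) ^ (Suc k - 10) = 16 * 16 ^ (k - 10)" by (simp add: t)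
    ultimately show ?case using step.IH by simp
  qed
  from this[OF s] have "prod_list primes3 * 16 ^ (?k - 10) \<le> (\<Prod>i<?k. primes3 ! min i (length primes3 - 1))" .
  also have "\<dots> \<le> \<Prod>(prime_factors m)"
    using primes3_contains[OF n] primes3_facts by (intro prod_ge_sorted) auto
  also have "\<dots> \<le> m" using m_pos by (intro prod_prime_factors_le) auto
  also have "\<dots> \<le> 2 * (q * q)"
  proof -
    have "3 * q \<le> q * q" using q_ge_3 by simp
    then show ?thesis using m_three[OF n] q_ge_3 by linarith
  qed
  finally have P: "prod_list primes3 * 16 ^ (?k - 10) \<le> 2 * (q * q)" .
  have "(16::nat) ^ ?k = 16 ^ (10 + (?k - 10))" using s by simp
  also have "\<dots> = 16 ^ 10 * 16 ^ (?k - 10)" by (rule power_add)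
  finally have "256 * 16 ^ ?k = 256 * 16 ^ 10 * (16::nat) ^ (?k - 10)" by simp
  also have "2 * \<dots> \<le> 9 * (prod_list primes3 * 16 ^ (?k - 10))"
    by (simp add: primes3_def)
  also have "\<dots> \<le> 9 * (2 * (q * q))" using P by simp
  finally have "256 * 16 ^ ?k \<le> 9 * (q * q)" by simp
  moreover have "(16 * 4 ^ ?k)\<^sup>2 = 256 * (16::nat) ^ ?k"
    by (simp add: power_mult_distrib flip: power_mult power_mult_distrib) (simp add: power_mult mult.commute)
  ultimately have "(16 * 4 ^ ?k)\<^sup>2 \<le> (3 * q)\<^sup>2" by (simp add: power2_eq_square)
  then show ?thesis by (rule power2_le_imp_le) simp
qed

lemma three_nonzero_large:
  assumes n: "n = 3" and q: "q \<ge> 154" and b: "b \<in> base - {0}"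
  shows "\<exists>x. r_primitive 2 x \<and> Tr x = b"
proof -
  let ?s = "card (prime_factors m)"
  note L = three_large_sieve[OF n]
  have qr: "real q \<ge> 154" using q by simp
  have W: "real W1 * real W1 \<le> 16 / 3 * q"
  proof -
    have "3 * (W1 * W1) \<le> 16 * q" using W1_sq_le(2) by (simp add: power2_eq_square)
    then have "real (3 * (W1 * W1)) \<le> real (16 * q)" by (simp only: of_nat_le_iff)
    then show ?thesis by simp
  qed
  \<comment> \<open>\<open>W1\<close> grows at most like \<open>sqrt q\<close>, so any slope
    \<open>c\<close> is available once \<open>q\<close> is large enough.\<close>
  have Wc: "real W1 < c * q" if "c > 0" "16 / 3 < c * c * q" for c :: real
  proof (rule ccontr)
    assume "\<not> ?thesis"
    then have "(c * q) * (c * q) \<le> real W1 * real W1" using that by (intro mult_mono) auto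
    also note W
    finally have "(c * c * q) * q \<le> 16 / 3 * q" by (simp add: mult_ac)
    then show False using that(2) q_gt_1 by simp
  qed
  consider "?s \<le> 4" | "?s = 5" | "?s = 6" | "7 \<le> ?s" "?s \<le> 9" | "10 \<le> ?s" by linarith
  then show ?thesis
  proof cases
    case 1
    show ?thesis
    proof (cases "q < 421")
      case True
      show ?thesis
        by (rule three_nonzero_W[OF n b _ L(1)[OF 1], where s = 4 and W = 16])
          (use 1 W1_le_two_power[OF card_P1_le(1)[OF True]] qr in auto)
    next
      case False
      then have q4: "real q \<ge> 421" by simp
      show ?thesis
      proof (cases "q < 4621")
        case True
        show ?thesis
          by (rule three_nonzero_W[OF n b _ L(1)[OF 1], where s = 4 and W = 32])
            (use 1 W1_le_two_power[OF card_P1_le(2)[OF True]] q4 in auto)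
      next
        case False
        then have q4: "real q \<ge> 4621" by simp
        show ?thesis
          by (rule three_nonzero_W[OF n b _ L(1)[OF 1], where s = 4 and W = "0.05 * q"])
            (use 1 Wc[of "0.05"] q4 in \<open>auto simp: algebra_simps\<close>)
      qed
    qed
  next
    case 2
    then have s5: "?s \<le> 5" by simp
    have q4: "real q \<ge> 400" using L(5) 2 by simp
    show ?thesis
    proof (cases "q < 421")
      case True
      show ?thesis
        by (rule three_nonzero_W[OF n b _ L(2)[OF s5], where s = 5 and W = 16])
          (use 2 W1_le_two_power[OF card_P1_le(1)[OF True]] q4 in auto)
    next
      case False
      then have q4: "real q \<ge> 421" by simp
      show ?thesis
      proof (cases "q < 4621")
        case True
        show ?thesis
          by (rule three_nonzero_W[OF n b _ L(2)[OF s5], where s = 5 and W = 32])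
            (use 2 W1_le_two_power[OF card_P1_le(2)[OF True]] q4 in auto)
      next
        case False
        then have q4: "real q \<ge> 4621" by simp
        show ?thesis
          by (rule three_nonzero_W[OF n b _ L(2)[OF s5], where s = 5 and W = "0.05 * q"])
            (use 2 Wc[of "0.05"] q4 in \<open>auto simp: algebra_simps\<close>)
      qed
    qed
  next
    case 3
    then have s6: "?s \<le> 6" by simp
    have q4: "real q \<ge> 2438" using L(6) 3 by simp
    show ?thesis
      by (rule three_nonzero_W[OF n b _ L(3)[OF s6], where s = 6 and W = "0.05 * q"])
        (use 3 Wc[of "0.05"] q4 in \<open>auto simp: algebra_simps\<close>)
  next
    case 4
    have q4: "real q \<ge> 15993" using L(7) 4 by simp
    show ?thesis
      by (rule three_nonzero_W[OF n b _ L(4)[OF 4(2)], where s = 9 and W = "0.03 * q"])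
        (use 4 Wc[of "0.03"] q4 in \<open>auto simp: algebra_simps\<close>)
  next
    \<comment> \<open>With so many primes the core criterion holds outright, without
      sieving.\<close>
    case 5
    note many = three_many[OF n 5]
    have "(W1 * 2 ^ ?s)\<^sup>2 \<le> q\<^sup>2"
    proof -
      have "9 * (W1 * 2 ^ ?s)\<^sup>2 = 3 * W1\<^sup>2 * (3 * 4 ^ ?s)"
        by (simp add: power_mult_distrib mult.commute flip: power_mult) (simp add: power_mult)
      also have "\<dots> \<le> (16 * q) * (3 * 4 ^ ?s)" using W1_sq_le(2) by (intro mult_right_mono) auto
      also have "\<dots> = 3 * q * (16 * 4 ^ ?s)" by simp
      also have "\<dots> \<le> 3 * q * (3 * q)" using many by (intro mult_left_mono) auto
      finally show ?thesis by (simp add: power2_eq_square)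
    qed
    then have le: "W1 * 2 ^ ?s \<le> q" by (rule power2_le_imp_le) simp
    have "prime_factors (N div 2) \<subseteq> P1 \<union> prime_factors m"
      by (auto simp: half_N in_prime_factors_iff prime_dvd_mult_iff)
    then have "card (prime_factors (N div 2)) \<le> card (P1 \<union> prime_factors m)" by (intro card_mono) auto
    also have "\<dots> \<le> card P1 + ?s" by (rule card_Un_le)
    finally have "2 * 2 ^ card (prime_factors (N div 2)) \<le> (2 * 2 ^ (card P1 + ?s) :: nat)"
      by (intro mult_left_mono power_increasing) auto
    also have "\<dots> \<le> q" using le by (simp add: W1_def power_add)
    finally have "real (2 * 2 ^ card (prime_factors (N div 2))) \<le> real q" by (simp only: of_nat_le_iff)
    moreover have "sqrt (real q) ^ (n - 1) = q" unfolding n by (simp add: eval_nat_numeral)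
    ultimately show ?thesis by (intro two_primitive_of_core[OF b]) simp
  qed
qed

lemma three_zero_large:
  assumes n: "n = 3" and q: "q \<ge> 75"
  shows "\<exists>x. r_primitive 2 x \<and> Tr x = 0"
proof -
  let ?s = "card (prime_factors m)"
  note L = three_large_sieve[OF n]
  have qr: "real q \<ge> 75" using q by simp
  \<comment> \<open>The tangent is taken near the smallest value 75, as \<open>8.65\<close> squared
    is 74.8225; the one at 10000 serves for \<open>q \<ge> 15993\<close>.\<close>
  have r1: "sqrt q \<le> (q + 74.8225) / 17.3" using sqrt_le_amgm[of "8.65"] by (simp add: power2_eq_square)
  have r2: "sqrt q \<le> (q + 10000) / 200" using sqrt_le_amgm[of 100] by (simp add: power2_eq_square)
  consider "?s \<le> 4" | "?s = 5" | "?s = 6" | "7 \<le> ?s" "?s \<le> 9" | "10 \<le> ?s" by linarith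
  then show ?thesis
  proof cases
    case 1
    show ?thesis
      by (rule three_zero[OF n _ L(1)[OF 1] _ r1, where s = 4]) (use 1 qr in \<open>auto simp: field_simps\<close>)
  next
    case 2
    then have s: "?s \<le> 5" "real q \<ge> 400" using L(5) by auto
    show ?thesis
      by (rule three_zero[OF n _ L(2)[OF s(1)] _ r1, where s = 5]) (use s in \<open>auto simp: field_simps\<close>)
  next
    case 3
    then have s: "?s \<le> 6" "real q \<ge> 2438" using L(6) by auto
    show ?thesis
      by (rule three_zero[OF n _ L(3)[OF s(1)] _ r1, where s = 6]) (use s in \<open>auto simp: field_simps\<close>)
  next
    case 4
    then have s: "?s \<le> 9" "real q \<ge> 15993" using L(7) by auto
    show ?thesis
      by (rule three_zero[OF n _ L(4)[OF s(1)] _ r2, where s = 9]) (use s in \<open>auto simp: field_simps\<close>)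
  next
    case 5
    have "4 ^ ?s \<le> q" using three_many[OF n 5] by linarith
    then have "real (4 ^ ?s) \<le> real q" by (simp only: of_nat_le_iff)
    moreover have "(2 ^ ?s)\<^sup>2 = (4::real) ^ ?s"
      by (simp add: mult.commute flip: power_mult) (simp add: power_mult)
    ultimately have "(2::real) ^ ?s \<le> sqrt q" by (intro real_le_rsqrt) simp
    then show ?thesis using n by (intro trace_0_of_core) auto
  qed
qed

text \<open>Here \<open>N div 2 = 2 * 31\<close>. At least two odd exponents are left, while 31 is
  the only odd multiple of 31 below 62.\<close>

lemma three_nonzero_5:
  assumes n: "n = 3" and q: "q = 5" and b: "b \<in> base - {0}"
  shows "\<exists>x. r_primitive 2 x \<and> Tr x = b"
proof (rule ex_two_primitive)
  interpret char_sum_bounds "N div 2" 0 "half_exps b" "sqrt (real q) ^ (n - 1)" "sqrt (real q) ^ (n - 1)"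
    by (rule half_exps_bounds[OF b])
  have B: "sqrt (real q) ^ (n - 1) = 5" unfolding n q by (simp add: eval_nat_numeral)
  have "N = q ^ n - 1" by (rule N_eq(2))
  also have "\<dots> = 124" unfolding n q by simp
  finally have N: "N div 2 = 62" by simp
  have T: "10 \<le> real (card (half_exps b))"
    using half_exps_card[OF b] unfolding B unfolding n q by simp
  have sm: "smooth {2} = {}" unfolding smooth_def unfolding N by simp
  have e1: "err0 {2} = 5" unfolding err0_def unfolding sm B by simp
  have e2: "dens {2} = 1 / 2" unfolding dens_def by simp
  have "dens {2} * (card (half_exps b) - err0 {2}) \<le> card (sifted {2})"
    by (rule card_sifted_ge) (auto simp: N)
  then have "1 / 2 * (real (card (half_exps b)) - 5) \<le> card (sifted {2})" by (simp only: e1 e2)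
  then have "real (card (sifted {2})) \<ge> 2" using T by argo
  then have c3: "card (sifted {2}) \<ge> 2" by simp
  have "\<not> sifted {2} \<subseteq> {31}"
  proof
    assume "sifted {2} \<subseteq> {31}"
    then have "card (sifted {2}) \<le> card {31::nat}" by (intro card_mono) auto
    then show False using c3 by simp
  qed
  then obtain k where k: "k \<in> half_exps b" "odd k" "k \<noteq> 31" by (auto simp: sifted_def)
  have "k < 62" using k(1) by (simp add: half_exps_def N)
  have "\<not> 31 dvd k"
  proof
    assume "31 dvd k"
    then obtain c where "k = 31 * c" by blast
    then have "c = 0 \<or> c = 1" using \<open>k < 62\<close> by linarith
    then show False using k \<open>k = 31 * c\<close> by auto
  qed
  moreover have "l = 2 \<or> l = 31" if "l \<in> prime_factors (N div 2)" for l
  proof -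
    have l: "prime l" "l dvd 2 * 31" using that by (auto simp: N in_prime_factors_iff)
    moreover have "prime (31::nat)" by simp
    ultimately show ?thesis by (metis prime_dvd_mult_iff primes_dvd_imp_eq two_is_prime_nat)
  qed
  ultimately show "\<exists>k\<in>half_exps b. \<forall>l\<in>prime_factors (N div 2). \<not> l dvd k"
    using k by (intro bexI[of _ k]) blast+
qed

lemma three_nonzero_all:
  assumes n: "n = 3" and "q \<noteq> 9" and b: "b \<in> base - {0}"
  shows "\<exists>x. r_primitive 2 x \<and> Tr x = b"
proof (cases "q \<ge> 154 \<or> q = 5")
  case False
  define i where "i = (int q - 3) div 2"
  have i: "int q = 2 * i + 3" using odd_q q_ge_3 by (auto simp: i_def elim!: oddE)
  have "i \<in> set [0..75]" using i False q_ge_3 by auto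
  then have "i = 1 \<or> i = 3 \<or> crit3 (2 * i + 3)" using crit3_all by (simp only: list_all_iff)
  then have "crit3 (int q)" using i False assms(2) by auto
  then show ?thesis using three_nonzero_small[OF n _ _ b] False by simp
qed (use three_nonzero_large three_nonzero_5 n b in blast)

lemma three_zero_all:
  assumes n: "n = 3"
  shows "\<exists>x. r_primitive 2 x \<and> Tr x = 0"
proof (cases "q \<ge> 75")
  case False
  define i where "i = (int q - 3) div 2"
  have i: "int q = 2 * i + 3" using odd_q q_ge_3 by (auto simp: i_def elim!: oddE)
  have "i \<in> set [0..35]" using i False q_ge_3 by auto
  then have "crit3_zero (2 * i + 3)" using crit3_zero_all by (simp only: list_all_iff)
  then have "crit3_zero (int q)" using i by simp
  then show ?thesis using three_zero_small[OF n] False by simp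
qed (use three_zero_large n in blast)

end

subsection \<open>Degree two, large fields\<close>

locale quadratic_trace_field = odd_trace_field +
  assumes n2: "n = 2"
begin

lemma m_two: "m = q + 1"
proof -
  have "m = (\<Sum>i<2. q ^ i)" using m_geometric unfolding n2 .
  then show ?thesis by (simp add: eval_nat_numeral lessThan_Suc)
qed

abbreviation "PA \<equiv> prime_factors ((q + 1) div 2)"
abbreviation "PB \<equiv> prime_factors ((q - 1) div 2)"

lemma half_N_two: "N div 2 = (q - 1) * ((q + 1) div 2)" "N div 2 = (q - 1) div 2 * (q + 1)"
proof -
  show e: "N div 2 = (q - 1) div 2 * (q + 1)" using half_N m_two by simp
  obtain c where "q = 2 * c + 1" using odd_q by (elim oddE)
  then show "N div 2 = (q - 1) * ((q + 1) div 2)" using e by simp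
qed

lemma half_q_plus_pos: "(q + 1) div 2 > 0" using q_ge_3 by simp

text \<open>Halving both \<open>q - 1\<close> and \<open>q + 1\<close> loses no prime, since one of
  the two halves is even.\<close>

lemma prime_factors_half_N_two: "prime_factors (N div 2) = PA \<union> PB"
proof (intro equalityI subsetI)
  fix l assume "l \<in> prime_factors (N div 2)"
  then have l: "prime l" "l dvd (q - 1) * ((q + 1) div 2)" unfolding half_N_two(1) by auto
  show "l \<in> PA \<union> PB"
  proof (cases "l dvd (q + 1) div 2")
    case False
    then have "l dvd q - 1" using l by (simp add: prime_dvd_mult_iff)
    moreover have "q - 1 = 2 * ((q - 1) div 2)" using odd_q by simp
    ultimately have "l = 2 \<or> l dvd (q - 1) div 2"
      using l(1) by (metis prime_dvd_mult_iff primes_dvd_imp_eq two_is_prime_nat)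
    moreover have "l dvd (q - 1) div 2" if "l = 2"
    proof -
      have "odd ((q + 1) div 2)" using False that by simp
      then show ?thesis using odd_q that by (auto elim!: oddE)
    qed
    ultimately show ?thesis using l half_q_pos by (auto simp: in_prime_factors_iff)
  qed (use l half_q_plus_pos in \<open>simp add: in_prime_factors_iff\<close>)
next
  fix l assume l: "l \<in> PA \<union> PB"
  have "l dvd N div 2"
  proof (cases "l \<in> PA")
    case True
    then show ?thesis unfolding half_N_two(1) by (intro dvd_mult) auto
  next
    case False
    then show ?thesis unfolding half_N_two(2) using l by (intro dvd_mult2) auto
  qed
  then show "l \<in> prime_factors (N div 2)" using l half_N_pos by (auto simp: in_prime_factors_iff)
qed

lemma PA_PB_disjoint: "PA \<inter> PB = {}"
proof -
  have "(q + 1) div 2 = (q - 1) div 2 + 1" using odd_q by (auto elim!: oddE)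
  then have "coprime ((q + 1) div 2) ((q - 1) div 2)" by (simp add: coprime_Suc_left_nat)
  then show ?thesis by (auto simp: in_prime_factors_iff) (metis coprime_common_divisor_nat not_prime_1)
qed

lemma sqrt_q_ge_1: "1 \<le> sqrt (real q)" using q_gt_1 by simp

text \<open>\<open>q - 1\<close> divides \<open>N div 2\<close>, so along with \<open>j\<close> also
  \<open>j + N div 2\<close> is trivial on \<open>base\<close>, and in degree two both sums have
  modulus exactly 1.\<close>

lemma half_exps_bounds_two:
  assumes "b \<in> base - {0}"
  shows "char_sum_bounds (N div 2) (q - 1) (half_exps b) 1 (sqrt (real q))"
proof
  fix j assume j: "\<not> N div 2 dvd j"
  then show "norm (\<Sum>k\<in>half_exps b. unity_char (N div 2) j k) \<le> sqrt (real q)"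
    using norm_half_sum_le[OF even_N j assms] n2 by simp
  assume d: "q - 1 dvd j"
  note nd = not_dvd_half[OF even_N j]
  have "q - 1 dvd j + N div 2" using d by (simp add: half_N_two(1))
  then have "norm (S j b) = 1" "norm (S (j + N div 2) b) = 1"
    using norm_S_trivial[OF nd(1) d _ assms] norm_S_trivial[OF nd(2) _ _ assms] n2 by simp_all
  then have "norm (S j b + S (j + N div 2) b) \<le> 2"
    using norm_triangle_ineq[of "S j b" "S (j + N div 2) b"] by linarith
  then show "norm (\<Sum>k\<in>half_exps b. unity_char (N div 2) j k) \<le> 1"
    by (simp add: sum_half_exps[OF even_N] norm_divide)
qed (use half_N_pos sqrt_q_ge_1 in auto)

lemma half_exps_card_two:
  assumes "b \<in> base - {0}"
  shows "(real q - 1) / 2 \<le> real (card (half_exps b))"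
proof -
  have "norm (S (N div 2) b) = 1"
    using norm_S_trivial[OF N_half[OF even_N] _ _ assms] n2 half_N_two(1) by simp
  then show ?thesis using card_half_exps_ge[OF even_N assms, of 1] n2 by simp
qed

text \<open>For \<open>d = q - 1\<close> the primes of \<open>(q + 1) div 2\<close> are smooth; the
  core parts \<open>CA\<close> and \<open>CB\<close> remain free.\<close>

lemma two_crit:
  assumes b: "b \<in> base - {0}" and C: "CA \<subseteq> PA" "CB \<subseteq> PB"
    and pos: "0 < 1 - (\<Sum>l\<in>PA - CA. 1 / real l) - (\<Sum>l\<in>PB - CB. 1 / real l)"
    and ineq: "(\<Sum>l\<in>PA - CA. 1 - 1 / real l) * (2 ^ card CA + sqrt q * (2 ^ (card CA + card CB) - 2 ^ card CA)) +
         (\<Sum>l\<in>PB - CB. 1 - 1 / real l) * (sqrt q * 2 ^ (card CA + card CB))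
       < (1 - (\<Sum>l\<in>PA - CA. 1 / real l) - (\<Sum>l\<in>PB - CB. 1 / real l)) *
         ((real q - 1) / 2 - ((2 ^ card CA - 1) + sqrt q * (2 ^ (card CA + card CB) - 2 ^ card CA)))"
  shows "\<exists>x. r_primitive 2 x \<and> Tr x = b"
proof (rule ex_two_primitive)
  interpret char_sum_bounds "N div 2" "q - 1" "half_exps b" 1 "sqrt q"
    by (rule half_exps_bounds_two[OF b])
  have fin: "finite CA" "finite CB" using C by (auto intro: finite_subset)
  have "\<exists>k\<in>half_exps b. \<forall>l\<in>CA \<union> CB \<union> (PA - CA) \<union> (PB - CB). \<not> l dvd k"
  proof (rule sieve_split[OF fin _ _ _ _ _ _ _ half_exps_card_two[OF b] pos])
    show "l \<in> CA \<union> CB \<union> (PA - CA) \<union> (PB - CB) \<Longrightarrow> prime l \<and> l dvd N div 2" for l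
      using C prime_factors_half_N_two by (auto simp: in_prime_factors_iff set_eq_iff subset_iff)
    show "q - 1 dvd N div 2 div l" if "l \<in> CA \<union> (PA - CA)" for l
    proof -
      have "l \<in> PA" using that C by auto
      then obtain c where c: "(q + 1) div 2 = l * c" "l > 0"
        by (auto simp: in_prime_factors_iff prime_gt_0_nat elim!: dvdE)
      have "N div 2 = l * ((q - 1) * c)" unfolding half_N_two(1) c(1) by simp
      then show ?thesis using c(2) by simp
    qed
  qed (use C PA_PB_disjoint ineq in auto)
  moreover have "CA \<union> CB \<union> (PA - CA) \<union> (PB - CB) = prime_factors (N div 2)"
    unfolding prime_factors_half_N_two using C by blast
  ultimately show "\<exists>k\<in>half_exps b. \<forall>l\<in>prime_factors (N div 2). \<not> l dvd k" by simp
qed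

abbreviation "PN \<equiv> prime_factors (N div 2)"

text \<open>The single bound \<open>sqrt q\<close> treats the primes of both halves alike, which is
  enough for large \<open>q\<close> and allows counting all primes together.\<close>

lemma two_crit_plain:
  assumes b: "b \<in> base - {0}" and C: "C \<subseteq> PN"
    and pos: "(\<Sum>l\<in>PN - C. 1 / real l) < 1"
    and ineq: "(\<Sum>l\<in>PN - C. 1 - 1 / real l) * (sqrt q * 2 ^ card C)
       < (1 - (\<Sum>l\<in>PN - C. 1 / real l)) * ((real q - 1) / 2 - sqrt q * (2 ^ card C - 1))"
  shows "\<exists>x. r_primitive 2 x \<and> Tr x = b"
proof (rule ex_two_primitive)
  interpret char_sum_bounds "N div 2" 0 "half_exps b" "sqrt q" "sqrt q"
    using half_exps_bounds[OF b] n2 by simp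
  have fin: "finite C" using C by (auto intro: finite_subset)
  have "\<exists>k\<in>half_exps b. \<forall>l\<in>{} \<union> C \<union> {} \<union> (PN - C). \<not> l dvd k"
  proof (rule sieve_split[OF _ fin _ _ _ _ _ _ _ half_exps_card_two[OF b]])
    show "l \<in> {} \<union> C \<union> {} \<union> (PN - C) \<Longrightarrow> prime l \<and> l dvd N div 2" for l
      using C by (auto simp: in_prime_factors_iff)
  qed (use C pos ineq in auto)
  moreover have "{} \<union> C \<union> {} \<union> (PN - C) = PN" using C by blast
  ultimately show "\<exists>k\<in>half_exps b. \<forall>l\<in>PN. \<not> l dvd k" by simp
qed

abbreviation "PL K \<equiv> PN - K"
definition "core K = PN \<inter> K"

definition rough :: "nat set \<Rightarrow> nat list \<Rightarrow> bool" where
  "rough K L \<longleftrightarrow> sorted L \<and> L \<noteq> [] \<and> 0 \<notin> set L \<and> (\<forall>l\<in>PL K. l < last L \<longrightarrow> l \<in> set L)"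

lemma sum_PL_le:
  assumes "rough K L" "card (PL K) \<le> k" "k \<le> length L"
  shows "(\<Sum>l\<in>PL K. 1 / real l) \<le> sum_list (map (\<lambda>l. 1 / real l) (take k L))"
proof -
  have "(\<Sum>l\<in>PL K. 1 / real l) \<le> (\<Sum>i<k. 1 / real (L ! min i (length L - 1)))"
    using assms unfolding rough_def by (intro sum_inverse_le_sorted') auto
  also have "\<dots> = (\<Sum>i<k. 1 / real (take k L ! i))"
    using assms(3) by (intro sum.cong) auto
  also have "\<dots> = sum_list (map (\<lambda>l. 1 / real l) (take k L))"
    using assms(3) by (simp add: sum_list_sum_nth atLeast0LessThan)
  finally show ?thesis .
qed

lemma prod_PL_ge:
  assumes "rough K L" "k \<le> card (PL K)" "k \<le> length L"
  shows "prod_list (take k L) \<le> \<Prod>(PL K)"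
proof -
  have "prod_list (take k L) = (\<Prod>i<k. take k L ! i)"
    using assms(3) by (simp add: prod.list_conv_set_nth atLeast0LessThan)
  also have "\<dots> = (\<Prod>i<k. L ! min i (length L - 1))"
    using assms(3) by (intro prod.cong) auto
  also have "\<dots> \<le> \<Prod>(PL K)"
    using assms unfolding rough_def by (intro prod_ge_sorted') auto
  finally show ?thesis .
qed

definition primes5 :: "nat list" where
  "primes5 = [5, 7, 11, 13, 17, 19, 23]"
definition primes7 :: "nat list" where
  "primes7 = [7, 11, 13, 17, 19, 23, 29, 31, 37, 41, 43, 47, 53, 59]"

lemma rough_primes5: "rough {2, 3} primes5"
proof -
  have "l \<in> set primes5" if "l \<in> PL {2, 3}" "l < 23" for l
  proof -
    have "prime l" "l \<noteq> 2" "l \<noteq> 3" using that by (auto simp: in_prime_factors_iff)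
    then show ?thesis using primes_below_73[of l] that(2) by (auto simp: primes5_def)
  qed
  then show ?thesis by (simp add: rough_def primes5_def)
qed

lemma rough_primes7: "rough {2, 3, 5} primes7"
proof -
  have "l \<in> set primes7" if "l \<in> PL {2, 3, 5}" "l < 59" for l
  proof -
    have "prime l" "l \<noteq> 2" "l \<noteq> 3" "l \<noteq> 5" using that by (auto simp: in_prime_factors_iff)
    then show ?thesis using primes_below_73[of l] that(2) by (auto simp: primes7_def)
  qed
  then show ?thesis by (simp add: rough_def primes7_def)
qed

lemma four_dvd_half_N: "4 dvd N div 2"
proof -
  obtain c where "q = 2 * c + 1" using odd_q by (elim oddE)
  then have "N div 2 = 2 * (c * (c + 1))" by (simp add: half_N_two(2))
  moreover obtain d where "c * (c + 1) = 2 * d" by (metis dvd_def even_mult_iff even_plus_one_iff)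
  ultimately have "N div 2 = 4 * d" by simp
  then show ?thesis by simp
qed

lemma two_in_PN: "2 \<in> PN"
  using four_dvd_half_N half_N_pos by (auto simp: in_prime_factors_iff intro: dvd_trans[of 2 4])

text \<open>\<open>q * q - 1\<close> is divisible by 8, and the odd primes are coprime to that
  factor.\<close>

lemma prod_PN_le: "8 * \<Prod>(PN - {2}) < q * q"
proof -
  have cop: "coprime 4 (\<Prod>(PN - {2}))"
  proof (rule prod_coprime_right)
    fix l assume "l \<in> PN - {2}"
    then have "prime l" "l \<noteq> 2" by auto
    then have "coprime 2 l" using primes_coprime two_is_prime_nat by metis
    then show "coprime 4 l" using coprime_mult_left_iff[of 2 2 l] by simp
  qed
  have "\<Prod>(PN - {2}) dvd N div 2"
    by (intro prod_primes_dvd) (auto simp: in_prime_factors_iff)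
  then have "4 * \<Prod>(PN - {2}) dvd N div 2" using four_dvd_half_N cop by (intro divides_mult)
  then have "4 * \<Prod>(PN - {2}) \<le> N div 2" using half_N_pos by (intro dvd_imp_le)
  then have "8 * \<Prod>(PN - {2}) \<le> N" by linarith
  also have "N = q * q - 1" using N_eq(2) n2 by (simp add: power2_eq_square)
  also have "\<dots> < q * q" using q_gt_1 by simp
  finally show ?thesis .
qed

lemma core_facts: "core K \<subseteq> PN" "PN - core K = PL K" "finite (core K)"
  by (auto simp: core_def)

lemma prod_PN_split:
  assumes "2 \<in> K"
  shows "\<Prod>(PN - {2}) = \<Prod>(core K - {2}) * \<Prod>(PL K)"
proof -
  have "PN - {2} = (core K - {2}) \<union> PL K" using assms by (auto simp: core_def)
  then show ?thesis by (simp only:) (intro prod.union_disjoint, auto simp: core_def)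
qed

text \<open>Trades the factor 4 of each core prime against the prime itself, so that core and
  remaining primes can be weighed jointly against \<open>q * q\<close>; both 2 and 3 present is the
  worst case.\<close>

lemma core_weight_3:
  "3 * 4 ^ card (core {2, 3}) \<le> 16 * \<Prod>(core {2, 3} - {2})" "card (core {2, 3}) \<le> 2"
proof -
  have core: "core {2, 3} \<subseteq> {2, 3}" "2 \<in> core {2, 3}" using two_in_PN by (auto simp: core_def)
  have "core {2, 3} = {2} \<or> core {2, 3} = {2, 3}" using core by blast
  moreover have "{2, 3} - {2} = {3 :: nat}" by auto
  ultimately show "3 * 4 ^ card (core {2, 3}) \<le> 16 * \<Prod>(core {2, 3} - {2})" "card (core {2, 3}) \<le> 2"
    by auto
qed

lemma core_weight_5:
  "11 * 4 ^ card (core {2, 3, 5}) \<le> 64 * \<Prod>(core {2, 3, 5} - {2})" "card (core {2, 3, 5}) \<le> 3"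
proof -
  have core: "core {2, 3, 5} \<subseteq> {2, 3, 5}" "2 \<in> core {2, 3, 5}" using two_in_PN by (auto simp: core_def)
  have "core {2, 3, 5} \<in> {{2}, {2, 3}, {2, 5}, {2, 3, 5}}" using core by auto
  moreover have "{2, 3} - {2} = {3 :: nat}" "{2, 5} - {2} = {5 :: nat}" "{2, 3, 5} - {2} = {3, 5 :: nat}" by auto
  ultimately show "11 * 4 ^ card (core {2, 3, 5}) \<le> 64 * \<Prod>(core {2, 3, 5} - {2})" "card (core {2, 3, 5}) \<le> 3"
    by auto
qed

lemma prod_PL_le_3: "3 * 4 ^ card (core {2, 3}) * \<Prod>(PL {2, 3}) < 2 * (q * q)"
proof -
  have "3 * 4 ^ card (core {2, 3}) * \<Prod>(PL {2, 3}) \<le> 16 * \<Prod>(core {2, 3} - {2}) * \<Prod>(PL {2, 3})"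
    using core_weight_3(1) by (rule mult_right_mono) simp
  also have "\<dots> = 2 * (8 * \<Prod>(PN - {2}))" by (subst prod_PN_split[of "{2, 3}"]) simp_all
  also have "\<dots> < 2 * (q * q)" using prod_PN_le by simp
  finally show ?thesis .
qed

lemma prod_PL_le_5: "11 * 4 ^ card (core {2, 3, 5}) * \<Prod>(PL {2, 3, 5}) < 8 * (q * q)"
proof -
  have "11 * 4 ^ card (core {2, 3, 5}) * \<Prod>(PL {2, 3, 5}) \<le> 64 * \<Prod>(core {2, 3, 5} - {2}) * \<Prod>(PL {2, 3, 5})"
    using core_weight_5(1) by (rule mult_right_mono) simp
  also have "\<dots> = 8 * (8 * \<Prod>(PN - {2}))" by (subst prod_PN_split[of "{2, 3, 5}"]) simp_all
  also have "\<dots> < 8 * (q * q)" using prod_PN_le by simp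
  finally show ?thesis .
qed

text \<open>After division by \<open>(1 - U) * sqrt q\<close>, with \<open>U\<close> the reciprocal
  sum, the sieved primes enter only through \<open>2 + (s - 1) / (1 - U)\<close>, the usual constant
  of the prime sieve.\<close>

lemma two_crit_Z:
  fixes u z :: real
  assumes b: "b \<in> base - {0}"
    and u: "(\<Sum>l\<in>PL K. 1 / real l) \<le> u" "u < 1" "card (PL K) \<le> s" "1 \<le> s" and z: "2 + (real s - 1) / (1 - u) \<le> z"
    and q: "2 * (2 ^ card (core K) * z - 1) < sqrt q - 1 / sqrt q"
  shows "\<exists>x. r_primitive 2 x \<and> Tr x = b"
proof (rule two_crit_plain[OF b core_facts(1), unfolded core_facts(2)])
  let ?U = "\<Sum>l\<in>PL K. 1 / real l" and ?w = "2 ^ card (core K) :: real" and ?t = "sqrt (real q)"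
  show U1: "?U < 1" using u by linarith
  have t: "?t > 0" using q_gt_1 by simp
  have "(\<Sum>l\<in>PL K. 1 - 1 / real l) = card (PL K) - ?U" by (simp add: sum_subtractf)
  also have "\<dots> \<le> real s - ?U" using u(3) by simp
  also have "\<dots> = (real s - 1) + (1 - ?U)" by simp
  also have "\<dots> \<le> (1 - ?U) * ((real s - 1) / (1 - u)) + (1 - ?U)"
  proof -
    have "(1 - u) * ((real s - 1) / (1 - u)) \<le> (1 - ?U) * ((real s - 1) / (1 - u))"
      using u by (intro mult_right_mono divide_nonneg_pos) auto
    then show ?thesis using u(2) by simp
  qed
  also have "\<dots> = (1 - ?U) * ((2 + (real s - 1) / (1 - u)) - 1)" by (simp add: algebra_simps)
  also have "\<dots> \<le> (1 - ?U) * (z - 1)" using z U1 by (intro mult_left_mono) auto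
  finally have "(\<Sum>l\<in>PL K. 1 - 1 / real l) * (?t * ?w) \<le> (1 - ?U) * (z - 1) * (?t * ?w)"
    using t by (intro mult_right_mono) auto
  also have "\<dots> = (1 - ?U) * (?t * ?w * (z - 1))" by (simp only: mult_ac)
  also have "\<dots> < (1 - ?U) * ((real q - 1) / 2 - ?t * (?w - 1))"
  proof (intro mult_strict_left_mono)
    have tt: "?t * ?t = real q" by simp
    have "?t * (2 * (?w * z - 1)) < ?t * (?t - 1 / ?t)" using q t by (intro mult_strict_left_mono)
    also have "\<dots> = real q - 1" using t by (simp add: right_diff_distrib tt)
    finally have "2 * (?t * (?w * z - 1)) < real q - 1" by (simp only: mult.left_commute)
    moreover have "?t * ?w * (z - 1) + ?t * (?w - 1) = ?t * (?w * z - 1)" by (simp add: algebra_simps)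
    moreover have "A < D / 2 - B" if "2 * C < D" "A + B = C" for A B C D :: real using that by linarith
    ultimately show "?t * ?w * (z - 1) < (real q - 1) / 2 - ?t * (?w - 1)" by blast
  qed (use U1 in auto)
  finally show "(\<Sum>l\<in>PL K. 1 - 1 / real l) * (?t * ?w) < (1 - ?U) * ((real q - 1) / 2 - ?t * (?w - 1))" .
qed

text \<open>This case fixes the threshold 15000: six primes from 5 on give a sieve constant below
  15.24, and \<open>2 * (4 * 15.24 - 1) < 122.3 - 1 / 122.3\<close>.\<close>

lemma two_large_few:
  assumes b: "b \<in> base - {0}" and q: "q \<ge> 15000" and s: "card (PL {2, 3}) \<le> 6"
  shows "\<exists>x. r_primitive 2 x \<and> Tr x = b"
proof (rule two_crit_Z[OF b sum_PL_le[OF rough_primes5 s], where s = 6 and z = "15.24"])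
  show "sum_list (map (\<lambda>l. 1 / real l) (take 6 primes5)) < 1"
    "2 + (real 6 - 1) / (1 - sum_list (map (\<lambda>l. 1 / real l) (take 6 primes5))) \<le> 15.24"
    by (simp_all add: primes5_def)
  have "(122.3::real)\<^sup>2 \<le> real q" using q by (simp add: power2_eq_square)
  then have t: "122.3 \<le> sqrt (real q)" by (rule real_le_rsqrt)
  have "1 / sqrt (real q) \<le> 1 / 122.3" using t q_gt_1 by (intro divide_left_mono) auto
  moreover have "2 ^ card (core {2, 3}) \<le> (2 ^ 2 :: real)"
    using core_weight_3(2) by (intro power_increasing) auto
  then have "2 ^ card (core {2, 3}) * 15.24 \<le> (4 * 15.24 :: real)" by (intro mult_right_mono) auto
  ultimately show "2 * (2 ^ card (core {2, 3}) * 15.24 - 1) < sqrt (real q) - 1 / sqrt (real q)" using t by simp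
qed (use s in \<open>simp_all add: primes5_def\<close>)

text \<open>The lower bound on \<open>q\<close> comes from the primes themselves: \<open>s\<close>
  primes outside the core have at least the product of the first \<open>s\<close> entries of
  \<open>L\<close>, which forces \<open>(2 * 2 ^ card (core K) * z) ^ 4 < q * q\<close>.\<close>

lemma two_large_mid:
  fixes u z :: real and a e w :: nat
  assumes b: "b \<in> base - {0}" and L: "rough K L" and s: "card (PL K) = s" "1 \<le> s" "s \<le> length L"
    and u: "sum_list (map (\<lambda>l. 1 / real l) (take s L)) \<le> u" "u < 1"
    and weight: "a * 4 ^ card (core K) * \<Prod>(PL K) < e * (q * q)" "card (core K) \<le> w" "e > 0"
    and z: "2 + (real s - 1) / (1 - u) \<le> z" "16 * 4 ^ w * e * z ^ 4 \<le> a * prod_list (take s L)"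
  shows "\<exists>x. r_primitive 2 x \<and> Tr x = b"
proof (rule two_crit_Z[OF b _ u(2) _ s(2) z(1)])
  show "(\<Sum>l\<in>PL K. 1 / real l) \<le> u" using sum_PL_le[OF L, of s] s u(1) by linarith
  show "card (PL K) \<le> s" using s by simp
  let ?w = "2 ^ card (core K) :: real" and ?t = "sqrt (real q)" and ?c = "4 ^ card (core K) :: real"
  have z0: "z \<ge> 0"
  proof -
    have "0 \<le> (real s - 1) / (1 - u)" using s u by (intro divide_nonneg_pos) auto
    then show ?thesis using z(1) by linarith
  qed
  have "a * 4 ^ card (core K) * prod_list (take s L) \<le> a * 4 ^ card (core K) * \<Prod>(PL K)"
    using prod_PL_ge[OF L, of s] s by (intro mult_left_mono) auto
  also note weight(1)
  finally have "real (a * 4 ^ card (core K) * prod_list (take s L)) < real (e * (q * q))"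
    by (simp only: of_nat_less_iff)
  then have "a * real (prod_list (take s L)) * ?c < e * (real q * q)"
    by (simp add: mult_ac)
  moreover have "16 * 4 ^ w * e * z ^ 4 * ?c \<le> a * real (prod_list (take s L)) * ?c"
    using z(2) by (intro mult_right_mono) auto
  ultimately have "16 * 4 ^ w * e * z ^ 4 * ?c < e * (real q * q)" by linarith
  then have "e * (16 * 4 ^ w * z ^ 4 * ?c) < e * (real q * q)" by (simp add: mult_ac)
  then have lt: "16 * 4 ^ w * z ^ 4 * ?c < real q * q" using weight(3) by simp
  have w2: "?w * ?w = ?c" by (simp flip: power_mult_distrib)
  have cw: "?c \<le> 4 ^ w" using weight(2) by (intro power_increasing) auto
  have "(2 * ?w * z) ^ 4 = 16 * z ^ 4 * (?w * ?w) * (?w * ?w)" by (simp add: power4_eq_xxxx)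
  also have "\<dots> \<le> 16 * z ^ 4 * ?c * 4 ^ w"
    unfolding w2 using cw z0 by (intro mult_left_mono) auto
  also have "\<dots> < real q * q" using lt by (simp add: mult_ac)
  also have "\<dots> = ?t ^ 4" by (simp add: power4_eq_xxxx)
  finally have "2 * ?w * z < ?t" by (rule power_less_imp_less_base) simp
  moreover have "1 / ?t \<le> 1" using sqrt_q_ge_1 by simp
  moreover have "2 * (?w * z - 1) = 2 * ?w * z - 2" by simp
  moreover have "Y < D - y" if "X < D" "y \<le> 1" "Y = X - 2" for X Y D y :: real using that by linarith
  ultimately show "2 * (?w * z - 1) < ?t - 1 / ?t" by blast
qed

lemma two_large_many:
  assumes b: "b \<in> base - {0}" and s: "14 \<le> card (PL {2, 3, 5})"
  shows "\<exists>x. r_primitive 2 x \<and> Tr x = b"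
proof (rule two_primitive_of_core[OF b])
  let ?K = "{2, 3, 5 :: nat}" and ?L = primes7
  let ?s = "card (PL ?K)" and ?c = "card (core ?K)"
  have len: "length primes7 = 14" by (simp add: primes7_def)
  have ind: "prod_list ?L * 16 ^ (k - 14) \<le> (\<Prod>i<k. ?L ! min i (length ?L - 1))" if "14 \<le> k" for k
    using that
  proof (induction k rule: dec_induct)
    case base
    have "prod_list ?L = (\<Prod>i<14. ?L ! i)"
      by (simp add: prod.list_conv_set_nth atLeast0LessThan len)
    also have "\<dots> = (\<Prod>i<14. ?L ! min i (length ?L - 1))"
      by (intro prod.cong) (auto simp: len)
    finally show ?case by simp
  next
    case (step k)
    obtain t where t: "k = 14 + t" using step(1) le_Suc_ex by blast
    have "?L ! min k (length ?L - 1) = 59" using step by (simp add: primes7_def)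
    moreover have "(16::nat) ^ (Suc k - 14) = 16 * 16 ^ (k - 14)" by (simp add: t)
    ultimately show ?case using step.IH by simp
  qed
  have "prod_list ?L * 16 ^ (?s - 14) \<le> (\<Prod>i<?s. ?L ! min i (length ?L - 1))"
    by (rule ind[OF s])
  also have "\<dots> \<le> \<Prod>(PL ?K)" using rough_primes7 unfolding rough_def by (intro prod_ge_sorted) auto
  finally have P: "prod_list ?L * 16 ^ (?s - 14) \<le> \<Prod>(PL ?K)" .
  have "(16::nat) ^ ?s = 16 ^ (14 + (?s - 14))" using s by simp
  also have "\<dots> = 16 ^ 14 * 16 ^ (?s - 14)" by (rule power_add)
  finally have "2 * 4096 * 16 ^ ?s = 2 * 4096 * 16 ^ 14 * (16::nat) ^ (?s - 14)" by simp
  also have "\<dots> \<le> 11 * prod_list ?L * 16 ^ (?s - 14)"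
    by (intro mult_right_mono) (simp_all add: primes7_def)
  also have "\<dots> \<le> 11 * \<Prod>(PL ?K)" using P by (simp add: mult.assoc)
  finally have "2 * 4096 * 16 ^ ?s * 4 ^ ?c \<le> 11 * \<Prod>(PL ?K) * 4 ^ ?c" by (rule mult_right_mono) simp
  also have "\<dots> < 8 * (q * q)" using prod_PL_le_5 by (simp add: mult_ac)
  finally have lt: "1024 * 16 ^ ?s * 4 ^ ?c < q * q" by (simp add: mult_ac)
  have "card PN \<le> card (core ?K \<union> PL ?K)" by (intro card_mono) (auto simp: core_def)
  also have "\<dots> \<le> ?c + ?s" by (rule card_Un_le)
  finally have "(2 * 2 ^ card PN) ^ 4 \<le> (2 * 2 ^ (?c + ?s) :: nat) ^ 4"
    by (intro power_mono mult_left_mono power_increasing) auto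
  also have "\<dots> = 16 * 16 ^ ?s * (4 ^ ?c * 4 ^ ?c)"
  proof -
    have "(2 ^ k) ^ 4 = (16::nat) ^ k" "(4::nat) ^ k * 4 ^ k = 16 ^ k" for k
    proof -
      have "(2 ^ k) ^ 4 = ((2::nat) ^ 4) ^ k" by (simp only: power_mult[symmetric] mult.commute)
      then show "(2 ^ k) ^ 4 = (16::nat) ^ k" by simp
      show "(4::nat) ^ k * 4 ^ k = 16 ^ k" by (simp flip: power_mult_distrib)
    qed
    then show ?thesis by (simp add: power_mult_distrib power_add)
  qed
  also have "\<dots> \<le> 16 * 16 ^ ?s * (4 ^ ?c * 4 ^ 3)"
    using core_weight_5(2) by (intro mult_left_mono power_increasing) auto
  also have "\<dots> < q * q" using lt by (simp add: mult_ac)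
  finally have "real ((2 * 2 ^ card PN) ^ 4) < real (q * q)" by (simp only: of_nat_less_iff)
  also have "real (q * q) = sqrt (real q) ^ 4" by (simp add: power4_eq_xxxx)
  finally have "real (2 * 2 ^ card PN) ^ 4 < sqrt (real q) ^ 4" by (simp only: of_nat_power)
  then have "real (2 * 2 ^ card PN) < sqrt (real q)" by (rule power_less_imp_less_base) simp
  then have "2 * 2 ^ card PN < sqrt (real q)" by simp
  then show "2 * 2 ^ card PN \<le> sqrt (real q) ^ (n - 1)" using n2 by simp
qed

lemma two_large:
  assumes b: "b \<in> base - {0}" and q: "q \<ge> 15000"
  shows "\<exists>x. r_primitive 2 x \<and> Tr x = b"
proof -
  \<comment> \<open>Moving 5 into the core lowers the count by at most one, so counts from eight on
    can be treated with the core \<open>{2, 3, 5}\<close>.\<close>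
  have "PL {2, 3} \<subseteq> insert 5 (PL {2, 3, 5})" by auto
  then have "card (PL {2, 3}) \<le> card (insert 5 (PL {2, 3, 5}))" by (intro card_mono) auto
  then have le: "card (PL {2, 3}) \<le> Suc (card (PL {2, 3, 5}))" by simp
  note mid = two_large_mid[OF b rough_primes7 _ _ _ _ _ prod_PL_le_5 core_weight_5(2)]
  consider "card (PL {2, 3}) \<le> 6" | "card (PL {2, 3}) = 7" | "card (PL {2, 3, 5}) = 7" | "card (PL {2, 3, 5}) = 8"
    | "card (PL {2, 3, 5}) = 9" | "card (PL {2, 3, 5}) = 10" | "card (PL {2, 3, 5}) = 11"
    | "card (PL {2, 3, 5}) = 12" | "card (PL {2, 3, 5}) = 13" | "14 \<le> card (PL {2, 3, 5})" using le by linarith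
  then show ?thesis
  proof cases
    case 1 then show ?thesis by (rule two_large_few[OF b q])
  next
    case 2 then show ?thesis
      by (rule two_large_mid[OF b rough_primes5 _ _ _ _ _ prod_PL_le_3 core_weight_3(2), where u = "0.6657" and z = 20])
        (simp_all add: primes5_def)
  next
    case 3 then show ?thesis
      by (rule mid[where u = "0.501" and z = 15]) (simp_all add: primes7_def)
  next
    case 4 then show ?thesis
      by (rule mid[where u = "0.54" and z = 18]) (simp_all add: primes7_def)
  next
    case 5 then show ?thesis
      by (rule mid[where u = "0.56" and z = 21]) (simp_all add: primes7_def)
  next
    case 6 then show ?thesis
      by (rule mid[where u = "0.59" and z = 25]) (simp_all add: primes7_def)
  next
    case 7 then show ?thesis
      by (rule mid[where u = "0.61" and z = 30]) (simp_all add: primes7_def)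
  next
    case 8 then show ?thesis
      by (rule mid[where u = "0.63" and z = 34]) (simp_all add: primes7_def)
  next
    case 9 then show ?thesis
      by (rule mid[where u = "0.65" and z = 40]) (simp_all add: primes7_def)
  next
    case 10 then show ?thesis by (rule two_large_many[OF b])
  qed
qed

end

subsection \<open>Degree two, medium-sized fields\<close>

text \<open>A prime \<open>l\<close> comes with the weight \<open>10000 / l\<close> rounded up, and the sieve inequality is checked in integers after
  scaling by 10000; 271 exceeds the weight of any prime not in the list.\<close>

definition odd_weights :: "(int \<times> int) list" where
  "odd_weights = [(3, 3334), (5, 2000), (7, 1429), (11, 910), (13, 770), (17, 589), (19, 527), (23, 435), (29, 345), (31, 323)]"

text \<open>The core consists of the listed primes up to \<open>K\<close>. The summands
  \<open>nA\<close> and \<open>nB\<close> in \<open>sA\<close> and \<open>sB\<close> compensate for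
  the rounding of the weights; \<open>eA\<close> and \<open>eB\<close> bound the number of unlisted
  primes. Collecting the terms with \<open>sqrt q\<close> turns the criterion into
  \<open>2 * sqrt q * z < l\<close>, which is then squared.\<close>

definition crit2_at :: "int \<Rightarrow> (int \<times> int) list \<Rightarrow> (int \<times> int) list \<Rightarrow> int \<Rightarrow> int \<Rightarrow> int \<Rightarrow> bool" where
  "crit2_at q A B eA eB K = (let
     CA = filter (\<lambda>x. fst x \<le> K) A; SA = filter (\<lambda>x. \<not> fst x \<le> K) A;
     CB = filter (\<lambda>x. fst x \<le> K) B; SB = filter (\<lambda>x. \<not> fst x \<le> K) B;
     a = 2 ^ length CA; w = a * 2 ^ length CB; nA = int (length SA); nB = int (length SB);
     uA = sum_list (map snd SA); uB = sum_list (map snd SB);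
     d = 10000 - uA - uB - 271 * (eA + eB);
     sA = 10000 * (nA + eA) - uA + nA; sB = 10000 * (nB + eB) - uB + nB;
     l = d * (q - 1 - 2 * (a - 1)) - 2 * sA * a;
     z = d * (w - a) + sA * (w - a) + sB * w
   in 0 < d \<and> 0 < l \<and> 4 * q * (z * z) < l * l)"

text \<open>The constant is \<open>74 = 2 * 37\<close> because the lists belong to the halves of
  \<open>q + 1\<close> and \<open>q - 1\<close>. A core within \<open>{2}\<close> and one within
  \<open>{2, 3}\<close> are tried in turn.\<close>

definition crit2 :: "int \<Rightarrow> (int \<times> int) list \<Rightarrow> (int \<times> int) list \<Rightarrow> bool" where
  "crit2 q A B = (let rA = 74 * prod_list (map fst A); rB = 74 * prod_list (map fst B);
     eA = (if q + 1 < rA then 0 else if q + 1 < 37 * rA then 1 else 2);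
     eB = (if q - 1 < rB then 0 else if q - 1 < 37 * rB then 1 else 2)
   in if crit2_at q A B eA eB 2 then True else crit2_at q A B eA eB 3)"

text \<open>Residues are carried along as \<open>q\<close> grows by 2, which saves a division by
  every prime at every step.\<close>

definition residue_step :: "int \<times> int \<times> int \<Rightarrow> int \<times> int \<times> int" where
  "residue_step = (\<lambda>(l, u, r). (l, u, if r + 2 < l then r + 2 else r + 2 - l))"

definition residues :: "int \<Rightarrow> (int \<times> int \<times> int) list" where
  "residues q = map (\<lambda>(l, u). (l, u, q mod l)) odd_weights"

text \<open>All powers below 15000 of the primes in \<open>odd_weights\<close>; any other number
  below 15000 divisible by one of these primes is no prime power and is passed over.\<close>

definition small_prime_powers :: "int list" where
  "small_prime_powers = [3, 5, 7, 9, 11, 13, 17, 19, 23, 25, 27, 29, 31, 49, 81, 121, 125, 169, 243, 289, 343, 361,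
     529, 625, 729, 841, 961, 1331, 2187, 2197, 2401, 3125, 4913, 6561, 6859, 12167, 14641]"

text \<open>Values that the sweep accepts without the criterion. Each is settled by a certificate,
  by a separate argument, or belongs to the true exceptions.\<close>

definition exceptions :: "int list" where
  "exceptions = [3, 5, 7, 9, 11, 13, 17, 19, 23, 25, 27, 29, 31, 37, 41, 43, 47, 49, 53, 59, 61, 67, 71, 73, 79, 81, 83, 89, 97, 101, 103, 109, 113, 121, 125, 127, 131, 137, 139, 149, 151, 157, 169, 173, 181, 191, 197, 199, 211, 229, 239, 241, 269, 281, 307, 311, 331, 337, 349, 361, 373, 379, 389, 409, 419, 421, 461, 463, 509, 521, 529, 547, 569, 571, 601, 617, 631, 659, 661, 701, 709, 761, 769, 841, 859, 881, 911, 1009, 1021, 1231, 1289, 1301, 1331, 1429, 1609, 1709, 1741, 1849, 1861, 2029, 2281, 2311, 2521, 2729, 3541, 4621]"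

text \<open>\<open>t\<close> records \<open>q mod 4 = 3\<close>, that is, whether 2 divides
  \<open>(q + 1) div 2\<close> rather than \<open>(q - 1) div 2\<close>.\<close>

definition sweep_test :: "int \<Rightarrow> bool \<Rightarrow> (int \<times> int \<times> int) list \<Rightarrow> bool" where
  "sweep_test q t R = (
     if list_ex (\<lambda>(l, u, r). r = 0) R \<and> \<not> List.member small_prime_powers q then True
     else if crit2 q ((if t then [(2, 5000)] else []) @ map (\<lambda>(l, u, r). (l, u)) (filter (\<lambda>(l, u, r). r = l - 1) R))
                     ((if t then [] else [(2, 5000)]) @ map (\<lambda>(l, u, r). (l, u)) (filter (\<lambda>(l, u, r). r = 1) R)) then True
     else List.member exceptions q)"

function sweep :: "int \<Rightarrow> int \<Rightarrow> bool \<Rightarrow> (int \<times> int \<times> int) list \<Rightarrow> bool" where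
  "sweep hi q t R = (if hi \<le> q then True else if sweep_test q t R then sweep hi (q + 2) (\<not> t) (map residue_step R) else False)"
  by pat_completeness auto
termination by (relation "measure (\<lambda>(hi, q, t, R). nat (hi - q))") auto

declare sweep.simps [simp del]

lemma sweep_0: "sweep 1003 3 True (residues 3)" by code_simp
lemma sweep_1: "sweep 2003 1003 True (residues 1003)" by code_simp
lemma sweep_2: "sweep 3003 2003 True (residues 2003)" by code_simp
lemma sweep_3: "sweep 4003 3003 True (residues 3003)" by code_simp
lemma sweep_4: "sweep 5003 4003 True (residues 4003)" by code_simp
lemma sweep_5: "sweep 7003 5003 True (residues 5003)" by code_simp
lemma sweep_6: "sweep 9003 7003 True (residues 7003)" by code_simp
lemma sweep_7: "sweep 11003 9003 True (residues 9003)" by code_simp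
lemma sweep_8: "sweep 13003 11003 True (residues 11003)" by code_simp
lemma sweep_9: "sweep 15003 13003 True (residues 13003)" by code_simp

lemma odd_weights: "(l, u) \<in> set odd_weights \<Longrightarrow>
    odd l \<and> 3 \<le> l \<and> l \<le> 31 \<and> prime (nat l) \<and> 10000 \<le> l * u \<and> l * (u - 1) \<le> 10000"
  and distinct_odd_weights: "distinct (map fst odd_weights)"
  and odd_weights_fst: "fst ` set odd_weights = {3, 5, 7, 11, 13, 17, 19, 23, 29, 31}"
  by (auto simp: odd_weights_def)

lemma residue_step_residues: "0 \<le> q \<Longrightarrow> map residue_step (residues q) = residues (q + 2)"
proof -
  assume q: "0 \<le> q"
  have "(if q mod l + 2 < l then q mod l + 2 else q mod l + 2 - l) = (q + 2) mod l" if "(l, u) \<in> set odd_weights" for l u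
  proof -
    have l: "3 \<le> l" using odd_weights[OF that] by simp
    then have r: "0 \<le> q mod l" "q mod l < l" by simp_all
    have e: "(q + 2) mod l = (q mod l + 2) mod l" by (simp add: mod_simps)
    show ?thesis
    proof (cases "q mod l + 2 < l")
      case True
      then show ?thesis unfolding e using r by simp
    next
      case False
      have "(q mod l + 2) mod l = (q mod l + 2 - l) mod l" by simp
      also have "\<dots> = q mod l + 2 - l" using False r l by (intro mod_pos_pos_trivial) linarith+
      finally show ?thesis unfolding e using False by simp
    qed
  qed
  then show ?thesis by (auto simp: residues_def residue_step_def)
qed

lemma sweep_sound:
  assumes "sweep hi q t R" "R = residues q" "0 \<le> q" "odd q" "t \<longleftrightarrow> q mod 4 = 3" "q \<le> x" "x < hi" "odd x"
  shows "sweep_test x (x mod 4 = 3) (residues x)"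
  using assms
proof (induction hi q t R rule: sweep.induct)
  case (1 hi q t R)
  have hq: "\<not> hi \<le> q" using 1 by linarith
  have test: "sweep_test q t R" and nxt: "sweep hi (q + 2) (\<not> t) (map residue_step R)"
    using 1(2) hq by (simp_all add: sweep.simps[of hi q t R] split: if_splits)
  show ?case
  proof (cases "x = q")
    case True
    then show ?thesis using test 1 by simp
  next
    case False
    have "q + 2 \<le> x" using 1 False by presburger
    moreover have "(\<not> t) = ((q + 2) mod 4 = 3)" using 1(5,6) by presburger
    ultimately show ?thesis
      using 1(1)[OF hq test nxt] 1(3,4,5,8,9) residue_step_residues[of q] by simp
  qed
qed

lemma sweep_all:
  assumes "3 \<le> x" "x < 15003" "odd x"
  shows "sweep_test x (x mod 4 = 3) (residues x)"
proof -
  consider "x < 1003" | "1003 \<le> x" "x < 2003" | "2003 \<le> x" "x < 3003" | "3003 \<le> x" "x < 4003" | "4003 \<le> x" "x < 5003"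
    | "5003 \<le> x" "x < 7003" | "7003 \<le> x" "x < 9003" | "9003 \<le> x" "x < 11003" | "11003 \<le> x" "x < 13003" | "13003 \<le> x"
    by linarith
  then show ?thesis
  proof cases
    case 1 then show ?thesis using assms by (intro sweep_sound[OF sweep_0 refl]) simp_all
  next
    case 2 then show ?thesis using assms by (intro sweep_sound[OF sweep_1 refl]) simp_all
  next
    case 3 then show ?thesis using assms by (intro sweep_sound[OF sweep_2 refl]) simp_all
  next
    case 4 then show ?thesis using assms by (intro sweep_sound[OF sweep_3 refl]) simp_all
  next
    case 5 then show ?thesis using assms by (intro sweep_sound[OF sweep_4 refl]) simp_all
  next
    case 6 then show ?thesis using assms by (intro sweep_sound[OF sweep_5 refl]) simp_all
  next
    case 7 then show ?thesis using assms by (intro sweep_sound[OF sweep_6 refl]) simp_all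
  next
    case 8 then show ?thesis using assms by (intro sweep_sound[OF sweep_7 refl]) simp_all
  next
    case 9 then show ?thesis using assms by (intro sweep_sound[OF sweep_8 refl]) simp_all
  next
    case 10 then show ?thesis using assms by (intro sweep_sound[OF sweep_9 refl]) simp_all
  qed
qed

definition all_weights :: "(int \<times> int) list" where "all_weights = (2, 5000) # odd_weights"

lemma all_weights: "(l, u) \<in> set all_weights \<Longrightarrow>
    2 \<le> l \<and> l \<le> 31 \<and> prime (nat l) \<and> 10000 \<le> l * u \<and> l * (u - 1) \<le> 10000"
  using odd_weights[of l u] by (auto simp: all_weights_def)

lemma distinct_all_weights: "distinct (map fst all_weights)"
  using distinct_odd_weights odd_weights_fst by (simp add: all_weights_def)

lemma all_weights_fst: "fst ` set all_weights = {2, 3, 5, 7, 11, 13, 17, 19, 23, 29, 31}"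
  using odd_weights_fst by (simp add: all_weights_def)

lemma map_filter_residues:
  "map (\<lambda>(l, u, r). (l, u)) (filter (\<lambda>(l, u, r). P l r) (residues q)) = filter (\<lambda>(l, u). P l (q mod l)) odd_weights"
proof -
  have "map (\<lambda>(l, u, r). (l, u)) (filter (\<lambda>(l, u, r). P l r) (map (\<lambda>(l, u). (l, u, q mod l)) W)) =
      filter (\<lambda>(l, u). P l (q mod l)) W" for W :: "(int \<times> int) list"
    by (induction W) auto
  then show ?thesis unfolding residues_def .
qed

lemma dvd_half_iff:
  fixes y l :: int
  assumes "odd l" "even y"
  shows "(y div 2) mod l = 0 \<longleftrightarrow> l dvd y"
proof -
  obtain x where x: "y = 2 * x" using assms(2) by blast
  have "coprime l 2" using assms(1) by simp
  then show ?thesis unfolding x by (simp add: coprime_dvd_mult_right_iff mod_eq_0_iff_dvd)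
qed

text \<open>An odd \<open>l\<close> divides \<open>q + 1\<close> or \<open>q - 1\<close> exactly if
  it divides the half, so the residues \<open>l - 1\<close> and 1 pick out the two lists.\<close>

lemma sweep_lists:
  assumes "odd (q::int)" "q \<ge> 3"
  shows "(if q mod 4 = 3 then [(2, 5000)] else []) @ map (\<lambda>(l, u, r). (l, u)) (filter (\<lambda>(l, u, r). r = l - 1) (residues q)) =
      filter (\<lambda>x. ((q + 1) div 2) mod fst x = 0) all_weights" (is "?A = ?A'")
    and "(if q mod 4 = 3 then [] else [(2, 5000)]) @ map (\<lambda>(l, u, r). (l, u)) (filter (\<lambda>(l, u, r). r = 1) (residues q)) =
      filter (\<lambda>x. ((q - 1) div 2) mod fst x = 0) all_weights" (is "?B = ?B'")
proof -
  have A: "q mod l = l - 1 \<longleftrightarrow> ((q + 1) div 2) mod l = 0" and B: "q mod l = 1 \<longleftrightarrow> ((q - 1) div 2) mod l = 0"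
    if "(l, u) \<in> set odd_weights" for l u
  proof -
    have l: "odd l" "3 \<le> l" using odd_weights[OF that] by auto
    have "l dvd q + 1 \<longleftrightarrow> q mod l = (-1) mod l" using mod_eq_dvd_iff[of q l "-1"] by simp
    also have "(-1) mod l = l - 1" using l by (simp add: zmod_minus1)
    finally show "q mod l = l - 1 \<longleftrightarrow> ((q + 1) div 2) mod l = 0"
      using dvd_half_iff[of l "q + 1"] l assms by simp
    have "l dvd q - 1 \<longleftrightarrow> q mod l = 1 mod l" using mod_eq_dvd_iff[of q l 1] by simp
    also have "1 mod l = 1" using l by simp
    finally show "q mod l = 1 \<longleftrightarrow> ((q - 1) div 2) mod l = 0"
      using dvd_half_iff[of l "q - 1"] l assms by simp
  qed
  have 2: "((q + 1) div 2) mod 2 = 0 \<longleftrightarrow> q mod 4 = 3" "((q - 1) div 2) mod 2 = 0 \<longleftrightarrow> \<not> q mod 4 = 3"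
    using assms by presburger+
  have "filter (\<lambda>(l, u). q mod l = l - 1) odd_weights = filter (\<lambda>x. ((q + 1) div 2) mod fst x = 0) odd_weights"
    "filter (\<lambda>(l, u). q mod l = 1) odd_weights = filter (\<lambda>x. ((q - 1) div 2) mod fst x = 0) odd_weights"
    using A B by (auto intro!: filter_cong)
  then show "?A = ?A'" "?B = ?B'"
    unfolding map_filter_residues all_weights_def using 2 by simp_all
qed

text \<open>A weight exceeds \<open>10000 / l\<close> by at most one, hence \<open>u - 1\<close> is
  a lower bound; this costs one unit per prime.\<close>

lemma sum_weights_le:
  fixes A :: "(int \<times> int) list"
  assumes "distinct (map fst A)" "\<And>l u. (l, u) \<in> set A \<Longrightarrow> 0 < l \<and> l * (u - 1) \<le> 10000"
  shows "(\<Sum>l\<in>nat ` set (map fst A). 1 - 1 / real l) \<le> real_of_int (10000 * int (length A) - sum_list (map snd A) + int (length A)) / 10000"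
proof -
  have inj: "inj_on nat (set (map fst A))"
    using assms(2) by (fastforce intro!: inj_onI simp: eq_nat_nat_iff less_imp_le)
  have "(\<Sum>l\<in>nat ` set (map fst A). 1 - 1 / real l) = (\<Sum>l\<in>set (map fst A). 1 - 1 / real (nat l))"
    by (subst sum.reindex[OF inj]) simp
  also have "\<dots> = (\<Sum>x\<leftarrow>A. 1 - 1 / real (nat (fst x)))"
    using sum.distinct_set_conv_list[OF assms(1), of "\<lambda>l. 1 - 1 / real (nat l)"] by (simp add: comp_def)
  also have "\<dots> \<le> (\<Sum>x\<leftarrow>A. 1 - (real_of_int (snd x) - 1) / 10000)"
  proof (rule sum_list_mono)
    fix x assume "x \<in> set A"
    then have "0 < fst x \<and> fst x * (snd x - 1) \<le> 10000" using assms(2)[of "fst x" "snd x"] by simp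
    then have "0 < real_of_int (fst x)" "real_of_int (fst x * (snd x - 1)) \<le> 10000" "real (nat (fst x)) = real_of_int (fst x)"
      by (simp_all only: of_int_0_less_iff of_int_le_numeral_iff) (simp add: less_imp_le)
    then show "1 - 1 / real (nat (fst x)) \<le> 1 - (real_of_int (snd x) - 1) / 10000" by (simp add: field_simps)
  qed
  also have "\<dots> = real_of_int (10000 * int (length A) - sum_list (map snd A) + int (length A)) / 10000"
    by (induction A) (auto simp: field_simps)
  finally show ?thesis .
qed

context quadratic_trace_field
begin

text \<open>\<open>R\<close> holds the prime factors of which only the size, from 37 on, and the
  maximal number \<open>e\<close> are known; they are always sieved, with weight 271 each in the
  reciprocal sum.\<close>

lemma split_core:
  fixes A :: "(int \<times> int) list" and e K :: int
  assumes P: "P = nat ` set (map fst A) \<union> R" "nat ` set (map fst A) \<inter> R = {}" "finite R" "int (card R) \<le> e" "\<forall>l\<in>R. 37 \<le> l"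
    and A: "distinct (map fst A)" "\<forall>l u. (l, u) \<in> set A \<longrightarrow> 2 \<le> l \<and> 10000 \<le> l * u \<and> l * (u - 1) \<le> 10000"
    and K: "K < 37"
  defines "C \<equiv> nat ` set (map fst (filter (\<lambda>x. fst x \<le> K) A))"
    and "SL \<equiv> filter (\<lambda>x. \<not> fst x \<le> K) A"
  shows "C \<subseteq> P" "card C = length (filter (\<lambda>x. fst x \<le> K) A)"
    "(\<Sum>l\<in>P - C. 1 / real l) \<le> (real_of_int (sum_list (map snd SL)) + 271 * real_of_int e) / 10000"
    "(\<Sum>l\<in>P - C. 1 - 1 / real l) \<le> (10000 * real_of_int (int (length SL) + e) - real_of_int (sum_list (map snd SL)) + real (length SL)) / 10000"
proof -
  let ?CL = "filter (\<lambda>x. fst x \<le> K) A"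
  have inj: "inj_on nat (set (map fst A))"
    using A(2) by (fastforce intro!: inj_onI simp: eq_nat_nat_iff)
  show "C \<subseteq> P" unfolding P(1) C_def by auto
  have dist: "distinct (map fst (filter Q A))" for Q
    using A(1) by (simp add: distinct_map inj_on_def)
  have "card C = card (set (map fst ?CL))"
    unfolding C_def by (intro card_image inj_on_subset[OF inj]) auto
  also have "\<dots> = length ?CL" using distinct_card[OF dist] by simp
  finally show "card C = length ?CL" .
  have "set (map fst A) - set (map fst ?CL) = set (map fst SL)" by (auto simp: SL_def)
  moreover have "nat ` set (map fst A) - nat ` set (map fst ?CL) = nat ` (set (map fst A) - set (map fst ?CL))"
    by (rule inj_on_image_set_diff[OF inj, symmetric]) auto
  moreover have "C \<inter> R = {}" using P(2) unfolding C_def by auto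
  ultimately have "nat ` set (map fst A) - C = nat ` set (map fst SL)" "C \<inter> R = {}" unfolding C_def by metis+
  then have D: "P - C = nat ` set (map fst SL) \<union> R" unfolding P(1) by blast
  have disj: "nat ` set (map fst SL) \<inter> R = {}" using P(2) unfolding SL_def by auto
  have sumD: "(\<Sum>l\<in>P - C. f l) = (\<Sum>l\<in>nat ` set (map fst SL). f l) + (\<Sum>l\<in>R. f l)" for f :: "nat \<Rightarrow> real"
    unfolding D using disj P(3) by (intro sum.union_disjoint) auto
  have SLw: "0 < l \<and> 10000 \<le> l * u" "0 < l \<and> l * (u - 1) \<le> 10000" if "(l, u) \<in> set SL" for l u
    using A(2)[rule_format, of l u] that by (auto simp: SL_def)
  have dSL: "distinct (map fst SL)" unfolding SL_def by (rule dist)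
  have cR: "real (card R) \<le> real_of_int e" using P(4) by linarith
  have "(\<Sum>l\<in>R. 1 / real l) \<le> (\<Sum>l\<in>R. 271 / 10000)"
  proof (rule sum_mono)
    fix l assume "l \<in> R"
    then have "real l \<ge> 37" using P(5) by simp
    then show "1 / real l \<le> 271 / 10000" by (simp add: field_simps)
  qed
  also have "\<dots> \<le> 271 * real_of_int e / 10000" using cR by simp
  finally show "(\<Sum>l\<in>P - C. 1 / real l) \<le> (real_of_int (sum_list (map snd SL)) + 271 * real_of_int e) / 10000"
    unfolding sumD using sum_weights_ge[OF dSL SLw(1)] by (simp add: add_divide_distrib)
  have "(\<Sum>l\<in>R. 1 - 1 / real l) \<le> (\<Sum>l\<in>R. 1)" by (intro sum_mono) simp
  also have "\<dots> \<le> real_of_int e" using cR by simp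
  finally show "(\<Sum>l\<in>P - C. 1 - 1 / real l) \<le> (10000 * real_of_int (int (length SL) + e) - real_of_int (sum_list (map snd SL)) + real (length SL)) / 10000"
    unfolding sumD using sum_weights_le[OF dSL SLw(2)] by (simp add: field_simps)
qed

lemma crit2_at_sound:
  fixes eA eB K :: int
  assumes b: "b \<in> base - {0}" and K: "K < 37" and crit: "crit2_at (int q) A B eA eB K"
    and PA: "PA = nat ` set (map fst A) \<union> RA" "nat ` set (map fst A) \<inter> RA = {}" "finite RA" "int (card RA) \<le> eA" "\<forall>l\<in>RA. 37 \<le> l"
    and PB: "PB = nat ` set (map fst B) \<union> RB" "nat ` set (map fst B) \<inter> RB = {}" "finite RB" "int (card RB) \<le> eB" "\<forall>l\<in>RB. 37 \<le> l"
    and A: "distinct (map fst A)" "\<forall>l u. (l, u) \<in> set A \<longrightarrow> 2 \<le> l \<and> 10000 \<le> l * u \<and> l * (u - 1) \<le> 10000"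
    and B: "distinct (map fst B)" "\<forall>l u. (l, u) \<in> set B \<longrightarrow> 2 \<le> l \<and> 10000 \<le> l * u \<and> l * (u - 1) \<le> 10000"
  shows "\<exists>x. r_primitive 2 x \<and> Tr x = b"
proof -
  let ?CA = "nat ` set (map fst (filter (\<lambda>x. fst x \<le> K) A))" and ?CB = "nat ` set (map fst (filter (\<lambda>x. fst x \<le> K) B))"
  note SA = split_core[OF PA A K] and SB = split_core[OF PB B K]
  define nA uA nB uB where "nA = int (length (filter (\<lambda>x. \<not> fst x \<le> K) A))" and "uA = sum_list (map snd (filter (\<lambda>x. \<not> fst x \<le> K) A))"
    and "nB = int (length (filter (\<lambda>x. \<not> fst x \<le> K) B))" and "uB = sum_list (map snd (filter (\<lambda>x. \<not> fst x \<le> K) B))"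
  define a w d sA sB where "a = (2::int) ^ length (filter (\<lambda>x. fst x \<le> K) A)" and "w = a * 2 ^ length (filter (\<lambda>x. fst x \<le> K) B)" and "d = 10000 - uA - uB - 271 * (eA + eB)"
    and "sA = 10000 * (nA + eA) - uA + nA" and "sB = 10000 * (nB + eB) - uB + nB"
  define l z where "l = d * (int q - 1 - 2 * (a - 1)) - 2 * sA * a" and "z = d * (w - a) + sA * (w - a) + sB * w"
  have "crit2_at (int q) A B eA eB K = (0 < d \<and> 0 < l \<and> 4 * int q * (z * z) < l * l)"
    unfolding crit2_at_def Let_def l_def z_def
    unfolding w_def sA_def sB_def unfolding a_def d_def unfolding nA_def uA_def nB_def uB_def by (rule refl)
  then have c: "0 < d" "0 < l" "4 * int q * (z * z) < l * l" using crit by simp_all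
  let ?t = "sqrt (real q)" and ?a = "real_of_int a" and ?w = "real_of_int w" and ?d = "real_of_int d"
  let ?UA = "\<Sum>l\<in>PA - ?CA. 1 / real l" and ?UB = "\<Sum>l\<in>PB - ?CB. 1 / real l"
  let ?VA = "\<Sum>l\<in>PA - ?CA. 1 - 1 / real l" and ?VB = "\<Sum>l\<in>PB - ?CB. 1 - 1 / real l"
  have cC: "card ?CA = length (filter (\<lambda>x. fst x \<le> K) A)" "card ?CB = length (filter (\<lambda>x. fst x \<le> K) B)"
    by (fact SA(2), fact SB(2))
  have ra: "?a = 2 ^ card ?CA" "?w = 2 ^ (card ?CA + card ?CB)" unfolding a_def w_def cC by (simp_all add: power_add)
  have aw: "0 < ?a" "?a \<le> ?w" unfolding ra by simp_all
  have VA: "?VA \<le> real_of_int sA / 10000" and VB: "?VB \<le> real_of_int sB / 10000"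
    using SA(4) SB(4) by (simp_all add: sA_def sB_def nA_def nB_def uA_def uB_def)
  have U: "?d / 10000 \<le> 1 - ?UA - ?UB"
    using SA(3) SB(3) by (simp add: d_def uA_def uB_def field_simps)
  have nonneg: "0 \<le> (\<Sum>l\<in>X. 1 - 1 / real l)" if "X \<subseteq> PA \<union> PB" for X
  proof (rule sum_nonneg)
    fix l assume "l \<in> X"
    then have "prime l" using that by auto
    then show "0 \<le> 1 - 1 / real l" using prime_gt_0_nat[of l] by simp
  qed
  have V0: "0 \<le> ?VA" "0 \<le> ?VB" by (rule nonneg, blast)+
  have sq: "(2 * ?t * real_of_int z)\<^sup>2 < (real_of_int l)\<^sup>2"
  proof -
    have "real_of_int (4 * int q * (z * z)) < real_of_int (l * l)" using c(3) by (simp only: of_int_less_iff)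
    then show ?thesis by (simp add: power_mult_distrib) (simp add: power2_eq_square)
  qed
  have "2 * ?t * real_of_int z < real_of_int l" by (rule power2_less_imp_less[OF sq]) (use c(2) in simp)
  then have main: "2 * (real_of_int sA * (?a + ?t * (?w - ?a)) + real_of_int sB * (?t * ?w)) <
      ?d * (real q - 1 - 2 * ((?a - 1) + ?t * (?w - ?a)))"
    by (simp add: l_def z_def algebra_simps)
  let ?Y = "(real q - 1) / 2 - ((?a - 1) + ?t * (?w - ?a))"
  have X0: "0 \<le> ?a + ?t * (?w - ?a)" "0 \<le> ?t * ?w" using aw by auto
  have "?VA * (?a + ?t * (?w - ?a)) + ?VB * (?t * ?w) \<le>
      real_of_int sA / 10000 * (?a + ?t * (?w - ?a)) + real_of_int sB / 10000 * (?t * ?w)"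
    using VA VB X0 by (intro add_mono mult_right_mono)
  also have "\<dots> < ?d / 10000 * ?Y" using main by (simp add: field_simps)
  finally have lt: "?VA * (?a + ?t * (?w - ?a)) + ?VB * (?t * ?w) < ?d / 10000 * ?Y" .
  \<comment> \<open>The left side is nonnegative and \<open>d\<close> is positive, so
    \<open>?Y\<close> is positive; only then may \<open>d / 10000\<close> be replaced by the larger
    true value.\<close>
  have "0 \<le> ?VA * (?a + ?t * (?w - ?a)) + ?VB * (?t * ?w)"
    by (rule add_nonneg_nonneg[OF mult_nonneg_nonneg[OF V0(1) X0(1)] mult_nonneg_nonneg[OF V0(2) X0(2)]])
  also note lt
  finally have dY: "0 < ?d / 10000 * ?Y" .
  have d: "0 < ?d / 10000" using c(1) by simp
  have "0 < ?Y" by (rule zero_less_mult_pos[OF dY d])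
  then have "?d / 10000 * ?Y \<le> (1 - ?UA - ?UB) * ?Y" by (intro mult_right_mono[OF U] less_imp_le)
  with lt have fin: "?VA * (?a + ?t * (?w - ?a)) + ?VB * (?t * ?w) < (1 - ?UA - ?UB) * ?Y" by (rule less_le_trans)
  have pos: "0 < 1 - ?UA - ?UB" using d U by (rule less_le_trans)
  show ?thesis by (rule two_crit[OF b SA(1) SB(1) pos]) (use fin in \<open>simp only: ra\<close>)
qed

lemma crit2_sound:
  assumes b: "b \<in> base - {0}" and q: "q < 15000"
    and crit: "crit2 (int q) (filter (\<lambda>x. ((int q + 1) div 2) mod fst x = 0) all_weights)
      (filter (\<lambda>x. ((int q - 1) div 2) mod fst x = 0) all_weights)"
  shows "\<exists>x. r_primitive 2 x \<and> Tr x = b"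
proof -
  define A where "A = filter (\<lambda>x. ((int q + 1) div 2) mod fst x = 0) all_weights"
  define B where "B = filter (\<lambda>x. ((int q - 1) div 2) mod fst x = 0) all_weights"
  define rA where "rA = 74 * prod_list (map fst A)"
  define rB where "rB = 74 * prod_list (map fst B)"
  define eA :: int where "eA = (if int q + 1 < rA then 0 else if int q + 1 < 37 * rA then 1 else 2)"
  define eB :: int where "eB = (if int q - 1 < rB then 0 else if int q - 1 < 37 * rB then 1 else 2)"
  have "crit2_at (int q) A B eA eB 2 \<or> crit2_at (int q) A B eA eB 3"
    using crit unfolding A_def[symmetric] B_def[symmetric] crit2_def Let_def rA_def[symmetric] rB_def[symmetric]
      eA_def[symmetric] eB_def[symmetric] by (simp split: if_splits)
  then obtain K where K: "K < 37" "crit2_at (int q) A B eA eB K" by force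
  have h1: "\<forall>l\<in>set (map fst all_weights). 0 < l \<and> prime (nat l)"
    by (auto dest!: all_weights)
  have h2: "\<forall>l. prime l \<longrightarrow> l dvd x \<longrightarrow> l < 37 \<longrightarrow> int l \<in> set (map fst all_weights)" for x
  proof (intro allI impI)
    fix l :: nat assume l: "prime l" "l < 37"
    have "l \<in> {2, 3, 5, 7, 11, 13, 17, 19, 23, 29, 31}" using primes_below_73[OF l(1)] l(2) by auto
    then have "int l \<in> {2, 3, 5, 7, 11, 13, 17, 19, 23, 29, 31}" by auto
    then show "int l \<in> set (map fst all_weights)" by (simp only: set_map all_weights_fst)
  qed
  have split: "\<exists>R. prime_factors x = nat ` set (map fst L) \<union> R \<and> nat ` set (map fst L) \<inter> R = {} \<and> finite R \<and>
      int (card R) \<le> e \<and> (\<forall>l\<in>R. 37 \<le> l)"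
    if x: "x > 0" "x \<le> 7500" and L: "L = filter (\<lambda>y. int x mod fst y = 0) all_weights"
      and e: "e = 0 \<or> e = 1 \<or> e = 2" "e = 0 \<Longrightarrow> int x < 37 * prod_list (map fst L)" "e = 1 \<Longrightarrow> int x < 1369 * prod_list (map fst L)"
    for x L and e :: int
  proof -
    have mL: "map fst L = filter (\<lambda>l. int x mod l = 0) (map fst all_weights)"
      by (simp add: L filter_map comp_def)
    have "prod_list (map fst L) \<ge> 1"
      by (intro prod_list_ge_1) (auto simp: L dest!: all_weights)
    then have "int x < int 37 ^ Suc (nat e) * prod_list (filter (\<lambda>l. int x mod l = 0) (map fst all_weights))"
      unfolding mL[symmetric] using e x by auto
    from prime_factors_split[OF x(1) distinct_all_weights h1 h2 _ this]
    obtain R where R: "prime_factors x = nat ` set (map fst L) \<union> R" "nat ` set (map fst all_weights) \<inter> R = {}"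
      "finite R" "card R \<le> nat e" "\<forall>l\<in>R. 37 \<le> l"
      unfolding mL by auto
    moreover have "set (map fst L) \<subseteq> set (map fst all_weights)" unfolding mL by (rule filter_is_subset)
    then have "nat ` set (map fst L) \<inter> R = {}" using R(2) by blast
    moreover have "int (card R) \<le> e" using R(4) e(1) by auto
    ultimately show ?thesis by blast
  qed
  have xA: "int ((q + 1) div 2) = (int q + 1) div 2" by simp
  have xB: "int ((q - 1) div 2) = (int q - 1) div 2" using q_gt_1 by (simp add: zdiv_int of_nat_diff)
  have eqA: "2 * int ((q + 1) div 2) = int q + 1" using odd_q by (auto elim!: oddE)
  have eqB: "2 * int ((q - 1) div 2) = int q - 1" using odd_q by (auto elim!: oddE)
  have "\<exists>R. PA = nat ` set (map fst A) \<union> R \<and> nat ` set (map fst A) \<inter> R = {} \<and> finite R \<and>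
      int (card R) \<le> eA \<and> (\<forall>l\<in>R. 37 \<le> l)"
  proof (rule split[OF half_q_plus_pos])
    show "A = filter (\<lambda>y. int ((q + 1) div 2) mod fst y = 0) all_weights" unfolding xA A_def by (rule refl)
    show "eA = 0 \<Longrightarrow> int ((q + 1) div 2) < 37 * prod_list (map fst A)"
      "eA = 1 \<Longrightarrow> int ((q + 1) div 2) < 1369 * prod_list (map fst A)"
      using eqA by (auto simp: eA_def rA_def split: if_splits)
  qed (use q in \<open>auto simp: eA_def\<close>)
  then obtain RA where RA: "PA = nat ` set (map fst A) \<union> RA" "nat ` set (map fst A) \<inter> RA = {}" "finite RA"
      "int (card RA) \<le> eA" "\<forall>l\<in>RA. 37 \<le> l" by blast
  have "\<exists>R. PB = nat ` set (map fst B) \<union> R \<and> nat ` set (map fst B) \<inter> R = {} \<and> finite R \<and>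
      int (card R) \<le> eB \<and> (\<forall>l\<in>R. 37 \<le> l)"
  proof (rule split[OF half_q_pos])
    show "B = filter (\<lambda>y. int ((q - 1) div 2) mod fst y = 0) all_weights" unfolding xB B_def by (rule refl)
    show "eB = 0 \<Longrightarrow> int ((q - 1) div 2) < 37 * prod_list (map fst B)"
      "eB = 1 \<Longrightarrow> int ((q - 1) div 2) < 1369 * prod_list (map fst B)"
      using eqB by (auto simp: eB_def rB_def split: if_splits)
  qed (use q in \<open>auto simp: eB_def\<close>)
  then obtain RB where RB: "PB = nat ` set (map fst B) \<union> RB" "nat ` set (map fst B) \<inter> RB = {}" "finite RB"
      "int (card RB) \<le> eB" "\<forall>l\<in>RB. 37 \<le> l" by blast
  have dist: "distinct (map fst (filter Q all_weights))" for Q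
    using distinct_all_weights by (simp add: distinct_map inj_on_def)
  show ?thesis
  proof (rule crit2_at_sound[OF b K RA RB])
    show "distinct (map fst A)" "distinct (map fst B)" unfolding A_def B_def by (rule dist)+
    show "\<forall>l u. (l, u) \<in> set A \<longrightarrow> 2 \<le> l \<and> 10000 \<le> l * u \<and> l * (u - 1) \<le> 10000"
      by (auto simp: A_def dest!: all_weights)
    show "\<forall>l u. (l, u) \<in> set B \<longrightarrow> 2 \<le> l \<and> 10000 \<le> l * u \<and> l * (u - 1) \<le> 10000"
      by (auto simp: B_def dest!: all_weights)
  qed
qed

lemma small_prime_power:
  assumes "(l, u) \<in> set odd_weights" "int q mod l = 0" "q < 15000"
  shows "int q \<in> set small_prime_powers"
proof -
  have l: "prime (nat l)" "3 \<le> l" using odd_weights[OF assms(1)] by auto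
  obtain p k where pk: "prime p" "k > 0" "q = p ^ k" using q by (auto simp: primepow_def)
  have "int (nat l) dvd int q" using assms(2) l(2) by (simp add: mod_eq_0_iff_dvd)
  then have "nat l dvd p ^ k" unfolding pk(3)[symmetric] by (simp only: int_dvd_int_iff)
  then have "nat l = p" using l(1) pk(1) by (metis prime_dvd_power primes_dvd_imp_eq)
  then have ql: "q = nat l ^ k" using pk by simp
  have "k < 9"
  proof (rule ccontr)
    assume "\<not> k < 9"
    then have "(3::nat) ^ 9 \<le> 3 ^ k" by (intro power_increasing) auto
    also have "\<dots> \<le> nat l ^ k" using l by (intro power_mono) auto
    finally show False using ql assms(3) by simp
  qed
  then have k: "k \<in> {1, 2, 3, 4, 5, 6, 7, 8}" using pk(2) by auto
  have "l \<in> {3, 5, 7, 11, 13, 17, 19, 23, 29, 31}"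
    using assms(1) odd_weights_fst by (metis fst_conv image_eqI)
  then have "nat l \<in> {3, 5, 7, 11, 13, 17, 19, 23, 29, 31}" by auto
  moreover have "nat l ^ k < 15000" using assms(3) ql by simp
  ultimately have "int (nat l ^ k) \<in> set small_prime_powers"
    using k by (elim insertE emptyE) (simp_all add: small_prime_powers_def)
  then show ?thesis using ql by simp
qed

lemma two_small:
  assumes b: "b \<in> base - {0}" and q: "q < 15000" "int q \<notin> set exceptions"
  shows "\<exists>x. r_primitive 2 x \<and> Tr x = b"
proof -
  have o: "odd (int q)" "int q \<ge> 3" using odd_q q_ge_3 by auto
  have "sweep_test (int q) (int q mod 4 = 3) (residues (int q))"
    using o q by (intro sweep_all) auto
  moreover have "List.member small_prime_powers (int q)" if ex: "list_ex (\<lambda>(l, u, r). r = 0) (residues (int q))"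
  proof -
    obtain l u where "(l, u) \<in> set odd_weights" "int q mod l = 0"
      using ex by (auto simp: list_ex_iff residues_def)
    then show ?thesis using small_prime_power[OF _ _ q(1)] by (simp)
  qed
  ultimately have "crit2 (int q) (filter (\<lambda>x. ((int q + 1) div 2) mod fst x = 0) all_weights)
      (filter (\<lambda>x. ((int q - 1) div 2) mod fst x = 0) all_weights)"
    using q(2) unfolding sweep_test_def sweep_lists[OF o] by (auto split: if_splits)
  then show ?thesis by (rule crit2_sound[OF b q(1)])
qed

end

subsection \<open>Degree two, explicit certificates\<close>

lemma (in cyclic_field) power_coprime_eq_1:
  assumes "(z::'a) ^ a = 1" "z ^ b = 1" "coprime a b"
  shows "z = 1"
proof (cases "b = 1")
  case True
  then show ?thesis using assms by simp
next
  case False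
  obtain x y where "a * x = b * y + 1"
    using coprime_bezout_strong[OF assms(3) False] by blast
  then have "z ^ (b * y + 1) = z ^ (a * x)" by simp
  then show ?thesis by (simp add: power_add power_mult assms)
qed

text \<open>\<open>c ^ (e div l)\<close> is a nontrivial root of unity of order \<open>l\<close>,
  and a power coprime to \<open>l\<close> cannot trivialise it.\<close>

lemma (in cyclic_field) power_div_prime_neq_1:
  assumes "prime l" "(c::'a) ^ e = 1" "l dvd e" "c ^ (e div l) \<noteq> 1" "\<not> l dvd k"
  shows "(c ^ k) ^ (e div l) \<noteq> 1"
proof
  assume "(c ^ k) ^ (e div l) = 1"
  then have "(c ^ (e div l)) ^ k = 1" by (simp add: mult.commute flip: power_mult)
  moreover have "(c ^ (e div l)) ^ l = 1" using assms by (simp flip: power_mult)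
  moreover have "coprime k l" using assms(1,5) by (metis coprime_commute prime_imp_coprime)
  ultimately show False using assms(4) power_coprime_eq_1 by blast
qed

text \<open>The tests at the primes of \<open>e\<close> say that \<open>c\<close> has exact order
  \<open>e\<close>, so it generates all roots of unity of that order. Exponents run from 1 because
  they are later passed as binary numerals, which have no zero.\<close>

lemma (in cyclic_field) root_of_unity_power:
  assumes "e dvd N" "(x::'a) ^ e = 1" "(c::'a) ^ e = 1" "\<And>l. prime l \<Longrightarrow> l dvd e \<Longrightarrow> c ^ (e div l) \<noteq> 1"
  shows "\<exists>k\<ge>1. k \<le> e \<and> x = c ^ k"
proof -
  obtain d where d: "N = e * d" using assms(1) by blast
  have pos: "e > 0" "d > 0" using d N_pos by (auto intro: Nat.gr0I)
  have ex: "\<exists>f. y = g ^ (d * f)" if y: "y ^ e = 1" for y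
  proof -
    have "y \<noteq> 0" using y pos by (auto simp: power_0_left)
    then obtain a where a: "y = g ^ a" using ex_pow by blast
    then have "e * d dvd a * e" using y by (simp add: power_eq_1_iff d flip: power_mult)
    then have "d dvd a" using pos by (simp add: mult.commute)
    then show ?thesis using a by blast
  qed
  obtain f h where fh: "c = g ^ (d * f)" "x = g ^ (d * h)" using ex assms(2,3) by metis
  have "coprime f e"
  proof (rule ccontr)
    assume "\<not> coprime f e"
    then obtain l where l: "prime l" "l dvd f" "l dvd e"
      by (metis coprime_iff_gcd_eq_1 gcd_greatest_iff prime_factor_nat)
    then obtain f' where "f = l * f'" by blast
    then have "c ^ (e div l) = g ^ (e * d * f')" using l by (auto simp: fh mult_ac simp flip: power_mult elim!: dvdE)
    also have "\<dots> = 1" by (simp add: power_eq_1_iff d)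
    finally show False using assms(4)[OF l(1,3)] by simp
  qed
  then obtain y where y: "[f * y = 1] (mod e)" using cong_solve_coprime_nat by auto
  define k where "k = (y * h) mod e + (if e dvd y * h then e else 0)"
  have k: "1 \<le> k" "k \<le> e" using pos by (auto simp: k_def less_imp_le dvd_eq_mod_eq_0)
  have "[k = y * h] (mod e)" by (simp add: k_def cong_def)
  then have "[f * k = f * (y * h)] (mod e)" by (rule cong_scalar_left)
  also have "[f * (y * h) = h] (mod e)" using cong_scalar_right[OF y, of h] by (simp add: mult.assoc)
  finally have "[d * (f * k) = d * h] (mod (d * e))" using pos by (simp add: cong_def)
  then have "c ^ k = x" unfolding fh power_mult[symmetric] power_eq_iff d by (simp add: mult_ac)
  then show ?thesis using k by blast
qed

section \<open>Products of a subfield element and an element of norm one\<close>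

context trace_field
begin

lemma base_closed:
  shows base_0: "0 \<in> base" and base_1: "1 \<in> base"
    and base_mult: "x \<in> base \<Longrightarrow> y \<in> base \<Longrightarrow> x * y \<in> base"
    and base_add: "x \<in> base \<Longrightarrow> y \<in> base \<Longrightarrow> x + y \<in> base"
    and base_diff: "x \<in> base \<Longrightarrow> y \<in> base \<Longrightarrow> x - y \<in> base"
proof -
  show "0 \<in> base" "1 \<in> base" using q_gt_1 by (simp_all add: base_def)
  show "x \<in> base \<Longrightarrow> y \<in> base \<Longrightarrow> x * y \<in> base" by (simp add: base_def power_mult_distrib)
  show "x \<in> base \<Longrightarrow> y \<in> base \<Longrightarrow> x + y \<in> base" for x y
    using frobenius_add[of x y 1] by (simp add: base_def)
  show "x - y \<in> base" if "x \<in> base" "y \<in> base"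
    using frobenius_add[of "x - y" y 1] that by (simp add: base_def eq_diff_eq)
qed

lemma base_closed_power: "x \<in> base \<Longrightarrow> x ^ k \<in> base"
  by (induction k) (simp_all add: base_1 base_mult)

lemma of_int_in_base: "of_int k \<in> base"
proof -
  have nat: "of_nat k \<in> base" for k by (induction k) (auto simp: base_0 base_1 intro: base_add)
  show ?thesis
  proof (cases k rule: int_cases2)
    case (nonneg n) then show ?thesis using nat by simp
  next
    case (nonpos n) then show ?thesis using base_diff[OF base_0 nat[of n]] by simp
  qed
qed

lemma CHAR_dvd_q: "CHAR('a) dvd q"
proof -
  obtain k where "q = CHAR('a) ^ k" using ex_CHAR_power by blast
  then show ?thesis using q_gt_1 by (cases k) auto
qed

lemma power_q_minus_1: "x \<in> base - {0} \<Longrightarrow> x ^ (q - 1) = 1"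
proof -
  assume x: "x \<in> base - {0}"
  have "x * x ^ (q - 1) = x ^ q" using q_gt_1 by (simp flip: power_Suc)
  then show ?thesis using x by (auto simp: base_def)
qed

end

context odd_trace_field
begin

lemma two_nonzero: "(2::'a) \<noteq> 0"
proof
  assume "(2::'a) = 0"
  then have "of_nat 2 = (0::'a)" by simp
  then have "CHAR('a) dvd 2" by (simp only: of_nat_eq_0_iff_char_dvd)
  moreover have "coprime 2 q" using odd_q by simp
  ultimately have "CHAR('a) dvd 1" using CHAR_dvd_q coprime_common_divisor by blast
  then have "of_nat 1 = (0::'a)" by (simp only: of_nat_eq_0_iff_char_dvd)
  then show False by simp
qed

end

context quadratic_trace_field
begin

text \<open>Nonzero elements of \<open>base\<close> are powers of \<open>g ^ (q + 1)\<close>, and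
  \<open>q + 1\<close> is even.\<close>

lemma base_square_root: "x \<in> base \<Longrightarrow> \<exists>y. y * y = x"
proof (cases "x = 0")
  case False
  assume "x \<in> base"
  then obtain k where "x = g ^ k" "m dvd k" using False ex_pow base_nonzero_iff by metis
  moreover have "even m" using odd_q by (simp add: m_two)
  ultimately obtain j where "x = g ^ (2 * j)" by (metis dvd_trans evenE)
  then show ?thesis by (intro exI[of _ "g ^ j"]) (simp add: mult_2 power_add)
qed auto

text \<open>\<open>w\<close> and \<open>v\<close> are the roots of \<open>X ^ 2 - t * X + 1\<close>;
  its discriminant lies in \<open>base\<close> and thus is a square in the quadratic
  extension.\<close>

lemma ex_norm_one: "t \<in> base \<Longrightarrow> \<exists>w v. w * v = 1 \<and> w + v = t"
proof -
  assume t: "t \<in> base"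
  have "t * t - of_int 4 \<in> base" using t by (intro base_diff base_mult of_int_in_base)
  then obtain s where s: "s * s = t * t - 4" using base_square_root by fastforce
  have "(t + s) / 2 * ((t - s) / 2) = (t * t - s * s) / (2 * 2)" by (simp add: algebra_simps)
  also have "\<dots> = (2 * 2) / (2 * 2)" unfolding s by simp
  also have "\<dots> = 1" by (rule divide_self) (rule no_zero_divisors[OF two_nonzero two_nonzero])
  finally have "(t + s) / 2 * ((t - s) / 2) = 1" .
  moreover have "(t + s) / 2 + (t - s) / 2 = t" using two_nonzero by (simp flip: add_divide_distrib)
  ultimately show ?thesis by blast
qed

lemma PA_iff: "l \<in> PA \<longleftrightarrow> prime l \<and> l dvd (q + 1) div 2"
  using half_q_plus_pos by (simp only: in_prime_factors_iff) blast

lemma PB_iff: "l \<in> PB \<longleftrightarrow> prime l \<and> l dvd (q - 1) div 2"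
  using half_q_pos by (simp only: in_prime_factors_iff) blast

lemma PA_dvd: "l \<in> PA \<Longrightarrow> prime l \<and> l > 0 \<and> l dvd q + 1"
proof -
  assume l: "l \<in> PA"
  have "2 * ((q + 1) div 2) = q + 1" using odd_q by simp
  then show ?thesis using l prime_gt_0_nat unfolding PA_iff by (metis dvd_mult)
qed

lemma PB_dvd: "l \<in> PB \<Longrightarrow> prime l \<and> l > 0 \<and> l dvd q - 1"
proof -
  assume l: "l \<in> PB"
  have "2 * ((q - 1) div 2) = q - 1" using odd_q by simp
  then show ?thesis using l prime_gt_0_nat unfolding PB_iff by (metis dvd_mult)
qed

text \<open>Up to scaling by \<open>base\<close>, a 2-primitive element is an element of norm one; the primes of
  \<open>(q - 1) div 2\<close> concern only the first factor and those of \<open>(q + 1) div 2\<close> only the second.\<close>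

lemma two_primitive_product:
  assumes x: "x \<in> base - {0}" "\<And>l. l \<in> PB \<Longrightarrow> x ^ ((q - 1) div l) \<noteq> 1"
    and u: "u ^ (q + 1) = 1" "\<And>l. l \<in> PA \<Longrightarrow> u ^ ((q + 1) div l) \<noteq> 1"
  shows "r_primitive 2 (x * u)"
proof -
  have q1: "2 * ((q + 1) div 2) = q + 1" "2 * ((q - 1) div 2) = q - 1" using odd_q by simp_all
  have N2: "N = (q - 1) * (q + 1)" using N_eq(1) m_two by simp
  obtain A where A: "x = g ^ ((q + 1) * A)"
    using x(1) ex_pow[of x] base_nonzero_iff m_two by (auto simp: dvd_def)
  have "u \<noteq> 0" using u(1) by auto
  then obtain B0 where B0: "u = g ^ B0" using ex_pow by blast
  then have "N dvd B0 * (q + 1)" using u(1) by (simp only: power_eq_1_iff flip: power_mult)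
  then have "q - 1 dvd B0" unfolding N2 by (subst (asm) dvd_times_right_cancel_iff) simp_all
  then obtain B where B: "u = g ^ ((q - 1) * B)" using B0 by (auto simp: dvd_def)
  \<comment> \<open>Half of the exponent of \<open>x * u\<close>. A prime of
    \<open>(q + 1) div 2\<close> divides the first summand, so \<open>B\<close> decides; for a prime
    of \<open>(q - 1) div 2\<close> it is \<open>A\<close>.\<close>
  let ?y = "(q + 1) div 2 * A + (q - 1) div 2 * B"
  have "2 * ?y = 2 * ((q + 1) div 2) * A + 2 * ((q - 1) div 2) * B" by (simp only: distrib_left mult.assoc)
  also have "\<dots> = (q + 1) * A + (q - 1) * B" unfolding q1 by (rule refl)
  finally have "2 * ?y = (q + 1) * A + (q - 1) * B" .
  then have xu: "x * u = g ^ (2 * ?y)" by (simp add: A B power_add)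
  show ?thesis unfolding xu
  proof (rule two_primitive_of_coprime)
    fix l assume l: "prime l" "l dvd N div 2"
    then have "l \<in> prime_factors (N div 2)" using half_N_pos by (simp only: in_prime_factors_iff) blast
    then have "l \<in> PA \<union> PB" unfolding prime_factors_half_N_two .
    then consider "l \<in> PA" "l \<notin> PB" | "l \<in> PB" "l \<notin> PA" using PA_PB_disjoint by blast
    then show "\<not> l dvd ?y"
    proof cases
      case 1
      then have d: "l dvd (q + 1) div 2" "\<not> l dvd (q - 1) div 2" unfolding PA_iff PB_iff using l(1) by blast+
      obtain e where e: "q + 1 = l * e" using PA_dvd[OF 1(1)] by blast
      show ?thesis
      proof
        assume "l dvd ?y"
        then have "l dvd (q - 1) div 2 * B" using d(1) by (simp only: dvd_add_right_iff dvd_mult2)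
        then have "l dvd B" using d(2) l(1) by (simp only: prime_dvd_mult_iff) blast
        then obtain C where C: "B = l * C" by blast
        have "(q + 1) div l = e" unfolding e using prime_gt_0_nat[OF l(1)] by simp
        then have "u ^ ((q + 1) div l) = g ^ (N * C)"
          unfolding B C N2 e power_mult[symmetric] by (simp only: mult_ac)
        then show False using u(2)[OF 1(1)] by (simp add: power_eq_1_iff)
      qed
    next
      case 2
      then have d: "l dvd (q - 1) div 2" "\<not> l dvd (q + 1) div 2" unfolding PA_iff PB_iff using l(1) by blast+
      obtain e where e: "q - 1 = l * e" using PB_dvd[OF 2(1)] by blast
      show ?thesis
      proof
        assume "l dvd ?y"
        then have "l dvd (q + 1) div 2 * A" using d(1) by (simp only: dvd_add_left_iff dvd_mult2)
        then have "l dvd A" using d(2) l(1) by (simp only: prime_dvd_mult_iff) blast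
        then obtain C where C: "A = l * C" by blast
        have "(q - 1) div l = e" unfolding e using prime_gt_0_nat[OF l(1)] by simp
        then have "x ^ ((q - 1) div l) = g ^ (N * C)"
          unfolding A C N2 e power_mult[symmetric] by (simp only: mult_ac)
        then show False using x(2)[OF 2(1)] by (simp add: power_eq_1_iff)
      qed
    qed
  qed
qed

text \<open>For an element of norm one the conjugate \<open>u ^ q\<close> is the inverse
  \<open>v\<close>.\<close>

lemma trace_product:
  assumes "x \<in> base" "u * v = 1" "u ^ (q + 1) = 1"
  shows "Tr (x * u) = x * (u + v)"
proof -
  have "u * u ^ q = u * v" using assms by simp
  then have "u ^ q = v" using assms(2) by (metis mult_left_cancel mult_zero_left zero_neq_one)
  then have "Tr u = u + v" unfolding field_trace_def n2 by (simp add: eval_nat_numeral lessThan_Suc add.commute)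
  then show ?thesis using trace_mult_base[OF assms(1)] by simp
qed

lemma two_primitive_factor:
  assumes "r_primitive 2 z"
  shows "\<exists>x u. z = x * u \<and> x \<in> base - {0} \<and> (\<forall>l\<in>PB. x ^ ((q - 1) div l) \<noteq> 1) \<and>
    u ^ (q + 1) = 1 \<and> (\<forall>l\<in>PA. u ^ ((q + 1) div l) \<noteq> 1)"
proof -
  have N2: "N = (q - 1) * (q + 1)" using N_eq(1) m_two by simp
  have "z \<noteq> 0" using assms by (simp add: r_primitive_def)
  then obtain k where k: "z = g ^ k" using ex_pow by blast
  then have gcd: "gcd k N = 2" using assms two_primitive_power_iff[OF even_N] by simp
  then obtain y where y: "k = 2 * y" by (metis dvdE gcd_dvd1)
  have cop: "\<not> l dvd y" if l: "prime l" "l dvd N div 2" for l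
  proof
    assume "l dvd y"
    then have "2 * l dvd 2 * y" "2 * l dvd 2 * (N div 2)" using l by (simp_all only: mult_dvd_mono dvd_refl)
    then have "2 * l dvd gcd k N" using y even_N by simp
    then have "l dvd 1" using gcd by simp
    then show False using l by (simp add: not_prime_unit)
  qed
  \<comment> \<open>The exponents add up to \<open>(q * q + 1) * y = N * y + 2 * y\<close>, so the
    product is \<open>z\<close> again.\<close>
  let ?x = "g ^ ((q + 1) * y)" and ?u = "g ^ ((q - 1) * (q * y))"
  have "(q + 1) * y + (q - 1) * (q * y) = N * y + k"
  proof -
    obtain r where "q = Suc r" using q_gt_1 by (cases q) auto
    then show ?thesis unfolding y N2 by (simp add: algebra_simps)
  qed
  then have "?x * ?u = g ^ (N * y + k)" by (simp only: power_add[symmetric])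
  also have "\<dots> = z" by (simp add: k power_add power_mult power_N)
  finally have "z = ?x * ?u" by simp
  moreover have "m dvd (q + 1) * y" unfolding m_two by (rule dvd_triv_left)
  then have "?x \<in> base - {0}" by (simp only: base_nonzero_iff Diff_iff singleton_iff power_eq_0_iff g_nonzero) simp
  moreover have "?x ^ ((q - 1) div l) \<noteq> 1" if l: "l \<in> PB" for l
  proof
    have "l \<in> prime_factors (N div 2)" unfolding prime_factors_half_N_two using l by blast
    then have lN: "prime l" "l dvd N div 2" by auto
    obtain c where c: "q - 1 = l * c" using PB_dvd[OF l] by blast
    have d: "(q - 1) div l = c" unfolding c using prime_gt_0_nat[OF lN(1)] by simp
    assume "?x ^ ((q - 1) div l) = 1"
    then have "g ^ ((q + 1) * y * c) = 1" unfolding d by (simp only: power_mult)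
    then have "N dvd (q + 1) * y * c" by (simp only: power_eq_1_iff)
    then have "(q + 1) * c * l dvd (q + 1) * c * y" unfolding N2 c by (simp only: mult_ac)
    moreover have "(q + 1) * c \<noteq> 0" using c q_gt_1 by (intro notI) simp
    ultimately have "l dvd y" by (simp only: dvd_times_left_cancel_iff simp_thms)
    then show False using cop[OF lN] by simp
  qed
  moreover have "?u ^ (q + 1) = g ^ (N * (q * y))" unfolding N2 power_mult[symmetric] by (simp only: mult_ac)
  then have "?u ^ (q + 1) = 1" by (simp add: power_eq_1_iff)
  moreover have "?u ^ ((q + 1) div l) \<noteq> 1" if l: "l \<in> PA" for l
  proof
    have "l \<in> prime_factors (N div 2)" unfolding prime_factors_half_N_two using l by blast
    then have lN: "prime l" "l dvd N div 2" by auto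
    have lq: "l dvd q + 1" using PA_dvd[OF l] by blast
    then obtain c where c: "q + 1 = l * c" by blast
    have d: "(q + 1) div l = c" unfolding c using prime_gt_0_nat[OF lN(1)] by simp
    assume "?u ^ ((q + 1) div l) = 1"
    then have "g ^ ((q - 1) * (q * y) * c) = 1" unfolding d by (simp only: power_mult)
    then have "N dvd (q - 1) * (q * y) * c" by (simp only: power_eq_1_iff)
    then have "(q - 1) * c * l dvd (q - 1) * c * (q * y)" unfolding N2 c by (simp only: mult_ac)
    moreover have "(q - 1) * c \<noteq> 0" using c q_gt_1 by (intro notI) simp
    ultimately have "l dvd q * y" by (simp only: dvd_times_left_cancel_iff simp_thms)
    moreover have "\<not> l dvd q"
    proof
      assume "l dvd q"
      then have "l dvd 1" using lq by (metis dvd_add_right_iff)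
      then show False using lN by (simp add: not_prime_unit)
    qed
    ultimately show False using cop[OF lN] lN(1) by (simp add: prime_dvd_mult_iff)
  qed
  ultimately show ?thesis by blast
qed

end

text \<open>Exponents are passed as binary numerals, so that fast exponentiation is plain pattern matching.\<close>

definition to_num :: "int \<Rightarrow> num" where "to_num k = num_of_nat (nat k)"

lemma to_num_code [code]: "to_num (Int.Pos n) = n"
  by (simp add: to_num_def nat_of_num_inverse flip: nat_of_num_numeral)

lemma nat_of_num_to_num: "0 < k \<Longrightarrow> nat_of_num (to_num k) = nat k"
  by (simp add: to_num_def num_of_nat_inverse)

text \<open>Routing the recursive result through a function lets the evaluation compute it once
  instead of twice.\<close>

definition sq_by :: "('b \<Rightarrow> 'b \<Rightarrow> 'b) \<Rightarrow> 'b \<Rightarrow> 'b" where "sq_by mu x = mu x x"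

fun power_by :: "('b \<Rightarrow> 'b \<Rightarrow> 'b) \<Rightarrow> 'b \<Rightarrow> num \<Rightarrow> 'b" where
  "power_by mu x num.One = x"
| "power_by mu x (num.Bit0 n) = sq_by mu (power_by mu x n)"
| "power_by mu x (num.Bit1 n) = mu (sq_by mu (power_by mu x n)) x"

text \<open>With \<open>V k = w ^ k + 1 / w ^ k\<close>, the indices \<open>k\<close>,
  \<open>k + 1\<close> pass to \<open>2 * k\<close>, \<open>2 * k + 1\<close> here and to
  \<open>2 * k + 1\<close>, \<open>2 * k + 2\<close> in \<open>lucas_step1\<close>, by
  \<open>V (2 * k) = V k ^ 2 - 2\<close> and
  \<open>V (2 * k + 1) = V k * V (k + 1) - V 1\<close>.\<close>

fun lucas_step0 :: "('b \<Rightarrow> 'b \<Rightarrow> 'b) \<Rightarrow> ('b \<Rightarrow> 'b \<Rightarrow> 'b) \<Rightarrow> 'b \<Rightarrow> 'b \<Rightarrow> 'b \<times> 'b \<Rightarrow> 'b \<times> 'b" where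
  "lucas_step0 mu su two t (a, b) = (su (mu a a) two, su (mu a b) t)"

fun lucas_step1 :: "('b \<Rightarrow> 'b \<Rightarrow> 'b) \<Rightarrow> ('b \<Rightarrow> 'b \<Rightarrow> 'b) \<Rightarrow> 'b \<Rightarrow> 'b \<Rightarrow> 'b \<times> 'b \<Rightarrow> 'b \<times> 'b" where
  "lucas_step1 mu su two t (a, b) = (su (mu a b) t, su (mu b b) two)"

text \<open>For \<open>t = w + 1 / w\<close> this computes \<open>w ^ n + 1 / w ^ n\<close> and its successor.\<close>

fun lucas_by :: "('b \<Rightarrow> 'b \<Rightarrow> 'b) \<Rightarrow> ('b \<Rightarrow> 'b \<Rightarrow> 'b) \<Rightarrow> 'b \<Rightarrow> 'b \<Rightarrow> num \<Rightarrow> 'b \<times> 'b" where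
  "lucas_by mu su two t num.One = (t, su (mu t t) two)"
| "lucas_by mu su two t (num.Bit0 n) = lucas_step0 mu su two t (lucas_by mu su two t n)"
| "lucas_by mu su two t (num.Bit1 n) = lucas_step1 mu su two t (lucas_by mu su two t n)"

text \<open>Ensures that for every integer \<open>B\<close> some listed \<open>E\<close> differs
  from \<open>B\<close> modulo all \<open>l\<close>, by branching over the forbidden residue.
  Residues that do not occur remove nothing, so any occurring residue is a harder case.\<close>

fun cover :: "int list \<Rightarrow> int list \<Rightarrow> bool" where
  "cover [] Es = (Es \<noteq> [])"
| "cover (l # ls) Es = (Es \<noteq> [] \<and> list_all (\<lambda>r. cover ls (filter (\<lambda>E. E mod l \<noteq> r) Es)) (map (\<lambda>E. E mod l) Es))"

lemma cover_sound: "cover ls Es \<Longrightarrow> \<exists>E\<in>set Es. \<forall>l\<in>set ls. E mod l \<noteq> B mod l"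
proof (induction ls arbitrary: Es)
  case Nil
  then show ?case by (cases Es) auto
next
  case (Cons l ls)
  define r where "r = (if B mod l \<in> (\<lambda>E. E mod l) ` set Es then B mod l else hd Es mod l)"
  have "Es \<noteq> []" using Cons.prems by simp
  then have "r \<in> (\<lambda>E. E mod l) ` set Es" by (auto simp: r_def)
  then have "cover ls (filter (\<lambda>E. E mod l \<noteq> r) Es)" using Cons.prems by (auto simp: list_all_iff)
  then obtain E where E: "E \<in> set Es" "E mod l \<noteq> r" "\<forall>l\<in>set ls. E mod l \<noteq> B mod l"
    using Cons.IH by fastforce
  have "E mod l \<noteq> B mod l"
  proof (cases "B mod l \<in> (\<lambda>E. E mod l) ` set Es")
    case True
    then show ?thesis using E(2) by (simp add: r_def)
  next
    case False
    then show ?thesis using imageI[OF E(1), of "\<lambda>E. E mod l"] by metis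
  qed
  then show ?case using E by auto
qed

definition all_distinct_by :: "('b \<Rightarrow> 'b \<Rightarrow> 'b) \<Rightarrow> ('b \<Rightarrow> bool) \<Rightarrow> (int \<Rightarrow> 'b) \<Rightarrow> 'b \<Rightarrow> int list \<Rightarrow> bool" where
  "all_distinct_by su nz f y Ls = list_all (\<lambda>l. nz (su (f l) y)) Ls"

text \<open>\<open>c\<close> has to generate the nonzero elements of the subfield; \<open>w\<close>,
  of norm one, is tested at the primes of \<open>ls3\<close>. For the existence of a 2-primitive
  element the primes of \<open>(q + 1) div 2\<close> suffice. Including 2 makes \<open>w\<close> a
  generator of the norm-one group, as the exact sets of traces require.\<close>

definition generators_ok where
  "generators_ok mu su un two nz (q::int) c t ls1 ls2 ls3 \<longleftrightarrow>
     2 * prod_list ls1 = q - 1 \<and> 2 * prod_list ls2 = q + 1 \<and>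
     nz c \<and> all_distinct_by su nz (\<lambda>l. power_by mu c (to_num ((q - 1) div l))) un (remdups (2 # ls1)) \<and>
     fst (lucas_by mu su two t (to_num (q + 1))) = two \<and>
     all_distinct_by su nz (\<lambda>l. fst (lucas_by mu su two t (to_num ((q + 1) div l)))) two (remdups ls3)"

definition prime_to :: "int list \<Rightarrow> int \<Rightarrow> bool" where
  "prime_to ls k \<longleftrightarrow> list_all (\<lambda>l. k mod l \<noteq> 0) ls"

text \<open>For \<open>b = c ^ B\<close> the candidate is \<open>c ^ (B - E) * w ^ k\<close>, which
  has trace \<open>b\<close>. It is 2-primitive if \<open>k\<close> avoids the primes of
  \<open>ls2\<close> and \<open>B - E\<close> those of \<open>ls1\<close>; since \<open>B\<close> is
  arbitrary, the \<open>E\<close> must form a cover.\<close>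

definition witnesses_ok where
  "witnesses_ok mu su two c t ls1 ls2 kE \<longleftrightarrow>
     list_all (\<lambda>(k, E). 0 < k \<and> 0 < E \<and> prime_to ls2 k \<and>
       fst (lucas_by mu su two t (to_num k)) = power_by mu c (to_num E)) kE \<and>
     cover (remdups ls1) (map snd kE)"

definition products_in :: "('b \<Rightarrow> 'b \<Rightarrow> 'b) \<Rightarrow> 'b list \<Rightarrow> 'b list \<Rightarrow> 'b list \<Rightarrow> bool" where
  "products_in mu Xs Vs tg \<longleftrightarrow> list_all (\<lambda>x. list_all (\<lambda>v. List.member tg (mu x v)) Vs) Xs \<and>
     list_all (\<lambda>b. list_ex (\<lambda>x. list_ex (\<lambda>v. mu x v = b) Vs) Xs) tg"

definition traces_ok where
  "traces_ok mu su two (q::int) c t ls1 ls2 tg \<longleftrightarrow>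
     products_in mu (map (\<lambda>k. power_by mu c (to_num k)) (filter (prime_to ls1) [1..q - 1]))
       (map (\<lambda>k. fst (lucas_by mu su two t (to_num k))) (filter (prime_to ls2) [1..q + 1])) tg"

lemma prime_dvd_prod_list_int:
  fixes ls :: "int list"
  assumes "prime l" "int l dvd prod_list ls" "\<forall>e\<in>set ls. prime e"
  shows "int l \<in> set ls"
proof -
  have p: "prime (int l)" using assms(1) by simp
  show ?thesis using assms(2,3)
  proof (induction ls)
    case Nil
    then show ?case using p by (simp add: not_prime_unit)
  next
    case (Cons e ls)
    then have "int l dvd e \<or> int l dvd prod_list ls" using p by (simp add: prime_dvd_mult_iff)
    then show ?case using Cons primes_dvd_imp_eq[OF p, of e] by auto
  qed
qed

text \<open>Computable representations of the subfield. They need not be faithful: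
  \<open>\<phi>\<close> has to respect the operations, and \<open>nz\<close> has to guarantee a
  nonzero image.\<close>

locale base_model = quadratic_trace_field +
  fixes \<phi> :: "'b \<Rightarrow> 'a" and mu su :: "'b \<Rightarrow> 'b \<Rightarrow> 'b" and un two :: 'b and nz :: "'b \<Rightarrow> bool"
  assumes phi_mult: "\<phi> (mu x y) = \<phi> x * \<phi> y" and phi_diff: "\<phi> (su x y) = \<phi> x - \<phi> y"
    and phi_1: "\<phi> un = 1" and phi_2: "\<phi> two = 2" and phi_nonzero: "nz x \<Longrightarrow> \<phi> x \<noteq> 0"
    and phi_base: "\<phi> x \<in> base"
begin

lemma phi_power: "\<phi> (power_by mu x k) = \<phi> x ^ nat_of_num k"
  by (induction k) (simp_all add: phi_mult sq_by_def power_add mult_ac)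

lemma phi_lucas:
  assumes "w * v = 1" "w + v = \<phi> t"
  shows "\<phi> (fst (lucas_by mu su two t k)) = w ^ nat_of_num k + v ^ nat_of_num k"
    "\<phi> (snd (lucas_by mu su two t k)) = w ^ Suc (nat_of_num k) + v ^ Suc (nat_of_num k)"
proof -
  have "\<phi> (fst (lucas_by mu su two t k)) = w ^ nat_of_num k + v ^ nat_of_num k \<and>
    \<phi> (snd (lucas_by mu su two t k)) = w ^ Suc (nat_of_num k) + v ^ Suc (nat_of_num k)"
  proof (induction k)
    case One
    have "(w + v) * (w + v) - 2 = w * w + v * v + 2 * (w * v - 1)" by (simp add: algebra_simps)
    then have "(w + v) * (w + v) - 2 = w * w + v * v" using assms(1) by simp
    then show ?case by (simp add: phi_mult phi_diff phi_2 flip: assms(2))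
  next
    case (Bit0 k)
    define W V where "W = w ^ nat_of_num k" and "V = v ^ nat_of_num k"
    have "W * V = 1" unfolding W_def V_def using assms(1) by (simp flip: power_mult_distrib)
    moreover have "(W + V) * (W + V) - 2 = W * W + V * V + 2 * (W * V - 1)"
      "(W + V) * (w * W + v * V) - (w + v) = w * (W * W) + v * (V * V) + (W * V - 1) * (w + v)"
      by (simp_all add: algebra_simps)
    ultimately have "(W + V) * (W + V) - 2 = W * W + V * V"
      "(W + V) * (w * W + v * V) - (w + v) = w * (W * W) + v * (V * V)"
      using assms(1) by simp_all
    then show ?case using Bit0.IH
      by (cases "lucas_by mu su two t k")
        (simp add: phi_mult phi_diff phi_2 power_add W_def[symmetric] V_def[symmetric] flip: assms(2))
  next
    case (Bit1 k)
    define W V where "W = w ^ nat_of_num k" and "V = v ^ nat_of_num k"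
    have "W * V = 1" unfolding W_def V_def using assms(1) by (simp flip: power_mult_distrib)
    moreover have "(W + V) * (w * W + v * V) - (w + v) = w * (W * W) + v * (V * V) + (W * V - 1) * (w + v)"
      "(w * W + v * V) * (w * W + v * V) - 2 = w * (w * (W * W)) + v * (v * (V * V)) + 2 * (w * v * (W * V) - 1)"
      by (simp_all add: algebra_simps)
    ultimately have "(W + V) * (w * W + v * V) - (w + v) = w * (W * W) + v * (V * V)"
      "(w * W + v * V) * (w * W + v * V) - 2 = w * (w * (W * W)) + v * (v * (V * V))"
      using assms(1) by simp_all
    then show ?case using Bit1.IH
      by (cases "lucas_by mu su two t k")
        (simp add: phi_mult phi_diff phi_2 power_add W_def[symmetric] V_def[symmetric] flip: assms(2))
  qed
  then show "\<phi> (fst (lucas_by mu su two t k)) = w ^ nat_of_num k + v ^ nat_of_num k"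
    "\<phi> (snd (lucas_by mu su two t k)) = w ^ Suc (nat_of_num k) + v ^ Suc (nat_of_num k)" by auto
qed

text \<open>Both sides amount to \<open>(w ^ k - 1) ^ 2 = 0\<close>. The order of \<open>w\<close>,
  an element of the large field, can therefore be tested on traces computed in the subfield.\<close>

lemma sum_inverse_eq_2_iff: "w * v = 1 \<Longrightarrow> w ^ k + v ^ k = 2 \<longleftrightarrow> (w::'a) ^ k = 1"
proof -
  assume "w * v = 1"
  then have WV: "w ^ k * v ^ k = 1" by (simp flip: power_mult_distrib)
  show ?thesis
  proof
    assume S: "w ^ k + v ^ k = 2"
    have "(w ^ k - 1) * (w ^ k - 1) = w ^ k * w ^ k - 2 * w ^ k + 1" by (simp add: algebra_simps)
    also have "\<dots> = w ^ k * w ^ k - (w ^ k + v ^ k) * w ^ k + w ^ k * v ^ k" unfolding S WV by (rule refl)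
    also have "\<dots> = 0" by (simp add: algebra_simps)
    finally have "(w ^ k - 1) * (w ^ k - 1) = 0" .
    then show "w ^ k = 1" by simp
  next
    assume "w ^ k = 1"
    then show "w ^ k + v ^ k = 2" using WV by simp
  qed
qed

context
  fixes c t :: 'b and ls1 ls2 ls3 :: "int list"
  assumes ok: "generators_ok mu su un two nz (int q) c t ls1 ls2 ls3"
    and primes: "\<forall>l\<in>set ls1. prime l" "\<forall>l\<in>set ls2. prime l" and ls3: "set ls2 \<subseteq> set ls3"
begin

lemma halves: "int ((q - 1) div 2) = prod_list ls1" "int ((q + 1) div 2) = prod_list ls2"
proof -
  obtain r where r: "q = 2 * r + 1" using odd_q by (elim oddE)
  then show "int ((q - 1) div 2) = prod_list ls1" "int ((q + 1) div 2) = prod_list ls2"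
    using ok by (auto simp: generators_ok_def)
qed

lemma PB_list: "l \<in> PB \<Longrightarrow> int l \<in> set ls1"
  by (rule prime_dvd_prod_list_int) (auto simp: primes simp flip: halves)

lemma PA_list: "l \<in> PA \<Longrightarrow> int l \<in> set ls2"
  by (rule prime_dvd_prod_list_int) (auto simp: primes simp flip: halves)

lemma dvd_q_minus_1: "prime l \<Longrightarrow> l dvd q - 1 \<Longrightarrow> int l \<in> set (2 # ls1)"
proof -
  assume l: "prime l" "l dvd q - 1"
  have "int (q - 1) = int (2 * ((q - 1) div 2))" using odd_q by simp
  also have "\<dots> = prod_list (2 # ls1)" using halves(1) by simp
  finally show ?thesis using l primes by (intro prime_dvd_prod_list_int) (auto simp flip: int_dvd_int_iff)
qed

lemma dvd_q_plus_1: "prime l \<Longrightarrow> l dvd q + 1 \<Longrightarrow> int l \<in> set (2 # ls2)"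
proof -
  assume l: "prime l" "l dvd q + 1"
  have "int (q + 1) = int (2 * ((q + 1) div 2))" using odd_q by simp
  also have "\<dots> = prod_list (2 # ls2)" using halves(2) by simp
  finally show ?thesis using l primes by (intro prime_dvd_prod_list_int) (auto simp flip: int_dvd_int_iff)
qed

lemma power_div_num:
  assumes "l > 0" "l dvd r" "r > 0"
  shows "nat_of_num (to_num (int r div int l)) = r div l"
proof -
  have "int r div int l = int (r div l)" by (simp add: zdiv_int)
  moreover have "0 < r div l" using assms by (simp add: div_greater_zero_iff dvd_imp_le)
  ultimately show ?thesis by (simp add: nat_of_num_to_num)
qed

lemma c_nonzero: "\<phi> c \<in> base - {0}"
  using ok phi_nonzero[of c] phi_base by (simp add: generators_ok_def)

lemma c_order: "prime l \<Longrightarrow> l dvd q - 1 \<Longrightarrow> \<phi> c ^ ((q - 1) div l) \<noteq> 1"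
proof -
  assume l: "prime l" "l dvd q - 1"
  have "nz (su (power_by mu c (to_num ((int q - 1) div int l))) un)"
    using ok dvd_q_minus_1[OF l] by (auto simp: generators_ok_def all_distinct_by_def list_all_iff)
  then have "\<phi> (power_by mu c (to_num (int (q - 1) div int l))) \<noteq> 1"
    using phi_nonzero q_gt_1 by (force simp: phi_diff phi_1 of_nat_diff)
  then show ?thesis using power_div_num[of l "q - 1"] l q_gt_1 by (simp add: phi_power prime_gt_0_nat)
qed

lemma base_power_c: "x \<in> base - {0} \<Longrightarrow> \<exists>k\<ge>1. k \<le> q - 1 \<and> x = \<phi> c ^ k"
  using root_of_unity_power[of "q - 1" x "\<phi> c"] power_q_minus_1 c_nonzero c_order N_eq(1) by auto

lemma c_power_ok: "l \<in> PB \<Longrightarrow> \<not> l dvd k \<Longrightarrow> (\<phi> c ^ k) ^ ((q - 1) div l) \<noteq> 1"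
  using PB_dvd[of l] power_q_minus_1[OF c_nonzero] c_order[of l] by (intro power_div_prime_neq_1) auto

context
  fixes w v :: 'a
  assumes wv: "w * v = 1" "w + v = \<phi> t"
begin

lemma w_order: "w ^ (q + 1) = 1" "l > 0 \<Longrightarrow> int l \<in> set ls3 \<Longrightarrow> l dvd q + 1 \<Longrightarrow> w ^ ((q + 1) div l) \<noteq> 1"
proof -
  have "\<phi> (fst (lucas_by mu su two t (to_num (int q + 1)))) = 2"
    using ok by (simp add: generators_ok_def phi_2)
  then have "w ^ nat_of_num (to_num (int q + 1)) + v ^ nat_of_num (to_num (int q + 1)) = 2"
    by (simp only: phi_lucas[OF wv])
  moreover have "nat_of_num (to_num (int q + 1)) = q + 1" by (simp add: nat_of_num_to_num)
  ultimately show "w ^ (q + 1) = 1" using sum_inverse_eq_2_iff[OF wv(1)] by metis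
  assume l: "l > 0" "int l \<in> set ls3" "l dvd q + 1"
  then have "nz (su (fst (lucas_by mu su two t (to_num ((int q + 1) div int l)))) two)"
    using ok by (auto simp: generators_ok_def all_distinct_by_def list_all_iff)
  then have "\<phi> (fst (lucas_by mu su two t (to_num ((int q + 1) div int l)))) \<noteq> 2"
    using phi_nonzero by (force simp: phi_diff phi_2)
  moreover have "nat_of_num (to_num ((int q + 1) div int l)) = (q + 1) div l"
    using power_div_num[of l "q + 1"] l by (simp add: add.commute)
  ultimately show "w ^ ((q + 1) div l) \<noteq> 1" using sum_inverse_eq_2_iff[OF wv(1)] by (simp add: phi_lucas[OF wv])
qed

lemma product_ok:
  assumes "x \<in> base - {0}" "\<And>l. l \<in> PB \<Longrightarrow> x ^ ((q - 1) div l) \<noteq> 1" "\<And>l. l \<in> PA \<Longrightarrow> \<not> l dvd k"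
  shows "r_primitive 2 (x * w ^ k)" "Tr (x * w ^ k) = x * (w ^ k + v ^ k)"
proof -
  have 1: "(w ^ k) ^ (q + 1) = 1" using w_order(1) by (metis mult.commute power_mult power_one)
  have "(w ^ k) ^ ((q + 1) div l) \<noteq> 1" if l: "l \<in> PA" for l
    using PA_dvd[OF l] w_order(1) w_order(2)[of l] PA_list[OF l] ls3 assms(3)[OF l] by (intro power_div_prime_neq_1) auto
  then show "r_primitive 2 (x * w ^ k)" using assms 1 by (intro two_primitive_product) auto
  have "w ^ k * v ^ k = 1" using wv(1) by (simp flip: power_mult_distrib)
  then show "Tr (x * w ^ k) = x * (w ^ k + v ^ k)" using assms(1) 1 by (intro trace_product) auto
qed

end

lemma prime_to_iff: "prime_to ls (int k) \<longleftrightarrow> (\<forall>l. int l \<in> set ls \<longrightarrow> \<not> l dvd k)" if "\<forall>l\<in>set ls. prime l"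
proof -
  have "(\<forall>l\<in>set ls. \<not> l dvd int k) \<longleftrightarrow> (\<forall>l. int l \<in> set ls \<longrightarrow> \<not> l dvd k)"
  proof (intro iffI allI ballI impI)
    fix l assume l: "\<forall>l. int l \<in> set ls \<longrightarrow> \<not> l dvd k" "l \<in> set ls"
    then have "l > 0" using that prime_gt_0_int by blast
    then show "\<not> l dvd int k" using l by (metis int_dvd_int_iff int_nat_eq less_imp_le nat_0_le)
  qed (metis int_dvd_int_iff)
  then show ?thesis by (simp add: prime_to_def list_all_iff mod_eq_0_iff_dvd)
qed

lemma witnesses_sound:
  assumes wit: "witnesses_ok mu su two c t ls1 ls2 kE" and b: "b \<in> base - {0}"
  shows "\<exists>x. r_primitive 2 x \<and> Tr x = b"
proof -
  obtain w v where wv: "w * v = 1" "w + v = \<phi> t" using ex_norm_one[OF phi_base] by blast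
  obtain B where B: "b = \<phi> c ^ B" using base_power_c[OF b] by blast
  have "cover (remdups ls1) (map snd kE)" using wit by (simp add: witnesses_ok_def)
  then obtain k E where kE: "(k, E) \<in> set kE" "\<forall>l\<in>set ls1. E mod l \<noteq> int B mod l"
    using cover_sound[of "remdups ls1" "map snd kE" "int B"] by auto
  have "0 < k \<and> 0 < E \<and> prime_to ls2 k \<and> fst (lucas_by mu su two t (to_num k)) = power_by mu c (to_num E)"
    using wit kE(1) by (auto simp: witnesses_ok_def list_all_iff)
  then have h: "0 < k" "0 < E" "prime_to ls2 k" and eq: "\<phi> (fst (lucas_by mu su two t (to_num k))) = \<phi> (power_by mu c (to_num E))"
    by simp_all
  have V: "w ^ nat k + v ^ nat k = \<phi> c ^ nat E"
    using eq h by (simp add: phi_lucas[OF wv] phi_power nat_of_num_to_num)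
  \<comment> \<open>Stands for \<open>B - E\<close> modulo \<open>q - 1\<close>, written without
    subtraction of exponents.\<close>
  define D where "D = B + (q - 2) * nat E"
  let ?x = "\<phi> c ^ D"
  have c0: "\<phi> c \<noteq> 0" and cq: "\<phi> c ^ (q - 1) = 1" using c_nonzero power_q_minus_1 by auto
  have nD: "\<not> l dvd D" if l: "l \<in> PB" for l
  proof
    assume "l dvd D"
    have "l dvd 2 * ((q - 1) div 2)" using l by auto
    then have "l dvd q - 1" using odd_q by simp
    have "int D = int B + (int q - 2) * E" using q_gt_1 h(2) by (simp add: D_def of_nat_diff)
    then have "int B - E = int D - (int q - 1) * E" by (simp add: algebra_simps)
    moreover have "int l dvd int D" "int l dvd int q - 1"
      using \<open>l dvd D\<close> \<open>l dvd q - 1\<close> q_gt_1 by (simp_all add: of_nat_diff flip: int_dvd_int_iff)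
    ultimately have "int l dvd int B - E" by simp
    then have "E mod int l = int B mod int l" by (metis mod_eq_dvd_iff)
    then show False using kE(2) PB_list[OF l] by blast
  qed
  have xl: "?x ^ ((q - 1) div l) \<noteq> 1" if "l \<in> PB" for l by (rule c_power_ok[OF that nD[OF that]])
  have xb: "?x \<in> base - {0}" using c_nonzero base_closed_power by simp
  have kl: "\<And>l. l \<in> PA \<Longrightarrow> \<not> l dvd nat k"
    using PA_list prime_to_iff[OF primes(2), of "nat k"] h by auto
  have "?x * (w ^ nat k + v ^ nat k) = \<phi> c ^ (B + (q - 1) * nat E)"
  proof -
    have "D + nat E = B + (q - 1) * nat E"
    proof -
      obtain r where "q = Suc (Suc r)" using q_gt_1 by (metis One_nat_def Suc_lessE less_imp_Suc_add add_Suc_right)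
      then show ?thesis by (simp add: D_def)
    qed
    then show ?thesis unfolding V by (simp flip: power_add)
  qed
  also have "\<dots> = b" unfolding B power_add power_mult cq by simp
  finally show ?thesis using product_ok[OF wv xb xl kl] by metis
qed

lemma traces_sound:
  assumes tr: "traces_ok mu su two (int q) c t ls1 ls2 tg" and full: "2 \<in> set ls3"
  shows "{Tr x | x. r_primitive 2 x} = \<phi> ` set tg"
proof -
  obtain w v where wv: "w * v = 1" "w + v = \<phi> t" using ex_norm_one[OF phi_base] by blast
  define Xs where "Xs = map (\<lambda>k. power_by mu c (to_num k)) (filter (prime_to ls1) [1..int q - 1])"
  define Vs where "Vs = map (\<lambda>k. fst (lucas_by mu su two t (to_num k))) (filter (prime_to ls2) [1..int q + 1])"
  have prod: "products_in mu Xs Vs tg" using tr unfolding traces_ok_def Xs_def Vs_def .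
  show ?thesis
  proof (intro equalityI subsetI)
    fix b assume "b \<in> {Tr x | x. r_primitive 2 x}"
    then obtain z where z: "b = Tr z" "r_primitive 2 z" by blast
    obtain x u where xu: "z = x * u" "x \<in> base - {0}" "\<forall>l\<in>PB. x ^ ((q - 1) div l) \<noteq> 1"
      "u ^ (q + 1) = 1" "\<forall>l\<in>PA. u ^ ((q + 1) div l) \<noteq> 1" using two_primitive_factor[OF z(2)] by blast
    obtain A where A: "A \<ge> 1" "A \<le> q - 1" "x = \<phi> c ^ A" using base_power_c[OF xu(2)] by blast
    \<comment> \<open>With 2 included, \<open>w\<close> is tested at all primes of
      \<open>q + 1\<close>, so every element of norm one is a power of it.\<close>
    have word: "w ^ ((q + 1) div l) \<noteq> 1" if "prime l" "l dvd q + 1" for l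
    proof -
      have "int l \<in> set ls3" using dvd_q_plus_1[OF that] ls3 full by auto
      then show ?thesis using w_order(2)[OF wv] that prime_gt_0_nat by blast
    qed
    have "q + 1 dvd N" unfolding N_eq(1) m_two by (rule dvd_triv_right)
    then obtain k where k: "k \<ge> 1" "k \<le> q + 1" "u = w ^ k"
      using root_of_unity_power[OF _ xu(4) w_order(1)[OF wv]] word by metis
    have nA: "\<not> l dvd A" if l: "int l \<in> set ls1" for l
    proof
      assume "l dvd A"
      then obtain a where a: "A = l * a" by blast
      have pl: "prime l" using primes(1) l by auto
      have "int l dvd int ((q - 1) div 2)" unfolding halves(1) using l by (rule prod_list_dvd)
      then have ld: "l dvd (q - 1) div 2" by (simp only: int_dvd_int_iff)
      then have lPB: "l \<in> PB" using pl half_q_pos by (simp add: in_prime_factors_iff)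
      have "l dvd 2 * ((q - 1) div 2)" using ld by simp
      then have "l dvd q - 1" using odd_q by simp
      then have "x ^ ((q - 1) div l) = (\<phi> c ^ (q - 1)) ^ a"
        by (auto simp: A(3) a mult_ac simp flip: power_mult elim!: dvdE)
      then show False using xu(3) lPB power_q_minus_1[OF c_nonzero] by simp
    qed
    have nk: "\<not> l dvd k" if l: "int l \<in> set ls2" for l
    proof
      assume "l dvd k"
      then obtain a where a: "k = l * a" by blast
      have pl: "prime l" using primes(2) l by auto
      have "int l dvd int ((q + 1) div 2)" unfolding halves(2) using l by (rule prod_list_dvd)
      then have ld: "l dvd (q + 1) div 2" by (simp only: int_dvd_int_iff)
      then have lPA: "l \<in> PA" using pl half_q_plus_pos by (simp add: in_prime_factors_iff)
      have "l dvd 2 * ((q + 1) div 2)" using ld by simp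
      then have "l dvd q + 1" using odd_q by simp
      then obtain e where e: "q + 1 = l * e" by blast
      have "u ^ ((q + 1) div l) = (w ^ (q + 1)) ^ a"
        unfolding k(3) a power_mult[symmetric] e using pl by (simp add: prime_gt_0_nat mult_ac)
      then show False using xu(5) lPA w_order(1)[OF wv] by simp
    qed
    have uv: "w ^ k * v ^ k = 1" using wv(1) by (simp flip: power_mult_distrib)
    have "b = x * (w ^ k + v ^ k)"
      unfolding z(1) xu(1) using trace_product[of x u "v ^ k"] xu k(3) uv by simp
    also have "w ^ k + v ^ k = \<phi> (fst (lucas_by mu su two t (to_num (int k))))"
      using k(1) by (simp add: phi_lucas[OF wv] nat_of_num_to_num)
    also have "x = \<phi> (power_by mu c (to_num (int A)))"
      using A by (simp add: phi_power nat_of_num_to_num)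
    finally have "b = \<phi> (mu (power_by mu c (to_num (int A))) (fst (lucas_by mu su two t (to_num (int k)))))"
      by (simp add: phi_mult)
    moreover have "power_by mu c (to_num (int A)) \<in> set Xs"
      unfolding Xs_def using A prime_to_iff[OF primes(1)] nA by (auto simp: of_nat_diff)
    moreover have "fst (lucas_by mu su two t (to_num (int k))) \<in> set Vs"
      unfolding Vs_def using k prime_to_iff[OF primes(2)] nk by auto
    ultimately show "b \<in> \<phi> ` set tg" using prod by (auto simp: products_in_def list_all_iff)
  next
    fix b assume "b \<in> \<phi> ` set tg"
    then obtain A k where A: "A \<in> {1..int q - 1}" "prime_to ls1 A" and k: "k \<in> {1..int q + 1}" "prime_to ls2 k"
      and b: "b = \<phi> (mu (power_by mu c (to_num A)) (fst (lucas_by mu su two t (to_num k))))"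
      using prod unfolding products_in_def Xs_def Vs_def by (auto simp: list_all_iff list_ex_iff)
    have b': "b = \<phi> c ^ nat A * (w ^ nat k + v ^ nat k)"
      unfolding b using A k by (simp add: phi_mult phi_power phi_lucas[OF wv] nat_of_num_to_num)
    have 1: "\<not> l dvd nat A" if "l \<in> PB" for l
      using PB_list[OF that] prime_to_iff[OF primes(1), of "nat A"] A by auto
    have 2: "\<not> l dvd nat k" if "l \<in> PA" for l
      using PA_list[OF that] prime_to_iff[OF primes(2), of "nat k"] k by auto
    have xb: "\<phi> c ^ nat A \<in> base - {0}"
      using c_nonzero phi_base[of "power_by mu c (to_num A)"] A by (simp add: phi_power nat_of_num_to_num)
    show "b \<in> {Tr x | x. r_primitive 2 x}"
      using product_ok[OF wv xb c_power_ok[OF _ 1] 2] b' by (intro CollectI exI[of _ "\<phi> c ^ nat A * w ^ nat k"]) simp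
  qed
qed

end
end

text \<open>An entry is \<open>(q, c, t, ls1, ls2, kE)\<close>: \<open>c\<close> is a primitive root of \<open>q\<close>, \<open>t = w + 1 / w\<close> for an
  element \<open>w\<close> of norm one, \<open>ls1\<close> and \<open>ls2\<close> list the prime factors of \<open>(q - 1) div 2\<close> and \<open>(q + 1) div 2\<close>
  with multiplicity, and \<open>(k, E)\<close> records \<open>w ^ k + 1 / w ^ k = c ^ E\<close>.\<close>

definition prime_certs_0 :: "(int \<times> int \<times> int \<times> int list \<times> int list \<times> (int \<times> int) list) list" where
  "prime_certs_0 = [
    (17, 3, 3, [2, 2, 2], [3, 3], [(1, 1), (4, 4)]), (19, 2, 6, [3, 3], [2, 5], [(1, 14), (3, 3)]),
    (23, 5, 3, [11], [2, 2, 3], [(1, 16), (5, 6)]), (29, 2, 4, [2, 7], [3, 5], [(1, 2), (2, 13), (4, 24), (7, 17)]),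
    (37, 2, 3, [2, 3, 3], [19], [(1, 26), (3, 17), (4, 24), (7, 21)]),
    (41, 6, 8, [2, 2, 5], [3, 7], [(1, 38), (2, 14), (4, 7), (8, 9)]),
    (43, 3, 3, [3, 7], [2, 11], [(3, 29), (5, 7), (9, 24)]), (47, 5, 8, [23], [2, 2, 2, 3], [(1, 8), (5, 14)]),
    (53, 2, 3, [2, 13], [3, 3, 3], [(1, 17), (2, 14), (4, 44), (7, 21)]),
    (59, 2, 9, [29], [2, 3, 5], [(1, 42), (7, 26)]),
    (61, 2, 5, [2, 3, 5], [31], [(1, 22), (2, 57), (3, 38), (6, 24), (13, 53), (14, 25)]),
    (67, 2, 3, [3, 11], [2, 17], [(1, 39), (3, 13), (5, 26)]),
    (71, 7, 5, [5, 7], [2, 2, 3, 3], [(1, 28), (5, 46), (11, 62)]),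
    (73, 5, 3, [2, 2, 3, 3], [37], [(1, 6), (2, 33), (3, 20), (4, 31)]),
    (79, 3, 4, [3, 13], [2, 2, 2, 5], [(1, 8), (3, 42), (7, 22)]), (83, 2, 3, [41], [2, 3, 7], [(1, 72), (5, 30)])]"

definition prime_certs_1 :: "(int \<times> int \<times> int \<times> int list \<times> int list \<times> (int \<times> int) list) list" where
  "prime_certs_1 = [
    (89, 3, 4, [2, 2, 11], [3, 3, 5], [(1, 32), (2, 9), (4, 64), (7, 3)]),
    (97, 5, 3, [2, 2, 2, 2, 3], [7, 7], [(1, 70), (2, 31), (3, 78), (5, 59)]),
    (101, 2, 6, [2, 5, 5], [3, 17], [(1, 70), (2, 31), (4, 42), (5, 95)]),
    (103, 5, 3, [3, 17], [2, 2, 13], [(1, 39), (3, 20), (11, 7)]),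
    (109, 6, 6, [2, 3, 3, 3], [5, 11], [(1, 1), (2, 42), (3, 28), (9, 93)]),
    (113, 3, 4, [2, 2, 2, 7], [3, 19], [(1, 24), (2, 20), (5, 53), (7, 3)]),
    (127, 3, 3, [3, 3, 7], [2, 2, 2, 2, 2, 2], [(1, 1), (3, 74), (9, 117)]),
    (131, 2, 6, [5, 13], [2, 3, 11], [(1, 73), (7, 57), (13, 64)]),
    (137, 3, 3, [2, 2, 17], [3, 23], [(1, 1), (2, 42), (4, 19), (5, 120)]),
    (139, 2, 6, [3, 23], [2, 5, 7], [(1, 42), (9, 62), (11, 40)]),
    (149, 2, 4, [2, 37], [3, 5, 5], [(1, 2), (2, 143), (4, 130), (7, 17)]),
    (151, 6, 4, [3, 5, 5], [2, 2, 19], [(1, 140), (3, 31), (29, 9)]),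
    (157, 5, 3, [2, 3, 13], [79], [(1, 82), (2, 147), (3, 149), (4, 92), (5, 103), (7, 114)]),
    (173, 2, 3, [2, 43], [3, 29], [(1, 27), (2, 95), (4, 64), (7, 110)])]"

definition prime_certs_2 :: "(int \<times> int \<times> int \<times> int list \<times> int list \<times> (int \<times> int) list) list" where
  "prime_certs_2 = [
    (181, 2, 6, [2, 3, 3, 5], [7, 13], [(1, 57), (2, 176), (3, 175), (5, 48), (10, 29), (11, 22)]),
    (191, 19, 5, [5, 19], [2, 2, 2, 2, 2, 3], [(1, 50), (5, 141), (7, 32)]),
    (197, 2, 3, [2, 7, 7], [3, 3, 11], [(1, 181), (2, 146), (4, 66), (5, 95)]),
    (199, 3, 4, [3, 3, 11], [2, 2, 5, 5], [(1, 14), (3, 186), (7, 13)]),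
    (211, 2, 6, [3, 5, 7], [2, 53], [(1, 44), (3, 39), (5, 40), (21, 182), (25, 3)]),
    (229, 6, 11, [2, 3, 19], [5, 23], [(1, 162), (2, 167), (3, 20), (4, 211), (6, 214), (12, 27)]),
    (239, 7, 5, [7, 17], [2, 2, 2, 3, 5], [(1, 138), (7, 146), (11, 203)]),
    (241, 7, 16, [2, 2, 2, 3, 5], [11, 11], [(1, 40), (3, 122), (4, 143), (6, 145), (7, 18), (14, 57)]),
    (269, 2, 4, [2, 67], [3, 3, 3, 5], [(1, 2), (2, 20), (4, 123), (8, 9)]),
    (281, 3, 4, [2, 2, 5, 7], [3, 47], [(1, 128), (2, 106), (4, 33), (7, 40), (14, 231), (17, 95)]),
    (307, 5, 6, [3, 3, 17], [2, 7, 11], [(1, 174), (5, 149), (13, 175)]),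
    (311, 17, 15, [5, 31], [2, 2, 3, 13], [(1, 50), (5, 256), (7, 12)]),
    (331, 3, 6, [3, 5, 11], [2, 83], [(1, 122), (3, 260), (7, 276), (13, 159), (19, 43)])]"

definition prime_certs_3 :: "(int \<times> int \<times> int \<times> int list \<times> int list \<times> (int \<times> int) list) list" where
  "prime_certs_3 = [
    (337, 10, 7, [2, 2, 2, 3, 7], [13, 13], [(1, 318), (3, 179), (4, 181), (7, 214), (9, 273), (12, 26)]),
    (349, 2, 5, [2, 3, 29], [5, 5, 7], [(1, 314), (2, 184), (3, 336), (6, 149), (11, 199), (16, 201)]),
    (373, 2, 7, [2, 3, 31], [11, 17], [(1, 198), (2, 235), (3, 178), (5, 83), (10, 56), (12, 123)]),
    (379, 2, 8, [3, 3, 3, 7], [2, 5, 19], [(1, 3), (9, 233), (21, 28)]),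
    (389, 2, 8, [2, 97], [3, 5, 13], [(1, 3), (2, 298), (4, 81), (14, 82)]),
    (409, 21, 5, [2, 2, 3, 17], [5, 41], [(1, 24), (2, 178), (3, 295), (6, 263), (11, 272), (12, 33)]),
    (419, 2, 9, [11, 19], [2, 3, 5, 7], [(1, 200), (11, 308), (13, 58)]),
    (421, 2, 6, [2, 3, 5, 7], [211], [(3, 345), (5, 69), (6, 312), (10, 313), (17, 118), (25, 409), (36, 304), (38, 290), (46, 347), (48, 236)]),
    (461, 2, 6, [2, 5, 23], [3, 7, 11], [(1, 112), (2, 359), (4, 110), (8, 458), (10, 127), (17, 131)]),
    (463, 3, 3, [3, 7, 11], [2, 2, 2, 29], [(1, 1), (3, 36), (7, 12), (9, 16), (21, 143)]),
    (509, 2, 6, [2, 127], [3, 5, 17], [(1, 10), (2, 409), (4, 411), (7, 306)])]"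

definition prime_certs_4 :: "(int \<times> int \<times> int \<times> int list \<times> int list \<times> (int \<times> int) list) list" where
  "prime_certs_4 = [
    (521, 3, 8, [2, 2, 5, 13], [3, 3, 29], [(1, 434), (2, 450), (4, 347), (5, 371), (7, 149), (13, 236)]),
    (547, 2, 3, [3, 7, 13], [2, 137], [(1, 429), (3, 313), (5, 520), (13, 18), (19, 77)]),
    (569, 3, 5, [2, 2, 71], [3, 5, 19], [(1, 296), (2, 487), (4, 449), (11, 152)]),
    (571, 3, 6, [3, 5, 19], [2, 11, 13], [(1, 546), (3, 245), (5, 493), (7, 429), (17, 197)]),
    (601, 7, 15, [2, 2, 3, 5, 5], [7, 43], [(1, 254), (2, 445), (4, 538), (11, 273), (12, 60), (16, 239)]),
    (617, 3, 3, [2, 2, 7, 11], [3, 103], [(1, 1), (2, 142), (4, 460), (5, 415), (7, 316), (16, 409)]),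
    (631, 3, 4, [3, 3, 5, 7], [2, 2, 79], [(1, 196), (3, 387), (5, 503), (7, 512), (9, 159)]),
    (659, 2, 5, [7, 47], [2, 3, 5, 11], [(1, 52), (7, 229), (13, 197)]),
    (661, 2, 5, [2, 3, 5, 11], [331], [(2, 641), (5, 253), (6, 79), (19, 477), (20, 88), (26, 572), (34, 334), (38, 98), (41, 273), (47, 90)]),
    (701, 2, 6, [2, 5, 5, 7], [3, 3, 3, 13], [(1, 430), (2, 611), (4, 379), (8, 106), (16, 182), (19, 97)])]"

definition prime_certs_5 :: "(int \<times> int \<times> int \<times> int list \<times> int list \<times> (int \<times> int) list) list" where
  "prime_certs_5 = [
    (709, 2, 6, [2, 3, 59], [5, 71], [(1, 173), (2, 98), (3, 307), (6, 147), (9, 430), (16, 606)]),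
    (761, 6, 4, [2, 2, 5, 19], [3, 127], [(1, 692), (2, 489), (4, 283), (5, 446), (8, 365), (19, 54)]),
    (769, 11, 11, [2, 2, 2, 2, 2, 2, 2, 3], [5, 7, 11], [(1, 1), (2, 441), (3, 454), (13, 110)]),
    (859, 2, 6, [3, 11, 13], [2, 5, 43], [(1, 120), (3, 626), (9, 444), (11, 689), (27, 655)]),
    (881, 3, 9, [2, 2, 2, 5, 11], [3, 3, 7, 7], [(1, 2), (2, 799), (4, 370), (8, 94), (20, 751), (23, 873)]),
    (911, 17, 12, [5, 7, 13], [2, 2, 2, 3, 19], [(1, 508), (7, 731), (17, 135), (37, 574)]),
    (1009, 11, 13, [2, 2, 2, 3, 3, 7], [5, 101], [(1, 357), (2, 304), (3, 230), (8, 474), (11, 277), (13, 689)]),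
    (1021, 10, 5, [2, 3, 5, 17], [7, 73], [(9, 242), (20, 534), (23, 909), (27, 500), (30, 131), (34, 990), (37, 43), (46, 607), (50, 148), (57, 725)]),
    (1231, 3, 4, [3, 5, 41], [2, 2, 2, 7, 11], [(1, 908), (3, 302), (5, 634), (9, 631), (13, 420)]),
    (1289, 6, 5, [2, 2, 7, 23], [3, 5, 43], [(1, 790), (2, 168), (4, 489), (7, 618), (8, 695), (13, 1095)])]"

definition prime_certs_6 :: "(int \<times> int \<times> int \<times> int list \<times> int list \<times> (int \<times> int) list) list" where
  "prime_certs_6 = [
    (1301, 2, 12, [2, 5, 5, 13], [3, 7, 31], [(1, 265), (2, 1106), (4, 150), (5, 1038), (8, 1083), (16, 631)]),
    (1429, 6, 6, [2, 3, 7, 17], [5, 11, 13], [(8, 1113), (18, 1297), (19, 596), (23, 377), (41, 24), (49, 778), (51, 896), (63, 259), (71, 1132), (72, 747)]),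
    (1609, 7, 12, [2, 2, 3, 67], [5, 7, 23], [(1, 766), (2, 1511), (3, 1303), (4, 764), (8, 1044), (9, 3)]),
    (1709, 3, 4, [2, 7, 61], [3, 3, 5, 19], [(1, 42), (2, 933), (4, 1356), (7, 133), (8, 44), (11, 1431)]),
    (1741, 2, 5, [2, 3, 5, 29], [13, 67], [(9, 780), (15, 1218), (17, 367), (25, 955), (27, 1328), (34, 1046), (37, 622), (40, 425), (53, 363), (54, 1037)]),
    (1861, 2, 5, [2, 3, 5, 31], [7, 7, 19], [(2, 1537), (5, 876), (16, 1658), (22, 284), (36, 1270), (43, 204), (48, 1325), (50, 1689), (51, 1443), (60, 1109)]),
    (2029, 2, 10, [2, 3, 13, 13], [5, 7, 29], [(1, 1619), (2, 1243), (4, 1260), (8, 1972), (11, 1161), (16, 1940)]),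
    (2281, 7, 5, [2, 2, 3, 5, 19], [7, 163], [(9, 1377), (12, 73), (18, 791), (23, 1870), (25, 1964), (47, 1478), (48, 582), (50, 1878), (52, 849), (57, 755)])]"

definition prime_certs_7 :: "(int \<times> int \<times> int \<times> int list \<times> int list \<times> (int \<times> int) list) list" where
  "prime_certs_7 = [
   
    (2311, 3, 4, [3, 5, 7, 11], [2, 2, 17, 17], [(19, 1880), (27, 1784), (47, 1475), (53, 856), (63, 2080), (65, 546), (71, 217), (73, 1599)]),
    (2521, 17, 9, [2, 2, 3, 3, 5, 7], [13, 97], [(5, 332), (14, 2396), (22, 2189), (28, 2172), (29, 1183), (37, 1403), (40, 2089), (46, 2440), (51, 2487), (53, 1086)]),
    (2729, 3, 4, [2, 2, 11, 31], [3, 5, 7, 13], [(1, 1396), (2, 1661), (8, 532), (16, 214), (17, 1017), (31, 453)]),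
    (3541, 7, 5, [2, 3, 5, 59], [7, 11, 23], [(2, 335), (4, 1809), (19, 2680), (24, 373), (25, 368), (39, 949), (47, 1552), (50, 2904), (54, 2816), (61, 2253)]),
    (4621, 2, 6, [2, 3, 5, 7, 11], [2311], [(1, 1619), (4, 1352), (6, 4042), (17, 864), (18, 4151), (20, 1540), (23, 3656), (24, 327), (28, 169), (30, 1021), (35, 2416), (43, 1173), (45, 3547), (48, 4248)])]"

text \<open>Here \<open>q = p\<^sup>2\<close>, the leading components are \<open>p\<close> and \<open>d\<close>, and \<open>(x, y)\<close> stands for \<open>x + y * s\<close> with \<open>s\<^sup>2 = d\<close>.\<close>

definition square_certs :: "(int \<times> int \<times> (int \<times> int) \<times> (int \<times> int) \<times> int list \<times> int list \<times> (int \<times> int) list) list" where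
  "square_certs = [
    (5, 2, (2, 1), (1, 1), [2, 2, 3], [13], [(1, 10), (2, 23), (3, 7), (5, 2)]),
    (7, -1, (2, 1), (1, 1), [2, 2, 2, 3], [5, 5], [(1, 22), (2, 18), (3, 7), (6, 23)]),
    (11, -1, (4, 1), (2, 1), [2, 2, 3, 5], [61], [(3, 82), (7, 34), (13, 21), (32, 110), (41, 55), (43, 107), (45, 14)]),
    (13, 2, (2, 1), (1, 2), [2, 2, 3, 7], [5, 17], [(1, 17), (2, 110), (3, 19), (4, 135), (11, 76), (14, 156)]),
    (19, -1, (3, 1), (6, 1), [2, 2, 3, 3, 5], [181], [(1, 351), (2, 26), (3, 55), (6, 208), (9, 84), (11, 59)]),
    (23, -1, (2, 1), (1, 1), [2, 2, 2, 3, 11], [5, 53], [(1, 222), (3, 478), (4, 231), (8, 61), (9, 80), (11, 101)]),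
    (29, 2, (4, 1), (4, 1), [2, 2, 3, 5, 7], [421], [(3, 636), (5, 681), (7, 787), (20, 144), (26, 309), (27, 550), (36, 622), (42, 128), (43, 359), (44, 791)]),
    (43, -1, (2, 1), (6, 1), [2, 2, 3, 7, 11], [5, 5, 37], [(4, 1509), (6, 848), (12, 1614), (19, 135), (21, 628), (23, 479), (33, 737), (43, 889), (56, 1102), (62, 1148)])]"

definition mult_mod :: "int \<Rightarrow> int \<Rightarrow> int \<Rightarrow> int" where "mult_mod p a b = a * b mod p"
definition diff_mod :: "int \<Rightarrow> int \<Rightarrow> int \<Rightarrow> int" where "diff_mod p a b = (a - b) mod p"
definition nonzero_mod :: "int \<Rightarrow> int \<Rightarrow> bool" where "nonzero_mod p a \<longleftrightarrow> a mod p \<noteq> 0"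

fun pair_mult :: "int \<Rightarrow> int \<Rightarrow> int \<times> int \<Rightarrow> int \<times> int \<Rightarrow> int \<times> int" where
  "pair_mult p d (a, b) (c, e) = ((a * c + d * (b * e)) mod p, (a * e + b * c) mod p)"
fun pair_diff :: "int \<Rightarrow> int \<times> int \<Rightarrow> int \<times> int \<Rightarrow> int \<times> int" where
  "pair_diff p (a, b) (c, e) = ((a - c) mod p, (b - e) mod p)"
text \<open>A test by the norm: a nonzero \<open>a * a - d * (b * b)\<close> rules out that its
  factor \<open>a + b * s\<close> vanishes.\<close>

fun pair_nonzero :: "int \<Rightarrow> int \<Rightarrow> int \<times> int \<Rightarrow> bool" where
  "pair_nonzero p d (a, b) \<longleftrightarrow> (a * a - d * (b * b)) mod p \<noteq> 0"

fun prime_cert_ok where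
  "prime_cert_ok (q, c, t, ls1, ls2, kE) \<longleftrightarrow>
     generators_ok (mult_mod q) (diff_mod q) 1 2 (nonzero_mod q) q c t ls1 ls2 ls2 \<and>
     witnesses_ok (mult_mod q) (diff_mod q) 2 c t ls1 ls2 kE"

fun prime_traces_ok where
  "prime_traces_ok (q, c, t, ls1, ls2, tg) \<longleftrightarrow>
     generators_ok (mult_mod q) (diff_mod q) 1 2 (nonzero_mod q) q c t ls1 ls2 (2 # ls2) \<and>
     traces_ok (mult_mod q) (diff_mod q) 2 q c t ls1 ls2 tg"

text \<open>The first condition is Euler's criterion for the field of \<open>p * p\<close> elements;
  it places a square root of \<open>d\<close> inside that field.\<close>

fun square_cert_ok where
  "square_cert_ok (p, d, c, t, ls1, ls2, kE) \<longleftrightarrow>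
     power_by (mult_mod p) d (to_num ((p * p - 1) div 2)) = 1 \<and>
     generators_ok (pair_mult p d) (pair_diff p) (1, 0) (2, 0) (pair_nonzero p d) (p * p) c t ls1 ls2 ls2 \<and>
     witnesses_ok (pair_mult p d) (pair_diff p) (2, 0) c t ls1 ls2 kE"

fun square_traces_ok where
  "square_traces_ok (p, d, c, t, ls1, ls2, tg) \<longleftrightarrow>
     power_by (mult_mod p) d (to_num ((p * p - 1) div 2)) = 1 \<and>
     generators_ok (pair_mult p d) (pair_diff p) (1, 0) (2, 0) (pair_nonzero p d) (p * p) c t ls1 ls2 (2 # ls2) \<and>
     traces_ok (pair_mult p d) (pair_diff p) (2, 0) (p * p) c t ls1 ls2 tg"

lemma prime_certs_0_ok: "list_all prime_cert_ok prime_certs_0" by code_simp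
lemma prime_certs_1_ok: "list_all prime_cert_ok prime_certs_1" by code_simp
lemma prime_certs_2_ok: "list_all prime_cert_ok prime_certs_2" by code_simp
lemma prime_certs_3_ok: "list_all prime_cert_ok prime_certs_3" by code_simp
lemma prime_certs_4_ok: "list_all prime_cert_ok prime_certs_4" by code_simp
lemma prime_certs_5_ok: "list_all prime_cert_ok prime_certs_5" by code_simp
lemma prime_certs_6_ok: "list_all prime_cert_ok prime_certs_6" by code_simp
lemma prime_certs_7_ok: "list_all prime_cert_ok prime_certs_7" by code_simp
lemma square_certs_ok: "list_all square_cert_ok square_certs" by code_simp
lemma traces_3_ok: "prime_traces_ok (3, 2, 0, [], [2], [0])" by code_simp
lemma traces_5_ok: "prime_traces_ok (5, 2, 1, [2], [3], [2, 3])" by code_simp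
lemma traces_7_ok: "prime_traces_ok (7, 3, 3, [3], [2, 2], [1, 2, 5, 6])" by code_simp
lemma traces_11_ok: "prime_traces_ok (11, 2, 5, [5], [2, 3], [1, 2, 3, 4, 7, 8, 9, 10])" by code_simp
lemma traces_13_ok: "prime_traces_ok (13, 2, 3, [2, 3], [7], [1, 3, 4, 5, 6, 7, 8, 9, 10, 12])" by code_simp
lemma traces_31_ok: "prime_traces_ok (31, 3, 4, [3, 5], [2, 2, 2, 2], [1, 2, 3, 4, 5, 6, 7, 8, 9, 10, 12, 13, 14, 15, 16, 17, 18, 19, 21, 22, 23, 24, 25, 26, 27, 28, 29, 30])" by code_simp
lemma traces_9_ok: "square_traces_ok (3, -1, (1, 1), (2, 1), [2, 2], [5], [(1, 0), (2, 0), (0, 1), (0, 2)])" by code_simp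

section \<open>Interpretation of the certificates in the field\<close>

lemma prime_dvd_power_eq: "prime p \<Longrightarrow> prime r \<Longrightarrow> r dvd p ^ k \<Longrightarrow> r = (p::nat)"
  using prime_dvd_power primes_dvd_imp_eq by blast

context trace_field
begin

lemma CHAR_eq: "prime p \<Longrightarrow> q = p ^ k \<Longrightarrow> CHAR('a) = p"
proof -
  assume p: "prime p" "q = p ^ k"
  have "prime CHAR('a)" by (rule prime_CHAR_semidom) (simp add: CHAR_pos_iff pos_char_exists)
  then show ?thesis using p CHAR_dvd_q by (intro prime_dvd_power_eq[of p _ k]) auto
qed

lemma of_int_mod_CHAR: "of_int (k mod int CHAR('a)) = (of_int k :: 'a)"
proof -
  have "of_int k = (of_int (int CHAR('a) * (k div int CHAR('a)) + k mod int CHAR('a)) :: 'a)" by simp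
  also have "\<dots> = of_int (k mod int CHAR('a))" unfolding of_int_add of_int_mult by simp
  finally show ?thesis by simp
qed

lemma of_int_mod_neq_0: "k mod int CHAR('a) \<noteq> 0 \<Longrightarrow> (of_int k :: 'a) \<noteq> 0"
  by (simp only: of_int_eq_0_iff_char_dvd dvd_eq_mod_eq_0) simp

end

context quadratic_trace_field
begin

lemma prime_field_model:
  assumes "CHAR('a) = p"
  shows "base_model g N q n of_int (mult_mod (int p)) (diff_mod (int p)) 1 2 (nonzero_mod (int p))"
proof unfold_locales
  show "of_int (mult_mod (int p) x y) = (of_int x * of_int y :: 'a)" for x y
    by (simp only: mult_mod_def of_int_mod_CHAR of_int_mult flip: assms)
  show "of_int (diff_mod (int p) x y) = (of_int x - of_int y :: 'a)" for x y
    by (simp only: diff_mod_def of_int_mod_CHAR of_int_diff flip: assms)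
  show "nonzero_mod (int p) x \<Longrightarrow> (of_int x :: 'a) \<noteq> 0" for x
    unfolding nonzero_mod_def assms[symmetric] by (rule of_int_mod_neq_0)
  show "of_int x \<in> base" for x by (rule of_int_in_base)
qed simp_all

lemma pair_model:
  assumes "CHAR('a) = p" "s \<in> base" "s * s = of_int d"
  shows "base_model g N q n (\<lambda>z. of_int (fst z) + of_int (snd z) * s)
    (pair_mult (int p) d) (pair_diff (int p)) (1, 0) (2, 0) (pair_nonzero (int p) d)"
proof unfold_locales
  fix x y :: "int \<times> int"
  obtain a b where x: "x = (a, b)" by fastforce
  obtain c e where y: "y = (c, e)" by fastforce
  have "of_int (a * c + d * (b * e)) + of_int (a * e + b * c) * s =
      of_int a * of_int c + (s * s) * (of_int b * of_int e) + (of_int a * of_int e + of_int b * of_int c) * s"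
    by (simp add: assms(3))
  also have "\<dots> = (of_int a + of_int b * s) * (of_int c + of_int e * s)" by (simp add: algebra_simps)
  finally show "of_int (fst (pair_mult (int p) d x y)) + of_int (snd (pair_mult (int p) d x y)) * s =
      (of_int (fst x) + of_int (snd x) * s) * (of_int (fst y) + of_int (snd y) * s)"
    unfolding x y pair_mult.simps fst_conv snd_conv by (simp only: of_int_mod_CHAR flip: assms(1))
  have "of_int (a - c) + of_int (b - e) * s = of_int a + of_int b * s - (of_int c + of_int e * s)"
    by (simp add: algebra_simps)
  then show "of_int (fst (pair_diff (int p) x y)) + of_int (snd (pair_diff (int p) x y)) * s =
      of_int (fst x) + of_int (snd x) * s - (of_int (fst y) + of_int (snd y) * s)"
    unfolding x y pair_diff.simps fst_conv snd_conv by (simp only: of_int_mod_CHAR flip: assms(1))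
  assume "pair_nonzero (int p) d x"
  then have "(a * a - d * (b * b)) mod int CHAR('a) \<noteq> 0" unfolding x assms(1) by simp
  then have "of_int (a * a - d * (b * b)) \<noteq> (0::'a)" by (rule of_int_mod_neq_0)
  moreover have "of_int (a * a - d * (b * b)) = of_int a * of_int a - s * s * (of_int b * of_int b)"
    by (simp add: assms(3))
  moreover have "\<dots> = (of_int a + of_int b * s) * (of_int a - of_int b * s)" by (simp add: algebra_simps)
  ultimately show "of_int (fst x) + of_int (snd x) * s \<noteq> 0" unfolding x by auto
next
  fix x :: "int \<times> int"
  show "of_int (fst x) + of_int (snd x) * s \<in> base"
    using assms(2) by (intro base_add base_mult of_int_in_base)
qed simp_all

text \<open>A root \<open>s\<close> exists in the large field, and
  \<open>s ^ q = s * d ^ ((q - 1) div 2) = s\<close> shows that Frobenius fixes it.\<close>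

lemma ex_base_sqrt:
  assumes "CHAR('a) = p" "power_by (mult_mod (int p)) d (to_num ((int q - 1) div 2)) = 1"
  shows "\<exists>s\<in>base. s * s = of_int d"
proof -
  interpret M: base_model g N q n of_int "mult_mod (int p)" "diff_mod (int p)" 1 2 "nonzero_mod (int p)"
    by (rule prime_field_model[OF assms(1)])
  obtain s :: 'a where s: "s * s = of_int d" using base_square_root[OF of_int_in_base[of d]] by blast
  have "of_int (power_by (mult_mod (int p)) d (to_num ((int q - 1) div 2))) = (1::'a)"
    unfolding assms(2) by simp
  moreover have pos: "0 < (int q - 1) div 2" using q_ge_3 by linarith
  ultimately have "(of_int d :: 'a) ^ nat ((int q - 1) div 2) = 1"
    by (simp only: M.phi_power nat_of_num_to_num[OF pos])
  moreover obtain r where r: "q = 2 * r + 1" using odd_q by (elim oddE)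
  ultimately have "(s * s) ^ r = 1" by (simp add: s)
  moreover have "s ^ q = s * (s * s) ^ r"
    unfolding r by (simp add: power_mult power2_eq_square)
  ultimately have "s \<in> base" by (simp add: base_def)
  then show ?thesis using s by blast
qed

lemma prime_cert_sound:
  assumes cert: "prime_cert_ok (int q, c, t, ls1, ls2, kE)" and p: "prime q"
    and ls: "\<forall>l\<in>set ls1. prime l" "\<forall>l\<in>set ls2. prime l" and b: "b \<in> base - {0}"
  shows "\<exists>x. r_primitive 2 x \<and> Tr x = b"
proof -
  interpret M: base_model g N q n of_int "mult_mod (int q)" "diff_mod (int q)" 1 2 "nonzero_mod (int q)"
    by (rule prime_field_model[OF CHAR_eq[OF p, of 1]]) simp
  show ?thesis by (rule M.witnesses_sound[OF _ ls _ _ b]) (use cert in auto)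
qed

lemma prime_traces_sound:
  assumes cert: "prime_traces_ok (int q, c, t, ls1, ls2, tg)" and p: "prime q"
    and ls: "\<forall>l\<in>set ls1. prime l" "\<forall>l\<in>set ls2. prime l"
  shows "{Tr x | x. r_primitive 2 x} = of_int ` set tg"
proof -
  interpret M: base_model g N q n of_int "mult_mod (int q)" "diff_mod (int q)" 1 2 "nonzero_mod (int q)"
    by (rule prime_field_model[OF CHAR_eq[OF p, of 1]]) simp
  show ?thesis by (rule M.traces_sound[OF _ ls]) (use cert in auto)
qed

lemma square_cert_sound:
  assumes cert: "square_cert_ok (int p, d, c, t, ls1, ls2, kE)" and p: "prime p" "q = p * p"
    and ls: "\<forall>l\<in>set ls1. prime l" "\<forall>l\<in>set ls2. prime l" and b: "b \<in> base - {0}"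
  shows "\<exists>x. r_primitive 2 x \<and> Tr x = b"
proof -
  have char: "CHAR('a) = p" using p by (intro CHAR_eq[of p 2]) (simp_all add: power2_eq_square)
  have qq: "int p * int p = int q" using p(2) by simp
  obtain s where s: "s \<in> base" "s * s = of_int d" using ex_base_sqrt[OF char, of d] cert unfolding square_cert_ok.simps qq by blast
  interpret M: base_model g N q n "\<lambda>z. of_int (fst z) + of_int (snd z) * s"
    "pair_mult (int p) d" "pair_diff (int p)" "(1, 0)" "(2, 0)" "pair_nonzero (int p) d"
    by (rule pair_model[OF char s])
  show ?thesis by (rule M.witnesses_sound[OF _ ls _ _ b]) (use cert in \<open>auto simp: qq\<close>)
qed

lemma square_traces_sound:
  assumes cert: "square_traces_ok (int p, d, c, t, ls1, ls2, tg)" and p: "prime p" "q = p * p"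
    and ls: "\<forall>l\<in>set ls1. prime l" "\<forall>l\<in>set ls2. prime l"
  shows "\<exists>s\<in>base. s * s = of_int d \<and>
    {Tr x | x. r_primitive 2 x} = (\<lambda>z. of_int (fst z) + of_int (snd z) * s) ` set tg"
proof -
  have char: "CHAR('a) = p" using p by (intro CHAR_eq[of p 2]) (simp_all add: power2_eq_square)
  have qq: "int p * int p = int q" using p(2) by simp
  obtain s where s: "s \<in> base" "s * s = of_int d" using ex_base_sqrt[OF char, of d] cert unfolding square_traces_ok.simps qq by blast
  interpret M: base_model g N q n "\<lambda>z. of_int (fst z) + of_int (snd z) * s"
    "pair_mult (int p) d" "pair_diff (int p)" "(1, 0)" "(2, 0)" "pair_nonzero (int p) d"
    by (rule pair_model[OF char s])
  have "{Tr x | x. r_primitive 2 x} = (\<lambda>z. of_int (fst z) + of_int (snd z) * s) ` set tg"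
    by (rule M.traces_sound[OF _ ls]) (use cert in \<open>auto simp: qq\<close>)
  then show ?thesis using s by blast
qed

end

definition prime_certs where
  "prime_certs = prime_certs_0 @ prime_certs_1 @ prime_certs_2 @ prime_certs_3 @ prime_certs_4 @ prime_certs_5 @ prime_certs_6 @ prime_certs_7"

lemma prime_certs_ok: "\<forall>z\<in>set prime_certs. prime_cert_ok z"
  using prime_certs_0_ok prime_certs_1_ok prime_certs_2_ok prime_certs_3_ok prime_certs_4_ok prime_certs_5_ok
    prime_certs_6_ok prime_certs_7_ok
  unfolding prime_certs_def list_all_iff set_append by blast

fun cert_primes :: "int \<times> int \<times> int \<times> int list \<times> int list \<times> (int \<times> int) list \<Rightarrow> int list" where
  "cert_primes (q, c, t, ls1, ls2, kE) = q # ls1 @ ls2"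

fun square_cert_primes :: "int \<times> int \<times> (int \<times> int) \<times> (int \<times> int) \<times> int list \<times> int list \<times> (int \<times> int) list \<Rightarrow> int list" where
  "square_cert_primes (p, d, c, t, ls1, ls2, kE) = p # ls1 @ ls2"

text \<open>One table for all certificates, so that each prime is tested only once.\<close>

definition prime_table :: "int list" where
  "prime_table = [
    2, 3, 5, 7, 11, 13, 17, 19, 23, 29, 31, 37, 41, 43, 47, 53, 59, 61, 67, 71, 73, 79, 83, 89, 97, 101, 103, 109,
    113, 127, 131, 137, 139, 149, 151, 157, 163, 173, 181, 191, 197, 199, 211, 229, 239, 241, 269, 281, 307, 311,
    331, 337, 349, 373, 379, 389, 409, 419, 421, 461, 463, 509, 521, 547, 569, 571, 601, 617, 631, 659, 661, 701,
    709, 761, 769, 859, 881, 911, 1009, 1021, 1231, 1289, 1301, 1429, 1609, 1709, 1741, 1861, 2029, 2281, 2311,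
    2521, 2729, 3541, 4621]"

text \<open>Since \<open>4761 = 69 * 69\<close>, a composite number below it has a prime factor of
  at most 67.\<close>

definition trial_division :: "int \<Rightarrow> bool" where
  "trial_division l \<longleftrightarrow> 1 < l \<and> l < 4761 \<and> list_all (\<lambda>d. if l < d * d then True else l mod d \<noteq> 0)
     [2, 3, 5, 7, 11, 13, 17, 19, 23, 29, 31, 37, 41, 43, 47, 53, 59, 61, 67]"

lemma trial_division_prime:
  assumes "trial_division l"
  shows "prime l"
proof (rule ccontr)
  assume np: "\<not> prime l"
  define k where "k = nat l"
  have k: "l = int k" "1 < k" "k < 4761" using assms by (auto simp: k_def trial_division_def)
  have "\<exists>p. prime p \<and> p dvd k \<and> p * p \<le> k"
  proof -
    have "\<not> prime k" using np k(1) by simp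
    then obtain a where a: "a dvd k" "a \<noteq> 1" "a \<noteq> k" using k(2) unfolding prime_nat_iff by blast
    then obtain b where b: "k = a * b" by blast
    have "a \<noteq> 0" "b \<noteq> 0" "b \<noteq> 1" using a b k(2) by (auto intro: Nat.gr0I)
    then have ab: "k = a * b" "1 < a" "1 < b" using a(2) b by linarith+
    have *: "\<exists>p. prime p \<and> p dvd k \<and> p * p \<le> k" if cd: "k = c * d" "1 < c" "c \<le> d" for c d
    proof -
      obtain p where p: "prime p" "p dvd c" using prime_factor_nat[of c] cd(2) by auto
      then have "p \<le> c" using cd(2) by (intro dvd_imp_le) auto
      then have "p * p \<le> c * d" using cd(3) by (intro mult_le_mono) auto
      then show ?thesis using p cd(1) by auto
    qed
    show ?thesis using *[of a b] *[of b a] ab by (cases "a \<le> b") (auto simp: mult.commute)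
  qed
  then obtain p where p: "prime p" "p dvd k" "p * p \<le> k" by blast
  have "p < 69"
  proof (rule ccontr)
    assume "\<not> p < 69"
    then have "69 * 69 \<le> p * p" by (intro mult_le_mono) auto
    then show False using p(3) k(3) by simp
  qed
  then have "p \<in> {2, 3, 5, 7, 11, 13, 17, 19, 23, 29, 31, 37, 41, 43, 47, 53, 59, 61, 67}"
    using primes_below_73[OF p(1)] by auto
  then have "int p \<in> set [2, 3, 5, 7, 11, 13, 17, 19, 23, 29, 31, 37, 41, 43, 47, 53, 59, 61, 67]" by auto
  moreover have "list_all (\<lambda>d. if l < d * d then True else l mod d \<noteq> 0)
     [2, 3, 5, 7, 11, 13, 17, 19, 23, 29, 31, 37, 41, 43, 47, 53, 59, 61, 67]"
    using assms by (simp only: trial_division_def)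
  ultimately have "if l < int p * int p then True else l mod int p \<noteq> 0" unfolding list_all_iff by blast
  moreover have "int p * int p \<le> l" using p(3) unfolding k(1) by (simp only: of_nat_mult[symmetric] of_nat_le_iff)
  moreover have "l mod int p = 0" using p(2) unfolding k(1) by (simp flip: zmod_int)
  ultimately show False by simp
qed

lemma prime_table: "\<forall>l\<in>set prime_table. prime l"
proof -
  have "list_all trial_division prime_table" by code_simp
  then show ?thesis using trial_division_prime by (auto simp: list_all_iff)
qed

lemma prime_certs_primes: "\<forall>z\<in>set prime_certs. \<forall>l\<in>set (cert_primes z). prime l"
proof -
  have "list_all (\<lambda>z. list_all (List.member prime_table) (cert_primes z)) prime_certs" by code_simp
  then show ?thesis using prime_table by (simp add: list_all_iff)
qed

lemma square_certs_primes: "\<forall>z\<in>set square_certs. \<forall>l\<in>set (square_cert_primes z). prime l"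
proof -
  have "list_all (\<lambda>z. list_all (List.member prime_table) (square_cert_primes z)) square_certs" by code_simp
  then show ?thesis using prime_table by (simp add: list_all_iff)
qed

context quadratic_trace_field
begin

lemma two_prime_certs:
  assumes "int q \<in> fst ` set prime_certs" "b \<in> base - {0}"
  shows "\<exists>x. r_primitive 2 x \<and> Tr x = b"
proof -
  obtain c t ls1 ls2 kE where z: "(int q, c, t, ls1, ls2, kE) \<in> set prime_certs" using assms(1) by fastforce
  have pr: "prime q" "\<forall>l\<in>set ls1. prime l" "\<forall>l\<in>set ls2. prime l" using prime_certs_primes z by fastforce+
  show ?thesis by (rule prime_cert_sound[OF _ pr assms(2)]) (use prime_certs_ok z in blast)
qed

lemma two_square_certs:
  assumes "int q \<in> (\<lambda>z. fst z * fst z) ` set square_certs" "b \<in> base - {0}"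
  shows "\<exists>x. r_primitive 2 x \<and> Tr x = b"
proof -
  obtain z0 where "z0 \<in> set square_certs" "int q = fst z0 * fst z0" using assms(1) by blast
  moreover obtain p d c t ls1 ls2 kE where "z0 = (p, d, c, t, ls1, ls2, kE)" by (rule prod_cases7)
  ultimately have z: "(p, d, c, t, ls1, ls2, kE) \<in> set square_certs" and p: "int q = p * p" by simp_all
  have pr: "prime p" "\<forall>l\<in>set ls1. prime l" "\<forall>l\<in>set ls2. prime l" using square_certs_primes z by fastforce+
  have "p > 0" using pr(1) prime_gt_0_int by blast
  then obtain r where r: "p = int r" using zero_le_imp_eq_int[of p] by auto
  have "int q = int (r * r)" using p r by simp
  then have "q = r * r" by (simp only: of_nat_eq_iff)
  moreover have "prime r" using pr(1) r by simp
  moreover have "square_cert_ok (int r, d, c, t, ls1, ls2, kE)" using square_certs_ok z r by (auto simp: list_all_iff)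
  ultimately show ?thesis using square_cert_sound pr(2,3) assms(2) by blast
qed

lemma traces_exact:
  "q = 3 \<Longrightarrow> {Tr x | x. r_primitive 2 x} = {0}"
  "q = 5 \<Longrightarrow> {Tr x | x. r_primitive 2 x} = {2, 3}"
  "q = 7 \<Longrightarrow> {Tr x | x. r_primitive 2 x} = {1, 2, 5, 6}"
  "q = 11 \<Longrightarrow> {Tr x | x. r_primitive 2 x} = {1, 2, 3, 4, 7, 8, 9, 10}"
  "q = 13 \<Longrightarrow> {Tr x | x. r_primitive 2 x} = {1, 3, 4, 5, 6, 7, 8, 9, 10, 12}"
  "q = 31 \<Longrightarrow> {Tr x | x. r_primitive 2 x} = {1, 2, 3, 4, 5, 6, 7, 8, 9, 10, 12, 13, 14, 15, 16, 17, 18, 19, 21, 22, 23,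
     24, 25, 26, 27, 28, 29, 30}"
proof -
  show "{Tr x | x. r_primitive 2 x} = {0}" if q: "q = 3"
  proof -
    have cert: "prime_traces_ok (int q, 2, 0, [], [2], [0])"
      unfolding q of_nat_numeral by (rule traces_3_ok)
    show ?thesis by (rule trans[OF prime_traces_sound[OF cert]]) (simp_all add: q)
  qed
  show "{Tr x | x. r_primitive 2 x} = {2, 3}" if q: "q = 5"
  proof -
    have cert: "prime_traces_ok (int q, 2, 1, [2], [3], [2, 3])"
      unfolding q of_nat_numeral by (rule traces_5_ok)
    show ?thesis by (rule trans[OF prime_traces_sound[OF cert]]) (simp_all add: q)
  qed
  show "{Tr x | x. r_primitive 2 x} = {1, 2, 5, 6}" if q: "q = 7"
  proof -
    have cert: "prime_traces_ok (int q, 3, 3, [3], [2, 2], [1, 2, 5, 6])"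
      unfolding q of_nat_numeral by (rule traces_7_ok)
    show ?thesis by (rule trans[OF prime_traces_sound[OF cert]]) (simp_all add: q)
  qed
  show "{Tr x | x. r_primitive 2 x} = {1, 2, 3, 4, 7, 8, 9, 10}" if q: "q = 11"
  proof -
    have cert: "prime_traces_ok (int q, 2, 5, [5], [2, 3], [1, 2, 3, 4, 7, 8, 9, 10])"
      unfolding q of_nat_numeral by (rule traces_11_ok)
    show ?thesis by (rule trans[OF prime_traces_sound[OF cert]]) (simp_all add: q)
  qed
  show "{Tr x | x. r_primitive 2 x} = {1, 3, 4, 5, 6, 7, 8, 9, 10, 12}" if q: "q = 13"
  proof -
    have cert: "prime_traces_ok (int q, 2, 3, [2, 3], [7], [1, 3, 4, 5, 6, 7, 8, 9, 10, 12])"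
      unfolding q of_nat_numeral by (rule traces_13_ok)
    show ?thesis by (rule trans[OF prime_traces_sound[OF cert]]) (simp_all add: q)
  qed
  show "{Tr x | x. r_primitive 2 x} = {1, 2, 3, 4, 5, 6, 7, 8, 9, 10, 12, 13, 14, 15, 16, 17, 18, 19, 21, 22, 23, 24, 25, 26, 27, 28, 29, 30}" if q: "q = 31"
  proof -
    have cert: "prime_traces_ok (int q, 3, 4, [3, 5], [2, 2, 2, 2], [1, 2, 3, 4, 5, 6, 7, 8, 9, 10, 12, 13, 14, 15, 16, 17, 18, 19, 21, 22, 23, 24, 25, 26, 27, 28, 29, 30])"
      unfolding q of_nat_numeral by (rule traces_31_ok)
    show ?thesis by (rule trans[OF prime_traces_sound[OF cert]]) (simp_all add: q)
  qed
qed

lemma prime_base: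
  assumes "prime q"
  shows "base = of_int ` {0..<int q}" "inj_on (of_int :: int \<Rightarrow> 'a) {0..<int q}"
proof -
  have char: "CHAR('a) = q" using assms by (intro CHAR_eq[of q 1]) simp_all
  show inj: "inj_on (of_int :: int \<Rightarrow> 'a) {0..<int q}"
  proof (rule inj_onI)
    fix x y assume xy: "x \<in> {0..<int q}" "y \<in> {0..<int q}" "(of_int x :: 'a) = of_int y"
    then have "of_int (x - y) = (0::'a)" by simp
    then have "(x - y) mod int q = 0" using of_int_mod_neq_0[of "x - y"] unfolding char by blast
    then have "x mod int q = y mod int q" by (simp add: mod_eq_dvd_iff mod_eq_0_iff_dvd)
    then show "x = y" using xy by simp
  qed
  have "finite base" by simp
  moreover have "of_int ` {0..<int q} \<subseteq> base" using of_int_in_base by blast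
  moreover have "card (of_int ` {0..<int q} :: 'a set) = card base"
    unfolding card_base using card_image[OF inj] by simp
  ultimately show "base = of_int ` {0..<int q}" using card_subset_eq by metis
qed

lemma traces_31: "q = 31 \<Longrightarrow> {Tr x | x. r_primitive 2 x} = base - {0, 11, 20}"
proof -
  assume q: "q = 31"
  have p: "prime q" by (simp add: q)
  have "{0, 11, 20} = (of_int ` {0, 11, 20} :: 'a set)" by simp
  then have "base - {0, 11, 20} = of_int ` ({0..<int q} - {0, 11, 20})"
    unfolding prime_base(1)[OF p] using inj_on_image_set_diff[OF prime_base(2)[OF p], of "{0..<int q}" "{0, 11, 20}"]
    by (simp add: q)
  also have "{0..<int q} = set [0..30]" by (simp add: q atLeastLessThanPlusOne_atLeastAtMost_int[symmetric])
  also have "set [0..30] - {0, 11, 20} = set [1, 2, 3, 4, 5, 6, 7, 8, 9, 10, 12, 13, 14, 15, 16, 17, 18, 19, 21, 22, 23, 24, 25, 26, 27, 28, 29, 30 :: int]" by code_simp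
  finally show ?thesis unfolding traces_exact(6)[OF q] by simp
qed

text \<open>The certificate supplies one root \<open>s\<close> of \<open>-1\<close>. Any root is
  \<open>s\<close> or \<open>-s\<close>, and the set of traces is symmetric; the entries 2 in the
  pairs become \<open>-1\<close> in characteristic 3.\<close>

lemma traces_9:
  assumes "q = 9"
  shows "\<exists>i\<in>base. i\<^sup>2 + 1 = 0" "i\<^sup>2 + 1 = 0 \<Longrightarrow> {Tr x | x. r_primitive 2 x} = {1, -1, i, -i}"
proof -
  have cert: "square_traces_ok (int 3, -1, (1, 1), (2, 1), [2, 2], [5], [(1, 0), (2, 0), (0, 1), (0, 2)])"
    unfolding of_nat_numeral by (rule traces_9_ok)
  obtain s where s: "s \<in> base" "s * s = of_int (-1)" and tr: "{Tr x | x. r_primitive 2 x} =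
      (\<lambda>z. of_int (fst z) + of_int (snd z) * s) ` set [(1, 0), (2, 0), (0, 1), (0, 2)]"
    using square_traces_sound[OF cert] assms by auto
  have "CHAR('a) = 3" by (rule CHAR_eq[of 3 2]) (simp_all add: assms)
  then have "of_nat 3 = (0::'a)" by (metis of_nat_CHAR)
  then have "(2::'a) + 1 = 0" by simp
  then have two: "(2::'a) = -1" by (simp only: eq_neg_iff_add_eq_0)
  have ss: "s\<^sup>2 = -1" using s(2) by (simp add: power2_eq_square)
  then show "\<exists>i\<in>base. i\<^sup>2 + 1 = 0" using s(1) by (intro bexI[of _ s]) simp_all
  have "{Tr x | x. r_primitive 2 x} = {1, 2, s, 2 * s}" unfolding tr by simp
  also have "\<dots> = {1, -1, s, -s}" unfolding two by simp
  finally have tr': "{Tr x | x. r_primitive 2 x} = {1, -1, s, -s}" .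
  assume "i\<^sup>2 + 1 = 0"
  then have "i * i = -1" by (simp add: power2_eq_square eq_neg_iff_add_eq_0)
  moreover have "(i - s) * (i + s) = i * i - s * s" by (simp add: algebra_simps)
  ultimately have "(i - s) * (i + s) = 0" using s(2) by simp
  then have "i = s \<or> i = - s" by (auto simp: eq_neg_iff_add_eq_0)
  then show "{Tr x | x. r_primitive 2 x} = {1, -1, i, -i}" unfolding tr' by auto
qed

end

subsection \<open>The remaining small fields\<close>

lemma prime_factors_subset_list:
  fixes n :: nat
  assumes "int n = prod_list ls" "\<forall>e\<in>set ls. prime e"
  shows "prime_factors n \<subseteq> nat ` set ls"
proof
  fix l assume "l \<in> prime_factors n"
  then have "prime l" "int l dvd prod_list ls" by (auto simp flip: assms(1))
  then have "int l \<in> set ls" using prime_dvd_prod_list_int assms(2) by blast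
  then have "nat (int l) \<in> nat ` set ls" by (rule imageI)
  then show "l \<in> nat ` set ls" by simp
qed

context char_sum_bounds
begin

text \<open>The union bound on integer cardinalities, which may be rounded or bounded by means other
  than character sums.\<close>

lemma ex_sifted_or_le:
  assumes "P \<subseteq> C \<union> S" "finite S"
  shows "(\<exists>k\<in>T. \<forall>l\<in>P. \<not> l dvd k) \<or> card (sifted C) \<le> (\<Sum>l\<in>S. card {k \<in> sifted C. l dvd k})"
proof (rule disjCI)
  assume "\<not> card (sifted C) \<le> (\<Sum>l\<in>S. card {k \<in> sifted C. l dvd k})"
  then have "\<not> sifted C \<subseteq> (\<Union>l\<in>S. {k \<in> sifted C. l dvd k})"
    using card_mono[of "\<Union>l\<in>S. {k \<in> sifted C. l dvd k}" "sifted C"]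
      card_UN_le[OF assms(2), of "\<lambda>l. {k \<in> sifted C. l dvd k}"] assms(2) by force
  then obtain k where "k \<in> sifted C" "\<forall>l\<in>S. \<not> l dvd k" by blast
  then have "k \<in> T" "\<forall>l\<in>C \<union> S. \<not> l dvd k" by (auto simp: sifted_def)
  then show "\<exists>k\<in>T. \<forall>l\<in>P. \<not> l dvd k" using assms(1) by blast
qed

end

lemma sieve_27:
  assumes "char_sum_bounds 364 26 T 1 (sqrt 27)" and T: "13 \<le> real (card T)" and K: "card {k \<in> T. 13 dvd k} \<le> 2"
  shows "\<exists>k\<in>T. \<forall>l\<in>{2, 7, 13}. \<not> l dvd k"
proof -
  interpret char_sum_bounds 364 26 T 1 "sqrt 27" by fact
  have sm: "smooth {2, 7} = {2, 7}" by (auto simp: smooth_def)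
  have "dens {2, 7} * (13 - 3) \<le> dens {2, 7} * (card T - err0 {2, 7})"
    using T by (intro mult_left_mono) (simp_all add: err0_def sm dens_def)
  also have "\<dots> \<le> card (sifted {2, 7})" by (rule card_sifted_ge) auto
  finally have "2 < card (sifted {2, 7})" by (simp add: dens_def)
  moreover have "card {k \<in> sifted {2, 7}. 13 dvd k} \<le> card {k \<in> T. 13 dvd k}"
    using fin by (intro card_mono) (auto simp: sifted_def)
  ultimately show ?thesis using K ex_sifted_or_le[of "{2, 7, 13}" "{2, 7}" "{13}"] by auto
qed

text \<open>The margin is thin: \<open>2 / 7 * (62 - 47.8)\<close> is about 4.06, just above the
  four multiples of 31 that are allowed.\<close>

lemma sieve_125:
  assumes "char_sum_bounds 7812 124 T 1 (sqrt 125)" and T: "62 \<le> real (card T)" and K: "card {k \<in> T. 31 dvd k} \<le> 4"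
  shows "\<exists>k\<in>T. \<forall>l\<in>{2, 3, 7, 31}. \<not> l dvd k"
proof -
  interpret char_sum_bounds 7812 124 T 1 "sqrt 125" by fact
  have sm: "smooth {2, 3, 7} = {3, 7}" by (auto simp: smooth_def)
  have "sqrt 125 \<le> (11.2 :: real)" by (rule real_le_lsqrt) (simp_all add: power2_eq_square)
  then have err: "err0 {2, 3, 7} \<le> 47.8" by (simp add: err0_def sm)
  have "dens {2, 3, 7} * (62 - 47.8) \<le> dens {2, 3, 7} * (card T - err0 {2, 3, 7})"
    using err T by (intro mult_left_mono) (simp_all add: dens_def)
  also have "\<dots> \<le> card (sifted {2, 3, 7})" by (rule card_sifted_ge) auto
  finally have "4 < card (sifted {2, 3, 7})" by (simp add: dens_def)
  moreover have "card {k \<in> sifted {2, 3, 7}. 31 dvd k} \<le> card {k \<in> T. 31 dvd k}"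
    using fin by (intro card_mono) (auto simp: sifted_def)
  ultimately show ?thesis using K ex_sifted_or_le[of "{2, 3, 7, 31}" "{2, 3, 7}" "{31}"] by auto
qed

lemma sieve_81:
  assumes "char_sum_bounds 3280 80 T 1 9" and T: "40 \<le> real (card T)"
  shows "\<exists>k\<in>T. \<forall>l\<in>{2, 5, 41}. \<not> l dvd k"
proof -
  interpret char_sum_bounds 3280 80 T 1 9 by fact
  have sm: "smooth {2} = {}" by (auto simp: smooth_def)
  have pc: "prime l \<and> l dvd 3280" if "l \<in> {2}" for l :: nat using that by simp
  have errs: "err0 {2} = 9" "errA {2} = 10" "errB {2} = 18" "dens {2} = 1 / 2"
    by (simp_all add: err0_def errA_def errB_def dens_def sm)
  have "dens {2} * (card T - err0 {2}) \<le> card (sifted {2})" by (rule card_sifted_ge) auto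
  then have "31 / 2 \<le> real (card (sifted {2}))" using T by (simp add: errs)
  \<comment> \<open>Rounding up from 15.5 is essential: \<open>16 * (1 - 1 / 5 - 1 / 41)\<close>
    exceeds the error total 12.08, while with 15.5 it would not.\<close>
  then have "16 \<le> card (sifted {2})" by linarith
  then have "16 \<le> real (card (sifted {2}))" by simp
  moreover have "real (card {k \<in> sifted {2}. 5 dvd k}) \<le> card (sifted {2}) / 5 + 72 / 10"
    using card_sifted_dvd_le[of "{2}" 5, OF _ pc] by (simp add: errs)
  moreover have "real (card {k \<in> sifted {2}. 41 dvd k}) \<le> card (sifted {2}) / 41 + 488 / 100"
    using card_sifted_dvd_le[of "{2}" 41, OF _ pc] by (simp add: errs)
  ultimately have "real (card {k \<in> sifted {2}. 5 dvd k}) + real (card {k \<in> sifted {2}. 41 dvd k}) < real (card (sifted {2}))"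
    by linarith
  then have "card {k \<in> sifted {2}. 5 dvd k} + card {k \<in> sifted {2}. 41 dvd k} < card (sifted {2})"
    by (simp only: of_nat_add[symmetric] of_nat_less_iff)
  then show ?thesis using ex_sifted_or_le[of "{2, 5, 41}" "{2}" "{5, 41}"] by auto
qed

lemma sieve_1331:
  assumes "char_sum_bounds 885780 1330 T 1 (sqrt 1331)" and T: "665 \<le> real (card T)"
  shows "\<exists>k\<in>T. \<forall>l\<in>{2, 3, 5, 7, 19, 37}. \<not> l dvd k"
proof -
  interpret char_sum_bounds 885780 1330 T 1 "sqrt 1331" by fact
  have sm: "smooth {2, 3} = {2, 3}" by (auto simp: smooth_def)
  have s: "sqrt 1331 \<le> (36.483 :: real)" by (rule real_le_lsqrt) (simp_all add: power2_eq_square)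
  have errs: "err0 {2, 3} = 3" "errA {2, 3} = 4" "errB {2, 3} = 4 * sqrt 1331" "dens {2, 3} = 1 / 3"
    by (simp_all add: err0_def errA_def errB_def dens_def sm)
  let ?n = "card (sifted {2, 3})" and ?K = "\<lambda>l. card {k \<in> sifted {2, 3}. l dvd k}"
  have "dens {2, 3} * (card T - err0 {2, 3}) \<le> ?n" by (rule card_sifted_ge) auto
  then have n: "221 \<le> ?n" using T by (simp add: errs)
  have pc: "prime l \<and> l dvd 885780" if "l \<in> {2, 3}" for l :: nat using that by auto
  have K: "real (?K 5) \<le> ?n / 5 + 3892 / 100" "real (?K 7) \<le> ?n / 7 + 417 / 10" "real (?K 19) \<le> ?n / 19 + 4609 / 100"
    "real (?K 37) \<le> ?n / 37 + 13 / 10"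
    using card_sifted_dvd_le[of "{2, 3}" 5, OF _ pc] card_sifted_dvd_le[of "{2, 3}" 7, OF _ pc] card_sifted_dvd_le[of "{2, 3}" 19, OF _ pc]
      card_sifted_dvd_le[of "{2, 3}" 37, OF _ pc] s by (simp_all add: errs)
  have "?K 5 + ?K 7 + ?K 19 + ?K 37 < ?n"
  \<comment> \<open>At 221 the real bounds add up to more than 221; rounding each count down gives
    at most \<open>83 + 73 + 57 + 7 = 220\<close>.\<close>
  proof (cases "?n = 221")
    case True
    have "real (?K 5) < 84" "real (?K 7) < 74" "real (?K 19) < 58" "real (?K 37) < 8"
      using K unfolding True of_nat_numeral by linarith+
    then have "?K 5 < 84" "?K 7 < 74" "?K 19 < 58" "?K 37 < 8" by (simp_all only: of_nat_less_numeral_iff)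
    then show ?thesis using True by linarith
  next
    case False
    then have "222 \<le> ?n" using n by linarith
    then have "222 \<le> real ?n" by simp
    then have "real (?K 5) + real (?K 7) + real (?K 19) + real (?K 37) < real ?n" using K by linarith
    then show ?thesis by (simp only: of_nat_add[symmetric] of_nat_less_iff)
  qed
  then show ?thesis using ex_sifted_or_le[of "{2, 3, 5, 7, 19, 37}" "{2, 3}" "{5, 7, 19, 37}"] by auto
qed

text \<open>At least 14 odd exponents remain, and at most 13 are spoiled because 7 and 13 never
  spoil simultaneously.\<close>

lemma sieve_729:
  assumes "char_sum_bounds 364 0 T 9 9" and T: "36 \<le> real (card T)"
    and K: "card {k \<in> T. odd k \<and> 7 dvd k} \<le> 13" "card {k \<in> T. odd k \<and> 13 dvd k} \<le> 13"
      "{k \<in> T. odd k \<and> 7 dvd k} = {} \<or> {k \<in> T. odd k \<and> 13 dvd k} = {}"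
  shows "\<exists>k\<in>T. \<forall>l\<in>{2, 7, 13}. \<not> l dvd k"
proof -
  interpret char_sum_bounds 364 0 T 9 9 by fact
  have errs: "err0 {2} = 9" "dens {2} = 1 / 2" by (simp_all add: err0_def dens_def algebra_simps)
  have "dens {2} * (card T - err0 {2}) \<le> card (sifted {2})" by (rule card_sifted_ge) auto
  then have "14 \<le> card (sifted {2})" using T by (simp add: errs)
  moreover have "{k \<in> sifted {2}. l dvd k} = {k \<in> T. odd k \<and> l dvd k}" for l by (auto simp: sifted_def)
  moreover have "card {k \<in> T. odd k \<and> 7 dvd k} + card {k \<in> T. odd k \<and> 13 dvd k} \<le> 13"
  proof (cases "{k \<in> T. odd k \<and> 7 dvd k} = {}")
    case True
    then have "card {k \<in> T. odd k \<and> 7 dvd k} = 0" by (simp only: card.empty)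
    then show ?thesis using K(2) by linarith
  next
    case False
    then have "{k \<in> T. odd k \<and> 13 dvd k} = {}" using K(3) by blast
    then have "card {k \<in> T. odd k \<and> 13 dvd k} = 0" by (simp only: card.empty)
    then show ?thesis using K(1) by linarith
  qed
  ultimately have "(\<Sum>l\<in>{7, 13}. card {k \<in> sifted {2}. l dvd k}) < card (sifted {2})" by simp
  then show ?thesis using ex_sifted_or_le[of "{2, 7, 13}" "{2}" "{7, 13}"] by auto
qed

context quadratic_trace_field
begin

lemma trace_two: "Tr x = x + x ^ q"
  unfolding field_trace_def n2 by (simp add: eval_nat_numeral lessThan_Suc add.commute)

text \<open>The trace and the norm of an element determine its minimal polynomial.\<close>

lemma card_half_exps_norm_le:
  "card {k \<in> half_exps b. (g ^ (2 * k)) ^ (q + 1) = c} \<le> 2"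
proof -
  define P where "P = [:c, - b, 1:]"
  let ?A = "{k \<in> half_exps b. (g ^ (2 * k)) ^ (q + 1) = c}"
  have inj: "inj_on (\<lambda>k. g ^ (2 * k)) ?A"
  proof (rule inj_onI)
    fix i j assume ij: "i \<in> ?A" "j \<in> ?A" "g ^ (2 * i) = g ^ (2 * j)"
    then have "2 * i < N" "2 * j < N" by (auto simp: half_exps_def)
    then show "i = j" using ij(3) by (simp add: power_eq_iff cong_def)
  qed
  have "poly P x = 0" if x: "x \<in> (\<lambda>k. g ^ (2 * k)) ` ?A" for x
  proof -
    have tr: "x + x ^ q = b" and nm: "x ^ (q + 1) = c"
      using x by (auto simp: half_exps_def trace_two)
    have "poly P x = c - x * (b - x)" by (simp add: P_def algebra_simps)
    also have "b - x = x ^ q" using tr by (simp add: diff_eq_eq add.commute)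
    finally show ?thesis using nm by simp
  qed
  then have sub: "(\<lambda>k. g ^ (2 * k)) ` ?A \<subseteq> {x. poly P x = 0}" by blast
  have "P \<noteq> 0" by (simp add: P_def)
  then have "card {x. poly P x = 0} \<le> Polynomial.degree P" by (rule card_poly_roots_bound)
  also have "\<dots> = 2" by (simp add: P_def)
  finally have "card {x. poly P x = 0} \<le> 2" .
  then show ?thesis using card_mono[OF _ sub] card_image[OF inj] by simp
qed

lemma N_two: "N = q * q - 1"
  using N_eq(2) by (simp add: n2 power2_eq_square)

text \<open>If 13 divides \<open>k\<close>, then \<open>g ^ (2 * k)\<close> has norm 1, and with the
  trace fixed at most two elements remain; this replaces the character bound at 13.\<close>

lemma two_27:
  assumes q: "q = 27" and b: "b \<in> base - {0}"
  shows "\<exists>x. r_primitive 2 x \<and> Tr x = b"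
proof -
  have e: "N = 728" "N div 2 = 364" "q - 1 = 26" "real q = 27" by (simp_all add: N_two q)
  have "prime_factors (N div 2) \<subseteq> nat ` set [2, 2, 7, 13]" by (rule prime_factors_subset_list) (simp_all add: e(1))
  then have sub: "prime_factors (N div 2) \<subseteq> {2, 7, 13}" by auto
  have K: "card {k \<in> half_exps b. 13 dvd k} \<le> 2"
  proof -
    let ?A = "{k \<in> half_exps b. (g ^ (2 * k)) ^ (q + 1) = 1}"
    have "(g ^ (2 * k)) ^ (q + 1) = 1" if k: "13 dvd k" for k
    proof -
      obtain r where r: "k = 13 * r" using k by blast
      have "2 * (13 * r) * (q + 1) = N * r" by (simp add: e(1) q)
      then show ?thesis unfolding r power_mult[symmetric] by (simp only: power_eq_1_iff dvd_triv_left)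
    qed
    then have "card {k \<in> half_exps b. 13 dvd k} \<le> card ?A" by (intro card_mono) auto
    also have "\<dots> \<le> 2" by (rule card_half_exps_norm_le)
    finally show ?thesis .
  qed
  have "\<exists>k\<in>half_exps b. \<forall>l\<in>{2, 7, 13}. \<not> l dvd k"
  proof (rule sieve_27)
    show "char_sum_bounds 364 26 (half_exps b) 1 (sqrt 27)" using half_exps_bounds_two[OF b] unfolding e(2-4) .
    show "13 \<le> real (card (half_exps b))" using half_exps_card_two[OF b] unfolding e(4) by simp
  qed (rule K)
  then show ?thesis using sub by (intro ex_two_primitive) blast
qed

lemma two_81:
  assumes q: "q = 81" and b: "b \<in> base - {0}"
  shows "\<exists>x. r_primitive 2 x \<and> Tr x = b"
proof -
  have e: "N = 6560" "N div 2 = 3280" "q - 1 = 80" "real q = 81" by (simp_all add: N_two q)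
  have "prime_factors (N div 2) \<subseteq> nat ` set [2, 2, 2, 2, 5, 41]" by (rule prime_factors_subset_list) (simp_all add: e(1))
  then have sub: "prime_factors (N div 2) \<subseteq> {2, 5, 41}" by auto
  have "\<exists>k\<in>half_exps b. \<forall>l\<in>{2, 5, 41}. \<not> l dvd k"
  proof (rule sieve_81)
    have s: "sqrt 81 = (9::real)" by (rule real_sqrt_unique) simp_all
    show "char_sum_bounds 3280 80 (half_exps b) 1 9" using half_exps_bounds_two[OF b] unfolding e(2-4) s .
    show "40 \<le> real (card (half_exps b))" using half_exps_card_two[OF b] unfolding e(4) by simp
  qed
  then show ?thesis using sub by (intro ex_two_primitive) blast
qed

text \<open>If 31 divides \<open>k\<close>, the norm is 1 or \<open>-1\<close>, which leaves at most
  four elements.\<close>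

lemma two_125:
  assumes q: "q = 125" and b: "b \<in> base - {0}"
  shows "\<exists>x. r_primitive 2 x \<and> Tr x = b"
proof -
  have e: "N = 15624" "N div 2 = 7812" "q - 1 = 124" "real q = 125" by (simp_all add: N_two q)
  have "prime_factors (N div 2) \<subseteq> nat ` set [2, 2, 3, 3, 7, 31]" by (rule prime_factors_subset_list) (simp_all add: e(1))
  then have sub: "prime_factors (N div 2) \<subseteq> {2, 3, 7, 31}" by auto
  have K: "card {k \<in> half_exps b. 31 dvd k} \<le> 4"
  proof -
    let ?A = "\<lambda>c. {k \<in> half_exps b. (g ^ (2 * k)) ^ (q + 1) = c}"
    have "(g ^ (2 * k)) ^ (q + 1) = 1 \<or> (g ^ (2 * k)) ^ (q + 1) = -1" if k: "31 dvd k" for k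
    proof -
      obtain r where r: "k = 31 * r" using k by blast
      have "2 * (31 * r) * (q + 1) * 2 = N * r" by (simp add: e(1) q)
      then have "((g ^ (2 * k)) ^ (q + 1)) ^ 2 = 1"
        unfolding r power_mult[symmetric] by (simp only: power_eq_1_iff dvd_triv_left)
      then show ?thesis by (simp only: power2_eq_1_iff)
    qed
    then have "card {k \<in> half_exps b. 31 dvd k} \<le> card (?A 1 \<union> ?A (-1))" by (intro card_mono) auto
    also have "\<dots> \<le> card (?A 1) + card (?A (-1))" by (rule card_Un_le)
    also have "\<dots> \<le> 4" using card_half_exps_norm_le[of b 1] card_half_exps_norm_le[of b "-1"] by linarith
    finally show ?thesis .
  qed
  have "\<exists>k\<in>half_exps b. \<forall>l\<in>{2, 3, 7, 31}. \<not> l dvd k"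
  proof (rule sieve_125)
    show "char_sum_bounds 7812 124 (half_exps b) 1 (sqrt 125)" using half_exps_bounds_two[OF b] unfolding e(2-4) .
    show "62 \<le> real (card (half_exps b))" using half_exps_card_two[OF b] unfolding e(4) by simp
  qed (rule K)
  then show ?thesis using sub by (intro ex_two_primitive) blast
qed

lemma two_1331:
  assumes q: "q = 1331" and b: "b \<in> base - {0}"
  shows "\<exists>x. r_primitive 2 x \<and> Tr x = b"
proof -
  have e: "N = 1771560" "N div 2 = 885780" "q - 1 = 1330" "real q = 1331" by (simp_all add: N_two q)
  have "prime_factors (N div 2) \<subseteq> nat ` set [2, 2, 3, 3, 5, 7, 19, 37]" by (rule prime_factors_subset_list) (simp_all add: e(1))
  then have sub: "prime_factors (N div 2) \<subseteq> {2, 3, 5, 7, 19, 37}" by auto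
  have "\<exists>k\<in>half_exps b. \<forall>l\<in>{2, 3, 5, 7, 19, 37}. \<not> l dvd k"
  proof (rule sieve_1331)
    show "char_sum_bounds 885780 1330 (half_exps b) 1 (sqrt 1331)" using half_exps_bounds_two[OF b] unfolding e(2-4) .
    show "665 \<le> real (card (half_exps b))" using half_exps_card_two[OF b] unfolding e(4) by simp
  qed
  then show ?thesis using sub by (intro ex_two_primitive) blast
qed

end

context odd_trace_field
begin

text \<open>Character sums are used for the prime 2 only. Multiples of 7 and of 13 are counted by
  means of the symmetry \<open>x\<close> to \<open>-x\<close>, and shown to impose incompatible
  conditions on \<open>b\<close>.\<close>

lemma three_nonzero_9:
  assumes n: "n = 3" and q: "q = 9" and b: "b \<in> base - {0}"
  shows "\<exists>x. r_primitive 2 x \<and> Tr x = b"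
proof -
  have N: "N = 728" "N div 2 = 364" by (simp_all add: N_eq(2) n q)
  have "b ^ q = b" "b \<noteq> 0" using b unfolding base_def by simp_all
  then have b0: "b \<noteq> 0" "b ^ 9 = b" unfolding q by simp_all
  have "CHAR('a) = 3"
  proof -
    have "prime CHAR('a)" by (rule prime_CHAR_semidom) (simp add: CHAR_pos_iff pos_char_exists)
    moreover have "CHAR('a) dvd 3 ^ 2" using CHAR_dvd_q unfolding q by simp
    ultimately have "CHAR('a) dvd 3" "prime CHAR('a)" using prime_dvd_power by blast+
    moreover have "prime (3::nat)" by simp
    ultimately show ?thesis using primes_dvd_imp_eq by blast
  qed
  then have "of_nat 3 = (0::'a)" by (metis of_nat_CHAR)
  then have three: "(3::'a) = 0" by simp
  have g364: "g ^ 364 = -1"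
  proof -
    have "(g ^ 364) ^ 2 = 1" by (simp add: power_eq_1_iff N(1) flip: power_mult)
    moreover have "g ^ 364 \<noteq> 1" by (simp add: power_eq_1_iff N(1))
    ultimately show ?thesis using power2_eq_1_iff[of "g ^ 364"] by blast
  qed
  have tr: "Tr x = x + x ^ 9 + x ^ 81" for x :: 'a
    unfolding field_trace_def n q by (simp add: numeral_3_eq_3 lessThan_Suc add_ac)
  have "prime_factors (N div 2) \<subseteq> nat ` set [2, 2, 7, 13]" by (rule prime_factors_subset_list) (simp_all add: N(1))
  then have sub: "prime_factors (N div 2) \<subseteq> {2, 7, 13}" by auto
  have s: "sqrt (real q) ^ (n - 1) = 9" "real q ^ (n - 1) = 81" by (simp_all add: q n)
  let ?O = "{k \<in> half_exps b. odd k}"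
  have odd: "odd k" "k < 364" "Tr (g ^ (2 * k)) = b" if "k \<in> ?O" for k
    using that by (simp_all add: half_exps_def N(2))
  \<comment> \<open>Since \<open>g ^ 364 = -1\<close>, the exponents \<open>k\<close> and
    \<open>k + 182\<close> belong to opposite elements, whose traces differ. So residues modulo 182
    can be counted, and these contain 13 odd multiples of 7 and 7 of 13.\<close>
  have kill: "card {k \<in> half_exps b. odd k \<and> l dvd k} \<le> 13" if l: "l = 7 \<or> l = 13" for l
  proof -
    let ?A = "{k \<in> half_exps b. odd k \<and> l dvd k}"
    have "inj_on (\<lambda>k. k mod 182) ?A"
    proof (rule inj_onI)
      have *: "i = j" if "i \<in> ?A" "j \<in> ?A" "i mod 182 = j mod 182" "i \<le> j" for i j
      proof (rule ccontr)
        assume ne: "i \<noteq> j"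
        have j: "j < 364" using odd that by auto
        have "182 dvd j - i" using that(3,4) by (metis mod_eq_dvd_iff_nat)
        then obtain t where t: "j - i = 182 * t" by blast
        have "182 * t < 364" unfolding t[symmetric] using j by linarith
        then have "t = 0 \<or> t = 1" by linarith
        then have "j = i + 182" using t ne that(4) by auto
        then have e: "2 * j = 2 * i + 364" by simp
        have gj: "g ^ (2 * j) = 0 - g ^ (2 * i)" unfolding e power_add g364 by simp
        have ij: "Tr (g ^ (2 * i)) = b" "Tr (g ^ (2 * j)) = b" using that by (auto intro: odd(3))
        have "Tr (0 - g ^ (2 * i)) = 0 - b" unfolding trace_minus ij(1) trace_0 by (rule refl)
        then have "b = - b" using ij(2) unfolding gj by simp
        then have "b + b = 0" by (simp only: eq_neg_iff_add_eq_0)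
        then have "2 * b = 0" by (simp only: mult_2)
        then show False using b0(1) two_nonzero by (simp only: mult_eq_0_iff) blast
      qed
      fix i j assume "i \<in> ?A" "j \<in> ?A" "i mod 182 = j mod 182"
      then show "i = j" using *[of i j] *[of j i] by (cases "i \<le> j") auto
    qed
    moreover have img: "(\<lambda>k. k mod 182) ` ?A \<subseteq> (\<lambda>j. l * (2 * j + 1)) ` {..<13}"
    proof (intro image_subsetI)
      fix k assume k: "k \<in> ?A"
      then obtain r where r: "k = l * r" by blast
      have "odd k" using k by blast
      then have odd_r: "odd r" unfolding r by simp
      have e: "l * (182 div l) = 182" and h: "182 div l = 26 \<or> 182 div l = 14" using l by auto
      have kr: "k mod 182 = l * (r mod (182 div l))" unfolding r mult_mod_right e by (rule refl)
      from h have y: "odd (r mod (182 div l)) \<and> r mod (182 div l) < 26"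
      proof (elim disjE)
        assume "182 div l = 26"
        moreover have "odd (r mod 26)" "r mod 26 < 26" using odd_r by presburger+
        ultimately show ?thesis by (simp only:) blast
      next
        assume "182 div l = 14"
        moreover have "odd (r mod 14)" "r mod 14 < 26" using odd_r by presburger+
        ultimately show ?thesis by (simp only:) blast
      qed
      then obtain j where j: "r mod (182 div l) = 2 * j + 1" by (blast elim: oddE)
      have "j < 13" using y unfolding j by linarith
      then show "k mod 182 \<in> (\<lambda>j. l * (2 * j + 1)) ` {..<13}" unfolding kr j by blast
    qed
    ultimately have "card ?A = card ((\<lambda>k. k mod 182) ` ?A)" by (intro card_image[symmetric])
    also have "\<dots> \<le> card ((\<lambda>j. l * (2 * j + 1)) ` {..<13})" by (intro card_mono img) simp
    also have "\<dots> \<le> card {..<13::nat}" by (intro card_image_le) simp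
    finally show ?thesis by simp
  qed
  \<comment> \<open>A multiple of 7 gives \<open>x ^ 27 = - x\<close>, hence
    \<open>b * b = -1\<close>. A multiple of 13 gives \<open>b = - c * v\<close> with
    \<open>c * c = -1\<close> and \<open>v = u + u ^ 2 + u ^ 4\<close> the quadratic period of a
    seventh root of unity, for which \<open>v * v = - v - 2\<close>. Together
    \<open>v * v = 1\<close>, so \<open>v = - 3 = 0\<close>, a contradiction.\<close>
  have excl: "{k \<in> half_exps b. odd k \<and> 7 dvd k} = {} \<or> {k \<in> half_exps b. odd k \<and> 13 dvd k} = {}"
  proof (rule ccontr)
    assume "\<not> ?thesis"
    then obtain k j where k: "k \<in> ?O" "7 dvd k" and j: "j \<in> ?O" "13 dvd j" by blast
    define x where "x = g ^ (2 * k)"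
    obtain i where i: "k = 7 * i" "odd i" using k(2) odd(1)[OF k(1)] by (auto elim!: dvdE)
    have "x ^ 26 = (g ^ 364) ^ i"
      unfolding x_def i(1) power_mult[symmetric] by (rule arg_cong[of _ _ "\<lambda>k. g ^ k"]) simp
    then have x26: "x ^ 26 = -1" using i(2) by (simp add: g364)
    have "x ^ (26 + 1) = - x" unfolding power_add x26 by simp
    then have x27: "x ^ 27 = - x" by simp
    have fd: "(u + w) ^ 27 = u ^ 27 + w ^ 27" for u w :: 'a
      by (rule freshmans_dream'[of _ 3]) (simp_all add: \<open>CHAR('a) = 3\<close>)
    have "b ^ 27 = Tr x ^ 27" unfolding x_def odd(3)[OF k(1)] by (rule refl)
    also have "\<dots> = (x + x ^ 9 + x ^ 81) ^ 27" by (simp only: tr)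
    also have "\<dots> = x ^ 27 + (x ^ 9) ^ 27 + (x ^ 81) ^ 27" by (simp only: fd)
    also have "\<dots> = x ^ 27 + (x ^ 27) ^ 9 + (x ^ 27) ^ 81" by (simp flip: power_mult)
    also have "\<dots> = - Tr x" unfolding x27 by (simp add: tr)
    also have "\<dots> = - b" unfolding x_def odd(3)[OF k(1)] by (rule refl)
    finally have "b ^ 27 = - b" .
    moreover have "b ^ 27 = (b ^ 9) ^ 3" by (simp flip: power_mult)
    ultimately have "b * (b * b) = b * (-1)" using b0(2) by (simp add: power3_eq_cube mult.assoc)
    then have bb: "b * b = -1" using b0(1) by (simp only: mult_cancel_left) simp
    define y where "y = g ^ (2 * j)"
    define c where "c = y ^ 7"
    obtain r where r: "j = 13 * r" "odd r" using j(2) odd(1)[OF j(1)] by (auto elim!: dvdE)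
    have "y ^ 14 = (g ^ 364) ^ r"
      unfolding y_def r(1) power_mult[symmetric] by (rule arg_cong[of _ _ "\<lambda>k. g ^ k"]) simp
    then have "y ^ 14 = -1" using r(2) by (simp add: g364)
    then have cc: "c * c = -1" unfolding c_def power_add[symmetric] by simp
    define u where "u = c * y"
    have c7: "c ^ 7 = - c"
    proof -
      have "c ^ 7 = (c * c) * (c * c) * (c * c) * c" by (simp add: eval_nat_numeral)
      then show ?thesis by (simp add: cc)
    qed
    have "u ^ 7 = - c * c" unfolding u_def power_mult_distrib c7 unfolding c_def by (rule refl)
    then have u7: "u ^ 7 = 1" by (simp add: cc)
    have y: "y = - c * u" by (simp add: u_def cc flip: mult.assoc)
    define v where "v = u + u ^ 2 + u ^ 4"
    have "b = - c * v"
    proof -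
      have c9: "c ^ 9 = c" "c ^ 81 = c"
      proof -
        have "c ^ (7 + 2) = c ^ 7 * (c * c)" by (simp only: power_add power2_eq_square)
        then show c9: "c ^ 9 = c" by (simp add: c7 cc)
        have "c ^ 81 = (c ^ 9) ^ 9" by (simp flip: power_mult)
        then show "c ^ 81 = c" by (simp add: c9)
      qed
      have "u ^ (7 + 2) = u ^ 7 * u ^ 2" "u ^ (7 * 11 + 4) = (u ^ 7) ^ 11 * u ^ 4" by (simp_all only: power_add power_mult)
      then have u9: "u ^ 9 = u ^ 2" "u ^ 81 = u ^ 4" by (simp_all add: u7)
      have "b = y + y ^ 9 + y ^ 81" using odd(3)[OF j(1)] unfolding tr y_def[symmetric] by (rule sym)
      also have "\<dots> = - c * u + - (c ^ 9 * u ^ 9) + - (c ^ 81 * u ^ 81)" unfolding y by (simp add: power_mult_distrib)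
      also have "\<dots> = - c * v" by (simp add: c9 u9 v_def algebra_simps)
      finally show ?thesis .
    qed
    then have "b * b = (c * c) * (v * v)" by (simp add: algebra_simps)
    then have vv: "v * v = 1" using bb cc by simp
    have "u \<noteq> 1"
    proof
      assume "u = 1"
      then have "v = 3" by (simp add: v_def)
      then show False using vv three by simp
    qed
    have "(u - 1) * (1 + u + u ^ 2 + u ^ 3 + u ^ 4 + u ^ 5 + u ^ 6) = u ^ 7 - 1"
      by (simp add: algebra_simps eval_nat_numeral)
    then have S: "1 + u + u ^ 2 + u ^ 3 + u ^ 4 + u ^ 5 + u ^ 6 = 0" using \<open>u \<noteq> 1\<close> u7 by simp
    have "v * v = u ^ 2 + u ^ 4 + u ^ 7 * u + 2 * (u ^ 3 + u ^ 5 + u ^ 6)"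
      by (simp add: v_def algebra_simps eval_nat_numeral)
    also have "\<dots> = 2 * (1 + u + u ^ 2 + u ^ 3 + u ^ 4 + u ^ 5 + u ^ 6) - v - 2"
      by (simp add: u7 v_def algebra_simps)
    finally have "v * v = - v - 2" by (simp add: S)
    then have "v = - 3" using vv by (simp add: algebra_simps eq_neg_iff_add_eq_0)
    then show False using vv three by simp
  qed
  have "\<exists>k\<in>half_exps b. \<forall>l\<in>{2, 7, 13}. \<not> l dvd k"
  proof (rule sieve_729[OF _ _ kill kill excl])
    show "char_sum_bounds 364 0 (half_exps b) 9 9" using half_exps_bounds[OF b] unfolding N(2) s .
    show "36 \<le> real (card (half_exps b))" using half_exps_card[OF b] unfolding s by simp
  qed simp_all
  then show ?thesis using sub by (intro ex_two_primitive) blast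
qed

end

subsection \<open>Reduction to prime degree\<close>

lemma exceptions_covered:
  "list_all (\<lambda>x. List.member (map fst prime_certs @ map (\<lambda>z. fst z * fst z) square_certs @
     [3, 5, 7, 9, 11, 13, 31, 27, 81, 125, 1331]) x) exceptions"
  by code_simp

lemma (in quadratic_trace_field) two_nonzero_all:
  assumes q: "q \<notin> {3, 5, 7, 9, 11, 13, 31}" and b: "b \<in> base - {0}"
  shows "\<exists>x. r_primitive 2 x \<and> Tr x = b"
proof (cases "q \<ge> 15000")
  case True
  then show ?thesis by (rule two_large[OF b])
next
  case False
  then have small: "q < 15000" by simp
  show ?thesis
  proof (cases "int q \<in> set exceptions")
    case False
    then show ?thesis by (rule two_small[OF b small])
  next
    case True
    then have "int q \<in> fst ` set prime_certs \<or> int q \<in> (\<lambda>z. fst z * fst z) ` set square_certs \<or>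
      int q \<in> {3, 5, 7, 9, 11, 13, 31, 27, 81, 125, 1331}"
      using exceptions_covered unfolding list_all_iff by auto
    moreover have "q = 27 \<or> q = 81 \<or> q = 125 \<or> q = 1331" if "int q \<in> {3, 5, 7, 9, 11, 13, 31, 27, 81, 125, 1331}"
      using that q by auto
    ultimately show ?thesis
      using two_prime_certs[OF _ b] two_square_certs[OF _ b] two_27[OF _ b] two_81[OF _ b] two_125[OF _ b] two_1331[OF _ b]
      by blast
  qed
qed

lemma (in odd_trace_field) prime_degree_all:
  assumes n: "prime n" "n \<ge> 3" and b: "b \<in> base"
  shows "\<exists>x. r_primitive 2 x \<and> Tr x = b"
proof (cases "n = 3")
  case True
  then show ?thesis
    using three_zero_all three_nonzero_all[of b] three_nonzero_9[of b] b by (cases "b = 0") auto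
next
  case False
  have "\<not> prime (4::nat)" by simp
  then have "n \<noteq> 4" using n(1) by blast
  then have "n \<ge> 5" using n(2) False by linarith
  then show ?thesis using ge5_zero ge5_nonzero[of b] n(1) b by (cases "b = 0") auto
qed

context odd_trace_field
begin

text \<open>Transitivity of the trace: the exponents \<open>i * e + a\<close> are regrouped by
  \<open>a\<close>.\<close>

lemma trace_tower:
  assumes "n = p * e"
  shows "Tr x = (\<Sum>a<e. field_trace (q ^ e) p x ^ (q ^ a))"
proof -
  have "Tr x = (\<Sum>i<p. \<Sum>k\<in>{i * e..<i * e + e}. x ^ (q ^ k))"
    unfolding field_trace_def assms by (rule sum.nat_group[symmetric])
  also have "\<dots> = (\<Sum>i<p. \<Sum>a<e. (x ^ ((q ^ e) ^ i)) ^ (q ^ a))"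
  proof (rule sum.cong[OF refl])
    fix i
    have "(\<Sum>k\<in>{i * e..<i * e + e}. x ^ (q ^ k)) = (\<Sum>a<e. x ^ (q ^ (i * e + a)))"
      using sum.shift_bounds_nat_ivl[of "\<lambda>k. x ^ (q ^ k)" 0 "i * e" e] by (simp add: atLeast0LessThan add.commute)
    also have "\<dots> = (\<Sum>a<e. (x ^ ((q ^ e) ^ i)) ^ (q ^ a))"
      by (simp add: power_add power_mult[symmetric] mult.commute)
    finally show "(\<Sum>k\<in>{i * e..<i * e + e}. x ^ (q ^ k)) = (\<Sum>a<e. (x ^ ((q ^ e) ^ i)) ^ (q ^ a))" .
  qed
  also have "\<dots> = (\<Sum>a<e. \<Sum>i<p. (x ^ ((q ^ e) ^ i)) ^ (q ^ a))" by (rule sum.swap)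
  also have "\<dots> = (\<Sum>a<e. field_trace (q ^ e) p x ^ (q ^ a))"
    unfolding field_trace_def frobenius_sum by (rule refl)
  finally show ?thesis .
qed

text \<open>The same generator serves at both levels; only the subfield changes.\<close>

lemma tower_locale:
  assumes "n = p * e" "e > 0" "p > 0"
  shows "odd_trace_field g N (q ^ e) p"
proof unfold_locales
  obtain r k where r: "prime r" "k > 0" "q = r ^ k" using q by (auto simp: primepow_def)
  then have "q ^ e = r ^ (k * e)" "k * e > 0" using assms(2) by (simp_all add: power_mult)
  then show "primepow (q ^ e)" using r(1) unfolding primepow_def by blast
  show "CARD('a) = (q ^ e) ^ p" by (simp add: card_q assms(1) mult.commute flip: power_mult)
qed (use assms odd_q in simp_all)

text \<open>The general result in degree two concerns nonzero traces only. For \<open>b = 0\<close>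
  a suitable \<open>z\<close> exists because, for \<open>e \<ge> 2\<close>, the kernel of the full
  trace has more elements than that of the intermediate one.\<close>

lemma ex_intermediate:
  assumes n: "n = p * e" "e \<ge> 2" "p > 0" and b: "b \<in> base"
  shows "\<exists>z. field_trace (q ^ e) p z \<noteq> 0 \<and> Tr z = b"
proof (cases "b = 0")
  case False
  have "fibre b \<noteq> {}" using card_fibre[OF b] q_gt_1 by auto
  then obtain z where z: "Tr z = b" by (auto simp: fibre_def)
  have "field_trace (q ^ e) p z \<noteq> 0"
  proof
    assume "field_trace (q ^ e) p z = 0"
    then have "Tr z = 0" unfolding trace_tower[OF n(1)] using q_gt_1 by (simp add: power_0_left)
    then show False using z False by simp
  qed
  then show ?thesis using z by blast
next
  case True
  interpret R: odd_trace_field g N "q ^ e" p using n by (intro tower_locale) auto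
  have "card (R.fibre 0) = (q ^ e) ^ (p - 1)" by (rule R.card_fibre[OF R.base_0])
  also have "\<dots> = q ^ (e * (p - 1))" by (simp add: power_mult)
  also have "\<dots> < q ^ (n - 1)"
  proof (rule power_strict_increasing)
    obtain r where "p = Suc r" using n(3) gr0_implies_Suc by blast
    then show "e * (p - 1) < n - 1" using n(1,2) by (simp add: mult.commute[of e r])
  qed (use q_gt_1 in simp)
  also have "\<dots> = card (fibre 0)" using card_fibre[OF b] True by simp
  finally have "\<not> fibre 0 \<subseteq> R.fibre 0" using card_mono[of "R.fibre 0" "fibre 0"] by auto
  then obtain z where "Tr z = 0" "field_trace (q ^ e) p z \<noteq> 0" by (auto simp: fibre_def R.fibre_def)
  then show ?thesis using True by blast
qed

lemma degree_ge_3: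
  assumes n: "n \<ge> 3" and b: "b \<in> base"
  shows "\<exists>x. r_primitive 2 x \<and> Tr x = b"
proof (cases "even n")
  case True
  then obtain e where e: "n = 2 * e" by blast
  then have e2: "e \<ge> 2" using n by linarith
  have "quadratic_trace_field g N (q ^ e) 2"
    unfolding quadratic_trace_field_def quadratic_trace_field_axioms_def using tower_locale[OF e] e2 by simp
  then interpret R: quadratic_trace_field g N "q ^ e" 2 .
  have tower: "Tr x = (\<Sum>a<e. field_trace (q ^ e) 2 x ^ (q ^ a))" for x by (rule trace_tower[OF e])
  show ?thesis
  proof (cases "q ^ e = 9")
    case False
    \<comment> \<open>\<open>q ^ e\<close> is not prime as \<open>e \<ge> 2\<close>, so 9 is the
      only exceptional value that can occur.\<close>
    have "q ^ e \<notin> {3, 5, 7, 11, 13, 31}"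
    proof -
      have "\<not> prime (q ^ e)" using e2 by (simp add: prime_power_iff)
      moreover have "prime (3::nat)" "prime (5::nat)" "prime (7::nat)" "prime (11::nat)" "prime (13::nat)" "prime (31::nat)"
        by simp_all
      ultimately show ?thesis by (metis empty_iff insert_iff)
    qed
    then have q: "q ^ e \<notin> {3, 5, 7, 9, 11, 13, 31}" using False by blast
    obtain z where z: "field_trace (q ^ e) 2 z \<noteq> 0" "Tr z = b" using ex_intermediate[OF e e2 _ b] by auto
    have "field_trace (q ^ e) 2 z \<in> R.base - {0}" using z(1) R.trace_in_base by blast
    then obtain x where "r_primitive 2 x" "field_trace (q ^ e) 2 x = field_trace (q ^ e) 2 z"
      using R.two_nonzero_all[OF q] by blast
    moreover from this(2) have "Tr x = Tr z" unfolding tower by simp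
    ultimately show ?thesis using z(2) by blast
  next
    case True
    have "q \<le> 3"
    proof (rule ccontr)
      assume "\<not> q \<le> 3"
      then have "4 ^ 2 \<le> q ^ 2" by (intro power_mono) auto
      also have "\<dots> \<le> q ^ e" using e2 q_gt_1 by (intro power_increasing) auto
      finally show False using True by simp
    qed
    then have q3: "q = 3" using q_ge_3 by simp
    have "e = 2"
    proof (rule ccontr)
      assume "e \<noteq> 2"
      then have "(3::nat) ^ 3 \<le> 3 ^ e" using e2 by (intro power_increasing) auto
      then show False using True q3 by simp
    qed
    \<comment> \<open>Here \<open>q = 3\<close> and \<open>n = 4\<close>. The remaining trace is
      \<open>y + y ^ 3\<close>, and \<open>y = 1\<close>, \<open>-1\<close>, \<open>i\<close> yield
      \<open>-1\<close>, \<open>1\<close>, \<open>0\<close>, which is all of the prime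
      field.\<close>
    then have tr: "Tr x = field_trace (q ^ e) 2 x + field_trace (q ^ e) 2 x ^ 3" for x
      unfolding tower by (simp add: q3 numeral_2_eq_2 lessThan_Suc)
    obtain i :: 'a where i: "i\<^sup>2 + 1 = 0" using R.traces_9(1)[OF True] by blast
    have T: "{field_trace (q ^ e) 2 x | x. r_primitive 2 x} = {1, -1, i, -i}" by (rule R.traces_9(2)[OF True i])
    have "CHAR('a) = 3" by (rule CHAR_eq[of 3 1]) (simp_all add: q3)
    then have "of_nat 3 = (0::'a)" by (metis of_nat_CHAR)
    then have "(2::'a) + 1 = 0" by simp
    then have two: "(2::'a) = -1" by (simp only: eq_neg_iff_add_eq_0)
    have "b ^ q = b" using b unfolding base_def by simp
    then have "b ^ 3 = b" unfolding q3 .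
    then have "b * ((b - 1) * (b + 1)) = 0" by (simp add: power3_eq_cube algebra_simps)
    then have "b = 0 \<or> b = 1 \<or> b = -1" by (auto simp: eq_neg_iff_add_eq_0)
    moreover have "\<exists>x. r_primitive 2 x \<and> Tr x = y + y ^ 3" if "y \<in> {1, -1, i, -i}" for y
      using that unfolding T[symmetric] tr by blast
    moreover have "(1::'a) + 1 ^ 3 = -1" "(-1::'a) + (-1) ^ 3 = 1" using two by simp_all
    moreover have "i + i ^ 3 = 0"
    proof -
      have "i + i ^ 3 = i * (i\<^sup>2 + 1)" by (simp add: power2_eq_square power3_eq_cube algebra_simps)
      then show ?thesis unfolding i by simp
    qed
    ultimately show ?thesis by (metis insertI1 insertI2)
  qed
next
  case False
  \<comment> \<open>For an odd prime degree every trace is attained, so here the intermediate trace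
    may be zero.\<close>
  obtain p where p: "prime p" "p dvd n" using prime_factor_nat[of n] n by auto
  then obtain e where e: "n = p * e" by blast
  have e0: "e > 0" using e n by (intro Nat.gr0I) simp
  have "p \<noteq> 2" using False p(2) by blast
  then have p3: "p \<ge> 3" using prime_ge_2_nat[OF p(1)] by linarith
  show ?thesis
  proof (cases "e = 1")
    case True
    then show ?thesis using prime_degree_all[of b] p(1) e n b by simp
  next
    case False
    then have e2: "e \<ge> 2" using e0 by linarith
    interpret R: odd_trace_field g N "q ^ e" p using tower_locale[OF e e0] p3 by simp
    obtain z where z: "Tr z = b" using ex_intermediate[OF e e2 _ b] p3 by auto
    obtain x where "r_primitive 2 x" "field_trace (q ^ e) p x = field_trace (q ^ e) p z"
      using R.prime_degree_all[OF p(1) p3 R.trace_in_base] by blast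
    moreover from this(2) have "Tr x = Tr z" unfolding trace_tower[OF e] by simp
    ultimately show ?thesis using z by blast
  qed
qed

end

text \<open>Multiplication by \<open>x\<close> permutes the nonzero elements of \<open>K\<close>, as
  in Fermat's theorem. This identifies the given subfield with the fixed points of
  Frobenius.\<close>

lemma subfield_power_card:
  fixes K :: "'a::finite_field set"
  assumes "is_subfield K" "x \<in> K"
  shows "x ^ card K = x"
proof (cases "x = 0")
  case True
  moreover have "card K > 0" using assms(2) by (auto simp: card_gt_0_iff)
  ultimately show ?thesis by simp
next
  case False
  let ?P = "\<Prod>y\<in>K - {0}. y"
  have inj: "inj_on ((*) x) (K - {0})" using False by (auto intro: inj_onI)
  have sub: "(*) x ` (K - {0}) \<subseteq> K - {0}" using assms False by (auto simp: is_subfield_def)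
  have "(*) x ` (K - {0}) = K - {0}"
    by (rule card_subset_eq[OF _ sub]) (simp_all add: card_image[OF inj])
  then have "?P = (\<Prod>y\<in>K - {0}. x * y)" using prod.reindex[OF inj, of "\<lambda>y. y"] by simp
  also have "\<dots> = x ^ card (K - {0}) * ?P" by (simp add: prod.distrib)
  finally have "x ^ card (K - {0}) = 1" by auto
  moreover have "card K = Suc (card (K - {0}))"
    using assms(1) card_Suc_Diff1[of K 0] by (simp add: is_subfield_def)
  ultimately show ?thesis by simp
qed

theorem theorem1p3:
  fixes q n :: nat and K :: "'a::finite_field set"
  assumes "primepow q" and "odd q" and "n \<ge> 2"
    and "CARD('a) = q ^ n"
    and "is_subfield K" and "card K = q"
  shows "(n \<ge> 3 \<longrightarrow> (\<forall>\<beta>\<in>K. \<exists>\<xi>::'a. r_primitive 2 \<xi> \<and> field_trace q n \<xi> = \<beta>)) \<and>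
    (n = 2 \<longrightarrow>
      (q \<notin> {3, 5, 7, 9, 11, 13, 31} \<longrightarrow>
         (\<forall>\<beta>\<in>K - {0}. \<exists>\<xi>::'a. r_primitive 2 \<xi> \<and> field_trace q 2 \<xi> = \<beta>)) \<and>
      (q = 3 \<longrightarrow> {field_trace q 2 \<xi> | \<xi>::'a. r_primitive 2 \<xi>} = {0}) \<and>
      (q = 5 \<longrightarrow> {field_trace q 2 \<xi> | \<xi>::'a. r_primitive 2 \<xi>} = {2, 3}) \<and>
      (q = 7 \<longrightarrow> {field_trace q 2 \<xi> | \<xi>::'a. r_primitive 2 \<xi>} = {1, 2, 5, 6}) \<and>
      (q = 9 \<longrightarrow> (\<exists>i\<in>K. i\<^sup>2 + 1 = 0) \<and>
         (\<forall>i\<in>K. i\<^sup>2 + 1 = 0 \<longrightarrow>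
            {field_trace q 2 \<xi> | \<xi>::'a. r_primitive 2 \<xi>} = {1, -1, i, -i})) \<and>
      (q = 11 \<longrightarrow> {field_trace q 2 \<xi> | \<xi>::'a. r_primitive 2 \<xi>} = {1, 2, 3, 4, 7, 8, 9, 10}) \<and>
      (q = 13 \<longrightarrow> {field_trace q 2 \<xi> | \<xi>::'a. r_primitive 2 \<xi>}
                    = {1, 3, 4, 5, 6, 7, 8, 9, 10, 12}) \<and>
      (q = 31 \<longrightarrow> {field_trace q 2 \<xi> | \<xi>::'a. r_primitive 2 \<xi>} = K - {0, 11, 20}))"
proof -
  obtain g :: 'a where g: "g \<noteq> 0" "bij_betw (\<lambda>k. g ^ k) {..<CARD('a) - 1} (UNIV - {0})"
    using finite_field_generator by blast
  interpret F: odd_trace_field g "CARD('a) - 1" q n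
    using assms g by unfold_locales auto
  have "K \<subseteq> F.base" using subfield_power_card[OF assms(5)] unfolding F.base_def assms(6) by blast
  then have K: "K = F.base" using F.card_base assms(6) by (intro card_subset_eq) simp_all
  have quadratic: "quadratic_trace_field g (CARD('a) - 1) q 2" if "n = 2"
    using F.odd_trace_field_axioms that by (simp add: quadratic_trace_field_def quadratic_trace_field_axioms_def)
  show ?thesis
  proof (intro conjI impI)
    assume "n \<ge> 3"
    then show "\<forall>\<beta>\<in>K. \<exists>\<xi>::'a. r_primitive 2 \<xi> \<and> field_trace q n \<xi> = \<beta>" using F.degree_ge_3 unfolding K by blast
  next
    assume n: "n = 2"
    interpret Q: quadratic_trace_field g "CARD('a) - 1" q 2 by (rule quadratic[OF n])
    have KQ: "K = Q.base" unfolding K F.base_def Q.base_def by (rule refl)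
    show "\<forall>\<beta>\<in>K - {0}. \<exists>\<xi>::'a. r_primitive 2 \<xi> \<and> field_trace q 2 \<xi> = \<beta>" if "q \<notin> {3, 5, 7, 9, 11, 13, 31}"
      using Q.two_nonzero_all[OF that] unfolding KQ by blast
    note ex = Q.traces_exact
    show "q = 3 \<Longrightarrow> {field_trace q 2 \<xi> | \<xi>::'a. r_primitive 2 \<xi>} = {0}" by (rule ex(1))
    show "q = 5 \<Longrightarrow> {field_trace q 2 \<xi> | \<xi>::'a. r_primitive 2 \<xi>} = {2, 3}" by (rule ex(2))
    show "q = 7 \<Longrightarrow> {field_trace q 2 \<xi> | \<xi>::'a. r_primitive 2 \<xi>} = {1, 2, 5, 6}" by (rule ex(3))
    show "q = 9 \<Longrightarrow> \<exists>i\<in>K. i\<^sup>2 + 1 = 0" unfolding KQ by (rule Q.traces_9(1))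
    show "q = 9 \<Longrightarrow> \<forall>i\<in>K. i\<^sup>2 + 1 = 0 \<longrightarrow> {field_trace q 2 \<xi> | \<xi>::'a. r_primitive 2 \<xi>} = {1, -1, i, -i}"
      using Q.traces_9(2) by blast
    show "q = 11 \<Longrightarrow> {field_trace q 2 \<xi> | \<xi>::'a. r_primitive 2 \<xi>} = {1, 2, 3, 4, 7, 8, 9, 10}" by (rule ex(4))
    show "q = 13 \<Longrightarrow> {field_trace q 2 \<xi> | \<xi>::'a. r_primitive 2 \<xi>} = {1, 3, 4, 5, 6, 7, 8, 9, 10, 12}" by (rule ex(5))
    show "q = 31 \<Longrightarrow> {field_trace q 2 \<xi> | \<xi>::'a. r_primitive 2 \<xi>} = K - {0, 11, 20}"
      unfolding KQ by (rule Q.traces_31)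
  qed
qed

end
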